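(* Let $0\le\delta\le 1/2$, let $I\subseteq\mathbb{R}$ be an open interval, and let $\theta$ be a weak solution to the mSQG equation of class $L_t^2\dot H^{-1+\delta}(I\times\mathbb{R}^2)$. Then $\theta$ conserves the (generalized) mean, impulse and angular momentum: if for some $t_0\in I$ the distribution $\theta(t_0)$ has a well-defined mean (respectively impulse, angular momentum), then $\theta(t)$ has a well-defined mean (respectively impulse, angular momentum) for every $t\in I$, and its value does not depend on $t\in I$.
   Context: **Littlewood–Paley projections and $\dot H^s$.** $P_{\le 0}$ is the Fourier multiplier with smooth symbol $\hat\chi_{\le0}$ equal to $1$ for $|\xi|\le1/2$ and supported in $|\xi|\le1$; $P_{\le q}$ has symbol $\hat\chi_{\le0}(2^{-q}\xi)$ and $P_q=P_{\le q+1}-P_{\le q}$, $q\in\mathbb{Z}$. $\dot H^s(\mathbb{R}^2)$ is the space of tempered distributions $\theta$ with $\|\theta\|_{\dot H^s}^2:=\sum_{q\in\mathbb{Z}}(2^{sq}\|P_q\theta\|_{L^2})^2<\infty$ and $P_{\le -m}\theta\to0$ weakly in $\mathcal{S}'$ as $m\to\infty$. $\mathcal{S}_0(\mathbb{R}^2)$ is the set of Schwartz functions whose Fourier transform has support a compact subset of $\mathbb{R}^2\setminus\{0\}$. $L^2_t\dot H^{s}(I\times\mathbb{R}^2)$ consists of $\theta$ that are strongly measurable in $t\in I$ with values in $\dot H^s$ and have $\int_I\|\theta(t)\|_{\dot H^s}^2dt<\infty$. **mSQG.** The equation is $\partial_t\theta+T^\ell\theta\,\nabla_\ell\theta=0$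 with $T^\ell=-\epsilon^{\ell a}\nabla_a(-\Delta)^{-1+\delta}$ (repeated indices summed), where $\epsilon^{j\ell}=-\epsilon^{\ell j}$, $\epsilon^{12}=1$. **Nonlinearity.** For $\psi\in C_c^\infty(\mathbb{R}^2)$ and $\theta\in\mathcal{S}_0(\mathbb{R}^2)$ let $B(\psi,\theta)=\int\psi\,T^\ell[\theta]\nabla_\ell\theta\,dx$. It obeys $|B(\psi,\theta)|\lesssim\|\nabla^2\psi\|_{L^\infty}\|\theta\|_{\dot H^{-1+\delta}}^2$, and $B(\psi,\theta)$ for $\theta\in\dot H^{-1+\delta}$ is defined as $\lim_n B(\psi,\theta_n)$ for any $\theta_n\in\mathcal{S}_0$ with $\theta_n\to\theta$ in $\dot H^{-1+\delta}$. **Weak solution.** A weak solution of class $L_t^2\dot H^{-1+\delta}(I\times\mathbb{R}^2)$ is $\theta$ in that class such that for all $\phi\in C_c^\infty(I\times\mathbb{R}^2)$, $-\langle\theta,\partial_t\phi\rangle+\int_I B(\phi(t),\theta(t))\,dt=0$. **Time slices.** For $t_0\in\bar I$, $\theta(t_0)\in\mathcal{D}'(\mathbb{R}^2)$ is the distribution $\theta(t)+\int_{t_0}^tB(\cdot,\theta(s))\,ds$, which is independent of $t$ in the weak sense and so is identified with a unique distribution on $\mathbb{R}^2$. **Generalized moments.** For $f\in\mathcal{D}'(\mathbb{R}^2)$ and a function $Q$, consider the limit $\lim_{R\to\infty}\langle f,\chi(\cdot/R)Q\rangle$, for $\chi\in C_c^\infty(\mathbb{R}^2)$ equal to $1$ in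 a neighborhood of $0$. $f$ has well-defined mean (resp. impulse, angular momentum) if this limit exists for every such $\chi$ and is independent of $\chi$ when $Q=1$ (resp. for both $Q=x_1$ and $Q=x_2$; resp. $Q=|x|^2$). The value of the mean (resp. components of impulse, angular momentum) is then this limit. *)

theory Defs
  imports "HOL-Analysis.Analysis"
begin

section \<open>Smooth functions, Schwartz functions and test functions\<close>

definition dir_deriv :: "'a::euclidean_space \<Rightarrow> ('a \<Rightarrow> 'b::real_normed_vector) \<Rightarrow> 'a \<Rightarrow> 'b" where
  "dir_deriv v f x = frechet_derivative f (at x) v"

definition iter_deriv :: "'a::euclidean_space list \<Rightarrow> ('a \<Rightarrow> 'b::real_normed_vector) \<Rightarrow> 'a \<Rightarrow> 'b" where
  "iter_deriv vs f = foldr dir_deriv vs f"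

definition smooth :: "('a::euclidean_space \<Rightarrow> 'b::real_normed_vector) \<Rightarrow> bool" where
  "smooth f \<longleftrightarrow> (\<forall>vs. set vs \<subseteq> Basis \<longrightarrow> (\<forall>x. iter_deriv vs f differentiable (at x)))"

definition supp :: "('a::topological_space \<Rightarrow> complex) \<Rightarrow> 'a set" where
  "supp f = closure {x. f x \<noteq> 0}"

definition test_functions :: "'a::euclidean_space set \<Rightarrow> ('a \<Rightarrow> complex) set" where
  "test_functions \<Omega> = {f. smooth f \<and> compact (supp f) \<and> supp f \<subseteq> \<Omega>}"

type_synonym plane = "real ^ 2"

definition schwartz :: "(plane \<Rightarrow> complex) set" where
  "schwartz = {f. smooth f \<and>
     (\<forall>N vs. set vs \<subseteq> Basis \<longrightarrow> bounded (range (\<lambda>x. (1 + norm x) ^ N *\<^sub>R iter_deriv vs f x)))}"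

text \<open>The seminorms below are used only where the suprema are finite: the first on Schwartz
  functions, the second on test functions.\<close>

definition schwartz_seminorm :: "nat \<Rightarrow> (plane \<Rightarrow> complex) \<Rightarrow> real" where
  "schwartz_seminorm N f =
     (SUP (vs, x) \<in> {vs. set vs \<subseteq> Basis \<and> length vs \<le> N} \<times> UNIV.
        (1 + norm x) ^ N * norm (iter_deriv vs f x))"

definition Ck_seminorm :: "nat \<Rightarrow> (plane \<Rightarrow> complex) \<Rightarrow> real" where
  "Ck_seminorm N f =
     (SUP (vs, x) \<in> {vs. set vs \<subseteq> Basis \<and> length vs \<le> N} \<times> UNIV. norm (iter_deriv vs f x))"


section \<open>Distributions on the plane\<close>

text \<open>Distributions are represented by total functions on \<open>plane \<Rightarrow> complex\<close> of which only the
  values at Schwartz functions (tempered case) or at test functions are significant.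
  The pairing is bilinear, without complex conjugation.\<close>

type_synonym functional = "(plane \<Rightarrow> complex) \<Rightarrow> complex"

definition linear_functional_on :: "(plane \<Rightarrow> complex) set \<Rightarrow> functional \<Rightarrow> bool" where
  "linear_functional_on V u \<longleftrightarrow>
     (\<forall>f\<in>V. \<forall>g\<in>V. \<forall>a b. u (\<lambda>x. a * f x + b * g x) = a * u f + b * u g)"

definition tempered_distribution :: "functional \<Rightarrow> bool" where
  "tempered_distribution u \<longleftrightarrow> linear_functional_on schwartz u \<and>
     (\<exists>C N. \<forall>f\<in>schwartz. norm (u f) \<le> C * schwartz_seminorm N f)"

definition distribution :: "functional \<Rightarrow> bool" where
  "distribution u \<longleftrightarrow> linear_functional_on (test_functions UNIV) u \<and>
     (\<forall>K. compact K \<longrightarrow>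
        (\<exists>C N. \<forall>f\<in>test_functions UNIV. supp f \<subseteq> K \<longrightarrow> norm (u f) \<le> C * Ck_seminorm N f))"

definition of_function :: "(plane \<Rightarrow> complex) \<Rightarrow> functional" where
  "of_function g = (\<lambda>f. LINT x|lborel. g x * f x)"

definition represents :: "(plane \<Rightarrow> complex) \<Rightarrow> functional \<Rightarrow> bool" where
  "represents g u \<longleftrightarrow> g \<in> borel_measurable lborel \<and>
     (\<forall>f\<in>schwartz. integrable lborel (\<lambda>x. g x * f x) \<and> u f = of_function g f)"

text \<open>Squared \<open>L\<^sup>2\<close> norm of a tempered distribution; it is infinite (infimum of the empty set)
  if the distribution is not given by a function. Any two representing functions agree
  almost everywhere.\<close>

definition L2_norm_sq :: "functional \<Rightarrow> ennreal" where
  "L2_norm_sq u = (INF g \<in> {g. represents g u}. \<integral>\<^sup>+ x. ennreal ((norm (g x))\<^sup>2) \<partial>lborel)"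


section \<open>Fourier transform and Fourier multipliers\<close>

definition fourier :: "(plane \<Rightarrow> complex) \<Rightarrow> plane \<Rightarrow> complex" where
  "fourier f \<xi> = (LINT x|lborel. exp (- \<i> * complex_of_real (x \<bullet> \<xi>)) * f x)"

definition inv_fourier :: "(plane \<Rightarrow> complex) \<Rightarrow> plane \<Rightarrow> complex" where
  "inv_fourier g x =
     (1 / (2 * pi)\<^sup>2) *\<^sub>R (LINT \<xi>|lborel. exp (\<i> * complex_of_real (x \<bullet> \<xi>)) * g \<xi>)"

definition multiplier :: "(plane \<Rightarrow> complex) \<Rightarrow> (plane \<Rightarrow> complex) \<Rightarrow> plane \<Rightarrow> complex" where
  "multiplier m f = inv_fourier (\<lambda>\<xi>. m \<xi> * fourier f \<xi>)"

definition fourier_dist :: "functional \<Rightarrow> functional" where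
  "fourier_dist u = (\<lambda>f. u (fourier f))"

definition inv_fourier_dist :: "functional \<Rightarrow> functional" where
  "inv_fourier_dist u = (\<lambda>f. u (inv_fourier f))"

definition times_dist :: "(plane \<Rightarrow> complex) \<Rightarrow> functional \<Rightarrow> functional" where
  "times_dist m u = (\<lambda>f. u (\<lambda>\<xi>. m \<xi> * f \<xi>))"

definition multiplier_dist :: "(plane \<Rightarrow> complex) \<Rightarrow> functional \<Rightarrow> functional" where
  "multiplier_dist m u = inv_fourier_dist (times_dist m (fourier_dist u))"

definition schwartz0 :: "(plane \<Rightarrow> complex) set" where
  "schwartz0 = {f \<in> schwartz. compact (supp (fourier f)) \<and> 0 \<notin> supp (fourier f)}"


section \<open>Littlewood--Paley projections and homogeneous Sobolev spaces\<close>

text \<open>The symbol \<open>h\<close> of the projection to frequencies at most one is a parameter throughout.\<close>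

definition LP_symbol :: "(plane \<Rightarrow> complex) \<Rightarrow> bool" where
  "LP_symbol h \<longleftrightarrow> smooth h \<and> (\<forall>\<xi>. norm \<xi> \<le> 1/2 \<longrightarrow> h \<xi> = 1) \<and> supp h \<subseteq> cball 0 1"

definition P_le :: "(plane \<Rightarrow> complex) \<Rightarrow> int \<Rightarrow> functional \<Rightarrow> functional" where
  "P_le h q u = multiplier_dist (\<lambda>\<xi>. h ((2 powi (- q)) *\<^sub>R \<xi>)) u"

definition P_eq :: "(plane \<Rightarrow> complex) \<Rightarrow> int \<Rightarrow> functional \<Rightarrow> functional" where
  "P_eq h q u = (\<lambda>f. P_le h (q + 1) u f - P_le h q u f)"

definition Hdot_norm_sq :: "(plane \<Rightarrow> complex) \<Rightarrow> real \<Rightarrow> functional \<Rightarrow> ennreal" where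
  "Hdot_norm_sq h s u =
     (\<Sum>\<^sub>\<infinity>q\<in>(UNIV :: int set). (ennreal (2 powr (s * real_of_int q)))\<^sup>2 * L2_norm_sq (P_eq h q u))"

definition Hdot :: "(plane \<Rightarrow> complex) \<Rightarrow> real \<Rightarrow> functional set" where
  "Hdot h s = {u. tempered_distribution u \<and> Hdot_norm_sq h s u < \<infinity> \<and>
     (\<forall>f\<in>schwartz. (\<lambda>m::nat. P_le h (- int m) u f) \<longlonglongrightarrow> 0)}"

definition tendsto_Hdot ::
    "(plane \<Rightarrow> complex) \<Rightarrow> real \<Rightarrow> (nat \<Rightarrow> functional) \<Rightarrow> functional \<Rightarrow> bool" where
  "tendsto_Hdot h s us u \<longleftrightarrow> (\<lambda>n. Hdot_norm_sq h s (\<lambda>f. us n f - u f)) \<longlonglongrightarrow> 0"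

text \<open>Integrals in time are taken with respect to \<^const>\<open>lebesgue\<close> rather than \<^const>\<open>lborel\<close>,
  because an almost everywhere limit of simple functions is in general only Lebesgue measurable.\<close>

definition simple_Hdot ::
    "(plane \<Rightarrow> complex) \<Rightarrow> real \<Rightarrow> real set \<Rightarrow> (real \<Rightarrow> functional) \<Rightarrow> bool" where
  "simple_Hdot h s I u \<longleftrightarrow> finite (u ` I) \<and> u ` I \<subseteq> Hdot h s \<and>
     (\<forall>v. {t \<in> I. u t = v} \<in> sets lebesgue)"

definition strongly_measurable_Hdot ::
    "(plane \<Rightarrow> complex) \<Rightarrow> real \<Rightarrow> real set \<Rightarrow> (real \<Rightarrow> functional) \<Rightarrow> bool" where
  "strongly_measurable_Hdot h s I \<theta> \<longleftrightarrow> \<theta> ` I \<subseteq> Hdot h s \<and>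
     (\<exists>u. (\<forall>n. simple_Hdot h s I (u n)) \<and>
          (AE t in lebesgue. t \<in> I \<longrightarrow> tendsto_Hdot h s (\<lambda>n. u n t) (\<theta> t)))"

definition L2t_Hdot ::
    "(plane \<Rightarrow> complex) \<Rightarrow> real \<Rightarrow> real set \<Rightarrow> (real \<Rightarrow> functional) set" where
  "L2t_Hdot h s I = {\<theta>. strongly_measurable_Hdot h s I \<theta> \<and>
     (\<integral>\<^sup>+ t\<in>I. Hdot_norm_sq h s (\<theta> t) \<partial>lebesgue) < \<infinity>}"


section \<open>The mSQG equation\<close>

definition partial :: "2 \<Rightarrow> (plane \<Rightarrow> complex) \<Rightarrow> plane \<Rightarrow> complex" where
  "partial a = dir_deriv (axis a 1)"

definition eps :: "2 \<Rightarrow> 2 \<Rightarrow> complex" where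
  "eps j l = (if j = 1 \<and> l = 2 then 1 else if j = 2 \<and> l = 1 then - 1 else 0)"

text \<open>\<open>(-\<Delta>)\<^sup>\<sigma>\<close>; the value of the symbol at the origin is irrelevant on \<^const>\<open>schwartz0\<close>.\<close>

definition neg_laplacian_power :: "real \<Rightarrow> (plane \<Rightarrow> complex) \<Rightarrow> plane \<Rightarrow> complex" where
  "neg_laplacian_power \<sigma> = multiplier (\<lambda>\<xi>. complex_of_real (norm \<xi> powr (2 * \<sigma>)))"

definition velocity :: "real \<Rightarrow> 2 \<Rightarrow> (plane \<Rightarrow> complex) \<Rightarrow> plane \<Rightarrow> complex" where
  "velocity \<delta> l f x = - (\<Sum>a\<in>UNIV. eps l a * partial a (neg_laplacian_power (- 1 + \<delta>) f) x)"

definition B0 :: "real \<Rightarrow> (plane \<Rightarrow> complex) \<Rightarrow> (plane \<Rightarrow> complex) \<Rightarrow> complex" where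
  "B0 \<delta> \<psi> f = (LINT x|lborel. \<psi> x * (\<Sum>l\<in>UNIV. velocity \<delta> l f x * partial l f x))"

definition B :: "(plane \<Rightarrow> complex) \<Rightarrow> real \<Rightarrow> (plane \<Rightarrow> complex) \<Rightarrow> functional \<Rightarrow> complex" where
  "B h \<delta> \<psi> u = (THE b. \<forall>f. (\<forall>n. f n \<in> schwartz0) \<and>
       tendsto_Hdot h (- 1 + \<delta>) (\<lambda>n. of_function (f n)) u \<longrightarrow> (\<lambda>n. B0 \<delta> \<psi> (f n)) \<longlonglongrightarrow> b)"

definition spacetime_pairing ::
    "real set \<Rightarrow> (real \<Rightarrow> functional) \<Rightarrow> (real \<times> plane \<Rightarrow> complex) \<Rightarrow> complex" where
  "spacetime_pairing I u \<phi> = (LINT t:I|lebesgue. u t (\<lambda>x. \<phi> (t, x)))"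

definition weak_solution ::
    "(plane \<Rightarrow> complex) \<Rightarrow> real \<Rightarrow> real set \<Rightarrow> (real \<Rightarrow> functional) \<Rightarrow> bool" where
  "weak_solution h \<delta> I \<theta> \<longleftrightarrow> \<theta> \<in> L2t_Hdot h (- 1 + \<delta>) I \<and>
     (\<forall>\<phi>\<in>test_functions (I \<times> UNIV).
        - spacetime_pairing I \<theta> (dir_deriv (1, 0) \<phi>)
        + (LINT t:I|lebesgue. B h \<delta> (\<lambda>x. \<phi> (t, x)) (\<theta> t)) = 0)"

text \<open>\<open>\<theta>(t) + \<integral>\<^bsub>t0\<^esub>\<^bsup>t\<^esup> B(\<cdot>, \<theta>(s)) ds\<close>, for a given representative \<open>\<theta>\<close>.\<close>

definition transported ::
    "(plane \<Rightarrow> complex) \<Rightarrow> real \<Rightarrow> (real \<Rightarrow> functional) \<Rightarrow> real \<Rightarrow> real \<Rightarrow> functional" where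
  "transported h \<delta> \<theta> t0 t =
     (\<lambda>\<psi>. \<theta> t \<psi> + (LINT s=ereal t0..ereal t|lebesgue. B h \<delta> \<psi> (\<theta> s)))"

text \<open>The time slice is the distribution \<open>u\<close> on the plane that, regarded as a time-independent
  distribution on \<open>I \<times> \<real>\<^sup>2\<close>, coincides with \<open>t \<mapsto> transported h \<delta> \<theta> t0 t\<close>. It is in general
  different from the pointwise value \<open>\<theta> t0\<close>, which is arbitrary on a null set of times.
  The condition \<^const>\<open>extensional\<close> fixes the insignificant values, so that \<open>u\<close> is unique.\<close>

definition time_slice ::
    "(plane \<Rightarrow> complex) \<Rightarrow> real \<Rightarrow> real set \<Rightarrow> (real \<Rightarrow> functional) \<Rightarrow> real \<Rightarrow> functional" where
  "time_slice h \<delta> I \<theta> t0 = (THE u. u \<in> extensional (test_functions UNIV) \<and> distribution u \<and>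
     (\<forall>\<phi>\<in>test_functions (I \<times> UNIV).
        spacetime_pairing I (transported h \<delta> \<theta> t0) \<phi> = spacetime_pairing I (\<lambda>_. u) \<phi>))"


section \<open>Generalized moments\<close>

definition has_moment :: "(plane \<Rightarrow> real) \<Rightarrow> functional \<Rightarrow> complex \<Rightarrow> bool" where
  "has_moment Q u L \<longleftrightarrow>
     (\<forall>c\<in>test_functions UNIV. (\<forall>\<^sub>F x in nhds 0. c x = 1) \<longrightarrow>
        ((\<lambda>R. u (\<lambda>x. c (x /\<^sub>R R) * complex_of_real (Q x))) \<longlongrightarrow> L) at_top)"

definition moment :: "(plane \<Rightarrow> real) \<Rightarrow> functional \<Rightarrow> complex" where
  "moment Q u = (THE L. has_moment Q u L)"

definition well_defined_mean :: "functional \<Rightarrow> bool" where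
  "well_defined_mean u \<longleftrightarrow> (\<exists>L. has_moment (\<lambda>x. 1) u L)"

definition mean :: "functional \<Rightarrow> complex" where
  "mean u = moment (\<lambda>x. 1) u"

definition well_defined_impulse :: "functional \<Rightarrow> bool" where
  "well_defined_impulse u \<longleftrightarrow> (\<forall>i. \<exists>L. has_moment (\<lambda>x. x $ i) u L)"

definition impulse :: "functional \<Rightarrow> complex ^ 2" where
  "impulse u = (\<chi> i. moment (\<lambda>x. x $ i) u)"

definition well_defined_angular_momentum :: "functional \<Rightarrow> bool" where
  "well_defined_angular_momentum u \<longleftrightarrow> (\<exists>L. has_moment (\<lambda>x. (norm x)\<^sup>2) u L)"

definition angular_momentum :: "functional \<Rightarrow> complex" where
  "angular_momentum u = moment (\<lambda>x. (norm x)\<^sup>2) u"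

end

theory Submission
  imports Defs "HOL-Probability.Probability"
begin

text \<open>
  On the Fourier side, \<open>B(\<psi>, f)\<close> is the integral of \<open>\<psi>\<close>-hat at \<open>- (\<xi> + \<eta>)\<close> against
  \<open>f\<close>-hat at \<open>\<xi>\<close> and \<open>\<eta>\<close> with the kernel \<open>(\<xi> \<times> \<eta>) \<bar>\<xi>\<bar>\<^sup>2\<^sup>\<sigma>\<close>, where \<open>\<sigma> = \<delta> - 1\<close>. Symmetrising
  in the two frequencies bounds the kernel by \<open>\<bar>\<xi> + \<eta>\<bar>\<^sup>2 \<bar>\<xi>\<bar>\<^sup>\<sigma> \<bar>\<eta>\<bar>\<^sup>\<sigma>\<close>. Hence \<open>B(\<psi>, \<theta>)\<close> is bounded by
  the squared norm of \<open>\<theta>\<close> times the integral of \<open>\<bar>k\<bar>\<^sup>2\<close> times the modulus of \<open>\<psi>\<close>-hat. This plays the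
  role of the supremum of the second derivatives and scales in the same way under dilations.

  Time slices at two times differ by the functional \<open>W \<psi>\<close>, the integral of \<open>B(\<psi>, \<theta>(s))\<close> over the
  times between them, because slices are unique; if a slice fails to exist at one time then it does
  so at all times. For the truncations \<open>\<chi>(x/R) Q(x)\<close> of
  \<open>1\<close> and \<open>x\<^sub>i\<close> the bound is of order \<open>R\<^sup>-\<^sup>2\<close> and \<open>R\<^sup>-\<^sup>1\<close>, so \<open>W\<close> tends to zero. For \<open>\<bar>x\<bar>\<^sup>2\<close> it is
  merely bounded, but the limit of the form for large \<open>R\<close> sees only the Hessian of \<open>\<bar>x\<bar>\<^sup>2\<close>, a multiple
  of the identity, against which the antisymmetric form vanishes; dominated convergence in time
  concludes.
\<close>

section \<open>Smooth families of functions\<close>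

text \<open>Two obstacles shape the development. The first is that \<open>B\<close> is a
  \<open>THE\<close>: its value means something only if some sequence from \<open>schwartz0\<close>
  approximates the given distribution and all such sequences give the same limit. Hence
  \<open>schwartz0\<close> must be shown to be dense, which is why Fourier inversion, Plancherel,
  Young's inequality and frequency cutoffs precede the nonlinearity. Independence of the sequence
  rests on the symmetry of the form: a difference of two values is the form at the difference and
  the sum. The integral \<open>wiener\<close> is preferred to a supremum of derivatives because it
  enters by a single Cauchy--Schwarz estimate with a translation invariant weight. The second
  obstacle is uniformity. Time slices, their difference quotients, normalised test functions and
  dilated cutoffs must be bounded in every seminorm at once. Therefore smoothness and decay are
  treated for indexed families, a single function being a family over \<open>unit\<close>. Norms
  stay squared and in \<open>ennreal\<close>; triangle inequalities with constants 2 suffice, since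
  only convergence and domination matter.\<close>

lemma iter_deriv_Nil [simp]: "iter_deriv [] f = f"
  and iter_deriv_Cons: "iter_deriv (v # vs) f = dir_deriv v (iter_deriv vs f)"
  and iter_deriv_snoc: "iter_deriv (vs @ [v]) f = iter_deriv vs (dir_deriv v f)"
  by (simp_all add: iter_deriv_def)

lemma dir_deriv_eq: "(f has_derivative f') (at x) \<Longrightarrow> dir_deriv v f x = f' v"
  unfolding dir_deriv_def using frechet_derivative_at by metis

lemma has_derivative_dir_deriv:
  fixes f :: "'a::euclidean_space \<Rightarrow> 'b::real_normed_vector"
  assumes "f differentiable at x"
  shows "(f has_derivative (\<lambda>v. dir_deriv v f x)) (at x)"
  using assms unfolding frechet_derivative_works dir_deriv_def by simp

text \<open>All iterated derivatives exist and satisfy \<open>D\<close>. With the trivial \<open>D\<close> this is smoothness, with \<open>wb\<close> below it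
  is boundedness of the family in every Schwartz seminorm, and with \<open>pb\<close> the members are uniformly
  multipliers of the Schwartz space.\<close>

definition dfam :: "(('i \<Rightarrow> 'a::euclidean_space \<Rightarrow> complex) \<Rightarrow> bool) \<Rightarrow> ('i \<Rightarrow> 'a \<Rightarrow> complex) \<Rightarrow> bool" where
  "dfam D f \<longleftrightarrow> (\<forall>vs. set vs \<subseteq> Basis \<longrightarrow>
     (\<forall>i x. iter_deriv vs (f i) differentiable at x) \<and> D (\<lambda>i. iter_deriv vs (f i)))"

lemma dfamD:
  assumes "dfam D f"
  shows dfam_differentiable: "f i differentiable at x" and dfam_pred: "D f"
    and dfam_deriv: "b \<in> Basis \<Longrightarrow> dfam D (\<lambda>i. dir_deriv b (f i))"
proof -
  show "f i differentiable at x" "D f"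
    using assms[unfolded dfam_def, rule_format, of "[]"] by auto
  assume "b \<in> Basis"
  then show "dfam D (\<lambda>i. dir_deriv b (f i))"
    using assms[unfolded dfam_def, rule_format, of "_ @ [b]"]
    by (simp add: dfam_def iter_deriv_snoc)
qed

lemma dfam_iter: "dfam D f \<Longrightarrow> set vs \<subseteq> Basis \<Longrightarrow> dfam D (\<lambda>i. iter_deriv vs (f i))"
proof (induction vs)
  case (Cons v vs)
  then show ?case
    using dfam_deriv[of D "\<lambda>i. iter_deriv vs (f i)" v] by (simp add: iter_deriv_Cons)
qed simp

lemma dfam_mono: "dfam D f \<Longrightarrow> (\<And>g. D g \<Longrightarrow> D' g) \<Longrightarrow> dfam D' f"
  by (auto simp: dfam_def)

text \<open>Derivatives of a family need only stay in the class \<open>C\<close> up to finite sums, which suits the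
  product rule.\<close>

inductive add_closure :: "(('i \<Rightarrow> 'a \<Rightarrow> complex) \<Rightarrow> bool) \<Rightarrow> ('i \<Rightarrow> 'a \<Rightarrow> complex) \<Rightarrow> bool" for C where
  base: "C f \<Longrightarrow> add_closure C f"
| zero: "add_closure C (\<lambda>i x. 0)"
| add: "add_closure C f \<Longrightarrow> add_closure C g \<Longrightarrow> add_closure C (\<lambda>i x. f i x + g i x)"

lemma add_closure_sum:
  "finite A \<Longrightarrow> (\<And>a. a \<in> A \<Longrightarrow> add_closure C (f a)) \<Longrightarrow> add_closure C (\<lambda>i x. \<Sum>a\<in>A. f a i x)"
proof (induction A rule: finite_induct)
  case (insert a A)
  then show ?case using add_closure.add[of C "f a" "\<lambda>i x. \<Sum>a\<in>A. f a i x"] by simp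
qed (simp add: add_closure.zero)

lemma dir_deriv_add:
  assumes "f differentiable at x" "g differentiable at x"
  shows "dir_deriv b (\<lambda>x. f x + g x :: complex) x = dir_deriv b f x + dir_deriv b g x"
  by (rule dir_deriv_eq) (intro has_derivative_add has_derivative_dir_deriv assms)

lemma dir_deriv_const [simp]: "dir_deriv b (\<lambda>x. c) = (\<lambda>x. 0)"
  by (rule ext, rule dir_deriv_eq) (rule has_derivative_const)

lemma dir_deriv_mult:
  fixes f g :: "'a::euclidean_space \<Rightarrow> complex"
  assumes "f differentiable at x" "g differentiable at x"
  shows "dir_deriv b (\<lambda>x. f x * g x) x = f x * dir_deriv b g x + dir_deriv b f x * g x"
  by (rule dir_deriv_eq[OF has_derivative_mult[OF has_derivative_dir_deriv has_derivative_dir_deriv]]) (use assms in auto)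

lemma dir_deriv_cmult:
  fixes f :: "'a::euclidean_space \<Rightarrow> complex"
  assumes "f differentiable at x"
  shows "dir_deriv b (\<lambda>x. c * f x) x = c * dir_deriv b f x"
  using dir_deriv_mult[of "\<lambda>_. c" x f b] assms by simp

text \<open>A coinduction principle with invariant \<open>C\<close>. Derivatives need only stay in
  \<open>add_closure C\<close>, so sums are handled here once and for all; this is why
  \<open>D\<close> must contain zero and be additive. The induction peels off the innermost
  derivative, the last entry of the list, so that the induction hypothesis applies to another member
  of the closure.\<close>

lemma dfam_coinduct:
  assumes "C f"
    and step: "\<And>f i x. C f \<Longrightarrow> f i differentiable at x" "\<And>f. C f \<Longrightarrow> D f"
      "\<And>f b. C f \<Longrightarrow> b \<in> Basis \<Longrightarrow> add_closure C (\<lambda>i. dir_deriv b (f i))"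
    and zero: "D (\<lambda>i x. 0)"
    and add: "\<And>f g. D f \<Longrightarrow> D g \<Longrightarrow> D (\<lambda>i x. f i x + g i x)"
  shows "dfam D f"
proof -
  have *: "(\<forall>i x. f i differentiable at x) \<and> D f \<and> (\<forall>b\<in>Basis. add_closure C (\<lambda>i. dir_deriv b (f i)))"
    if "add_closure C f" for f
    using that
  proof induction
    case (base f)
    then show ?case using step by blast
  next
    case zero
    show ?case using assms(5) by (auto intro: add_closure.zero)
  next
    case (add f g)
    then have "dir_deriv b (\<lambda>x. f i x + g i x) = (\<lambda>x. dir_deriv b (f i) x + dir_deriv b (g i) x)" for b i
      by (auto intro!: dir_deriv_add)
    with add assms(6) show ?case
      by (auto intro: add_closure.add)
  qed
  have "(\<forall>i x. iter_deriv vs (f i) differentiable at x) \<and> D (\<lambda>i. iter_deriv vs (f i))"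
    if "set vs \<subseteq> Basis" "add_closure C f" for vs f
    using that
  proof (induction vs arbitrary: f rule: rev_induct)
    case Nil
    then show ?case using * by simp
  next
    case (snoc b vs)
    then show ?case using *[OF snoc.prems(2)] snoc.IH[of "\<lambda>i. dir_deriv b (f i)"]
      by (simp add: iter_deriv_snoc)
  qed
  then show ?thesis using assms(1) by (auto simp: dfam_def intro: add_closure.base)
qed

lemma dfam_add:
  fixes D :: "('i \<Rightarrow> 'a::euclidean_space \<Rightarrow> complex) \<Rightarrow> bool"
  assumes "dfam D f" "dfam D g"
    and zero: "D (\<lambda>i x. 0)" and add: "\<And>f g. D f \<Longrightarrow> D g \<Longrightarrow> D (\<lambda>i x. f i x + g i x)"
  shows "dfam D (\<lambda>i x. f i x + g i x)"
proof (rule dfam_coinduct[where C = "\<lambda>h. \<exists>f g. dfam D f \<and> dfam D g \<and> h = (\<lambda>i x. f i x + g i x)"])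
  fix h :: "'i \<Rightarrow> 'a \<Rightarrow> complex" and i x
  assume "\<exists>f g. dfam D f \<and> dfam D g \<and> h = (\<lambda>i x. f i x + g i x)"
  then obtain f g where *: "dfam D f" "dfam D g" and h: "h = (\<lambda>i x. f i x + g i x)" by blast
  show "h i differentiable at x" unfolding h
    by (intro differentiable_add dfam_differentiable[OF *(1)] dfam_differentiable[OF *(2)])
next
  fix h :: "'i \<Rightarrow> 'a \<Rightarrow> complex"
  assume "\<exists>f g. dfam D f \<and> dfam D g \<and> h = (\<lambda>i x. f i x + g i x)"
  then show "D h" using add dfam_pred by blast
next
  fix h :: "'i \<Rightarrow> 'a \<Rightarrow> complex" and b :: 'a
  assume "\<exists>f g. dfam D f \<and> dfam D g \<and> h = (\<lambda>i x. f i x + g i x)" and b: "b \<in> Basis"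
  then obtain f g where *: "dfam D f" "dfam D g" and h: "h = (\<lambda>i x. f i x + g i x)" by blast
  have "(\<lambda>i. dir_deriv b (h i)) = (\<lambda>i x. dir_deriv b (f i) x + dir_deriv b (g i) x)"
    unfolding h by (intro ext dir_deriv_add dfam_differentiable[OF *(1)] dfam_differentiable[OF *(2)])
  then show "add_closure (\<lambda>h. \<exists>f g. dfam D f \<and> dfam D g \<and> h = (\<lambda>i x. f i x + g i x)) (\<lambda>i. dir_deriv b (h i))"
    using dfam_deriv[OF *(1) b] dfam_deriv[OF *(2) b] by (intro add_closure.base) blast
qed (use assms in auto)

text \<open>The product rule produces two summands that are again products of the same kind, so
  these products are an invariant up to sums. Three predicates are allowed because the factors may
  differ in nature: a \<open>pb\<close> multiplier times a \<open>wb\<close> family is again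
  \<open>wb\<close>.\<close>

lemma dfam_mult:
  fixes D3 :: "('i \<Rightarrow> 'a::euclidean_space \<Rightarrow> complex) \<Rightarrow> bool"
  assumes "dfam D1 f" "dfam D2 g"
    and mult: "\<And>f g. D1 f \<Longrightarrow> D2 g \<Longrightarrow> D3 (\<lambda>i x. f i x * g i x)"
    and zero: "D3 (\<lambda>i x. 0)" and add: "\<And>f g. D3 f \<Longrightarrow> D3 g \<Longrightarrow> D3 (\<lambda>i x. f i x + g i x)"
  shows "dfam D3 (\<lambda>i x. f i x * g i x)"
proof (rule dfam_coinduct[where C = "\<lambda>h. \<exists>f g. dfam D1 f \<and> dfam D2 g \<and> h = (\<lambda>i x. f i x * g i x)"])
  fix h :: "'i \<Rightarrow> 'a \<Rightarrow> complex" and i x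
  assume "\<exists>f g. dfam D1 f \<and> dfam D2 g \<and> h = (\<lambda>i x. f i x * g i x)"
  then obtain f g where *: "dfam D1 f" "dfam D2 g" and h: "h = (\<lambda>i x. f i x * g i x)" by blast
  show "h i differentiable at x" unfolding h
    by (intro differentiable_mult dfam_differentiable[OF *(1)] dfam_differentiable[OF *(2)])
next
  fix h :: "'i \<Rightarrow> 'a \<Rightarrow> complex"
  assume "\<exists>f g. dfam D1 f \<and> dfam D2 g \<and> h = (\<lambda>i x. f i x * g i x)"
  then show "D3 h" using mult dfam_pred by blast
next
  fix h :: "'i \<Rightarrow> 'a \<Rightarrow> complex" and b :: 'a
  assume "\<exists>f g. dfam D1 f \<and> dfam D2 g \<and> h = (\<lambda>i x. f i x * g i x)" and b: "b \<in> Basis"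
  then obtain f g where *: "dfam D1 f" "dfam D2 g" and h: "h = (\<lambda>i x. f i x * g i x)" by blast
  have "(\<lambda>i. dir_deriv b (h i)) = (\<lambda>i x. f i x * dir_deriv b (g i) x + dir_deriv b (f i) x * g i x)"
    unfolding h by (intro ext dir_deriv_mult dfam_differentiable[OF *(1)] dfam_differentiable[OF *(2)])
  then show "add_closure (\<lambda>h. \<exists>f g. dfam D1 f \<and> dfam D2 g \<and> h = (\<lambda>i x. f i x * g i x)) (\<lambda>i. dir_deriv b (h i))"
    using dfam_deriv[OF *(1) b] dfam_deriv[OF *(2) b] *
    by (auto simp only: intro!: add_closure.add[OF add_closure.base add_closure.base])
qed (use assms in auto)

lemma smooth_iff_dfam: "smooth f \<longleftrightarrow> dfam (\<lambda>_. True) (\<lambda>_::unit. f)"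
  by (simp add: smooth_def dfam_def)

lemma smooth_deriv: "smooth f \<Longrightarrow> b \<in> Basis \<Longrightarrow> smooth (dir_deriv b f)" for f :: "'a::euclidean_space \<Rightarrow> complex"
  unfolding smooth_iff_dfam by (rule dfam_deriv)

lemma smooth_iter: "smooth f \<Longrightarrow> set vs \<subseteq> Basis \<Longrightarrow> smooth (iter_deriv vs f)" for f :: "'a::euclidean_space \<Rightarrow> complex"
  unfolding smooth_iff_dfam by (rule dfam_iter)

lemma smooth_differentiable: "smooth f \<Longrightarrow> f differentiable at x" for f :: "'a::euclidean_space \<Rightarrow> complex"
  unfolding smooth_iff_dfam by (rule dfam_differentiable)

lemma smooth_continuous: "smooth f \<Longrightarrow> continuous_on A f" for f :: "'a::euclidean_space \<Rightarrow> complex"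
  by (meson smooth_differentiable continuous_at_imp_continuous_on differentiable_imp_continuous_within)

lemma smooth_add: "smooth f \<Longrightarrow> smooth g \<Longrightarrow> smooth (\<lambda>x. f x + g x)" for f :: "'a::euclidean_space \<Rightarrow> complex"
  unfolding smooth_iff_dfam by (rule dfam_add) auto

lemma smooth_mult: "smooth f \<Longrightarrow> smooth g \<Longrightarrow> smooth (\<lambda>x. f x * g x)" for f :: "'a::euclidean_space \<Rightarrow> complex"
  unfolding smooth_iff_dfam by (rule dfam_mult) auto

lemma smooth_const: "smooth (\<lambda>x::'a::euclidean_space. c::complex)"
  unfolding smooth_iff_dfam
  by (rule dfam_coinduct[where C = "\<lambda>h. \<exists>c. h = (\<lambda>i x. c)"]) (auto intro: add_closure.zero)

lemma has_derivative_Basis_sum: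
  fixes f :: "'a::euclidean_space \<Rightarrow> complex"
  assumes "(f has_derivative f') (at x)"
  shows "f' v = (\<Sum>c\<in>Basis. of_real (v \<bullet> c) * f' c)"
proof -
  interpret bounded_linear f' using assms has_derivative_bounded_linear by blast
  have "f' v = f' (\<Sum>c\<in>Basis. (v \<bullet> c) *\<^sub>R c)" by (simp add: euclidean_representation)
  then show ?thesis by (simp add: sum scaleR scaleR_conv_of_real)
qed

lemma dir_deriv_compose_affine:
  fixes f :: "'b::euclidean_space \<Rightarrow> complex" and L :: "'a::euclidean_space \<Rightarrow> 'b"
  assumes "\<And>x. f differentiable at x" "bounded_linear L"
  shows "(\<lambda>x. f (a + L x)) differentiable at x"
    and "dir_deriv v (\<lambda>x. f (a + L x)) x = (\<Sum>c\<in>Basis. of_real (L v \<bullet> c) * dir_deriv c f (a + L x))"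
proof -
  have "((\<lambda>x. a + L x) has_derivative L) (at x)"
    using bounded_linear_imp_has_derivative[OF assms(2)]
    by (auto intro!: derivative_eq_intros)
  from has_derivative_compose[OF this has_derivative_dir_deriv[OF assms(1)]]
  have *: "((\<lambda>x. f (a + L x)) has_derivative (\<lambda>v. dir_deriv (L v) f (a + L x))) (at x)" .
  then show "(\<lambda>x. f (a + L x)) differentiable at x" by (rule differentiableI)
  show "dir_deriv v (\<lambda>x. f (a + L x)) x = (\<Sum>c\<in>Basis. of_real (L v \<bullet> c) * dir_deriv c f (a + L x))"
    unfolding dir_deriv_eq[OF *] by (rule has_derivative_Basis_sum[OF has_derivative_dir_deriv[OF assms(1)]])
qed

lemma smooth_compose_affine:
  fixes f :: "'b::euclidean_space \<Rightarrow> complex" and L :: "'a::euclidean_space \<Rightarrow> 'b"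
  assumes "smooth f" and L: "bounded_linear L"
  shows "smooth (\<lambda>x. f (a + L x))"
proof -
  \<comment> \<open>The factor \<open>c\<close> collects the coefficients
    \<open>L b \<bullet> d\<close> of the chain rule; without it a derivative would not be a sum of
    members of the class.\<close>
  let ?C = "\<lambda>h :: unit \<Rightarrow> 'a \<Rightarrow> complex. \<exists>(c::complex) f. smooth f \<and> h = (\<lambda>_. \<lambda>x. c * f (a + L x))"
  have "dfam (\<lambda>_. True) (\<lambda>_::unit. \<lambda>x. 1 * f (a + L x))"
  proof (rule dfam_coinduct[where C = ?C])
    show "?C (\<lambda>_. \<lambda>x. 1 * f (a + L x))" using assms(1) by blast
  next
    fix h i and x :: 'a assume "?C h"
    then obtain c f where f: "smooth f" "h = (\<lambda>_. \<lambda>x. c * f (a + L x))" by blast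
    show "h i differentiable at x" unfolding f(2)
      by (intro differentiable_mult differentiable_const dir_deriv_compose_affine(1) smooth_differentiable f(1) L)
  next
    fix h and b :: 'a assume "?C h" and b: "b \<in> Basis"
    then obtain c f where f: "smooth f" "h = (\<lambda>_. \<lambda>x. c * f (a + L x))" by blast
    have "(\<lambda>i. dir_deriv b (h i)) = (\<lambda>i x. \<Sum>d\<in>Basis. (c * of_real (L b \<bullet> d)) * dir_deriv d f (a + L x))"
      unfolding f(2)
      by (intro ext, subst dir_deriv_cmult)
        (simp_all add: dir_deriv_compose_affine[OF smooth_differentiable[OF f(1)] L] sum_distrib_left mult.assoc)
    moreover have "add_closure ?C (\<lambda>i x. \<Sum>d\<in>Basis. (c * of_real (L b \<bullet> d)) * dir_deriv d f (a + L x))"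
    proof (intro add_closure_sum add_closure.base)
      fix d :: 'b assume "d \<in> Basis"
      then have "smooth (dir_deriv d f)" by (rule smooth_deriv[OF f(1)])
      then show "?C (\<lambda>i x. (c * of_real (L b \<bullet> d)) * dir_deriv d f (a + L x))" by blast
    qed simp
    ultimately show "add_closure ?C (\<lambda>i. dir_deriv b (h i))" by simp
  qed auto
  then show ?thesis unfolding smooth_iff_dfam by simp
qed

lemma smooth_cnj:
  fixes f :: "'a::euclidean_space \<Rightarrow> complex"
  assumes "smooth f" shows "smooth (\<lambda>x. cnj (f x))"
  unfolding smooth_iff_dfam
proof (rule dfam_coinduct[where C = "\<lambda>h. \<exists>f. smooth f \<and> h = (\<lambda>_ x. cnj (f x))"])
  have *: "((\<lambda>x. cnj (f x)) has_derivative (\<lambda>v. cnj (dir_deriv v f x))) (at x)" if "smooth f" for f and x :: 'a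
    by (intro has_derivative_cnj has_derivative_dir_deriv smooth_differentiable that)
  fix h :: "unit \<Rightarrow> 'a \<Rightarrow> complex" and i and x b :: 'a
  assume "\<exists>f. smooth f \<and> h = (\<lambda>_ x. cnj (f x))"
  then obtain f where f: "smooth f" "h = (\<lambda>_ x. cnj (f x))" by blast
  show "h i differentiable at x" unfolding f(2) by (rule differentiableI[OF *[OF f(1)]])
  assume b: "b \<in> Basis"
  have "(\<lambda>i. dir_deriv b (h i)) = (\<lambda>i x. cnj (dir_deriv b f x))"
    unfolding f(2) by (intro ext dir_deriv_eq[OF *[OF f(1)]])
  then show "add_closure (\<lambda>h. \<exists>f. smooth f \<and> h = (\<lambda>_ x. cnj (f x))) (\<lambda>i. dir_deriv b (h i))"
    using smooth_deriv[OF f(1) b] by (intro add_closure.base exI[of _ "dir_deriv b f"]) simp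
qed (use assms in \<open>simp_all, blast\<close>)

lemma smooth_bounded_linear:
  fixes L :: "'a::euclidean_space \<Rightarrow> complex"
  assumes "bounded_linear L" shows "smooth L"
  unfolding smooth_iff_dfam
proof (rule dfam_coinduct[where C = "\<lambda>h. h = (\<lambda>_. L) \<or> (\<exists>c. h = (\<lambda>_ _. c))"])
  have *: "(L has_derivative L) (at x)" for x
    using assms bounded_linear_imp_has_derivative by blast
  have D: "dir_deriv b L = (\<lambda>_. L b)" for b by (intro ext dir_deriv_eq *)
  show "add_closure (\<lambda>h. h = (\<lambda>_. L) \<or> (\<exists>c. h = (\<lambda>_ _. c))) (\<lambda>i. dir_deriv b (f i))"
    if "f = (\<lambda>_. L) \<or> (\<exists>c. f = (\<lambda>_ _. c))" for f :: "unit \<Rightarrow> 'a \<Rightarrow> complex" and b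
    using that
  proof (elim disjE exE)
    assume "f = (\<lambda>_. L)"
    then have "(\<lambda>i. dir_deriv b (f i)) = (\<lambda>_ _. L b)" by (simp add: D)
    then show ?thesis by (intro add_closure.base disjI2) blast
  qed (simp add: add_closure.zero)
  show "f i differentiable at x"
    if "f = (\<lambda>_. L) \<or> (\<exists>c. f = (\<lambda>_ _. c))" for f :: "unit \<Rightarrow> 'a \<Rightarrow> complex" and i x
    using that differentiableI[OF *] by auto
qed auto

text \<open>Basis vectors of the plane become the basis vectors \<open>(0, v)\<close> of space-time.
  Bounds for derivatives of \<phi> on space-time thereby turn into bounds for all its slices,
  uniform in time.\<close>

lemma iter_deriv_compose_snd:
  fixes \<phi> :: "'b::euclidean_space \<times> 'a::euclidean_space \<Rightarrow> complex"
  assumes "smooth \<phi>" "set vs \<subseteq> Basis"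
  shows "iter_deriv vs (\<lambda>x. \<phi> (t, x)) x = iter_deriv (map (Pair 0) vs) \<phi> (t, x)"
  using assms(2)
proof (induction vs arbitrary: x)
  case (Cons v vs)
  have IH: "iter_deriv vs (\<lambda>x. \<phi> (t, x)) = (\<lambda>x. iter_deriv (map (Pair 0) vs) \<phi> (t, x))"
    using Cons by auto
  have "smooth (iter_deriv (map (Pair 0) vs) \<phi>)"
    by (rule smooth_iter[OF assms(1)]) (use Cons in \<open>auto simp: Basis_prod_def\<close>)
  then have "(iter_deriv (map (Pair 0) vs) \<phi> has_derivative (\<lambda>v. dir_deriv v (iter_deriv (map (Pair 0) vs) \<phi>) (t, x))) (at (t, x))"
    by (intro has_derivative_dir_deriv smooth_differentiable)
  moreover have "((\<lambda>x. (t, x)) has_derivative (\<lambda>v. (0, v))) (at x)"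
    by (auto intro!: derivative_eq_intros)
  ultimately have "((\<lambda>x. iter_deriv (map (Pair 0) vs) \<phi> (t, x)) has_derivative
      (\<lambda>v. dir_deriv (0, v) (iter_deriv (map (Pair 0) vs) \<phi>) (t, x))) (at x)"
    by (rule has_derivative_compose[rotated])
  then show ?case by (simp add: iter_deriv_Cons IH dir_deriv_eq)
qed simp

lemma dir_deriv_zero_outside:
  assumes "closed K" "\<And>y. y \<notin> K \<Longrightarrow> f y = 0" "x \<notin> K"
  shows "dir_deriv v f x = (0::complex)"
proof -
  have "((\<lambda>x. 0) has_derivative (\<lambda>_. 0::complex)) (at x)" by simp
  moreover have "open (- K)" using assms by auto
  ultimately have "(f has_derivative (\<lambda>_. 0)) (at x)"
    by (rule has_derivative_transform_within_open) (use assms in auto)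
  then show ?thesis by (rule dir_deriv_eq)
qed

lemma iter_deriv_zero_outside:
  fixes f :: "'a::euclidean_space \<Rightarrow> complex"
  assumes "closed K" "\<And>y. y \<notin> K \<Longrightarrow> f y = 0" "x \<notin> K"
  shows "iter_deriv vs f x = 0"
  using assms(3)
proof (induction vs arbitrary: x)
  case Nil
  then show ?case using assms(2) by simp
next
  case (Cons v vs)
  show ?case unfolding iter_deriv_Cons by (rule dir_deriv_zero_outside[OF assms(1) Cons.IH Cons.prems])
qed

lemma zero_outside_supp: "x \<notin> supp f \<Longrightarrow> f x = 0"
  unfolding supp_def using closure_subset[of "{x. f x \<noteq> 0}"] by auto

lemma supp_subset: "closed K \<Longrightarrow> (\<And>x. x \<notin> K \<Longrightarrow> f x = 0) \<Longrightarrow> supp f \<subseteq> K"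
  unfolding supp_def by (intro closure_minimal) auto

lemma closed_supp [simp]: "closed (supp f)" by (simp add: supp_def)

lemma compact_supp: "compact K \<Longrightarrow> (\<And>x. x \<notin> K \<Longrightarrow> f x = 0) \<Longrightarrow> compact (supp f)" for f :: "'a::euclidean_space \<Rightarrow> complex"
  using compact_Int_closed[of K "supp f"] supp_subset[of K f] compact_imp_closed[of K] by (simp add: Int_absorb1)

section \<open>Schwartz functions\<close>

lemma DIM_plane [simp]: "card (Basis :: plane set) = 2"
  by (simp add: DIM_cart)

text \<open>\<open>lborel\<close> on the plane is the image of a product measure indexed by
  \<open>Basis\<close>, so products of one-dimensional functions integrate factor by factor. It
  serves for the comparison function in \<open>integrable_decay\<close> and for the
  Gaussian.\<close>

lemma integral_prod_Basis:
  fixes f :: "plane \<Rightarrow> real \<Rightarrow> 'b::{real_normed_field,banach,second_countable_topology}"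
  assumes "\<And>b. b \<in> Basis \<Longrightarrow> integrable lborel (f b)"
  shows "integrable lborel (\<lambda>x. \<Prod>b\<in>Basis. f b (x \<bullet> b))"
    and "(LINT x|lborel. (\<Prod>b\<in>Basis. f b (x \<bullet> b))) = (\<Prod>b\<in>Basis. LINT x|lborel. f b x)"
proof -
  interpret product_sigma_finite "\<lambda>_::plane. lborel::real measure" by standard
  have [measurable]: "\<And>b. b \<in> Basis \<Longrightarrow> f b \<in> borel_measurable borel"
    using borel_measurable_integrable[OF assms] by simp
  have m: "(\<lambda>x::plane. \<Prod>b\<in>Basis. f b (x \<bullet> b)) \<in> borel_measurable borel" by measurable
  have t: "(\<lambda>f::plane \<Rightarrow> real. \<Sum>b\<in>Basis. f b *\<^sub>R b) \<in> (\<Pi>\<^sub>M b\<in>Basis. lborel) \<rightarrow>\<^sub>M borel"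
    by measurable
  have eq: "(\<Prod>b\<in>Basis. f b ((\<Sum>c\<in>Basis. y c *\<^sub>R c) \<bullet> b)) = (\<Prod>b\<in>Basis. f b (y b))" for y
    by (intro prod.cong refl) simp
  show "integrable lborel (\<lambda>x. \<Prod>b\<in>Basis. f b (x \<bullet> b))"
    unfolding lborel_eq[where 'a=plane] integrable_distr_eq[OF t m] eq
    by (intro product_integrable_prod assms) auto
  show "(LINT x|lborel. (\<Prod>b\<in>Basis. f b (x \<bullet> b))) = (\<Prod>b\<in>Basis. LINT x|lborel. f b x)"
    unfolding lborel_eq[where 'a=plane] integral_distr[OF t m] eq
    by (intro product_integral_prod assms) auto
qed

text \<open>Comparison with the product of the two functions
  \<open>inverse (1 + (x \<bullet> b)\<^sup>2)\<close>. Each factor of the denominator is at most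
  \<open>(1 + norm x)\<^sup>2\<close>, which explains the exponent 4. This weight is the standard
  dominating function in what follows.\<close>

lemma integrable_decay: "integrable lborel (\<lambda>x::plane. inverse ((1 + norm x) ^ 4))"
proof (rule Bochner_Integration.integrable_bound)
  have "integrable lborel (\<lambda>x::real. inverse (1 + x\<^sup>2))"
    using integrable_inverse_1_plus_square by (simp add: set_integrable_def)
  then show "integrable lborel (\<lambda>x::plane. \<Prod>b\<in>Basis. inverse (1 + (x \<bullet> b)\<^sup>2))"
    by (rule integral_prod_Basis(1)[where f = "\<lambda>_ x. inverse (1 + x\<^sup>2)"])
  have "inverse ((1 + norm x) ^ 4) \<le> (\<Prod>b\<in>Basis. inverse (1 + (x \<bullet> b)\<^sup>2))" for x :: plane
  proof -
    have "(\<Prod>b\<in>(Basis::plane set). 1 + (x \<bullet> b)\<^sup>2) \<le> (\<Prod>b\<in>(Basis::plane set). (1 + norm x)\<^sup>2)"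
    proof (intro prod_mono conjI)
      fix b :: plane assume "b \<in> Basis"
      then have "(x \<bullet> b)\<^sup>2 \<le> (norm x)\<^sup>2" using Basis_le_norm[of b x] by (simp add: abs_le_square_iff[symmetric])
      then show "1 + (x \<bullet> b)\<^sup>2 \<le> (1 + norm x)\<^sup>2"
        using norm_ge_zero[of x] by (simp add: power2_sum add_increasing2)
    qed simp
    also have "\<dots> = (1 + norm x) ^ 4" by simp
    finally have "(\<Prod>b\<in>(Basis::plane set). 1 + (x \<bullet> b)\<^sup>2) \<le> (1 + norm x) ^ 4" .
    moreover have "(\<Prod>b\<in>(Basis::plane set). inverse (1 + (x \<bullet> b)\<^sup>2)) = inverse (\<Prod>b\<in>Basis. 1 + (x \<bullet> b)\<^sup>2)"
      using prod_inversef[of "\<lambda>b. 1 + (x \<bullet> b)\<^sup>2" "Basis::plane set"] by (simp add: o_def)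
    ultimately show ?thesis
      by (simp only:, intro le_imp_inverse_le prod_pos) (auto intro: add_pos_nonneg)
  qed
  moreover have "0 \<le> (\<Prod>b\<in>Basis. inverse (1 + (x \<bullet> b)\<^sup>2))" for x :: plane by (intro prod_nonneg) auto
  ultimately show "AE x::plane in lborel. norm (inverse ((1 + norm x) ^ 4)) \<le> norm (\<Prod>b\<in>Basis. inverse (1 + (x \<bullet> b)\<^sup>2))"
    by (intro AE_I2) simp
qed simp

lemma nn_integral_plane_affine:
  fixes f :: "plane \<Rightarrow> ennreal"
  assumes [measurable]: "f \<in> borel_measurable borel" and c: "c \<noteq> 0"
  shows "(\<integral>\<^sup>+x. f x \<partial>lborel) = ennreal (c\<^sup>2) * (\<integral>\<^sup>+x. f (t + c *\<^sub>R x) \<partial>lborel)"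
  by (subst lborel_affine[OF c, of t])
     (simp add: nn_integral_density nn_integral_distr nn_integral_cmult)

lemma integrable_plane_affine:
  fixes f :: "plane \<Rightarrow> 'b::{banach,second_countable_topology}"
  assumes f: "integrable lborel f" and c: "c \<noteq> 0"
  shows "integrable lborel (\<lambda>x. f (t + c *\<^sub>R x))"
proof -
  have [measurable]: "f \<in> borel_measurable borel" using borel_measurable_integrable[OF f] by simp
  have "(\<integral>\<^sup>+x. norm (f x) \<partial>lborel) = ennreal (c\<^sup>2) * (\<integral>\<^sup>+x. norm (f (t + c *\<^sub>R x)) \<partial>lborel)"
    by (rule nn_integral_plane_affine) (use c in auto)
  moreover have "(\<integral>\<^sup>+x. norm (f x) \<partial>lborel) < \<infinity>" using f by (simp add: integrable_iff_bounded)
  ultimately have "(\<integral>\<^sup>+x. norm (f (t + c *\<^sub>R x)) \<partial>lborel) < \<infinity>"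
    using c by (auto simp: ennreal_mult_less_top)
  then show ?thesis by (simp add: integrable_iff_bounded)
qed

lemma integral_plane_affine:
  fixes f :: "plane \<Rightarrow> 'b::{banach,second_countable_topology}"
  assumes f: "f \<in> borel_measurable borel" and c: "c \<noteq> 0"
  shows "(LINT x|lborel. f x) = c\<^sup>2 *\<^sub>R (LINT x|lborel. f (t + c *\<^sub>R x))"
  using f c by (subst lborel_affine[OF c, of t]) (simp add: integral_density integral_distr)

section \<open>Families bounded in every Schwartz seminorm, and their multipliers\<close>

definition wb :: "('i \<Rightarrow> plane \<Rightarrow> complex) \<Rightarrow> bool" where
  "wb f \<longleftrightarrow> (\<forall>N. \<exists>K. \<forall>i x. (1 + norm x) ^ N * norm (f i x) \<le> K)"

definition pb :: "('i \<Rightarrow> plane \<Rightarrow> complex) \<Rightarrow> bool" where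
  "pb f \<longleftrightarrow> (\<exists>N K. \<forall>i x. norm (f i x) \<le> K * (1 + norm x) ^ N)"

lemma wb_zero [simp]: "wb (\<lambda>i x. 0)" by (auto simp: wb_def)

lemma wb_add: "wb f \<Longrightarrow> wb g \<Longrightarrow> wb (\<lambda>i x. f i x + g i x)"
  unfolding wb_def
proof
  fix N assume "\<forall>N. \<exists>K. \<forall>i x. (1 + norm x) ^ N * norm (f i x) \<le> K" "\<forall>N. \<exists>K. \<forall>i x. (1 + norm x) ^ N * norm (g i x) \<le> K"
  then obtain K K' where *: "\<And>i x. (1 + norm x) ^ N * norm (f i x) \<le> K" "\<And>i x. (1 + norm x) ^ N * norm (g i x) \<le> K'"
    by metis
  have "(1 + norm x) ^ N * norm (f i x + g i x) \<le> K + K'" for i x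
  proof -
    have "(1 + norm x) ^ N * norm (f i x + g i x) \<le> (1 + norm x) ^ N * (norm (f i x) + norm (g i x))"
      by (intro mult_left_mono norm_triangle_ineq) simp
    then show ?thesis using add_mono[OF *] by (simp add: ring_distribs) (meson order_trans)
  qed
  then show "\<exists>K. \<forall>i x. (1 + norm x) ^ N * norm (f i x + g i x) \<le> K" by blast
qed

lemma wb_mult: "pb m \<Longrightarrow> wb f \<Longrightarrow> wb (\<lambda>i x. m i x * f i x)"
  unfolding wb_def
proof
  fix N assume "pb m" and f: "\<forall>N. \<exists>K. \<forall>i x. (1 + norm x) ^ N * norm (f i x) \<le> K"
  then obtain M C where m: "\<And>i x. norm (m i x) \<le> C * (1 + norm x) ^ M" by (auto simp: pb_def)
  obtain K where K: "\<And>i x. (1 + norm x) ^ (N + M) * norm (f i x) \<le> K" using f by metis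
  have "(1 + norm x) ^ N * norm (m i x * f i x) \<le> \<bar>C\<bar> * K" for i x
  proof -
    have "norm (m i x) \<le> \<bar>C\<bar> * (1 + norm x) ^ M"
      using m[of i x] by (meson abs_ge_self add_nonneg_nonneg mult_right_mono norm_ge_zero order_trans zero_le_one zero_le_power)
    then have "(1 + norm x) ^ N * norm (m i x * f i x) \<le> (1 + norm x) ^ N * ((\<bar>C\<bar> * (1 + norm x) ^ M) * norm (f i x))"
      unfolding norm_mult by (intro mult_left_mono mult_right_mono) auto
    also have "\<dots> = \<bar>C\<bar> * ((1 + norm x) ^ (N + M) * norm (f i x))" by (simp add: power_add)
    also have "\<dots> \<le> \<bar>C\<bar> * K" by (intro mult_left_mono K) simp
    finally show ?thesis .
  qed
  then show "\<exists>K. \<forall>i x. (1 + norm x) ^ N * norm (m i x * f i x) \<le> K" by blast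
qed

abbreviation sfam :: "('i \<Rightarrow> plane \<Rightarrow> complex) \<Rightarrow> bool" where "sfam \<equiv> dfam wb"

lemma sfam_add: "sfam f \<Longrightarrow> sfam g \<Longrightarrow> sfam (\<lambda>i x. f i x + g i x)"
  by (rule dfam_add[OF _ _ wb_zero wb_add])

lemma sfam_mult: "dfam pb m \<Longrightarrow> sfam f \<Longrightarrow> sfam (\<lambda>i x. m i x * f i x)"
  by (rule dfam_mult[OF _ _ wb_mult wb_zero wb_add])

lemma pb_const [simp]: "pb (\<lambda>i x. c)" unfolding pb_def by (intro exI[of _ 0] exI[of _ "norm c"]) auto

lemma dfam_pb_const [simp]: "dfam pb (\<lambda>i x. c)"
proof -
  have "iter_deriv vs (\<lambda>x::plane. c) = (if vs = [] then (\<lambda>x. c) else (\<lambda>x. 0))" for vs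
    by (induction vs) (auto simp: iter_deriv_Cons)
  then show ?thesis by (auto simp: dfam_def)
qed

lemma pb_linear:
  assumes "bounded_linear L" shows "pb (\<lambda>i. L)"
proof -
  obtain K where K: "\<And>x. norm (L x) \<le> norm x * K" "K > 0" using bounded_linear.pos_bounded[OF assms] by blast
  have "norm (L x) \<le> K * (1 + norm x) ^ 1" for x
    using K(1)[of x] K(2) by (simp add: algebra_simps)
  then show ?thesis unfolding pb_def by blast
qed

lemma dfam_pb_linear:
  assumes "bounded_linear L" shows "dfam pb (\<lambda>i. L)"
proof -
  have *: "(L has_derivative L) (at x)" for x
    using assms bounded_linear_imp_has_derivative by blast
  have D: "dir_deriv b L = (\<lambda>_. L b)" for b by (intro ext dir_deriv_eq *)
  show ?thesis unfolding dfam_def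
  proof (intro allI impI)
    fix vs :: "plane list" assume "set vs \<subseteq> Basis"
    show "(\<forall>i x. iter_deriv vs L differentiable at x) \<and> pb (\<lambda>i. iter_deriv vs L)"
    proof (cases vs rule: rev_cases)
      case Nil
      then show ?thesis using pb_linear[OF assms] differentiableI[OF *] by simp
    next
      case (snoc ws b)
      have "dfam pb (\<lambda>i::unit. \<lambda>x::plane. L b)" by simp
      with \<open>set vs \<subseteq> Basis\<close> snoc show ?thesis by (simp add: iter_deriv_snoc D dfam_def pb_def)
    qed
  qed
qed

lemma sfam_cmult: "sfam f \<Longrightarrow> sfam (\<lambda>i x. c * f i x)"
  by (rule sfam_mult) auto

lemma sfam_coord: "sfam f \<Longrightarrow> sfam (\<lambda>i x. complex_of_real (x \<bullet> b) * f i x)"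
  by (intro sfam_mult dfam_pb_linear bounded_linear_compose[OF bounded_linear_of_real] bounded_linear_inner_left)

lemma sfam_sum: "finite A \<Longrightarrow> (\<And>a. a \<in> A \<Longrightarrow> sfam (f a)) \<Longrightarrow> sfam (\<lambda>i x. \<Sum>a\<in>A. f a i x)"
proof (induction A rule: finite_induct)
  case empty
  have "iter_deriv vs (\<lambda>x::plane. 0 :: complex) = (\<lambda>x. 0)" for vs
    by (induction vs) (auto simp: iter_deriv_Cons)
  then show ?case by (simp add: dfam_def)
next
  case (insert a A)
  then show ?case using sfam_add[of "f a" "\<lambda>i x. \<Sum>a\<in>A. f a i x"] by simp
qed

lemma schwartzI_bounds:
  assumes "\<And>vs x. set vs \<subseteq> Basis \<Longrightarrow> iter_deriv vs f differentiable at x"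
    and "\<And>vs N. set vs \<subseteq> Basis \<Longrightarrow> \<exists>K. \<forall>x. (1 + norm x) ^ N * norm (iter_deriv vs f x) \<le> K"
  shows "f \<in> schwartz"
proof -
  have "bounded (range (\<lambda>x. (1 + norm x) ^ N *\<^sub>R iter_deriv vs f x))" if vs: "set vs \<subseteq> Basis" for N vs
  proof -
    obtain K where K: "\<And>x. (1 + norm x) ^ N * norm (iter_deriv vs f x) \<le> K" using assms(2)[OF vs] by metis
    show ?thesis by (rule boundedI[of _ K]) (use K in \<open>auto simp: abs_mult\<close>)
  qed
  then show ?thesis using assms(1) by (simp add: schwartz_def smooth_def)
qed

lemma schwartz_weight_bound:
  assumes "f \<in> schwartz" "set vs \<subseteq> Basis"
  shows "\<exists>K. \<forall>x. (1 + norm x) ^ N * norm (iter_deriv vs f x) \<le> K"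
proof -
  have "bounded (range (\<lambda>x. (1 + norm x) ^ N *\<^sub>R iter_deriv vs f x))"
    using assms by (simp add: schwartz_def)
  then obtain K where "\<And>y. y \<in> range (\<lambda>x. (1 + norm x) ^ N *\<^sub>R iter_deriv vs f x) \<Longrightarrow> norm y \<le> K"
    unfolding bounded_iff by metis
  from this[OF rangeI] have "(1 + norm x) ^ N * norm (iter_deriv vs f x) \<le> K" for x by (simp add: abs_mult)
  then show ?thesis by metis
qed

lemma sfam_member:
  assumes "sfam f" shows "f i \<in> schwartz"
proof (rule schwartzI_bounds)
  fix vs :: "plane list" and N assume vs: "set vs \<subseteq> Basis"
  show "iter_deriv vs (f i) differentiable at x" for x
    using assms vs by (simp add: dfam_def)
  have "wb (\<lambda>i. iter_deriv vs (f i))" using assms vs by (simp add: dfam_def)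
  then show "\<exists>K. \<forall>x. (1 + norm x) ^ N * norm (iter_deriv vs (f i) x) \<le> K" unfolding wb_def by metis
qed

lemma schwartz_iff_sfam: "f \<in> schwartz \<longleftrightarrow> sfam (\<lambda>_::unit. f)"
proof
  assume f: "f \<in> schwartz"
  show "sfam (\<lambda>_::unit. f)"
    unfolding dfam_def
  proof (intro allI impI conjI)
    fix vs :: "plane list" assume vs: "set vs \<subseteq> Basis"
    show "iter_deriv vs f differentiable at x" for x
      using f vs by (simp add: schwartz_def smooth_def)
    have "\<exists>K. \<forall>x. (1 + norm x) ^ N * norm (iter_deriv vs f x) \<le> K" for N
      by (rule schwartz_weight_bound[OF f vs])
    then show "wb (\<lambda>_::unit. iter_deriv vs f)" unfolding wb_def by simp
  qed
next
  assume "sfam (\<lambda>_::unit. f)"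
  from sfam_member[OF this] show "f \<in> schwartz" .
qed

lemma sfam_bound: "sfam f \<Longrightarrow> \<exists>K\<ge>0. \<forall>i x. norm (f i x) \<le> K * inverse ((1 + norm x) ^ N)"
proof -
  assume "sfam f"
  from dfam_pred[OF this] obtain K where K: "\<And>i x. (1 + norm x) ^ N * norm (f i x) \<le> K" unfolding wb_def by metis
  have "norm (f i x) \<le> \<bar>K\<bar> * inverse ((1 + norm x) ^ N)" for i x
  proof -
    have "0 < (1 + norm x) ^ N" by (intro zero_less_power) (simp add: add_pos_nonneg)
    then show ?thesis using K[of x i] by (simp add: field_simps)
  qed
  then show ?thesis by (intro exI[of _ "\<bar>K\<bar>"]) auto
qed

lemma schwartz_smooth: "f \<in> schwartz \<Longrightarrow> smooth f" by (simp add: schwartz_def)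

lemma smooth_borel: "smooth f \<Longrightarrow> f \<in> borel_measurable borel" for f :: "'a::euclidean_space \<Rightarrow> complex"
  using smooth_continuous borel_measurable_continuous_onI by blast

lemma schwartz_borel [measurable_dest]: "f \<in> schwartz \<Longrightarrow> f \<in> borel_measurable borel"
  by (intro smooth_borel schwartz_smooth)

lemma schwartz_bound: "f \<in> schwartz \<Longrightarrow> \<exists>K\<ge>0. \<forall>x. norm (f x) \<le> K * inverse ((1 + norm x) ^ N)"
  unfolding schwartz_iff_sfam using sfam_bound[of "\<lambda>_::unit. f" N] by auto

lemma integrable_decay_bound:
  fixes f :: "plane \<Rightarrow> 'b::{banach,second_countable_topology}"
  assumes "f \<in> borel_measurable borel" "\<And>x. norm (f x) \<le> K * inverse ((1 + norm x) ^ 4)"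
  shows "integrable lborel f"
proof (rule Bochner_Integration.integrable_bound)
  show "integrable lborel (\<lambda>x::plane. K * inverse ((1 + norm x) ^ 4))"
    by (intro integrable_mult_right integrable_decay)
  show "AE x in lborel. norm (f x) \<le> norm (K * inverse ((1 + norm x) ^ 4))"
    by (intro AE_I2 order_trans[OF assms(2)]) simp
qed (use assms in simp)

lemma schwartz_integrable: "f \<in> schwartz \<Longrightarrow> integrable lborel f"
  using schwartz_bound[of f 4] by (auto intro: integrable_decay_bound schwartz_borel)

lemma schwartz_add: "f \<in> schwartz \<Longrightarrow> g \<in> schwartz \<Longrightarrow> (\<lambda>x. f x + g x) \<in> schwartz"
  unfolding schwartz_iff_sfam by (rule sfam_add)

lemma schwartz_cmult: "f \<in> schwartz \<Longrightarrow> (\<lambda>x. c * f x) \<in> schwartz"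
  unfolding schwartz_iff_sfam by (rule sfam_cmult)

lemma schwartz_diff: "f \<in> schwartz \<Longrightarrow> g \<in> schwartz \<Longrightarrow> (\<lambda>x. f x - g x) \<in> schwartz"
  using schwartz_add[OF _ schwartz_cmult[of g "-1"]] by simp

lemma pb_wb: "wb f \<Longrightarrow> pb f"
proof -
  assume "wb f"
  then obtain K where "\<And>i x. (1 + norm x) ^ 0 * norm (f i x) \<le> K" unfolding wb_def by metis
  then show ?thesis unfolding pb_def by (intro exI[of _ 0] exI[of _ K]) simp
qed

lemma schwartz_mult: "f \<in> schwartz \<Longrightarrow> g \<in> schwartz \<Longrightarrow> (\<lambda>x. f x * g x) \<in> schwartz"
  unfolding schwartz_iff_sfam by (rule sfam_mult[OF dfam_mono[OF _ pb_wb]])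

lemma schwartz_deriv: "f \<in> schwartz \<Longrightarrow> b \<in> Basis \<Longrightarrow> dir_deriv b f \<in> schwartz"
  unfolding schwartz_iff_sfam by (rule dfam_deriv)

lemma compact_support_schwartz:
  assumes "smooth f" "compact K" "\<And>x. x \<notin> K \<Longrightarrow> f x = 0"
  shows "f \<in> schwartz"
proof -
  have "wb (\<lambda>_::unit. iter_deriv vs f)" if vs: "set vs \<subseteq> Basis" for vs
    unfolding wb_def
  proof
    fix N
    have "continuous_on K (\<lambda>x. (1 + norm x) ^ N * norm (iter_deriv vs f x))"
      by (intro continuous_intros smooth_continuous smooth_iter assms vs)
    from compact_imp_bounded[OF compact_continuous_image[OF this assms(2)]]
    obtain C where C: "\<And>x. x \<in> K \<Longrightarrow> norm ((1 + norm x) ^ N * norm (iter_deriv vs f x)) \<le> C"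
      unfolding bounded_iff by blast
    have "(1 + norm x) ^ N * norm (iter_deriv vs f x) \<le> \<bar>C\<bar>" for x
    proof (cases "x \<in> K")
      case True
      from C[OF this] show ?thesis by (auto simp: abs_mult)
    qed (simp add: iter_deriv_zero_outside[OF compact_imp_closed[OF assms(2)] assms(3)])
    then show "\<exists>K. \<forall>(i::unit) x. (1 + norm x) ^ N * norm (iter_deriv vs f x) \<le> K" by blast
  qed
  then show ?thesis unfolding schwartz_iff_sfam dfam_def
    using smooth_iter[OF assms(1)] smooth_differentiable by blast
qed

lemma test_functions_schwartz: "f \<in> test_functions \<Omega> \<Longrightarrow> f \<in> schwartz"
  unfolding test_functions_def using compact_support_schwartz[of f "supp f"] zero_outside_supp by auto

section \<open>The Fourier transform of Schwartz functions\<close>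

abbreviation expi :: "real \<Rightarrow> complex" where "expi t \<equiv> exp (\<i> * complex_of_real t)"
abbreviation expni :: "real \<Rightarrow> complex" where "expni t \<equiv> exp (- \<i> * complex_of_real t)"

lemma norm_exp_ii [simp]: "norm (exp (- (\<i> * complex_of_real t))) = 1" "norm (expi t) = 1"
  by (simp_all add: norm_exp_eq_Re)

lemma fourier_integrand_borel [measurable]:
  "f \<in> borel_measurable borel \<Longrightarrow> (\<lambda>x. expni (x \<bullet> \<xi>) * f x) \<in> borel_measurable borel" for \<xi> :: plane
  by measurable

lemma fourier_integrable:
  assumes "integrable lborel f"
  shows "integrable lborel (\<lambda>x. expni (x \<bullet> \<xi>) * f x)"
proof (rule Bochner_Integration.integrable_bound[OF assms])
  have "f \<in> borel_measurable borel" using borel_measurable_integrable[OF assms] by simp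
  then show "(\<lambda>x. expni (x \<bullet> \<xi>) * f x) \<in> borel_measurable lborel"
    using fourier_integrand_borel by simp
qed (simp add: norm_mult)

lemma norm_fourier_le: "norm (fourier f \<xi>) \<le> (LINT x|lborel. norm (f x))"
proof -
  have "norm (fourier f \<xi>) \<le> (LINT x|lborel. norm (expni (x \<bullet> \<xi>) * f x))"
    unfolding fourier_def by (rule integral_norm_bound)
  then show ?thesis by (simp add: norm_mult)
qed

lemma inv_fourier_eq: "inv_fourier g x = complex_of_real (1 / (2 * pi)\<^sup>2) * fourier g (- x)"
  by (simp add: inv_fourier_def fourier_def inner_commute scaleR_conv_of_real)

lemma fourier_add: "integrable lborel f \<Longrightarrow> integrable lborel g \<Longrightarrow> fourier (\<lambda>x. f x + g x) \<xi> = fourier f \<xi> + fourier g \<xi>"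
  unfolding fourier_def ring_distribs by (intro Bochner_Integration.integral_add fourier_integrable)

lemma fourier_diff: "integrable lborel f \<Longrightarrow> integrable lborel g \<Longrightarrow> fourier (\<lambda>x. f x - g x) \<xi> = fourier f \<xi> - fourier g \<xi>"
  unfolding fourier_def ring_distribs by (intro Bochner_Integration.integral_diff fourier_integrable)

lemma fourier_cmult: "fourier (\<lambda>x. c * f x) \<xi> = c * fourier f \<xi>"
  unfolding fourier_def by (simp add: mult.left_commute)

lemma fourier_sum:
  "(\<And>a. a \<in> A \<Longrightarrow> integrable lborel (f a)) \<Longrightarrow> fourier (\<lambda>x. \<Sum>a\<in>A. f a x) \<xi> = (\<Sum>a\<in>A. fourier (f a) \<xi>)"
  unfolding fourier_def sum_distrib_left by (intro Bochner_Integration.integral_sum fourier_integrable)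

lemma exp_first_order: "norm (expni t - 1 + \<i> * complex_of_real t) \<le> t\<^sup>2"
proof -
  have "norm (expi (- t) - (\<Sum>k\<le>1. (\<i> * complex_of_real (- t)) ^ k / fact k)) \<le> \<bar>- t\<bar> ^ Suc 1 / fact (Suc 1)"
    by (rule iexp_approx1)
  then have "norm (expni t - 1 + \<i> * complex_of_real t) \<le> t\<^sup>2 / 2"
    by (simp add: power2_eq_square algebra_simps)
  also have "\<dots> \<le> t\<^sup>2" by simp
  finally show ?thesis .
qed

text \<open>The second-order remainder of the exponential (\<open>exp_first_order\<close>) yields an
  error bound quadratic in the increment, so no interchange of limits is needed. Only a quadratic
  weight is assumed integrable; thus the lemma also covers truncated functions and Schwartz
  functions multiplied by powers of the norm, which are not known to be Schwartz.\<close>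

lemma fourier_has_derivative:
  assumes [measurable]: "f \<in> borel_measurable borel"
    and int: "integrable lborel (\<lambda>x. (1 + norm x)\<^sup>2 * norm (f x))"
  shows "(fourier f has_derivative (\<lambda>v. fourier (\<lambda>x. - \<i> * complex_of_real (x \<bullet> v) * f x) \<xi>)) (at \<xi>)"
proof -
  let ?D = "\<lambda>v x. - \<i> * complex_of_real (x \<bullet> v) * f x"
  have w: "norm x \<le> (1 + norm x)\<^sup>2" "1 \<le> (1 + norm x)\<^sup>2" "(norm x)\<^sup>2 \<le> (1 + norm x)\<^sup>2" for x :: plane
    using zero_le_power2[of "norm x"] norm_ge_zero[of x] by (simp_all add: power2_sum)
  have i0: "integrable lborel f"
    by (rule Bochner_Integration.integrable_bound[OF int])
      (auto simp: abs_mult intro!: AE_I2 mult_right_mono[OF w(2), of "norm (f _)", simplified])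
  have i1: "integrable lborel (?D v)" for v
  proof (rule Bochner_Integration.integrable_bound[OF integrable_mult_left[OF int, of "norm v"]])
    have "norm (?D v x) \<le> (1 + norm x)\<^sup>2 * norm (f x) * norm v" for x
    proof -
      have "\<bar>x \<bullet> v\<bar> \<le> (1 + norm x)\<^sup>2 * norm v"
        using Cauchy_Schwarz_ineq2[of x v] mult_right_mono[OF w(1)[of x], of "norm v"] by simp
      from mult_right_mono[OF this, of "norm (f x)"] show ?thesis
        by (simp add: norm_mult algebra_simps)
    qed
    then show "AE x in lborel. norm (?D v x) \<le> norm ((1 + norm x)\<^sup>2 * norm (f x) * norm v)"
      by (intro AE_I2) (simp add: abs_mult)
  qed simp
  let ?M = "LINT x|lborel. (1 + norm x)\<^sup>2 * norm (f x)"
  show ?thesis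
  proof (rule has_derivativeI_sandwich[where e = 1 and H = "\<lambda>y. ?M * norm (y - \<xi>)"])
    show "bounded_linear (\<lambda>v. fourier (?D v) \<xi>)"
    proof (rule bounded_linear_intro)
      fix u v :: plane and r :: real
      have "(?D (u + v)) = (\<lambda>x. (?D u x) + (?D v x))"
        by (rule ext) (simp add: inner_add_right algebra_simps)
      then show "fourier (?D (u + v)) \<xi> =
          fourier (?D u) \<xi> + fourier (?D v) \<xi>"
        using fourier_add[OF i1 i1] by simp
      have "(?D (r *\<^sub>R v)) = (\<lambda>x. complex_of_real r * (?D v x))"
        by (rule ext) simp
      then show "fourier (?D (r *\<^sub>R v)) \<xi> = r *\<^sub>R fourier (?D v) \<xi>"
        by (simp only: fourier_cmult scaleR_conv_of_real)
      have "norm (fourier (?D v) \<xi>) \<le> (LINT x|lborel. norm (?D v x))"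
        by (rule norm_fourier_le)
      also have "\<dots> \<le> (LINT x|lborel. (1 + norm x)\<^sup>2 * norm (f x) * norm v)"
      proof (rule integral_mono)
        fix x
        have "\<bar>x \<bullet> v\<bar> \<le> (1 + norm x)\<^sup>2 * norm v"
          using Cauchy_Schwarz_ineq2[of x v] mult_right_mono[OF w(1)[of x], of "norm v"] by simp
        from mult_right_mono[OF this, of "norm (f x)"]
        show "norm (?D v x) \<le> (1 + norm x)\<^sup>2 * norm (f x) * norm v"
          by (simp add: norm_mult algebra_simps)
      qed (use integrable_norm[OF i1[of v]] integrable_mult_left[OF int, of "norm v"] in simp_all)
      finally show "norm (fourier (?D v) \<xi>) \<le> norm v * ?M"
        by (simp add: mult.commute)
    qed
    show "((\<lambda>y. ?M * norm (y - \<xi>)) \<longlongrightarrow> 0) (at \<xi>)"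
      by (rule tendsto_eq_intros refl | simp)+
    fix y assume "y \<noteq> \<xi>"
    define v where "v = y - \<xi>"
    have v: "v \<noteq> 0" and y: "y = \<xi> + v" using \<open>y \<noteq> \<xi>\<close> by (auto simp: v_def)
    have "fourier f y - fourier f \<xi> - fourier (?D v) \<xi> =
        (LINT x|lborel. expni (x \<bullet> y) * f x - expni (x \<bullet> \<xi>) * f x
           - expni (x \<bullet> \<xi>) * (?D v x))"
      unfolding fourier_def
      by (subst Bochner_Integration.integral_diff, intro Bochner_Integration.integrable_diff fourier_integrable i0, intro fourier_integrable i1,
          subst Bochner_Integration.integral_diff, intro fourier_integrable i0, intro fourier_integrable i0, rule refl)
    also have "\<dots> = (LINT x|lborel. expni (x \<bullet> \<xi>) * f x * (expni (x \<bullet> v) - 1 + \<i> * complex_of_real (x \<bullet> v)))"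
      by (intro Bochner_Integration.integral_cong refl) (simp add: y inner_add_right exp_add[symmetric] algebra_simps exp_diff exp_minus field_simps)
    also have "norm \<dots> \<le> (LINT x|lborel. (1 + norm x)\<^sup>2 * norm (f x) * (norm v)\<^sup>2)"
    proof (rule Bochner_Integration.integral_norm_bound_integral)
      show "integrable lborel (\<lambda>x. (1 + norm x)\<^sup>2 * norm (f x) * (norm v)\<^sup>2)" by (intro integrable_mult_left int)
      have "norm (expni (x \<bullet> \<xi>) * f x * (expni (x \<bullet> v) - 1 + \<i> * complex_of_real (x \<bullet> v)))
         \<le> (1 + norm x)\<^sup>2 * norm (f x) * (norm v)\<^sup>2" for x
      proof -
        have "norm (expni (x \<bullet> v) - 1 + \<i> * complex_of_real (x \<bullet> v)) \<le> (x \<bullet> v)\<^sup>2"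
          by (rule exp_first_order)
        also have "\<dots> \<le> (norm x * norm v)\<^sup>2"
          using Cauchy_Schwarz_ineq2[of x v] by (simp add: abs_le_square_iff[symmetric] abs_mult)
        also have "\<dots> \<le> (1 + norm x)\<^sup>2 * (norm v)\<^sup>2"
          using mult_right_mono[OF w(3)[of x], of "(norm v)\<^sup>2"] by (simp add: power_mult_distrib)
        finally have "norm (expni (x \<bullet> v) - 1 + \<i> * complex_of_real (x \<bullet> v)) \<le> (1 + norm x)\<^sup>2 * (norm v)\<^sup>2" .
        from mult_left_mono[OF this norm_ge_zero[of "f x"]] show ?thesis
          unfolding norm_mult by (simp add: mult.assoc mult.left_commute)
      qed
      then show "norm (expni (x \<bullet> \<xi>) * f x * (expni (x \<bullet> v) - 1 + \<i> * complex_of_real (x \<bullet> v)))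
         \<le> (1 + norm x)\<^sup>2 * norm (f x) * (norm v)\<^sup>2" for x .
      have "integrable lborel (\<lambda>x. expni (x \<bullet> y) * f x - expni (x \<bullet> \<xi>) * f x
           - expni (x \<bullet> \<xi>) * (?D v x))"
        by (intro Bochner_Integration.integrable_diff fourier_integrable i0 i1)
      also have "(\<lambda>x. expni (x \<bullet> y) * f x - expni (x \<bullet> \<xi>) * f x
           - expni (x \<bullet> \<xi>) * (?D v x)) =
         (\<lambda>x. expni (x \<bullet> \<xi>) * f x * (expni (x \<bullet> v) - 1 + \<i> * complex_of_real (x \<bullet> v)))"
        by (rule ext) (simp add: y inner_add_right exp_add[symmetric] algebra_simps exp_diff exp_minus field_simps)
      finally show "integrable lborel (\<lambda>x. expni (x \<bullet> \<xi>) * f x * (expni (x \<bullet> v) - 1 + \<i> * complex_of_real (x \<bullet> v)))" .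
    qed
    also have "\<dots> = ?M * norm v * norm v" by (simp add: power2_eq_square)
    finally show "norm (fourier f y - fourier f \<xi> - fourier (?D (y - \<xi>)) \<xi>) / norm (y - \<xi>)
        \<le> ?M * norm (y - \<xi>)"
      unfolding v_def[symmetric] using v by (simp add: field_simps)
  qed simp
qed

lemma schwartz_weight_integrable:
  assumes "f \<in> schwartz"
  shows "integrable lborel (\<lambda>x. (1 + norm x) ^ N * norm (f x))"
proof -
  obtain K where K: "\<And>x. norm (f x) \<le> K * inverse ((1 + norm x) ^ (4 + N))" using schwartz_bound[OF assms, of "4 + N"] by metis
  have [measurable]: "f \<in> borel_measurable borel" using assms by (rule schwartz_borel)
  show ?thesis
  proof (rule integrable_decay_bound)
    fix x :: plane
    have "1 + norm x > 0" by (simp add: add_pos_nonneg)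
    then have "(1 + norm x) ^ N * (K * inverse ((1 + norm x) ^ (4 + N))) = K * inverse ((1 + norm x) ^ 4)"
      by (simp add: power_add field_simps)
    moreover have "(1 + norm x) ^ N * norm (f x) \<le> (1 + norm x) ^ N * (K * inverse ((1 + norm x) ^ (4 + N)))"
      by (intro mult_left_mono K) simp
    ultimately have "(1 + norm x) ^ N * norm (f x) \<le> K * inverse ((1 + norm x) ^ 4)" by linarith
    then show "norm ((1 + norm x) ^ N * norm (f x)) \<le> K * inverse ((1 + norm x) ^ 4)" by (simp add: abs_mult)
  qed simp
qed

lemma schwartz_fourier_has_derivative:
  "f \<in> schwartz \<Longrightarrow> (fourier f has_derivative (\<lambda>v. fourier (\<lambda>x. - \<i> * complex_of_real (x \<bullet> v) * f x) \<xi>)) (at \<xi>)"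
  by (intro fourier_has_derivative schwartz_borel schwartz_weight_integrable)

lemma dir_deriv_scaleR:
  fixes g :: "'a::euclidean_space \<Rightarrow> 'b::real_normed_vector"
  assumes "g differentiable at x" shows "dir_deriv (c *\<^sub>R b) g x = c *\<^sub>R dir_deriv b g x"
  using has_derivative_bounded_linear[OF has_derivative_dir_deriv[OF assms]] by (rule linear_cmul[OF bounded_linear.linear])

lemma mean_value_bound:
  fixes g :: "'a::euclidean_space \<Rightarrow> complex"
  assumes d: "\<And>x. g differentiable at x" and t: "0 \<le> t"
    and M: "\<And>s. 0 \<le> s \<Longrightarrow> s \<le> t \<Longrightarrow> norm (dir_deriv b g (x + s *\<^sub>R b)) \<le> M"
  shows "norm (g (x + t *\<^sub>R b) - g x) \<le> M * t"
proof -
  have "norm (g (x + t *\<^sub>R b) - g (x + 0 *\<^sub>R b)) \<le> M * norm (t - 0)"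
  proof (rule differentiable_bound[of "{0..t}" "\<lambda>s. g (x + s *\<^sub>R b)" "\<lambda>s h. h *\<^sub>R dir_deriv b g (x + s *\<^sub>R b)" M t 0])
    fix s assume s: "s \<in> {0..t}"
    have "((\<lambda>s. x + s *\<^sub>R b) has_derivative (\<lambda>h. h *\<^sub>R b)) (at s)"
      by (auto intro!: derivative_eq_intros)
    from has_derivative_compose[OF this has_derivative_dir_deriv[OF d]]
    show "((\<lambda>s. g (x + s *\<^sub>R b)) has_derivative (\<lambda>h. h *\<^sub>R dir_deriv b g (x + s *\<^sub>R b))) (at s within {0..t})"
      by (simp add: dir_deriv_scaleR d has_derivative_at_withinI)
    show "onorm (\<lambda>h. h *\<^sub>R dir_deriv b g (x + s *\<^sub>R b)) \<le> M"
    proof (rule onorm_le)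
      fix h :: real
      have "\<bar>h\<bar> * norm (dir_deriv b g (x + s *\<^sub>R b)) \<le> \<bar>h\<bar> * M" using M[of s] s by (intro mult_left_mono) auto
      then show "norm (h *\<^sub>R dir_deriv b g (x + s *\<^sub>R b)) \<le> M * norm h" by (simp add: mult.commute)
    qed
  qed (use t in auto)
  then show ?thesis using t by simp
qed

text \<open>The difference quotients of \<open>g\<close> have integral zero by translation
  invariance. The mean value bound dominates them by a multiple of the decay weight, and dominated
  convergence passes to the derivative. This is integration by parts for
  \<open>fourier_dir_deriv\<close>.\<close>

lemma integral_dir_deriv_eq_0:
  fixes g :: "plane \<Rightarrow> complex"
  assumes d: "\<And>x. g differentiable at x" and int: "integrable lborel g" and b: "b \<in> Basis"
    and K: "\<And>x. norm (dir_deriv b g x) \<le> K * inverse ((1 + norm x) ^ 4)"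
  shows "(LINT x|lborel. dir_deriv b g x) = 0"
proof -
  define t :: "nat \<Rightarrow> real" where "t n = 1 / real (Suc n)" for n
  have t: "0 < t n" "t n \<le> 1" for n by (auto simp: t_def)
  have tl: "t \<longlonglongrightarrow> 0" unfolding t_def by (rule LIMSEQ_Suc[OF lim_1_over_n])
  define s where "s n x = (g (x + t n *\<^sub>R b) - g x) /\<^sub>R t n" for n x
  have gm [measurable]: "g \<in> borel_measurable borel" using borel_measurable_integrable[OF int] by simp
  have sh: "integrable lborel (\<lambda>x. g (x + y))" "(LINT x|lborel. g (x + y)) = (LINT x|lborel. g x)" for y
    using integrable_plane_affine[OF int, of 1 y] integral_plane_affine[OF gm, of 1 y] by (simp_all add: add.commute)
  have s0: "(LINT x|lborel. s n x) = 0" for n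
    unfolding s_def by (simp add: sh int)
  have lim: "(\<lambda>n. s n x) \<longlonglongrightarrow> dir_deriv b g x" for x
  proof -
    have "(\<lambda>h. norm (g (x + h) - g x - dir_deriv h g x) / norm h) \<midarrow>0\<rightarrow> 0"
      using has_derivative_dir_deriv[OF d] unfolding has_derivative_at by blast
    moreover have "filterlim (\<lambda>n. t n *\<^sub>R b) (at 0) sequentially"
      unfolding filterlim_at using t(1) b nonzero_Basis[OF b] tl
      by (auto intro!: tendsto_eq_intros eventuallyI simp: less_imp_neq[symmetric])
    ultimately have "(\<lambda>n. norm (g (x + t n *\<^sub>R b) - g x - dir_deriv (t n *\<^sub>R b) g x) / norm (t n *\<^sub>R b)) \<longlonglongrightarrow> 0"
      by (rule filterlim_compose)
    moreover have "norm (g (x + t n *\<^sub>R b) - g x - dir_deriv (t n *\<^sub>R b) g x) / norm (t n *\<^sub>R b) = norm (s n x - dir_deriv b g x)" for n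
    proof -
      have "s n x - dir_deriv b g x = (g (x + t n *\<^sub>R b) - g x - dir_deriv (t n *\<^sub>R b) g x) /\<^sub>R t n"
        using t(1)[of n] by (simp add: s_def dir_deriv_scaleR[OF d] scaleR_diff_right)
      then show ?thesis using t(1)[of n] b by (simp add: divide_inverse mult.commute)
    qed
    ultimately have "(\<lambda>n. norm (s n x - dir_deriv b g x)) \<longlonglongrightarrow> 0" by simp
    then show ?thesis by (rule LIM_zero_cancel[OF tendsto_norm_zero_cancel])
  qed
  have sm [measurable]: "s n \<in> borel_measurable borel" for n unfolding s_def by measurable
  have dm [measurable]: "dir_deriv b g \<in> borel_measurable borel"
    by (rule borel_measurable_LIMSEQ_metric[OF sm lim])
  \<comment> \<open>The constant 16 is the fourth power of 2: a displacement of length at most one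
    changes \<open>1 + norm x\<close> by at most the factor 2.\<close>
  have bnd: "norm (s n x) \<le> (16 * K) * inverse ((1 + norm x) ^ 4)" for n x
  proof -
    have K0: "K \<ge> 0" using order_trans[OF norm_ge_zero K[of 0]] by simp
    have "norm (g (x + t n *\<^sub>R b) - g x) \<le> ((16 * K) * inverse ((1 + norm x) ^ 4)) * t n"
    proof (rule mean_value_bound[OF d])
      fix r assume r: "0 \<le> r" "r \<le> t n"
      then have "norm (r *\<^sub>R b) \<le> 1" using t(2)[of n] b by simp
      then have "norm x \<le> norm (x + r *\<^sub>R b) + 1" using norm_triangle_ineq4[of "x + r *\<^sub>R b" "r *\<^sub>R b"] by simp
      then have "1 + norm x \<le> 2 * (1 + norm (x + r *\<^sub>R b))" using norm_ge_zero[of "x + r *\<^sub>R b"]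
        by (smt (verit))
      then have "(1 + norm x) ^ 4 \<le> (2 * (1 + norm (x + r *\<^sub>R b))) ^ 4" by (intro power_mono) auto
      then have *: "(1 + norm x) ^ 4 \<le> 16 * (1 + norm (x + r *\<^sub>R b)) ^ 4" by (simp only: power_mult_distrib) simp
      have pos: "0 < (1 + norm x) ^ 4" "0 < (1 + norm (x + r *\<^sub>R b)) ^ 4" by (rule zero_less_power, simp add: add_pos_nonneg)+
      have "inverse ((1 + norm (x + r *\<^sub>R b)) ^ 4) \<le> 16 * inverse ((1 + norm x) ^ 4)"
        using * pos by (simp add: field_simps)
      from mult_left_mono[OF this K0] order_trans[OF K[of "x + r *\<^sub>R b"] this[THEN mult_left_mono, OF K0]]
      show "norm (dir_deriv b g (x + r *\<^sub>R b)) \<le> (16 * K) * inverse ((1 + norm x) ^ 4)" by simp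
    qed (use t(1)[of n] in simp)
    moreover have "norm (s n x) = norm (g (x + t n *\<^sub>R b) - g x) / t n"
      using t(1)[of n] by (simp add: s_def divide_inverse mult.commute)
    ultimately show ?thesis using t(1)[of n] by (simp only: pos_divide_le_eq)
  qed
  have "(\<lambda>n. LINT x|lborel. s n x) \<longlonglongrightarrow> (LINT x|lborel. dir_deriv b g x)"
  proof (rule integral_dominated_convergence[where w = "\<lambda>x. (16 * K) * inverse ((1 + norm x) ^ 4)"])
    show "integrable lborel (\<lambda>x::plane. (16 * K) * inverse ((1 + norm x) ^ 4))"
      by (intro integrable_mult_right integrable_decay)
  qed (use lim bnd in auto)
  then show ?thesis using LIMSEQ_unique[OF _ tendsto_const] by (simp add: s0 LIMSEQ_const_iff)
qed

lemma has_derivative_exp_inner: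
  "((\<lambda>x. expni (x \<bullet> \<xi>)) has_derivative (\<lambda>v. expni (x \<bullet> \<xi>) * (- \<i> * complex_of_real (v \<bullet> \<xi>)))) (at x)"
  for \<xi> x :: plane
proof -
  have "((\<lambda>x. - \<i> * complex_of_real (x \<bullet> \<xi>)) has_derivative (\<lambda>v. - \<i> * complex_of_real (v \<bullet> \<xi>))) (at x)"
    by (intro bounded_linear_imp_has_derivative bounded_linear_compose[OF bounded_linear_mult_right]
        bounded_linear_compose[OF bounded_linear_of_real] bounded_linear_inner_left)
  from has_derivative_compose[OF this DERIV_exp[unfolded has_field_derivative_def]] show ?thesis .
qed

lemma fourier_dir_deriv:
  assumes f: "f \<in> schwartz" and b: "b \<in> Basis"
  shows "fourier (dir_deriv b f) \<xi> = \<i> * complex_of_real (\<xi> \<bullet> b) * fourier f \<xi>"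
proof -
  \<comment> \<open>The whole integrand of the transform is differentiated; the vanishing of the
    integral of its derivative is, after the product rule, the claimed formula.\<close>
  define g where "g x = expni (x \<bullet> \<xi>) * f x" for x
  have fd: "f differentiable at x" for x using schwartz_smooth[OF f] by (rule smooth_differentiable)
  have ed: "(\<lambda>x. expni (x \<bullet> \<xi>)) differentiable at x" for x :: plane
    by (rule differentiableI[OF has_derivative_exp_inner])
  have gd: "dir_deriv b g x = expni (x \<bullet> \<xi>) * dir_deriv b f x + (- \<i> * complex_of_real (b \<bullet> \<xi>)) * (expni (x \<bullet> \<xi>) * f x)" for x
    unfolding g_def dir_deriv_mult[OF ed fd] dir_deriv_eq[OF has_derivative_exp_inner] by (simp add: algebra_simps)
  obtain K1 K2 where K: "\<And>x. norm (f x) \<le> K1 * inverse ((1 + norm x) ^ 4)" "\<And>x. norm (dir_deriv b f x) \<le> K2 * inverse ((1 + norm x) ^ 4)"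
    using schwartz_bound[OF f, of 4] schwartz_bound[OF schwartz_deriv[OF f b], of 4] by metis
  have "(LINT x|lborel. dir_deriv b g x) = 0"
  proof (rule integral_dir_deriv_eq_0[OF _ _ b])
    show "g differentiable at x" for x unfolding g_def by (intro differentiable_mult ed fd)
    show "integrable lborel g" unfolding g_def by (intro fourier_integrable schwartz_integrable f)
    show "norm (dir_deriv b g x) \<le> (K2 + \<bar>b \<bullet> \<xi>\<bar> * K1) * inverse ((1 + norm x) ^ 4)" for x
    proof -
      have "norm (dir_deriv b g x) \<le> norm (dir_deriv b f x) + \<bar>b \<bullet> \<xi>\<bar> * norm (f x)"
        unfolding gd by (rule order_trans[OF norm_triangle_ineq]) (simp add: norm_mult)
      also have "\<dots> \<le> K2 * inverse ((1 + norm x) ^ 4) + \<bar>b \<bullet> \<xi>\<bar> * (K1 * inverse ((1 + norm x) ^ 4))"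
        by (intro add_mono mult_left_mono K) simp
      finally show ?thesis by (simp add: algebra_simps)
    qed
  qed
  then have "fourier (dir_deriv b f) \<xi> + (- \<i> * complex_of_real (b \<bullet> \<xi>)) * fourier f \<xi> = 0"
    unfolding gd fourier_def
    by (simp only: Bochner_Integration.integral_add[OF fourier_integrable[OF schwartz_integrable[OF schwartz_deriv[OF f b]]]
        integrable_mult_right[OF fourier_integrable[OF schwartz_integrable[OF f]]]] integral_mult_right_zero)
  then show ?thesis by (simp add: inner_commute)
qed

text \<open>The symbol of \<open>1 - \<Delta>\<close> gives decay of the Fourier transform without multi-index bookkeeping.\<close>

definition bessel :: "(plane \<Rightarrow> complex) \<Rightarrow> plane \<Rightarrow> complex" where
  "bessel f x = f x + (\<Sum>b\<in>Basis. (- 1) * dir_deriv b (dir_deriv b f) x)"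

lemma sfam_bessel:
  assumes "sfam f" shows "sfam (\<lambda>i. bessel (f i))"
  unfolding bessel_def
  by (intro sfam_add[OF assms sfam_sum[OF finite_Basis sfam_cmult]] dfam_deriv assms)

lemma fourier_bessel:
  assumes f: "f \<in> schwartz"
  shows "fourier (bessel f) \<xi> = complex_of_real (1 + (norm \<xi>)\<^sup>2) * fourier f \<xi>"
proof -
  have d: "dir_deriv b (dir_deriv b f) \<in> schwartz" if "b \<in> Basis" for b
    by (intro schwartz_deriv f that)
  have n: "(norm \<xi>)\<^sup>2 = (\<Sum>b\<in>Basis. (\<xi> \<bullet> b) * (\<xi> \<bullet> b))"
    by (rule trans[OF power2_norm_eq_inner euclidean_inner])
  have "fourier (bessel f) \<xi> = fourier f \<xi> + (\<Sum>b\<in>Basis. (- 1) * fourier (dir_deriv b (dir_deriv b f)) \<xi>)"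
    unfolding bessel_def
    by (subst fourier_add, intro schwartz_integrable f, intro Bochner_Integration.integrable_sum integrable_mult_right schwartz_integrable d, assumption,
        subst fourier_sum, intro integrable_mult_right schwartz_integrable d, assumption, simp only: fourier_cmult)
  also have "\<dots> = fourier f \<xi> + (\<Sum>b\<in>Basis. complex_of_real ((\<xi> \<bullet> b) * (\<xi> \<bullet> b)) * fourier f \<xi>)"
  proof -
    have r: "- 1 * (\<i> * a * (\<i> * a * z)) = (a * a) * z" for a z :: complex
      by (simp add: complex_eq_iff algebra_simps)
    show ?thesis
      by (intro arg_cong2[where f = "(+)"] sum.cong refl) (simp only: fourier_dir_deriv schwartz_deriv f r of_real_mult)
  qed
  also have "\<dots> = complex_of_real (1 + (norm \<xi>)\<^sup>2) * fourier f \<xi>"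
  proof -
    have "(\<Sum>b\<in>Basis. complex_of_real ((\<xi> \<bullet> b) * (\<xi> \<bullet> b)) * fourier f \<xi>) = complex_of_real (\<Sum>b\<in>Basis. (\<xi> \<bullet> b) * (\<xi> \<bullet> b)) * fourier f \<xi>"
      unfolding of_real_sum by (rule sum_distrib_right[symmetric])
    then show ?thesis by (simp only: n of_real_add of_real_1 distrib_right mult_1_left)
  qed
  finally show ?thesis .
qed

text \<open>Applying \<open>bessel\<close> multiplies the transform by
  \<open>1 + (norm \<xi>)\<^sup>2\<close> and keeps the family bounded in all seminorms. Each
  induction step therefore gains one factor of decay, uniformly in the index.\<close>

lemma sfam_fourier_weight:
  fixes f :: "'i \<Rightarrow> plane \<Rightarrow> complex"
  assumes "sfam f"
  shows "\<exists>K. \<forall>i \<xi>. (1 + (norm \<xi>)\<^sup>2) ^ N * norm (fourier (f i) \<xi>) \<le> K"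
  using assms
proof (induction N arbitrary: f)
  case 0
  from sfam_bound[OF 0, of 4] obtain K where K: "\<And>i x. norm (f i x) \<le> K * inverse ((1 + norm x) ^ 4)" by metis
  have "norm (fourier (f i) \<xi>) \<le> (LINT x::plane|lborel. K * inverse ((1 + norm x) ^ 4))" for i \<xi>
    by (rule order_trans[OF norm_fourier_le integral_mono])
      (intro integrable_norm schwartz_integrable sfam_member[OF 0] integrable_mult_right integrable_decay K)+
  then show ?case by auto
next
  case (Suc N)
  from Suc.IH[OF sfam_bessel[OF Suc.prems]] obtain K
    where "\<And>i \<xi>. (1 + (norm \<xi>)\<^sup>2) ^ N * norm (fourier (bessel (f i)) \<xi>) \<le> K" by metis
  then have *: "(1 + (norm \<xi>)\<^sup>2) ^ N * ((1 + (norm \<xi>)\<^sup>2) * norm (fourier (f i) \<xi>)) \<le> K" for i \<xi>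
    by (simp add: fourier_bessel[OF sfam_member[OF Suc.prems]] norm_mult del: of_real_add of_real_power)
  then show ?case by (intro exI[of _ K]) (simp only: power_Suc2 mult.assoc *, simp)
qed

lemma wb_fourier:
  assumes "sfam f" shows "wb (\<lambda>i. fourier (f i))"
  unfolding wb_def
proof
  fix N
  obtain K where K: "\<And>i \<xi>. (1 + (norm \<xi>)\<^sup>2) ^ N * norm (fourier (f i) \<xi>) \<le> K"
    using sfam_fourier_weight[OF assms, of N] by metis
  have "(1 + norm \<xi>) ^ N * norm (fourier (f i) \<xi>) \<le> 2 ^ N * K" for i \<xi>
  proof -
    have "1 + r \<le> 2 * (1 + r\<^sup>2)" if "0 \<le> r" for r :: real
    proof -
      have "2 * r \<le> r\<^sup>2 + 1" using zero_le_power2[of "r - 1"] by (simp add: power2_diff)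
      with zero_le_power2[of r] show ?thesis by (smt (verit))
    qed
    then have "(1 + norm \<xi>) ^ N \<le> (2 * (1 + (norm \<xi>)\<^sup>2)) ^ N" by (intro power_mono) auto
    from mult_right_mono[OF this norm_ge_zero[of "fourier (f i) \<xi>"]]
    have "(1 + norm \<xi>) ^ N * norm (fourier (f i) \<xi>) \<le> 2 ^ N * ((1 + (norm \<xi>)\<^sup>2) ^ N * norm (fourier (f i) \<xi>))"
      by (simp only: power_mult_distrib mult.assoc)
    also have "\<dots> \<le> 2 ^ N * K" by (intro mult_left_mono K) simp
    finally show ?thesis .
  qed
  then show "\<exists>K. \<forall>i x. (1 + norm x) ^ N * norm (fourier (f i) x) \<le> K" by metis
qed

text \<open>A derivative of a transform is the transform of a coordinate multiple, hence of another
  Schwartz family. The transforms themselves form an invariant for \<open>dfam_coinduct\<close>, and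
  only the decay from \<open>wb_fourier\<close> has to be added.\<close>

lemma sfam_fourier:
  fixes f :: "'i \<Rightarrow> plane \<Rightarrow> complex"
  assumes "sfam f" shows "sfam (\<lambda>i. fourier (f i))"
proof -
  let ?C = "\<lambda>h :: 'i \<Rightarrow> plane \<Rightarrow> complex. \<exists>f. sfam f \<and> h = (\<lambda>i. fourier (f i))"
  show ?thesis
  proof (rule dfam_coinduct[of ?C])
    show "?C (\<lambda>i. fourier (f i))" using assms by metis
    fix h assume "?C h"
    then obtain g where g: "sfam g" and h: "h = (\<lambda>i. fourier (g i))" by metis
    show "h i differentiable at x" for i x unfolding h
      by (rule differentiableI[OF schwartz_fourier_has_derivative[OF sfam_member[OF g]]])
    show "wb h" unfolding h by (rule wb_fourier[OF g])
    fix b :: plane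
    have "(\<lambda>i. dir_deriv b (h i)) = (\<lambda>i. fourier (\<lambda>x. - \<i> * (complex_of_real (x \<bullet> b) * g i x)))"
      unfolding h by (intro ext) (subst dir_deriv_eq[OF schwartz_fourier_has_derivative[OF sfam_member[OF g]]], simp only: mult.assoc)
    moreover have "sfam (\<lambda>i x. - \<i> * (complex_of_real (x \<bullet> b) * g i x))"
      by (rule sfam_cmult[OF sfam_coord[OF g]])
    ultimately show "add_closure ?C (\<lambda>i. dir_deriv b (h i))"
      by (intro add_closure.base exI[of _ "\<lambda>i x. - \<i> * (complex_of_real (x \<bullet> b) * g i x)"] conjI)
  qed (rule wb_zero, rule wb_add)
qed

lemma schwartz_fourier: "f \<in> schwartz \<Longrightarrow> fourier f \<in> schwartz"
  unfolding schwartz_iff_sfam by (rule sfam_fourier)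

lemma sfam_reflect:
  fixes f :: "'i \<Rightarrow> plane \<Rightarrow> complex"
  assumes "sfam f" shows "sfam (\<lambda>i x. f i (- x))"
proof -
  let ?C = "\<lambda>h :: 'i \<Rightarrow> plane \<Rightarrow> complex. \<exists>f. sfam f \<and> h = (\<lambda>i x. f i (- x))"
  show ?thesis
  proof (rule dfam_coinduct[of ?C])
    show "?C (\<lambda>i x. f i (- x))" using assms by metis
    fix h assume "?C h"
    then obtain g where g: "sfam g" and h: "h = (\<lambda>i x. g i (- x))" by metis
    have *: "((\<lambda>x. g i (- x)) has_derivative (\<lambda>v. dir_deriv (- v) (g i) (- x))) (at x)" for i x
      by (rule has_derivative_compose[of "\<lambda>x. - x" "\<lambda>x. - x", OF _ has_derivative_dir_deriv[OF dfam_differentiable[OF g]]])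
        (auto intro!: derivative_eq_intros)
    show "h i differentiable at x" for i x unfolding h by (rule differentiableI[OF *])
    show "wb h" using dfam_pred[OF g] unfolding h wb_def by (metis norm_minus_cancel)
    fix b :: plane assume b: "b \<in> Basis"
    have "(\<lambda>i. dir_deriv b (h i)) = (\<lambda>i x. (- 1) * dir_deriv b (g i) (- x))"
      unfolding h
    proof (intro ext, subst dir_deriv_eq[OF *])
      fix i x
      show "dir_deriv (- b) (g i) (- x) = (- 1) * dir_deriv b (g i) (- x)"
        using dir_deriv_scaleR[OF dfam_differentiable[OF g, of i "- x"], of "- 1" b] by simp
    qed
    moreover have "sfam (\<lambda>i x. (- 1) * dir_deriv b (g i) x)"
      by (rule sfam_cmult[OF dfam_deriv[OF g b]])
    ultimately show "add_closure ?C (\<lambda>i. dir_deriv b (h i))"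
      by (intro add_closure.base) metis
  qed (rule wb_zero, rule wb_add)
qed

lemma sfam_inv_fourier: "sfam f \<Longrightarrow> sfam (\<lambda>i. inv_fourier (f i))"
  unfolding inv_fourier_eq[abs_def] by (intro sfam_cmult sfam_reflect sfam_fourier)

lemma schwartz_inv_fourier: "f \<in> schwartz \<Longrightarrow> inv_fourier f \<in> schwartz"
  unfolding schwartz_iff_sfam by (rule sfam_inv_fourier)

section \<open>Fourier inversion\<close>

text \<open>Domination by a product of two integrable functions is the form in which most of the
  later uses of Fubini's theorem are justified.\<close>

lemma integrable_pair_bound:
  fixes u :: "plane \<times> plane \<Rightarrow> 'b::{banach,second_countable_topology}"
  assumes f: "integrable lborel f" and g: "integrable lborel g"
    and m: "u \<in> borel_measurable (lborel \<Otimes>\<^sub>M lborel)"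
    and bound: "\<And>x y. norm (u (x, y)) \<le> (f x :: real) * (g y :: real)"
  shows "integrable (lborel \<Otimes>\<^sub>M lborel) u"
proof (rule lborel_pair.Fubini_integrable[OF m])
  have fix_int: "integrable lborel (\<lambda>y. u (x, y))" for x
  proof (rule Bochner_Integration.integrable_bound[OF integrable_mult_right[OF g, of "f x"]])
    show "(\<lambda>y. u (x, y)) \<in> borel_measurable lborel" using m by measurable
    show "AE y in lborel. norm (u (x, y)) \<le> norm (f x * g y)"
      by (intro AE_I2 order_trans[OF bound]) simp
  qed
  then show "AE x in lborel. integrable lborel (\<lambda>y. u (x, y))" by simp
  show "integrable lborel (\<lambda>x. LINT y|lborel. norm (u (x, y)))"
  proof (rule Bochner_Integration.integrable_bound[OF integrable_mult_left[OF f, of "LINT y|lborel. g y"]])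
    show "(\<lambda>x. LINT y|lborel. norm (u (x, y))) \<in> borel_measurable lborel" using m by measurable
    have "norm (LINT y|lborel. norm (u (x, y))) \<le> norm (f x * (LINT y|lborel. g y))" for x
    proof -
      have "norm (LINT y|lborel. norm (u (x, y))) = (LINT y|lborel. norm (u (x, y)))" by simp
      also have "\<dots> \<le> (LINT y|lborel. f x * g y)"
        by (intro integral_mono integrable_norm fix_int integrable_mult_right g bound)
      also have "\<dots> \<le> norm (f x * (LINT y|lborel. g y))" by simp
      finally show ?thesis .
    qed
    then show "AE x in lborel. norm (LINT y|lborel. norm (u (x, y))) \<le> norm (f x * (LINT y|lborel. g y))" by simp
  qed
qed

lemma integrable_borel: "integrable lborel f \<Longrightarrow> f \<in> borel_measurable borel"
  for f :: "'a::euclidean_space \<Rightarrow> 'b::{banach,second_countable_topology}"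
  using borel_measurable_integrable[of lborel f] by simp

lemma fourier_transfer:
  assumes f: "integrable lborel f" and g: "integrable lborel g"
  shows "(LINT x|lborel. fourier f x * g x) = (LINT x|lborel. f x * fourier g x)"
proof -
  have [measurable]: "f \<in> borel_measurable borel" "g \<in> borel_measurable borel"
    using f g by (auto intro: integrable_borel)
  have int: "integrable (lborel \<Otimes>\<^sub>M lborel) (\<lambda>(x, y). expni (x \<bullet> y) * f x * g y)"
    by (rule integrable_pair_bound[OF integrable_norm[OF f] integrable_norm[OF g]]) (measurable, simp add: norm_mult)
  have "(LINT y|lborel. fourier f y * g y) = (LINT y|lborel. LINT x|lborel. expni (x \<bullet> y) * f x * g y)"
    unfolding fourier_def by (simp only: integral_mult_left_zero)
  also have "\<dots> = (LINT x|lborel. LINT y|lborel. expni (x \<bullet> y) * f x * g y)"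
    by (rule lborel_pair.Fubini_integral[OF int])
  also have "\<dots> = (LINT x|lborel. LINT y|lborel. f x * (expni (y \<bullet> x) * g y))"
    by (simp only: inner_commute mult_ac)
  also have "\<dots> = (LINT x|lborel. f x * fourier g x)"
    unfolding fourier_def by (simp only: integral_mult_right_zero)
  finally show ?thesis .
qed

lemma integral_plane_reflect:
  fixes f :: "plane \<Rightarrow> complex"
  assumes "f \<in> borel_measurable borel"
  shows "(LINT x|lborel. f (- x)) = (LINT x|lborel. f x)"
  using integral_plane_affine[OF assms, of "- 1" 0] by simp

text \<open>Read off from the characteristic function of the standard normal distribution, whose
  density is this Gaussian divided by \<open>sqrt (2 * pi)\<close>.\<close>

lemma gauss_real:
  fixes t :: real
  shows "integrable lborel (\<lambda>x. complex_of_real (exp (- x\<^sup>2 / 2)) * expi (t * x))"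
    and "(LINT x|lborel. complex_of_real (exp (- x\<^sup>2 / 2)) * expi (t * x))
      = complex_of_real (sqrt (2 * pi) * exp (- t\<^sup>2 / 2))"
proof -
  have i: "integrable lborel (\<lambda>x::real. exp (- x\<^sup>2 / 2))"
    using integrable_mult_right[OF integrable_std_normal_moment[of 0], of "sqrt (2 * pi)"]
    by (simp add: std_normal_density_def)
  show "integrable lborel (\<lambda>x. complex_of_real (exp (- x\<^sup>2 / 2)) * expi (t * x))"
  proof (rule Bochner_Integration.integrable_bound[OF i])
    show "AE x in lborel. norm (complex_of_real (exp (- x\<^sup>2 / 2)) * expi (t * x)) \<le> norm (exp (- x\<^sup>2 / 2))"
      by (intro AE_I2) (simp add: norm_mult)
  qed measurable
  have "complex_of_real (exp (- t\<^sup>2 / 2)) = char std_normal_distribution t"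
    by (simp add: char_std_normal_distribution)
  also have "\<dots> = (LINT x|lborel. std_normal_density x *\<^sub>R expi (t * x))"
    unfolding char_def by (subst integral_density) auto
  also have "\<dots> = (LINT x|lborel. complex_of_real (1 / sqrt (2 * pi)) * (complex_of_real (exp (- x\<^sup>2 / 2)) * expi (t * x)))"
    by (simp only: std_normal_density_def scaleR_conv_of_real of_real_mult mult.assoc)
  also have "\<dots> = complex_of_real (1 / sqrt (2 * pi)) * (LINT x|lborel. complex_of_real (exp (- x\<^sup>2 / 2)) * expi (t * x))"
    by (rule integral_mult_right_zero)
  finally have e: "complex_of_real (exp (- t\<^sup>2 / 2)) = complex_of_real (1 / sqrt (2 * pi)) * (LINT x|lborel. complex_of_real (exp (- x\<^sup>2 / 2)) * expi (t * x))" .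
  have "complex_of_real (sqrt (2 * pi)) * complex_of_real (1 / sqrt (2 * pi)) = 1" by (simp flip: of_real_mult)
  then show "(LINT x|lborel. complex_of_real (exp (- x\<^sup>2 / 2)) * expi (t * x))
      = complex_of_real (sqrt (2 * pi) * exp (- t\<^sup>2 / 2))"
    unfolding of_real_mult e mult.assoc[symmetric] by simp
qed

abbreviation gau :: "plane \<Rightarrow> complex" where "gau z \<equiv> complex_of_real (exp (- (norm z)\<^sup>2 / 2))"

lemma gauss_plane:
  fixes z :: plane
  shows "integrable lborel (\<lambda>x. expi (x \<bullet> z) * gau x)"
    and "(LINT x|lborel. expi (x \<bullet> z) * gau x)
      = complex_of_real (2 * pi * exp (- (norm z)\<^sup>2 / 2))"
proof -
  let ?f = "\<lambda>(b::plane) x. complex_of_real (exp (- x\<^sup>2 / 2)) * expi ((z \<bullet> b) * x)"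
  have n: "(\<Prod>b\<in>Basis. complex_of_real (exp (- (x \<bullet> b)\<^sup>2 / 2))) = gau x" for x :: plane
  proof -
    have "(norm x)\<^sup>2 = (\<Sum>b\<in>Basis. (x \<bullet> b)\<^sup>2)"
      unfolding power2_eq_square[of "_ \<bullet> _"] by (rule trans[OF power2_norm_eq_inner euclidean_inner])
    then have "- (norm x)\<^sup>2 / 2 = (\<Sum>b\<in>Basis. - (x \<bullet> b)\<^sup>2 / 2)" by (simp add: sum_negf sum_divide_distrib)
    then show ?thesis by (simp only: exp_sum[OF finite_Basis] of_real_prod)
  qed
  have "(\<Prod>b\<in>Basis. expi ((z \<bullet> b) * (x \<bullet> b))) = expi (x \<bullet> z)" for x :: plane
    unfolding exp_sum[OF finite_Basis, symmetric] sum_distrib_left[symmetric] of_real_sum[symmetric]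
    by (simp only: euclidean_inner[of z x, symmetric] inner_commute[of x z])
  then have eq: "(\<Prod>b\<in>Basis. ?f b (x \<bullet> b)) = expi (x \<bullet> z) * gau x" for x
    unfolding prod.distrib n by (simp only: mult.commute)
  show "integrable lborel (\<lambda>x. expi (x \<bullet> z) * gau x)"
    using integral_prod_Basis(1)[of ?f, OF gauss_real(1)] unfolding eq .
  have "(LINT x|lborel. expi (x \<bullet> z) * gau x) = (\<Prod>b\<in>Basis. complex_of_real (sqrt (2 * pi)) * complex_of_real (exp (- (z \<bullet> b)\<^sup>2 / 2)))"
    using integral_prod_Basis(2)[of ?f, OF gauss_real(1)] unfolding eq gauss_real(2) of_real_mult[of "sqrt (2 * pi)"] .
  also have "\<dots> = complex_of_real (sqrt (2 * pi)) ^ 2 * gau z"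
    unfolding prod.distrib n prod_constant DIM_plane ..
  also have "\<dots> = complex_of_real (2 * pi * exp (- (norm z)\<^sup>2 / 2))"
    by (simp flip: of_real_power)
  finally show "(LINT x|lborel. expi (x \<bullet> z) * gau x)
      = complex_of_real (2 * pi * exp (- (norm z)\<^sup>2 / 2))" .
qed

lemma gauss_scaled:
  fixes z :: plane
  assumes e: "\<epsilon> > 0"
  shows "integrable lborel (\<lambda>x. expi (x \<bullet> z) * gau (\<epsilon> *\<^sub>R x))" (is ?I)
    and "(LINT x|lborel. expi (x \<bullet> z) * gau (\<epsilon> *\<^sub>R x))
      = complex_of_real (2 * pi / \<epsilon>\<^sup>2 * exp (- (norm (z /\<^sub>R \<epsilon>))\<^sup>2 / 2))" (is ?E)
proof -
  have eq: "(0 + \<epsilon> *\<^sub>R x) \<bullet> (z /\<^sub>R \<epsilon>) = x \<bullet> z" for x :: plane using e by simp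
  note i = gauss_plane(1)[of "z /\<^sub>R \<epsilon>"]
  show ?I using integrable_plane_affine[OF i, of \<epsilon> 0] e unfolding eq by simp
  have "(LINT x|lborel. expi (x \<bullet> (z /\<^sub>R \<epsilon>)) * gau x)
     = \<epsilon>\<^sup>2 *\<^sub>R (LINT x|lborel. expi (x \<bullet> z) * gau (\<epsilon> *\<^sub>R x))"
    using integral_plane_affine[OF integrable_borel[OF i], of \<epsilon> 0] e unfolding eq by simp
  then have "complex_of_real (2 * pi * exp (- (norm (z /\<^sub>R \<epsilon>))\<^sup>2 / 2)) = complex_of_real (\<epsilon>\<^sup>2) * (LINT x|lborel. expi (x \<bullet> z) * gau (\<epsilon> *\<^sub>R x))"
    unfolding gauss_plane(2) scaleR_conv_of_real .
  then show ?E using e by (simp add: field_simps)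
qed

text \<open>Gaussian regularisation. Damping the inverse integral by
  \<open>gau (e n *\<^sub>R \<xi>)\<close> gives \<open>A n\<close>, which tends to the undamped
  integral by dominated convergence (\<open>A1\<close>). Fubini and the transform of the Gaussian
  rewrite \<open>A n\<close> as a Gaussian average of \<open>f\<close> around \<open>x\<close> at
  scale \<open>e n\<close> (\<open>A2\<close>), and continuity of \<open>f\<close> yields the second
  limit (\<open>A3\<close>).\<close>

theorem fourier_inversion:
  assumes f: "f \<in> schwartz"
  shows "inv_fourier (fourier f) x = f x"
proof -
  define e where "e n = 1 / real (Suc n)" for n
  have e: "0 < e n" for n by (auto simp: e_def)
  have el: "e \<longlonglongrightarrow> 0" unfolding e_def by (rule LIMSEQ_Suc[OF lim_1_over_n])
  note fi = schwartz_integrable[OF f] and Fi = schwartz_integrable[OF schwartz_fourier[OF f]]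
  have [measurable]: "f \<in> borel_measurable borel" "fourier f \<in> borel_measurable borel"
    using fi Fi by (auto intro: integrable_borel)
  let ?G = "\<lambda>r \<xi>. gau (r *\<^sub>R \<xi>)"
  define A where "A n = (LINT \<xi>|lborel. expi (x \<bullet> \<xi>) * fourier f \<xi> * ?G (e n) \<xi>)" for n
  have A1: "A \<longlonglongrightarrow> (LINT \<xi>|lborel. expi (x \<bullet> \<xi>) * fourier f \<xi>)"
    unfolding A_def
  proof (rule integral_dominated_convergence[where w = "\<lambda>\<xi>. norm (fourier f \<xi>)"])
    show "integrable lborel (\<lambda>\<xi>. norm (fourier f \<xi>))" by (intro integrable_norm Fi)
    show "AE \<xi> in lborel. (\<lambda>n. expi (x \<bullet> \<xi>) * fourier f \<xi> * ?G (e n) \<xi>) \<longlonglongrightarrow> expi (x \<bullet> \<xi>) * fourier f \<xi>"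
    proof (intro AE_I2)
      fix \<xi> :: plane
      have "(\<lambda>n. expi (x \<bullet> \<xi>) * fourier f \<xi> * ?G (e n) \<xi>) \<longlonglongrightarrow> expi (x \<bullet> \<xi>) * fourier f \<xi> * ?G 0 \<xi>"
        by (intro tendsto_intros el) simp
      then show "(\<lambda>n. expi (x \<bullet> \<xi>) * fourier f \<xi> * ?G (e n) \<xi>) \<longlonglongrightarrow> expi (x \<bullet> \<xi>) * fourier f \<xi>"
        by simp
    qed
    show "AE \<xi> in lborel. norm (expi (x \<bullet> \<xi>) * fourier f \<xi> * ?G (e n) \<xi>) \<le> norm (fourier f \<xi>)" for n
      by (intro AE_I2) (simp add: norm_mult mult_left_le)
  qed measurable
  have A2: "A n = complex_of_real (2 * pi) * (LINT z|lborel. f (x + e n *\<^sub>R z) * gau z)" for n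
  proof -
    have Gi: "integrable lborel (?G (e n) :: plane \<Rightarrow> complex)" using gauss_scaled(1)[OF e[of n], of 0] by simp
    let ?u = "\<lambda>\<xi> y. expi (\<xi> \<bullet> (x - y)) * ?G (e n) \<xi> * f y"
    have int: "integrable (lborel \<Otimes>\<^sub>M lborel) (\<lambda>(\<xi>, y). ?u \<xi> y)"
      by (rule integrable_pair_bound[OF integrable_norm[OF Gi] integrable_norm[OF fi]]) (measurable, simp add: norm_mult)
    have "A n = (LINT \<xi>|lborel. LINT y|lborel. ?u \<xi> y)"
      unfolding A_def
    proof (intro Bochner_Integration.integral_cong refl)
      fix \<xi>
      have "expi (\<xi> \<bullet> (x - y)) = expi (x \<bullet> \<xi>) * expni (y \<bullet> \<xi>)" for y
        by (simp add: inner_diff_right inner_commute exp_add[symmetric] algebra_simps)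
      then have "?u \<xi> y = (expi (x \<bullet> \<xi>) * ?G (e n) \<xi>) * (expni (y \<bullet> \<xi>) * f y)" for y
        by (simp only: mult_ac)
      then have "(LINT y|lborel. ?u \<xi> y) = (expi (x \<bullet> \<xi>) * ?G (e n) \<xi>) * fourier f \<xi>"
        unfolding fourier_def by (simp only: integral_mult_right_zero)
      then show "expi (x \<bullet> \<xi>) * fourier f \<xi> * ?G (e n) \<xi> = (LINT y|lborel. ?u \<xi> y)"
        by (simp only: mult_ac)
    qed
    also have "\<dots> = (LINT y|lborel. LINT \<xi>|lborel. ?u \<xi> y)"
      by (rule lborel_pair.Fubini_integral[OF int, symmetric])
    also have "\<dots> = (LINT y|lborel. complex_of_real (2 * pi / (e n)\<^sup>2 * exp (- (norm ((x - y) /\<^sub>R e n))\<^sup>2 / 2)) * f y)"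
      by (simp only: integral_mult_left_zero gauss_scaled(2)[OF e])
    also have "\<dots> = (e n)\<^sup>2 *\<^sub>R (LINT z|lborel. complex_of_real (2 * pi / (e n)\<^sup>2 * exp (- (norm ((x - (x + e n *\<^sub>R z)) /\<^sub>R e n))\<^sup>2 / 2)) * f (x + e n *\<^sub>R z))"
      by (rule integral_plane_affine) (use e[of n] in \<open>measurable, simp\<close>)
    also have "\<dots> = (e n)\<^sup>2 *\<^sub>R (LINT z|lborel. complex_of_real (2 * pi / (e n)\<^sup>2) * (f (x + e n *\<^sub>R z) * gau z))"
      using e[of n] by (simp add: mult_ac)
    also have "\<dots> = complex_of_real ((e n)\<^sup>2 * (2 * pi / (e n)\<^sup>2)) * (LINT z|lborel. f (x + e n *\<^sub>R z) * gau z)"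
      by (simp only: integral_mult_right_zero scaleR_conv_of_real of_real_mult mult.assoc)
    finally show ?thesis using e[of n] by simp
  qed
  have A3: "(\<lambda>n. complex_of_real (2 * pi) * (LINT z|lborel. f (x + e n *\<^sub>R z) * gau z))
     \<longlonglongrightarrow> complex_of_real (2 * pi) * (LINT z::plane|lborel. f x * gau z)"
  proof (intro tendsto_mult tendsto_const)
    obtain K where K: "\<And>x. norm (f x) \<le> K" using schwartz_bound[OF f, of 0] by auto
    have gi: "integrable lborel (\<lambda>z::plane. exp (- (norm z)\<^sup>2 / 2))"
      using integrable_norm[OF gauss_plane(1)[of 0]] by simp
    show "(\<lambda>n. LINT z|lborel. f (x + e n *\<^sub>R z) * gau z) \<longlonglongrightarrow> (LINT z::plane|lborel. f x * gau z)"
    proof (rule integral_dominated_convergence[where w = "\<lambda>z. K * exp (- (norm z)\<^sup>2 / 2)"])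
      show "integrable lborel (\<lambda>z::plane. K * exp (- (norm z)\<^sup>2 / 2))" by (intro integrable_mult_right gi)
      show "AE z in lborel. (\<lambda>n. f (x + e n *\<^sub>R z) * gau z) \<longlonglongrightarrow> f x * gau z"
      proof (intro AE_I2 tendsto_mult tendsto_const)
        fix z :: plane
        have "(\<lambda>n. x + e n *\<^sub>R z) \<longlonglongrightarrow> x + 0 *\<^sub>R z" by (intro tendsto_intros el)
        then have "(\<lambda>n. x + e n *\<^sub>R z) \<longlonglongrightarrow> x" by simp
        moreover have "isCont f x" using smooth_differentiable[OF schwartz_smooth[OF f]] differentiable_imp_continuous_within by metis
        ultimately show "(\<lambda>n. f (x + e n *\<^sub>R z)) \<longlonglongrightarrow> f x" by (rule isCont_tendsto_compose[rotated])
      qed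
      show "AE z in lborel. norm (f (x + e n *\<^sub>R z) * gau z) \<le> K * exp (- (norm z)\<^sup>2 / 2)" for n
        by (intro AE_I2) (simp add: norm_mult K mult_right_mono)
    qed measurable
  qed
  have "(LINT \<xi>|lborel. expi (x \<bullet> \<xi>) * fourier f \<xi>) = complex_of_real (2 * pi) * (LINT z::plane|lborel. f x * gau z)"
    by (rule LIMSEQ_unique[OF A1]) (rule A3[folded A2])
  also have "(LINT z::plane|lborel. f x * gau z) = f x * complex_of_real (2 * pi)"
    using gauss_plane(2)[of 0] by simp
  finally have "(LINT \<xi>|lborel. expi (x \<bullet> \<xi>) * fourier f \<xi>) = complex_of_real ((2 * pi)\<^sup>2) * f x"
    by (simp add: power2_eq_square)
  then show ?thesis by (simp add: inv_fourier_def scaleR_conv_of_real)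
qed

lemma fourier_inv_fourier:
  assumes f: "f \<in> schwartz"
  shows "fourier (inv_fourier f) \<xi> = f \<xi>"
proof -
  have [measurable]: "fourier f \<in> borel_measurable borel"
    by (intro schwartz_borel schwartz_fourier f)
  have "fourier (inv_fourier f) \<xi> = complex_of_real (1 / (2 * pi)\<^sup>2) * (LINT x|lborel. expni (x \<bullet> \<xi>) * fourier f (- x))"
    unfolding inv_fourier_eq[abs_def] fourier_cmult fourier_def[of "\<lambda>x. fourier f (- x)"] ..
  also have "(LINT x|lborel. expni (x \<bullet> \<xi>) * fourier f (- x)) = (LINT x|lborel. expi (x \<bullet> \<xi>) * fourier f x)"
    using integral_plane_reflect[of "\<lambda>x. expi (x \<bullet> \<xi>) * fourier f x"] by simp
  also have "complex_of_real (1 / (2 * pi)\<^sup>2) * \<dots> = inv_fourier (fourier f) \<xi>"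
    by (simp add: inv_fourier_def scaleR_conv_of_real inner_commute)
  finally show ?thesis using fourier_inversion[OF f] by simp
qed

lemma fourier_reflect:
  assumes "f \<in> borel_measurable borel"
  shows "fourier (\<lambda>x. f (- x)) \<xi> = fourier f (- \<xi>)"
proof -
  have "(\<lambda>x. expi (x \<bullet> \<xi>) * f x) \<in> borel_measurable borel" using assms by measurable
  from integral_plane_reflect[OF this] show ?thesis unfolding fourier_def by simp
qed

lemma inv_fourier_transfer:
  assumes f: "integrable lborel f" and g: "integrable lborel g"
  shows "(LINT x|lborel. inv_fourier f x * g x) = (LINT x|lborel. f x * inv_fourier g x)"
proof -
  have [measurable]: "f \<in> borel_measurable borel" "g \<in> borel_measurable borel"
    using f g by (auto intro: integrable_borel)
  have Fm: "(\<lambda>x. fourier f x) \<in> borel_measurable borel" unfolding fourier_def by measurable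
  have gi: "integrable lborel (\<lambda>x. g (- x))" using integrable_plane_affine[OF g, of "- 1" 0] by simp
  have "(LINT x|lborel. fourier f (- x) * g x) = (LINT x|lborel. fourier f x * g (- x))"
    using integral_plane_reflect[of "\<lambda>x. fourier f x * g (- x)"] Fm by simp
  also have "\<dots> = (LINT x|lborel. f x * fourier g (- x))"
    unfolding fourier_transfer[OF f gi] by (simp only: fourier_reflect[OF integrable_borel[OF g]])
  finally have "(LINT x|lborel. fourier f (- x) * g x) = (LINT x|lborel. f x * fourier g (- x))" .
  then show ?thesis
    unfolding inv_fourier_eq mult.left_commute[of _ "complex_of_real (1 / (2 * pi)\<^sup>2)"] mult.assoc integral_mult_right_zero
    by simp
qed

lemma schwartz_cnj:
  assumes "f \<in> schwartz" shows "(\<lambda>x. cnj (f x)) \<in> schwartz"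
proof -
  have *: "iter_deriv vs (\<lambda>x. cnj (f x)) = (\<lambda>x. cnj (iter_deriv vs f x))" if "set vs \<subseteq> Basis" for vs
    using that
  proof (induction vs)
    case (Cons v vs)
    have "iter_deriv vs f differentiable at x" for x
      using Cons by (intro smooth_differentiable smooth_iter schwartz_smooth assms) auto
    from has_derivative_cnj[OF has_derivative_dir_deriv[OF this]] Cons show ?case
      by (auto simp: iter_deriv_Cons intro!: ext dir_deriv_eq)
  qed simp
  show ?thesis
  proof (rule schwartzI_bounds)
    fix vs :: "plane list" and N assume vs: "set vs \<subseteq> Basis"
    show "iter_deriv vs (\<lambda>x. cnj (f x)) differentiable at x" for x
      using smooth_differentiable[OF smooth_iter[OF smooth_cnj[OF schwartz_smooth[OF assms]] vs]] .
    show "\<exists>K. \<forall>x. (1 + norm x) ^ N * norm (iter_deriv vs (\<lambda>x. cnj (f x)) x) \<le> K"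
      using schwartz_weight_bound[OF assms vs, of N] by (simp add: *[OF vs])
  qed
qed

lemma cnj_fourier: "cnj (fourier f \<xi>) = complex_of_real ((2 * pi)\<^sup>2) * inv_fourier (\<lambda>x. cnj (f x)) \<xi>"
proof -
  have "cnj (fourier f \<xi>) = (LINT x|lborel. cnj (expni (x \<bullet> \<xi>) * f x))"
    unfolding fourier_def by (rule Bochner_Integration.integral_cnj[symmetric])
  then show ?thesis by (simp add: inv_fourier_def scaleR_conv_of_real exp_cnj inner_commute)
qed

lemma schwartz_square_integrable: "f \<in> schwartz \<Longrightarrow> integrable lborel (\<lambda>x. (norm (f x))\<^sup>2)"
proof -
  assume f: "f \<in> schwartz"
  from schwartz_integrable[OF schwartz_mult[OF f schwartz_cnj[OF f]], THEN integrable_norm]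
  show ?thesis by (simp add: norm_mult power2_eq_square)
qed

text \<open>Up to \<open>(2 * pi)\<^sup>2\<close> the conjugate of a transform is the inverse
  transform of the conjugate. Moving one transform across the integral by
  \<open>fourier_transfer\<close> and inverting leaves the norm of \<open>f\<close>.\<close>

theorem plancherel:
  assumes f: "f \<in> schwartz"
  shows "(LINT \<xi>|lborel. (norm (fourier f \<xi>))\<^sup>2) = (2 * pi)\<^sup>2 * (LINT x|lborel. (norm (f x))\<^sup>2)"
proof -
  have c: "(\<lambda>x. cnj (f x)) \<in> schwartz" by (rule schwartz_cnj[OF f])
  have sq: "complex_of_real (LINT x|lborel. (norm (g x))\<^sup>2) = (LINT x|lborel. g x * cnj (g x))" for g :: "plane \<Rightarrow> complex"
    by (simp only: integral_complex_of_real[symmetric] complex_norm_square)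
  have "complex_of_real (LINT \<xi>|lborel. (norm (fourier f \<xi>))\<^sup>2) = (LINT \<xi>|lborel. complex_of_real ((2 * pi)\<^sup>2) * (fourier f \<xi> * inv_fourier (\<lambda>x. cnj (f x)) \<xi>))"
    unfolding sq cnj_fourier by (simp only: mult_ac)
  also have "\<dots> = complex_of_real ((2 * pi)\<^sup>2) * (LINT x|lborel. f x * fourier (inv_fourier (\<lambda>x. cnj (f x))) x)"
    unfolding integral_mult_right_zero
      fourier_transfer[OF schwartz_integrable[OF f] schwartz_integrable[OF schwartz_inv_fourier[OF c]]] ..
  also have "\<dots> = complex_of_real ((2 * pi)\<^sup>2 * (LINT x|lborel. (norm (f x))\<^sup>2))"
    unfolding fourier_inv_fourier[OF c] of_real_mult sq ..
  finally show ?thesis by (simp only: of_real_eq_iff)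
qed

lemma plancherel_inv:
  assumes f: "f \<in> schwartz"
  shows "(LINT \<xi>|lborel. (norm (inv_fourier f \<xi>))\<^sup>2) = (LINT x|lborel. (norm (f x))\<^sup>2) / (2 * pi)\<^sup>2"
  using plancherel[OF schwartz_inv_fourier[OF f]] by (simp add: fourier_inv_fourier[OF f])

section \<open>Fourier multipliers and the norm of distributions\<close>

text \<open>The transpose of the multiplier with symbol \<open>m\<close>.\<close>

definition mop :: "(plane \<Rightarrow> complex) \<Rightarrow> (plane \<Rightarrow> complex) \<Rightarrow> plane \<Rightarrow> complex" where
  "mop m f = fourier (\<lambda>\<xi>. m \<xi> * inv_fourier f \<xi>)"

lemma multiplier_dist_mop: "multiplier_dist m u f = u (mop m f)"
  by (simp add: multiplier_dist_def inv_fourier_dist_def times_dist_def fourier_dist_def mop_def)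

lemma mop_schwartz: "m \<in> schwartz \<Longrightarrow> f \<in> schwartz \<Longrightarrow> mop m f \<in> schwartz"
  unfolding mop_def by (intro schwartz_fourier schwartz_mult schwartz_inv_fourier)

lemma mop_mop:
  assumes "m \<in> schwartz" "k \<in> schwartz" "f \<in> schwartz"
  shows "mop m (mop k f) = mop (\<lambda>\<xi>. m \<xi> * k \<xi>) f"
  unfolding mop_def
  by (simp only: fourier_inversion[OF schwartz_mult[OF assms(2) schwartz_inv_fourier[OF assms(3)]]] mult.assoc)

lemma inv_fourier_linear:
  assumes "f \<in> schwartz" "g \<in> schwartz"
  shows "inv_fourier (\<lambda>x. a * f x + b * g x) \<xi> = a * inv_fourier f \<xi> + b * inv_fourier g \<xi>"
proof -
  have i: "integrable lborel (\<lambda>x. a * f x)" "integrable lborel (\<lambda>x. b * g x)"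
    by (intro integrable_mult_right schwartz_integrable assms)+
  show ?thesis unfolding inv_fourier_eq fourier_add[OF i] fourier_cmult by (simp only: distrib_left mult.left_commute)
qed

lemma fourier_linear:
  assumes "f \<in> schwartz" "g \<in> schwartz"
  shows "fourier (\<lambda>x. a * f x + b * g x) \<xi> = a * fourier f \<xi> + b * fourier g \<xi>"
proof -
  have i: "integrable lborel (\<lambda>x. a * f x)" "integrable lborel (\<lambda>x. b * g x)"
    by (intro integrable_mult_right schwartz_integrable assms)+
  show ?thesis unfolding fourier_add[OF i] fourier_cmult ..
qed

lemma mop_linear:
  assumes "m \<in> schwartz" "f \<in> schwartz" "g \<in> schwartz"
  shows "mop m (\<lambda>x. a * f x + b * g x) = (\<lambda>x. a * mop m f x + b * mop m g x)"
proof -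
  have s: "(\<lambda>\<xi>. m \<xi> * inv_fourier f \<xi>) \<in> schwartz" "(\<lambda>\<xi>. m \<xi> * inv_fourier g \<xi>) \<in> schwartz"
    by (intro schwartz_mult schwartz_inv_fourier assms)+
  have "(\<lambda>\<xi>. m \<xi> * inv_fourier (\<lambda>x. a * f x + b * g x) \<xi>) = (\<lambda>\<xi>. a * (m \<xi> * inv_fourier f \<xi>) + b * (m \<xi> * inv_fourier g \<xi>))"
    unfolding inv_fourier_linear[OF assms(2,3)] by (simp add: algebra_simps)
  then show ?thesis unfolding mop_def by (simp only: fourier_linear[OF s, abs_def])
qed

lemma mop_symbol_linear:
  assumes "m \<in> schwartz" "k \<in> schwartz" "f \<in> schwartz"
  shows "mop (\<lambda>\<xi>. a * m \<xi> + b * k \<xi>) f = (\<lambda>x. a * mop m f x + b * mop k f x)"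
proof -
  have s: "(\<lambda>\<xi>. m \<xi> * inv_fourier f \<xi>) \<in> schwartz" "(\<lambda>\<xi>. k \<xi> * inv_fourier f \<xi>) \<in> schwartz"
    by (intro schwartz_mult schwartz_inv_fourier assms)+
  have "(\<lambda>\<xi>. (a * m \<xi> + b * k \<xi>) * inv_fourier f \<xi>) = (\<lambda>\<xi>. a * (m \<xi> * inv_fourier f \<xi>) + b * (k \<xi> * inv_fourier f \<xi>))"
    by (simp add: algebra_simps)
  then show ?thesis unfolding mop_def by (simp only: fourier_linear[OF s, abs_def])
qed

lemma mop_symbol_diff:
  assumes "m \<in> schwartz" "k \<in> schwartz" "f \<in> schwartz"
  shows "mop (\<lambda>\<xi>. m \<xi> - k \<xi>) f = (\<lambda>x. mop m f x - mop k f x)"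
  using mop_symbol_linear[OF assms, of 1 "- 1"] by simp

lemma mop_zero [simp]: "mop (\<lambda>\<xi>. 0) f = (\<lambda>x. 0)"
  by (rule ext) (simp add: mop_def fourier_def)

section \<open>Linear functionals, and the squared norm as an infimum over representatives\<close>

lemma linear_functional_diff:
  assumes "linear_functional_on V u" "f \<in> V" "g \<in> V"
  shows "u (\<lambda>x. f x - g x) = u f - u g"
  using assms(1)[unfolded linear_functional_on_def, rule_format, OF assms(2,3), of 1 "- 1"] by simp

lemma linear_functional_zero:
  assumes "linear_functional_on V u" "f \<in> V"
  shows "u (\<lambda>x. 0) = 0"
  using linear_functional_diff[OF assms assms(2)] by simp

lemma linear_functional_cmult:
  assumes "linear_functional_on V u" "f \<in> V"
  shows "u (\<lambda>x. c * f x) = c * u f"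
  using assms(1)[unfolded linear_functional_on_def, rule_format, OF assms(2,2), of c 0] by simp

lemma tempered_linear: "tempered_distribution u \<Longrightarrow> linear_functional_on schwartz u"
  by (simp add: tempered_distribution_def)

definition l2 :: "(plane \<Rightarrow> complex) \<Rightarrow> ennreal" where
  "l2 g = (\<integral>\<^sup>+ x. ennreal ((norm (g x))\<^sup>2) \<partial>lborel)"

lemma L2_norm_sq_le: "represents g u \<Longrightarrow> L2_norm_sq u \<le> l2 g"
  unfolding L2_norm_sq_def l2_def by (rule INF_lower) simp

lemma L2_norm_sq_lessD: "L2_norm_sq u < c \<Longrightarrow> \<exists>g. represents g u \<and> l2 g < c"
  unfolding L2_norm_sq_def l2_def INF_less_iff by auto

lemma represents_cong: "(\<And>f. f \<in> schwartz \<Longrightarrow> u f = v f) \<Longrightarrow> represents g u \<longleftrightarrow> represents g v"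
  unfolding represents_def by auto

lemma L2_norm_sq_cong: "(\<And>f. f \<in> schwartz \<Longrightarrow> u f = v f) \<Longrightarrow> L2_norm_sq u = L2_norm_sq v"
  unfolding L2_norm_sq_def using represents_cong[of u v] by simp

lemma L2_norm_sq_zero: "(\<And>f. f \<in> schwartz \<Longrightarrow> u f = 0) \<Longrightarrow> L2_norm_sq u = 0"
proof -
  assume "\<And>f. f \<in> schwartz \<Longrightarrow> u f = 0"
  then have "represents (\<lambda>x. 0) u" by (simp add: represents_def of_function_def)
  from L2_norm_sq_le[OF this] show ?thesis by (simp add: l2_def)
qed

text \<open>The infimum in \<open>L2_norm_sq\<close> is not known to be attained. The estimate is
  therefore used for representatives within \<open>e / (2 * c)\<close> and
  \<open>e / (2 * d)\<close> of the two infima, which costs \<open>e\<close> in total; such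
  representatives have finite norm.\<close>

lemma L2_norm_sq_combine:
  assumes "\<And>a b. represents a u \<Longrightarrow> represents b v \<Longrightarrow> l2 a < \<infinity> \<Longrightarrow> l2 b < \<infinity> \<Longrightarrow> X \<le> ennreal c * l2 a + ennreal d * l2 b"
    and c: "c > 0" and d: "d > 0"
  shows "X \<le> ennreal c * L2_norm_sq u + ennreal d * L2_norm_sq v"
proof (rule ennreal_le_epsilon)
  fix e :: real assume e: "0 < e" and fin: "ennreal c * L2_norm_sq u + ennreal d * L2_norm_sq v < top"
  have fu: "L2_norm_sq u < top" "L2_norm_sq v < top"
    using fin c d by (auto simp: ennreal_mult_less_top)
  have "L2_norm_sq u < L2_norm_sq u + ennreal (e / (2 * c))" "L2_norm_sq v < L2_norm_sq v + ennreal (e / (2 * d))"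
    using fu e c d by (simp_all add: ennreal_add_less_top less_top[symmetric] ennreal_lessI)
  then obtain a b where a: "represents a u" "l2 a < L2_norm_sq u + ennreal (e / (2 * c))"
    and b: "represents b v" "l2 b < L2_norm_sq v + ennreal (e / (2 * d))"
    using L2_norm_sq_lessD by metis
  have fa: "l2 a < \<infinity>" "l2 b < \<infinity>" using a(2) b(2) fu by (auto intro: less_trans simp: ennreal_add_less_top top.not_eq_extremum)
  have "X \<le> ennreal c * l2 a + ennreal d * l2 b" by (rule assms(1)[OF a(1) b(1) fa])
  also have "\<dots> \<le> ennreal c * (L2_norm_sq u + ennreal (e / (2 * c))) + ennreal d * (L2_norm_sq v + ennreal (e / (2 * d)))"
    by (intro add_mono mult_left_mono less_imp_le[OF a(2)] less_imp_le[OF b(2)]) auto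
  also have "\<dots> = ennreal c * L2_norm_sq u + ennreal d * L2_norm_sq v + (ennreal (c * (e / (2 * c))) + ennreal (d * (e / (2 * d))))"
  proof -
    have "ennreal r * (x + ennreal (e / (2 * r))) = ennreal r * x + ennreal (r * (e / (2 * r)))" if "r > 0" for r x
      using that e by (subst ennreal_mult) (auto simp: distrib_left)
    then show ?thesis using c d by (simp only: add_ac)
  qed
  also have "ennreal (c * (e / (2 * c))) + ennreal (d * (e / (2 * d))) = ennreal e"
    using e c d by (simp flip: ennreal_plus)
  finally show "X \<le> ennreal c * L2_norm_sq u + ennreal d * L2_norm_sq v + ennreal e" .
qed

lemma represents_diff:
  assumes "represents a u" "represents b v"
  shows "represents (\<lambda>x. a x - b x) (\<lambda>f. u f - v f)"
  using assms unfolding represents_def of_function_def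
  by (auto simp: left_diff_distrib)

lemma l2_diff:
  assumes [measurable]: "a \<in> borel_measurable borel" "b \<in> borel_measurable borel"
  shows "l2 (\<lambda>x. a x - b x) \<le> 2 * l2 a + 2 * l2 b"
proof -
  have "(norm (a x - b x))\<^sup>2 \<le> 2 * (norm (a x))\<^sup>2 + 2 * (norm (b x))\<^sup>2" for x
  proof -
    have "(norm (a x - b x))\<^sup>2 \<le> (norm (a x) + norm (b x))\<^sup>2"
      by (intro power_mono norm_triangle_ineq4) simp
    also have "\<dots> \<le> 2 * (norm (a x))\<^sup>2 + 2 * (norm (b x))\<^sup>2"
      using zero_le_power2[of "norm (a x) - norm (b x)"] by (simp add: power2_sum power2_diff)
    finally show ?thesis .
  qed
  then have "l2 (\<lambda>x. a x - b x) \<le> (\<integral>\<^sup>+x. ennreal (2 * (norm (a x))\<^sup>2 + 2 * (norm (b x))\<^sup>2) \<partial>lborel)"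
    unfolding l2_def by (intro nn_integral_mono ennreal_leI)
  also have "\<dots> = (\<integral>\<^sup>+x. 2 * ennreal ((norm (a x))\<^sup>2) + 2 * ennreal ((norm (b x))\<^sup>2) \<partial>lborel)"
    by (simp add: ennreal_mult)
  also have "\<dots> = 2 * l2 a + 2 * l2 b"
    unfolding l2_def by (simp add: nn_integral_add nn_integral_cmult)
  finally show ?thesis .
qed

lemma represents_borel: "represents a u \<Longrightarrow> a \<in> borel_measurable borel"
  by (simp add: represents_def)

text \<open>The triangle inequality for squared norms. The constants 2 are the price for avoiding
  square roots in \<open>ennreal\<close>, and they do no harm in limits.\<close>

lemma L2_norm_sq_diff: "L2_norm_sq (\<lambda>f. u f - v f) \<le> 2 * L2_norm_sq u + 2 * L2_norm_sq v"
  using L2_norm_sq_combine[of u v "L2_norm_sq (\<lambda>f. u f - v f)" 2 2]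
    order_trans[OF L2_norm_sq_le[OF represents_diff] l2_diff[OF represents_borel represents_borel]]
  by simp

section \<open>Multipliers as convolutions, and Young's inequality\<close>

definition kern :: "(plane \<Rightarrow> complex) \<Rightarrow> plane \<Rightarrow> complex" where
  "kern m x = complex_of_real (1 / (2 * pi)\<^sup>2) * fourier m x"

lemma kern_schwartz: "m \<in> schwartz \<Longrightarrow> kern m \<in> schwartz"
  unfolding kern_def[abs_def] by (intro schwartz_cmult schwartz_fourier)

text \<open>\<open>mop\<close> inverts first and transforms last, so its kernel is the forward
  transform of the symbol with the constant of \<open>inv_fourier\<close>. Fubini carries out the
  frequency integral first.\<close>

lemma mop_convolution:
  assumes m: "m \<in> schwartz" and f: "f \<in> schwartz"
  shows "mop m f y = (LINT x|lborel. kern m (y - x) * f x)"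
proof -
  note mi = schwartz_integrable[OF m] and fi = schwartz_integrable[OF f]
  have [measurable]: "f \<in> borel_measurable borel" "m \<in> borel_measurable borel"
    using fi mi by (auto intro: integrable_borel)
  define c where "c = complex_of_real (1 / (2 * pi)\<^sup>2)"
  let ?u = "\<lambda>\<xi> x. (c * expni (\<xi> \<bullet> (y - x)) * m \<xi>) * f x"
  have int: "integrable (lborel \<Otimes>\<^sub>M lborel) (\<lambda>(\<xi>, x). ?u \<xi> x)"
    by (rule integrable_pair_bound[OF integrable_mult_right[OF integrable_norm[OF mi], of "norm c"] integrable_norm[OF fi]])
      (measurable, simp add: norm_mult)
  have "mop m f y = (LINT \<xi>|lborel. LINT x|lborel. ?u \<xi> x)"
    unfolding mop_def fourier_def[of _ y]
  proof (intro Bochner_Integration.integral_cong refl)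
    fix \<xi>
    have "expni (\<xi> \<bullet> (y - x)) = expni (\<xi> \<bullet> y) * expi (\<xi> \<bullet> x)" for x
      by (simp add: inner_diff_right exp_add[symmetric] algebra_simps)
    then have "?u \<xi> x = (c * expni (\<xi> \<bullet> y) * m \<xi>) * (expi (\<xi> \<bullet> x) * f x)" for x
      by (simp only: mult_ac)
    then have "(LINT x|lborel. ?u \<xi> x) = (c * expni (\<xi> \<bullet> y) * m \<xi>) * (LINT x|lborel. expi (\<xi> \<bullet> x) * f x)"
      by (simp only: integral_mult_right_zero)
    then show "expni (\<xi> \<bullet> y) * (m \<xi> * inv_fourier f \<xi>) = (LINT x|lborel. ?u \<xi> x)"
      by (simp add: inv_fourier_def scaleR_conv_of_real mult_ac c_def)
  qed
  also have "\<dots> = (LINT x|lborel. LINT \<xi>|lborel. ?u \<xi> x)"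
    by (rule lborel_pair.Fubini_integral[OF int, symmetric])
  also have "\<dots> = (LINT x|lborel. kern m (y - x) * f x)"
    unfolding kern_def c_def[symmetric] fourier_def mult.assoc[of c]
    by (simp only: integral_mult_left_zero integral_mult_right_zero)
  finally show ?thesis .
qed

text \<open>The constant of Young's inequality for convolution with the kernel of \<open>m\<close>.\<close>

definition kmass :: "(plane \<Rightarrow> complex) \<Rightarrow> real" where
  "kmass m = (LINT x|lborel. norm (kern m x))"

lemma kmass_nn: "m \<in> schwartz \<Longrightarrow> (\<integral>\<^sup>+x. ennreal (norm (kern m x)) \<partial>lborel) = ennreal (kmass m)"
  unfolding kmass_def
  by (rule nn_integral_eq_integral) (auto intro!: integrable_norm schwartz_integrable kern_schwartz)

lemma kmass_nonneg: "0 \<le> kmass m"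
  by (simp add: kmass_def)

lemma kmass_shift:
  assumes "m \<in> schwartz"
  shows "(\<integral>\<^sup>+y. ennreal (norm (kern m (y - x))) \<partial>lborel) = ennreal (kmass m)"
    and "(\<integral>\<^sup>+y. ennreal (norm (kern m (x - y))) \<partial>lborel) = ennreal (kmass m)"
proof -
  have [measurable]: "kern m \<in> borel_measurable borel" by (intro schwartz_borel kern_schwartz assms)
  show "(\<integral>\<^sup>+y. ennreal (norm (kern m (y - x))) \<partial>lborel) = ennreal (kmass m)"
    using nn_integral_plane_affine[of "\<lambda>y. ennreal (norm (kern m y))" 1 "- x"] kmass_nn[OF assms] by simp
  show "(\<integral>\<^sup>+y. ennreal (norm (kern m (x - y))) \<partial>lborel) = ennreal (kmass m)"
    using nn_integral_plane_affine[of "\<lambda>y. ennreal (norm (kern m y))" "- 1" x] kmass_nn[OF assms] by simp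
qed

text \<open>A dilation of the symbol dilates the kernel and preserves its integral norm in dimension
  two. Hence all cutoffs \<open>hs h q\<close> share one operator bound, independent of
  \<open>q\<close>.\<close>

lemma kmass_scale:
  assumes m: "m \<in> schwartz" and c: "c > 0"
  shows "kmass (\<lambda>\<xi>. m (c *\<^sub>R \<xi>)) = kmass m"
proof -
  have [measurable]: "m \<in> borel_measurable borel" "kern m \<in> borel_measurable borel"
    by (intro schwartz_borel kern_schwartz m)+
  have "fourier m (x /\<^sub>R c) = c\<^sup>2 *\<^sub>R fourier (\<lambda>\<xi>. m (c *\<^sub>R \<xi>)) x" for x
  proof -
    have eq: "(0 + c *\<^sub>R \<xi>) \<bullet> (x /\<^sub>R c) = \<xi> \<bullet> x" for \<xi> using c by simp
    have "(\<lambda>\<xi>. expni (\<xi> \<bullet> (x /\<^sub>R c)) * m \<xi>) \<in> borel_measurable borel" by measurable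
    from integral_plane_affine[OF this, of c 0] show ?thesis
      using c unfolding fourier_def eq by simp
  qed
  then have k: "kern (\<lambda>\<xi>. m (c *\<^sub>R \<xi>)) x = kern m (x /\<^sub>R c) /\<^sub>R c\<^sup>2" for x
    using c by (simp add: kern_def scaleR_conv_of_real)
  have "(LINT x|lborel. norm (kern m (x /\<^sub>R c))) = c\<^sup>2 * (LINT x|lborel. norm (kern m x))"
    using integral_plane_affine[of "\<lambda>x. norm (kern m (x /\<^sub>R c))" c 0] c by simp
  then show ?thesis unfolding kmass_def k using c by simp
qed

abbreviation LL :: "(plane \<times> plane) measure" where "LL \<equiv> lborel \<Otimes>\<^sub>M lborel"

text \<open>Young's inequality for a distribution given by a square integrable function. The new
  representative \<open>G'\<close> is the convolution of \<open>G\<close> with the reflected kernel.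
  That it represents the transposed functional is Fubini; its norm is bounded by Cauchy--Schwarz
  with the kernel split into two square roots.\<close>

lemma represents_mop:
  assumes m: "m \<in> schwartz" and G: "represents G w" and fin: "l2 G < \<infinity>"
  shows "\<exists>G'. represents G' (\<lambda>f. w (mop m f)) \<and> l2 G' \<le> ennreal ((kmass m)\<^sup>2) * l2 G"
proof (intro exI conjI)
  let ?k = "\<lambda>y x. ennreal (norm (kern m (y - x)))" and ?r = "\<lambda>y x. ennreal (sqrt (norm (kern m (y - x))))"
    and ?g = "\<lambda>y. ennreal ((norm (G y))\<^sup>2)" and ?q = "\<lambda>y x. ennreal (sqrt (norm (kern m (y - x))) * norm (G y))"
  define G' where "G' x = (LINT y|lborel. G y * kern m (y - x))" for x
  note ks = kern_schwartz[OF m]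
  have [measurable]: "kern m \<in> borel_measurable borel" "G \<in> borel_measurable borel"
    using schwartz_borel[OF ks] G by (auto simp: represents_def)
  have G'm [measurable]: "G' \<in> borel_measurable borel" unfolding G'_def by measurable
  show "represents G' (\<lambda>f. w (mop m f))"
    unfolding represents_def
  proof (intro conjI ballI)
    fix f assume f: "f \<in> schwartz"
    have [measurable]: "f \<in> borel_measurable borel" using f by (rule schwartz_borel)
    let ?u = "\<lambda>y x. G y * (kern m (y - x) * f x)"
    have int: "integrable LL (\<lambda>(y, x). ?u y x)"
    proof (rule integrableI_bounded)
      \<comment> \<open>The product of \<open>norm (G y)\<close> and \<open>norm (f x)\<close> is
        bounded by the sum of their squares, so the double integral splits into two, and in each of
        them the kernel can be integrated first.\<close>
      have e: "ennreal (norm (?u y x)) \<le> ?k y x * ?g y + ?k y x * ennreal ((norm (f x))\<^sup>2)" for y x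
      proof -
        have "norm (G y) * norm (f x) \<le> (norm (G y))\<^sup>2 + (norm (f x))\<^sup>2"
          using sum_squares_bound[of "norm (G y)" "norm (f x)"] mult_nonneg_nonneg[OF norm_ge_zero[of "G y"] norm_ge_zero[of "f x"]]
          by linarith
        from mult_left_mono[OF this norm_ge_zero[of "kern m (y - x)"]]
        have "norm (?u y x) \<le> norm (kern m (y - x)) * (norm (G y))\<^sup>2 + norm (kern m (y - x)) * (norm (f x))\<^sup>2"
          by (simp add: norm_mult algebra_simps)
        then show ?thesis by (simp flip: ennreal_mult ennreal_plus)
      qed
      have "(\<integral>\<^sup>+p. ennreal (norm (case p of (y, x) \<Rightarrow> ?u y x)) \<partial>LL) \<le>
        (\<integral>\<^sup>+p. (case p of (y, x) \<Rightarrow> ?k y x * ?g y) + (case p of (y, x) \<Rightarrow> ?k y x * ennreal ((norm (f x))\<^sup>2)) \<partial>LL)"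
        by (intro nn_integral_mono) (use e in auto)
      also have "\<dots> = (\<integral>\<^sup>+p. (case p of (y, x) \<Rightarrow> ?k y x * ?g y) \<partial>LL)
          + (\<integral>\<^sup>+p. (case p of (y, x) \<Rightarrow> ?k y x * ennreal ((norm (f x))\<^sup>2)) \<partial>LL)"
        by (rule nn_integral_add) measurable
      also have "(\<integral>\<^sup>+p. (case p of (y, x) \<Rightarrow> ?k y x * ?g y) \<partial>LL) =
          (\<integral>\<^sup>+y. \<integral>\<^sup>+x. ?k y x * ?g y \<partial>lborel \<partial>lborel)"
        by (subst lborel.nn_integral_fst[symmetric]) auto
      also have "\<dots> = ennreal (kmass m) * l2 G"
        unfolding l2_def by (simp add: nn_integral_multc nn_integral_cmult kmass_shift[OF m])
      also have "(\<integral>\<^sup>+p. (case p of (y, x) \<Rightarrow> ?k y x * ennreal ((norm (f x))\<^sup>2)) \<partial>LL) =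
          (\<integral>\<^sup>+x. \<integral>\<^sup>+y. ?k y x * ennreal ((norm (f x))\<^sup>2) \<partial>lborel \<partial>lborel)"
        by (subst lborel_pair.nn_integral_snd[symmetric]) auto
      also have "\<dots> = ennreal (kmass m) * l2 f"
        unfolding l2_def by (simp add: nn_integral_multc nn_integral_cmult kmass_shift[OF m])
      also have "ennreal (kmass m) * l2 G + ennreal (kmass m) * l2 f < \<infinity>"
      proof -
        have "l2 f < \<infinity>" unfolding l2_def
          by (subst nn_integral_eq_integral[OF schwartz_square_integrable[OF f]]) auto
        then show ?thesis using fin by (simp add: ennreal_mult_less_top)
      qed
      finally show "(\<integral>\<^sup>+p. ennreal (norm (case p of (y, x) \<Rightarrow> ?u y x)) \<partial>LL) < \<infinity>" .
    qed measurable
    have eq: "(LINT y|lborel. ?u y x) = G' x * f x" for x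
      unfolding G'_def by (simp only: mult.assoc[symmetric] integral_mult_left_zero)
    show "integrable lborel (\<lambda>x. G' x * f x)"
      using lborel_pair.integrable_snd[OF int] unfolding eq .
    have "w (mop m f) = (LINT y|lborel. G y * mop m f y)"
      using G mop_schwartz[OF m f] by (simp add: represents_def of_function_def)
    also have "\<dots> = (LINT y|lborel. LINT x|lborel. ?u y x)"
      by (simp only: mop_convolution[OF m f] integral_mult_right_zero)
    also have "\<dots> = (LINT x|lborel. LINT y|lborel. ?u y x)"
      by (rule lborel_pair.Fubini_integral[OF int, symmetric])
    finally show "w (mop m f) = of_function G' f" by (simp only: eq of_function_def)
  qed simp
  have "ennreal ((norm (G' x))\<^sup>2) \<le> ennreal (kmass m) * (\<integral>\<^sup>+y. ?k y x * ?g y \<partial>lborel)" for x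
  proof -
    have "ennreal (norm (G' x)) \<le> (\<integral>\<^sup>+y. ennreal (norm (G y * kern m (y - x))) \<partial>lborel)"
    \<comment> \<open>Where the integral defining \<open>G'\<close> does not exist, its value is 0
      by convention and the bound is trivial.\<close>
    proof (cases "integrable lborel (\<lambda>y. G y * kern m (y - x))")
      case True
      then show ?thesis unfolding G'_def by (rule integral_norm_bound_ennreal)
    qed (simp add: G'_def not_integrable_integral_eq)
    also have "\<dots> = (\<integral>\<^sup>+y. ?r y x * ?q y x \<partial>lborel)"
    proof (intro nn_integral_cong)
      fix y
      have "norm (G y * kern m (y - x)) = sqrt (norm (kern m (y - x))) * (sqrt (norm (kern m (y - x))) * norm (G y))"
        by (simp add: norm_mult mult.assoc[symmetric])
      then show "ennreal (norm (G y * kern m (y - x))) = ?r y x * ?q y x"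
        by (simp add: ennreal_mult)
    qed
    finally have "ennreal (norm (G' x)) \<le> (\<integral>\<^sup>+y. ?r y x * ?q y x \<partial>lborel)" .
    then have "(ennreal (norm (G' x)))\<^sup>2 \<le> (\<integral>\<^sup>+y. ?r y x * ?q y x \<partial>lborel)\<^sup>2"
      by (rule power_mono) simp
    also have "\<dots> \<le> (\<integral>\<^sup>+y. (?r y x)\<^sup>2 \<partial>lborel) * (\<integral>\<^sup>+y. (?q y x)\<^sup>2 \<partial>lborel)"
      by (rule Cauchy_Schwarz_nn_integral) measurable
    also have "(\<integral>\<^sup>+y. (?r y x)\<^sup>2 \<partial>lborel) = ennreal (kmass m)"
      using kmass_shift(1)[OF m, of x] by (simp add: ennreal_power)
    also have "(\<integral>\<^sup>+y. (?q y x)\<^sup>2 \<partial>lborel) = (\<integral>\<^sup>+y. ?k y x * ?g y \<partial>lborel)"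
      by (simp add: ennreal_power power_mult_distrib ennreal_mult)
    finally show ?thesis by (simp add: ennreal_power)
  qed
  then have "l2 G' \<le> (\<integral>\<^sup>+x. ennreal (kmass m) * (\<integral>\<^sup>+y. ?k y x * ?g y \<partial>lborel) \<partial>lborel)"
    unfolding l2_def by (intro nn_integral_mono)
  also have "\<dots> = ennreal (kmass m) * (\<integral>\<^sup>+x. \<integral>\<^sup>+y. ?k y x * ?g y \<partial>lborel \<partial>lborel)"
    by (rule nn_integral_cmult) measurable
  also have "(\<integral>\<^sup>+x. \<integral>\<^sup>+y. ?k y x * ?g y \<partial>lborel \<partial>lborel)
      = (\<integral>\<^sup>+y. \<integral>\<^sup>+x. ?k y x * ?g y \<partial>lborel \<partial>lborel)"
    by (rule lborel_pair.Fubini') measurable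
  also have "\<dots> = ennreal (kmass m) * l2 G"
    unfolding l2_def by (simp add: nn_integral_multc nn_integral_cmult kmass_shift[OF m])
  finally show "l2 G' \<le> ennreal ((kmass m)\<^sup>2) * l2 G"
    by (simp add: power2_eq_square ennreal_mult kmass_nonneg mult.assoc)
qed

text \<open>\<open>L2_norm_sq_combine\<close> is applied with \<open>w\<close> in both slots, whence
  the factor 2. The constant \<open>c\<close> is kept apart from \<open>kmass m\<close>, which may
  vanish, because the combination lemma asks for positive factors.\<close>

lemma L2_norm_sq_mop:
  assumes m: "m \<in> schwartz" and c: "(kmass m)\<^sup>2 \<le> c" "0 < c"
  shows "L2_norm_sq (\<lambda>f. w (mop m f)) \<le> ennreal (2 * c) * L2_norm_sq w"
proof -
  have *: "L2_norm_sq (\<lambda>f. w (mop m f)) \<le> ennreal c * l2 a" if "represents a w" "l2 a < \<infinity>" for a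
  proof -
    obtain G' where G': "represents G' (\<lambda>f. w (mop m f))" "l2 G' \<le> ennreal ((kmass m)\<^sup>2) * l2 a"
      using represents_mop[OF m \<open>represents a w\<close> \<open>l2 a < \<infinity>\<close>] by metis
    have "L2_norm_sq (\<lambda>f. w (mop m f)) \<le> ennreal ((kmass m)\<^sup>2) * l2 a"
      by (rule order_trans[OF L2_norm_sq_le[OF G'(1)] G'(2)])
    also have "\<dots> \<le> ennreal c * l2 a" by (intro mult_right_mono ennreal_leI c) simp
    finally show ?thesis .
  qed
  have "L2_norm_sq (\<lambda>f. w (mop m f)) \<le> ennreal c * L2_norm_sq w + ennreal c * L2_norm_sq w"
  proof (rule L2_norm_sq_combine[OF _ c(2) c(2)])
    fix a b assume "represents a w" "l2 a < \<infinity>"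
    from *[OF this] show "L2_norm_sq (\<lambda>f. w (mop m f)) \<le> ennreal c * l2 a + ennreal c * l2 b"
      by (rule order_trans) simp
  qed
  also have "\<dots> = (ennreal c + ennreal c) * L2_norm_sq w" by (rule distrib_right[symmetric])
  also have "ennreal c + ennreal c = ennreal (2 * c)" using c by (simp flip: ennreal_plus)
  finally show ?thesis .
qed

lemma schwartz_l2: "f \<in> schwartz \<Longrightarrow> l2 f = ennreal (LINT x|lborel. (norm (f x))\<^sup>2)"
  unfolding l2_def by (rule nn_integral_eq_integral[OF schwartz_square_integrable]) auto

lemma represents_schwartz:
  assumes "f \<in> schwartz" "\<And>g. g \<in> schwartz \<Longrightarrow> u g = of_function f g"
  shows "represents f u"
  unfolding represents_def using assms
  by (auto intro!: schwartz_borel schwartz_integrable schwartz_mult)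

text \<open>For a Schwartz function the infimum is attained. Any other representative is tested
  against the conjugate of \<open>f\<close>, and Cauchy--Schwarz gives the comparison of norms
  without showing that representatives agree almost everywhere.\<close>

lemma L2_norm_sq_schwartz:
  assumes f: "f \<in> schwartz" and u: "\<And>g. g \<in> schwartz \<Longrightarrow> u g = of_function f g"
  shows "L2_norm_sq u = l2 f"
proof (rule antisym)
  show "L2_norm_sq u \<le> l2 f" by (rule L2_norm_sq_le[OF represents_schwartz[OF assms]])
  have "l2 f \<le> l2 g" if g: "represents g u" for g
  proof -
    have [measurable]: "g \<in> borel_measurable borel" "f \<in> borel_measurable borel"
      using represents_borel[OF g] schwartz_borel[OF f] .
    have c: "(\<lambda>x. cnj (f x)) \<in> schwartz" by (rule schwartz_cnj[OF f])
    define A where "A = (LINT x|lborel. (norm (f x))\<^sup>2)"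
    have A0: "0 \<le> A" by (simp add: A_def)
    have "complex_of_real A = of_function f (\<lambda>x. cnj (f x))"
      unfolding A_def of_function_def by (simp only: integral_complex_of_real[symmetric] complex_norm_square)
    also have "\<dots> = (LINT x|lborel. g x * cnj (f x))"
      using g u[OF c] c by (simp add: represents_def of_function_def)
    finally have "ennreal A = ennreal (norm (LINT x|lborel. g x * cnj (f x)))" using A0 by (metis norm_of_real abs_of_nonneg)
    also have "\<dots> \<le> (\<integral>\<^sup>+x. ennreal (norm (g x * cnj (f x))) \<partial>lborel)"
      using g c by (intro integral_norm_bound_ennreal) (simp add: represents_def)
    also have "\<dots> = (\<integral>\<^sup>+x. ennreal (norm (g x)) * ennreal (norm (f x)) \<partial>lborel)"
      by (simp add: norm_mult ennreal_mult)
    finally have "(ennreal A)\<^sup>2 \<le> (\<integral>\<^sup>+x. ennreal (norm (g x)) * ennreal (norm (f x)) \<partial>lborel)\<^sup>2"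
      by (rule power_mono) simp
    also have "\<dots> \<le> (\<integral>\<^sup>+x. (ennreal (norm (g x)))\<^sup>2 \<partial>lborel) * (\<integral>\<^sup>+x. (ennreal (norm (f x)))\<^sup>2 \<partial>lborel)"
      by (rule Cauchy_Schwarz_nn_integral) measurable
    also have "\<dots> = l2 g * ennreal A"
      using schwartz_l2[OF f] by (simp add: l2_def ennreal_power A_def)
    finally have *: "ennreal A * ennreal A \<le> l2 g * ennreal A" by (simp add: power2_eq_square)
    show ?thesis
    proof (cases "A = 0")
      case False
      with * A0 have "ennreal A \<le> l2 g"
        by (metis ennreal_mult_le_mult_iff ennreal_neq_top ennreal_eq_0_iff mult.commute order_antisym)
      then show ?thesis by (simp add: schwartz_l2[OF f] A_def)
    qed (simp add: schwartz_l2[OF f] A_def[symmetric])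
  qed
  then show "l2 f \<le> L2_norm_sq u" unfolding L2_norm_sq_def l2_def by (intro INF_greatest) auto
qed

text \<open>Written as an integral over counting measure, the Littlewood--Paley sum becomes
  accessible to Tonelli's theorem and to dominated convergence.\<close>

lemma infsum_eq_nn_integral_count_space: "(\<Sum>\<^sub>\<infinity>q\<in>UNIV. f q) = (\<integral>\<^sup>+q. f q \<partial>count_space UNIV)" for f :: "int \<Rightarrow> ennreal"
proof (rule antisym)
  have "sum f F \<le> (\<integral>\<^sup>+q. f q \<partial>count_space UNIV)" if "finite F" for F
  proof -
    have "sum f F = (\<integral>\<^sup>+q. f q \<partial>count_space F)" using that by (simp add: nn_integral_count_space_finite)
    also have "\<dots> = (\<integral>\<^sup>+q. f q * indicator F q \<partial>count_space UNIV)"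
      by (rule nn_integral_count_space_indicator) simp
    also have "\<dots> \<le> (\<integral>\<^sup>+q. f q \<partial>count_space UNIV)"
      by (intro nn_integral_mono) (auto simp: indicator_def)
    finally show ?thesis .
  qed
  then show "(\<Sum>\<^sub>\<infinity>q\<in>UNIV. f q) \<le> (\<integral>\<^sup>+q. f q \<partial>count_space UNIV)"
    by (subst nonneg_infsum_complete) (auto intro: SUP_least)
  have "(\<integral>\<^sup>+q. f q \<partial>count_space UNIV) = (\<integral>\<^sup>+n. f (int_decode n) \<partial>count_space UNIV)"
    by (rule nn_integral_bij_count_space[symmetric]) (simp add: bij_int_decode)
  also have "\<dots> = (SUP n. \<Sum>i<n. f (int_decode i))"
    unfolding nn_integral_count_space_nat by (rule suminf_eq_SUP)
  also have "\<dots> \<le> (\<Sum>\<^sub>\<infinity>q\<in>UNIV. f q)"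
  proof (rule SUP_least)
    fix n
    have "(\<Sum>i<n. f (int_decode i)) = sum f (int_decode ` {..<n})"
      by (subst sum.reindex) (auto simp: inj_on_def int_decode_eq)
    also have "\<dots> \<le> (\<Sum>\<^sub>\<infinity>q\<in>UNIV. f q)"
      by (subst nonneg_infsum_complete) (auto intro: SUP_upper)
    finally show "(\<Sum>i<n. f (int_decode i)) \<le> (\<Sum>\<^sub>\<infinity>q\<in>UNIV. f q)" .
  qed
  finally show "(\<integral>\<^sup>+q. f q \<partial>count_space UNIV) \<le> (\<Sum>\<^sub>\<infinity>q\<in>UNIV. f q)" .
qed

section \<open>Littlewood--Paley projections\<close>

definition hs :: "(plane \<Rightarrow> complex) \<Rightarrow> int \<Rightarrow> plane \<Rightarrow> complex" where
  "hs h q \<xi> = h ((2 powi (- q)) *\<^sub>R \<xi>)"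

definition ps :: "(plane \<Rightarrow> complex) \<Rightarrow> int \<Rightarrow> plane \<Rightarrow> complex" where
  "ps h q \<xi> = hs h (q + 1) \<xi> - hs h q \<xi>"

text \<open>The symbol of a wide frequency band. Since \<open>hs h q\<close> is one only up to
  \<open>2 powr (q - 1)\<close> but vanishes beyond \<open>2 powr q\<close>, the shift by one at the
  upper end makes the symbol equal to one from \<open>2 powr (- N)\<close> to
  \<open>2 powr N\<close>.\<close>

definition ms :: "(plane \<Rightarrow> complex) \<Rightarrow> int \<Rightarrow> plane \<Rightarrow> complex" where
  "ms h N \<xi> = hs h (N + 1) \<xi> - hs h (- N) \<xi>"

lemma P_le_mop: "P_le h q u f = u (mop (hs h q) f)"
  by (simp add: P_le_def multiplier_dist_mop hs_def[abs_def])

lemma P_eq_mop: "P_eq h q u f = u (mop (hs h (q + 1)) f) - u (mop (hs h q) f)"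
  by (simp add: P_eq_def P_le_mop)

lemma powi_powr: "(2::real) powi q = 2 powr real_of_int q"
  by (simp add: powr_real_of_int')

context
  fixes h :: "plane \<Rightarrow> complex"
  assumes h: "LP_symbol h"
begin

lemma h_schwartz: "h \<in> schwartz"
proof (rule compact_support_schwartz[of h "cball 0 1"])
  show "smooth h" using h by (simp add: LP_symbol_def)
  show "h x = 0" if "x \<notin> cball 0 1" for x
    using h that by (intro zero_outside_supp) (auto simp: LP_symbol_def)
qed simp

lemma hs_one: "norm \<xi> \<le> 2 powr (real_of_int q - 1) \<Longrightarrow> hs h q \<xi> = 1"
proof -
  assume "norm \<xi> \<le> 2 powr (real_of_int q - 1)"
  then have "2 powr (- real_of_int q) * norm \<xi> \<le> 2 powr (- real_of_int q) * 2 powr (real_of_int q - 1)"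
    by (intro mult_left_mono) auto
  also have "\<dots> = 1 / 2" by (simp add: powr_diff powr_minus field_simps)
  finally have "norm ((2 powi (- q)) *\<^sub>R \<xi>) \<le> 1 / 2" by (simp add: powi_powr)
  then show ?thesis using h unfolding hs_def LP_symbol_def by blast
qed

lemma hs_zero: "2 powr real_of_int q < norm \<xi> \<Longrightarrow> hs h q \<xi> = 0"
proof -
  assume "2 powr real_of_int q < norm \<xi>"
  then have "2 powr (- real_of_int q) * 2 powr real_of_int q < 2 powr (- real_of_int q) * norm \<xi>"
    by (intro mult_strict_left_mono) auto
  then have "norm ((2 powi (- q)) *\<^sub>R \<xi>) > 1" by (simp add: powi_powr powr_add[symmetric])
  then have "(2 powi (- q)) *\<^sub>R \<xi> \<notin> supp h" using h by (auto simp: LP_symbol_def)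
  then show ?thesis unfolding hs_def by (rule zero_outside_supp)
qed

lemma hs_schwartz: "hs h q \<in> schwartz"
proof (rule compact_support_schwartz[of _ "cball 0 (2 powr real_of_int q)"])
  have "smooth (\<lambda>\<xi>. h (0 + (2 powi (- q)) *\<^sub>R \<xi>))"
    using h by (intro smooth_compose_affine bounded_linear_scaleR_right) (simp add: LP_symbol_def)
  then show "smooth (hs h q)" by (simp add: hs_def[abs_def])
qed (auto intro: hs_zero)

lemma ps_schwartz: "ps h q \<in> schwartz"
  unfolding ps_def[abs_def] by (intro schwartz_diff hs_schwartz)

lemma ms_schwartz: "ms h q \<in> schwartz"
  unfolding ms_def[abs_def] by (intro schwartz_diff hs_schwartz)

lemma kmass_hs: "kmass (hs h q) = kmass h"
  unfolding hs_def[abs_def] by (rule kmass_scale[OF h_schwartz]) simp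

lemma ps_zero_low: "norm \<xi> \<le> 2 powr (real_of_int q - 1) \<Longrightarrow> ps h q \<xi> = 0"
proof -
  assume *: "norm \<xi> \<le> 2 powr (real_of_int q - 1)"
  have "2 powr (real_of_int q - 1) \<le> 2 powr (real_of_int (q + 1) - 1)" by simp
  with * have "norm \<xi> \<le> 2 powr (real_of_int (q + 1) - 1)" by linarith
  then show ?thesis using * by (simp add: ps_def hs_one)
qed

lemma ps_zero_high: "2 powr (real_of_int q + 1) < norm \<xi> \<Longrightarrow> ps h q \<xi> = 0"
proof -
  assume *: "2 powr (real_of_int q + 1) < norm \<xi>"
  have "2 powr real_of_int q \<le> 2 powr (real_of_int q + 1)" by simp
  with * have "2 powr real_of_int q < norm \<xi>" by linarith
  then show ?thesis using * by (simp add: ps_def hs_zero)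
qed

lemma ms_one: "2 powr (- real_of_int N) < norm \<xi> \<Longrightarrow> norm \<xi> \<le> 2 powr real_of_int N \<Longrightarrow> ms h N \<xi> = 1"
  by (simp add: ms_def hs_one hs_zero)

lemma ms_zero_low: "0 \<le> N \<Longrightarrow> norm \<xi> \<le> 2 powr (- real_of_int N - 1) \<Longrightarrow> ms h N \<xi> = 0"
proof -
  assume N: "0 \<le> N" and *: "norm \<xi> \<le> 2 powr (- real_of_int N - 1)"
  have "2 powr (- real_of_int N - 1) \<le> 2 powr (real_of_int (N + 1) - 1)" using N by simp
  with * have "norm \<xi> \<le> 2 powr (real_of_int (N + 1) - 1)" by linarith
  then have "hs h (N + 1) \<xi> = 1" by (rule hs_one)
  moreover have "hs h (- N) \<xi> = 1" by (rule hs_one) (use * in simp)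
  ultimately show ?thesis by (simp add: ms_def)
qed

lemma ms_zero_high: "0 \<le> N \<Longrightarrow> 2 powr (real_of_int N + 1) < norm \<xi> \<Longrightarrow> ms h N \<xi> = 0"
proof -
  assume N: "0 \<le> N" and *: "2 powr (real_of_int N + 1) < norm \<xi>"
  have "2 powr real_of_int (- N) \<le> 2 powr (real_of_int N + 1)" using N by simp
  with * have "2 powr real_of_int (- N) < norm \<xi>" by linarith
  then have "hs h (- N) \<xi> = 0" by (rule hs_zero)
  moreover have "hs h (N + 1) \<xi> = 0" by (rule hs_zero) (use * in simp)
  ultimately show ?thesis by (simp add: ms_def)
qed

lemma ms_mult_ps:
  assumes "\<bar>j\<bar> < N" shows "ms h N \<xi> * ps h j \<xi> = ps h j \<xi>"
proof (cases "2 powr (real_of_int j - 1) < norm \<xi> \<and> norm \<xi> \<le> 2 powr (real_of_int j + 1)")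
  case True
  have j: "- N \<le> j - 1" "j + 1 \<le> N" using assms by auto
  have "2 powr (- real_of_int N) \<le> 2 powr (real_of_int j - 1)" using j(1) by simp
  moreover have "2 powr (real_of_int j + 1) \<le> 2 powr real_of_int N" using j(2) by simp
  ultimately have "2 powr (- real_of_int N) < norm \<xi>" "norm \<xi> \<le> 2 powr real_of_int N" using True by linarith+
  then show ?thesis by (simp add: ms_one)
next
  case False
  then show ?thesis using ps_zero_low ps_zero_high by force
qed

lemma ms_mult_ps_far:
  assumes "N + 2 < \<bar>j\<bar>" "0 \<le> N" shows "ms h N \<xi> * ps h j \<xi> = 0"
proof (cases "2 powr (real_of_int j - 1) < norm \<xi> \<and> norm \<xi> \<le> 2 powr (real_of_int j + 1)")
  case True
  show ?thesis
  proof (cases "j > 0")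
    case j: True
    have "N + 1 \<le> j - 1" using assms j by auto
    then have "2 powr (real_of_int N + 1) \<le> 2 powr (real_of_int j - 1)" by simp
    then have "2 powr (real_of_int N + 1) < norm \<xi>" using True by linarith
    then show ?thesis using assms by (simp add: ms_zero_high)
  next
    case j: False
    have "j + 1 \<le> - N - 1" using assms j by auto
    then have "2 powr (real_of_int j + 1) \<le> 2 powr (- real_of_int N - 1)" by simp
    then have "norm \<xi> \<le> 2 powr (- real_of_int N - 1)" using True by linarith
    then show ?thesis using assms by (simp add: ms_zero_low)
  qed
next
  case False
  then show ?thesis using ps_zero_low ps_zero_high by force
qed

text \<open>The wider band symbol is one wherever the narrower one is nonzero. This permits a second
  localisation that does not alter what was localised before.\<close>

lemma ms_mult_ms:
  assumes "0 \<le> N" shows "ms h N \<xi> * ms h (N + 1) \<xi> = ms h N \<xi>"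
proof (cases "2 powr (- real_of_int N - 1) < norm \<xi> \<and> norm \<xi> \<le> 2 powr (real_of_int N + 1)")
  case True
  then show ?thesis using ms_one[of "N + 1" \<xi>] by simp
next
  case False
  then show ?thesis using ms_zero_low[OF assms] ms_zero_high[OF assms] by force
qed

lemma P_eq_ps:
  assumes "linear_functional_on schwartz u" "f \<in> schwartz"
  shows "P_eq h q u f = u (mop (ps h q) f)"
  using mop_symbol_diff[OF hs_schwartz hs_schwartz assms(2), of "q + 1" q]
    linear_functional_diff[OF assms(1) mop_schwartz[OF hs_schwartz assms(2)] mop_schwartz[OF hs_schwartz assms(2)], of "q + 1" q]
  unfolding P_eq_mop ps_def[abs_def] by simp

end

section \<open>Elementary calculus of the homogeneous norm\<close>

lemma linear_of_function:
  assumes "\<And>f. f \<in> schwartz \<Longrightarrow> integrable lborel (\<lambda>x. g x * f x)"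
  shows "linear_functional_on schwartz (of_function g)"
  unfolding linear_functional_on_def of_function_def
proof (intro ballI allI)
  fix f k a b assume f: "f \<in> schwartz" "k \<in> schwartz"
  have "(LINT x|lborel. g x * (a * f x + b * k x)) = (LINT x|lborel. a * (g x * f x) + b * (g x * k x))"
    by (simp only: distrib_left mult.left_commute)
  also have "\<dots> = a * (LINT x|lborel. g x * f x) + b * (LINT x|lborel. g x * k x)"
    by (simp only: Bochner_Integration.integral_add[OF integrable_mult_right[OF assms[OF f(1)]] integrable_mult_right[OF assms[OF f(2)]]] integral_mult_right_zero)
  finally show "(LINT x|lborel. g x * (a * f x + b * k x)) = a * (LINT x|lborel. g x * f x) + b * (LINT x|lborel. g x * k x)" .
qed

lemma linear_of_schwartz: "g \<in> schwartz \<Longrightarrow> linear_functional_on schwartz (of_function g)"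
  by (intro linear_of_function schwartz_integrable schwartz_mult)

definition wt :: "real \<Rightarrow> int \<Rightarrow> ennreal" where
  "wt s q = (ennreal (2 powr (s * real_of_int q)))\<^sup>2"

lemma Hdot_norm_sq_nn: "Hdot_norm_sq h s u = (\<integral>\<^sup>+q. wt s q * L2_norm_sq (P_eq h q u) \<partial>count_space UNIV)"
  unfolding Hdot_norm_sq_def infsum_eq_nn_integral_count_space wt_def ..

lemma wt_pos: "0 < wt s q" and wt_fin: "wt s q < \<infinity>"
  by (simp_all add: wt_def ennreal_power)

lemma Hdot_norm_sq_diff: "Hdot_norm_sq h s (\<lambda>f. u f - v f) \<le> 2 * Hdot_norm_sq h s u + 2 * Hdot_norm_sq h s v"
proof -
  have "P_eq h q (\<lambda>f. u f - v f) = (\<lambda>f. P_eq h q u f - P_eq h q v f)" for q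
    by (rule ext) (simp add: P_eq_mop)
  then have "Hdot_norm_sq h s (\<lambda>f. u f - v f) \<le> (\<integral>\<^sup>+q. wt s q * (2 * L2_norm_sq (P_eq h q u) + 2 * L2_norm_sq (P_eq h q v)) \<partial>count_space UNIV)"
    unfolding Hdot_norm_sq_nn by (intro nn_integral_mono mult_left_mono) (auto simp: L2_norm_sq_diff)
  also have "\<dots> = (\<integral>\<^sup>+q. 2 * (wt s q * L2_norm_sq (P_eq h q u)) + 2 * (wt s q * L2_norm_sq (P_eq h q v)) \<partial>count_space UNIV)"
    by (simp add: distrib_left mult.left_commute)
  also have "\<dots> = 2 * Hdot_norm_sq h s u + 2 * Hdot_norm_sq h s v"
    unfolding Hdot_norm_sq_nn by (simp add: nn_integral_add nn_integral_cmult)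
  finally show ?thesis .
qed

lemma Hdot_norm_sq_cong:
  assumes "\<And>f. f \<in> schwartz \<Longrightarrow> u f = v f" "LP_symbol h"
  shows "Hdot_norm_sq h s u = Hdot_norm_sq h s v"
  unfolding Hdot_norm_sq_nn
proof (intro nn_integral_cong arg_cong2[where f = "(*)"] refl L2_norm_sq_cong)
  fix f q assume "f \<in> schwartz"
  then show "P_eq h q u f = P_eq h q v f"
    unfolding P_eq_mop using assms(1) mop_schwartz[OF hs_schwartz[OF assms(2)]] by simp
qed

lemma Hdot_norm_sq_swap:
  "Hdot_norm_sq h s (\<lambda>f. u f - v f) = Hdot_norm_sq h s (\<lambda>f. v f - u f)"
proof -
  have le: "L2_norm_sq (\<lambda>f. - w f) \<le> L2_norm_sq w" for w
  proof -
    have "represents (\<lambda>x. - g x) (\<lambda>f. - w f)" if "represents g w" for g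
      using that by (simp add: represents_def of_function_def)
    moreover have "l2 (\<lambda>x. - g x) = l2 g" for g by (simp add: l2_def)
    ultimately have "L2_norm_sq (\<lambda>f. - w f) \<le> l2 g" if "represents g w" for g
      using L2_norm_sq_le[of "\<lambda>x. - g x" "\<lambda>f. - w f"] that by simp
    then show ?thesis unfolding L2_norm_sq_def[of w] l2_def by (intro INF_greatest) auto
  qed
  have eq: "L2_norm_sq (\<lambda>f. - w f) = L2_norm_sq w" for w
    using le[of w] le[of "\<lambda>f. - w f"] by simp
  have "P_eq h q (\<lambda>f. u f - v f) = (\<lambda>f. - P_eq h q (\<lambda>f. v f - u f) f)" for q
    by (rule ext) (simp add: P_eq_mop)
  then show ?thesis unfolding Hdot_norm_sq_nn by (simp add: eq)
qed

lemma Hdot_L2_finite: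
  assumes "Hdot_norm_sq h s u < \<infinity>"
  shows "L2_norm_sq (P_eq h q u) < \<infinity>"
proof -
  have "wt s q * L2_norm_sq (P_eq h q u) = (\<integral>\<^sup>+j. wt s j * L2_norm_sq (P_eq h j u) \<partial>count_space {q})"
    by (simp add: nn_integral_count_space_finite)
  also have "\<dots> = (\<integral>\<^sup>+j. wt s j * L2_norm_sq (P_eq h j u) * indicator {q} j \<partial>count_space UNIV)"
    by (rule nn_integral_count_space_indicator) simp
  also have "\<dots> \<le> Hdot_norm_sq h s u"
    unfolding Hdot_norm_sq_nn by (intro nn_integral_mono) (auto simp: indicator_def)
  finally have "wt s q * L2_norm_sq (P_eq h q u) < \<infinity>" using assms by simp
  then show ?thesis using wt_pos[of s q] by (auto simp: ennreal_mult_less_top)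
qed

section \<open>Density of frequency-localised Schwartz functions\<close>

lemma represents_add:
  assumes "represents a u" "represents b v"
  shows "represents (\<lambda>x. a x + b x) (\<lambda>f. u f + v f)"
  using assms unfolding represents_def of_function_def
  by (auto simp: distrib_right)

lemma l2_minus: "l2 (\<lambda>x. - b x) = l2 b" by (simp add: l2_def)

lemma l2_add:
  assumes [measurable]: "a \<in> borel_measurable borel" "b \<in> borel_measurable borel"
  shows "l2 (\<lambda>x. a x + b x) \<le> 2 * l2 a + 2 * l2 b"
  using l2_diff[of a "\<lambda>x. - b x"] by (simp add: l2_minus)

text \<open>Multiplication by a coordinate keeps \<open>g\<close> integrable and supported in the
  same ball, so these transforms form an invariant under derivatives. No regularity of
  \<open>g\<close> enters, as required for sharply truncated functions.\<close>

lemma smooth_fourier_compact: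
  assumes "integrable lborel g" "\<And>x. r < norm x \<Longrightarrow> g x = 0"
  shows "smooth (fourier g)"
proof -
  let ?C = "\<lambda>h :: unit \<Rightarrow> plane \<Rightarrow> complex. \<exists>g. integrable lborel g \<and> (\<forall>x. r < norm x \<longrightarrow> g x = 0) \<and> h = (\<lambda>_. fourier g)"
  have mult_int: "integrable lborel (\<lambda>x. p x * g x)"
    if g: "integrable lborel g" "\<And>x. r < norm x \<Longrightarrow> g x = 0" and p: "p \<in> borel_measurable borel"
      and bound: "\<And>x. norm x \<le> r \<Longrightarrow> norm (p x) \<le> K" for g :: "plane \<Rightarrow> complex" and p :: "plane \<Rightarrow> complex" and K
  proof (rule Bochner_Integration.integrable_bound[OF integrable_mult_right[OF integrable_norm[OF g(1)], of K]])
    show "(\<lambda>x. p x * g x) \<in> borel_measurable lborel" using p integrable_borel[OF g(1)] by measurable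
    have "norm (p x * g x) \<le> norm (K * norm (g x))" for x
    proof (cases "norm x \<le> r")
      case True
      then have "norm (p x) \<le> \<bar>K\<bar>" using bound[OF True] by linarith
      then show ?thesis by (simp add: norm_mult abs_mult mult_right_mono)
    qed (use g(2)[of x] in simp)
    then show "AE x in lborel. norm (p x * g x) \<le> norm (K * norm (g x))" by simp
  qed
  have der: "(fourier g has_derivative (\<lambda>v. fourier (\<lambda>x. - \<i> * complex_of_real (x \<bullet> v) * g x) \<xi>)) (at \<xi>)"
    if g: "integrable lborel g" "\<And>x. r < norm x \<Longrightarrow> g x = 0" for g \<xi>
  proof (rule fourier_has_derivative[OF integrable_borel[OF g(1)]])
    have "integrable lborel (\<lambda>x. complex_of_real ((1 + norm x)\<^sup>2) * g x)"
      by (rule mult_int[OF g, where K = "(1 + r)\<^sup>2"]) (auto simp del: of_real_power simp: power_mono)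
    from integrable_norm[OF this] show "integrable lborel (\<lambda>x. (1 + norm x)\<^sup>2 * norm (g x))"
      by (simp add: norm_mult del: of_real_power of_real_add)
  qed
  have "dfam (\<lambda>_. True) (\<lambda>_::unit. fourier g)"
  proof (rule dfam_coinduct[of ?C])
    show "?C (\<lambda>_. fourier g)" using assms by (intro exI[of _ g]) simp
    fix h :: "unit \<Rightarrow> plane \<Rightarrow> complex" assume "?C h"
    then obtain g where g: "integrable lborel g" "\<And>x. r < norm x \<Longrightarrow> g x = 0" and h: "h = (\<lambda>_. fourier g)" by metis
    show "h i differentiable at x" for i x unfolding h by (rule differentiableI[OF der[OF g]])
    fix b :: plane
    have "(\<lambda>i. dir_deriv b (h i)) = (\<lambda>_. fourier (\<lambda>x. - \<i> * complex_of_real (x \<bullet> b) * g x))"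
      unfolding h by (intro ext dir_deriv_eq[OF der[OF g]])
    moreover have "integrable lborel (\<lambda>x. - \<i> * complex_of_real (x \<bullet> b) * g x)"
    proof (rule mult_int[OF g, where K = "r * norm b"])
      fix x :: plane assume "norm x \<le> r"
      then have "norm x * norm b \<le> r * norm b" by (rule mult_right_mono) simp
      then show "norm (- \<i> * complex_of_real (x \<bullet> b)) \<le> r * norm b"
        using Cauchy_Schwarz_ineq2[of x b] by (simp add: norm_mult)
    qed measurable
    ultimately show "add_closure ?C (\<lambda>i. dir_deriv b (h i))"
      by (intro add_closure.base exI[of _ "\<lambda>x. - \<i> * complex_of_real (x \<bullet> b) * g x"] conjI) (auto simp: g(2))
  qed auto
  then show ?thesis by (simp add: smooth_iff_dfam)
qed

lemma supp_mono:
  assumes "closed K" "\<And>x. f x \<noteq> 0 \<Longrightarrow> x \<in> K" shows "supp f \<subseteq> K"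
  by (rule supp_subset[OF assms(1)]) (use assms(2) in blast)

lemma schwartz0I:
  assumes g: "g \<in> schwartz" and r: "0 < r" and supp: "\<And>\<xi>. g \<xi> \<noteq> 0 \<Longrightarrow> r \<le> norm \<xi> \<and> norm \<xi> \<le> R"
  shows "inv_fourier g \<in> schwartz0"
proof -
  have F: "fourier (inv_fourier g) = g" by (rule ext) (rule fourier_inv_fourier[OF g])
  have K: "compact (cball 0 R - ball (0::plane) r)" by (intro compact_diff) auto
  have "supp g \<subseteq> cball 0 R - ball 0 r"
    by (rule supp_mono[OF compact_imp_closed[OF K]]) (use supp in \<open>force simp: dist_norm\<close>)
  moreover from this have "compact (supp g)"
    using compact_Int_closed[OF K closed_supp[of g]] by (simp add: Int_absorb1)
  ultimately show ?thesis
    using r schwartz_inv_fourier[OF g] by (auto simp: schwartz0_def F)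
qed

context
  fixes h :: "plane \<Rightarrow> complex" and s :: real
  assumes h: "LP_symbol h"
begin

text \<open>A band of frequencies is a finite telescoping sum of pieces \<open>P_eq\<close>, each
  represented by a square integrable function; \<open>k\<close> counts the pieces above the lowest
  level \<open>a\<close>.\<close>

lemma represents_partial_sum:
  fixes k :: nat
  assumes u: "linear_functional_on schwartz u" and fin: "\<And>q. L2_norm_sq (P_eq h q u) < \<infinity>"
  shows "\<exists>G. represents G (\<lambda>f. u (mop (\<lambda>\<xi>. hs h (a + int k) \<xi> - hs h a \<xi>) f)) \<and> l2 G < \<infinity>"
proof (induction k)
  case 0
  have "represents (\<lambda>x. 0) (\<lambda>f. u (\<lambda>x. 0))"
    using linear_functional_zero[OF u hs_schwartz[OF h]] by (simp add: represents_def of_function_def)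
  then show ?case by (intro exI[of _ "\<lambda>x. 0"]) (simp add: l2_def)
next
  case (Suc k)
  then obtain G where G: "represents G (\<lambda>f. u (mop (\<lambda>\<xi>. hs h (a + int k) \<xi> - hs h a \<xi>) f))" "l2 G < \<infinity>" by metis
  obtain G' where G': "represents G' (P_eq h (a + int k) u)" "l2 G' < \<infinity>"
    using L2_norm_sq_lessD[OF fin] by metis
  have "u (mop (\<lambda>\<xi>. hs h (a + int k) \<xi> - hs h a \<xi>) f) + P_eq h (a + int k) u f = u (mop (\<lambda>\<xi>. hs h (a + int (Suc k)) \<xi> - hs h a \<xi>) f)"
    if f: "f \<in> schwartz" for f
  proof -
    note m = mop_schwartz[OF hs_schwartz[OF h] f]
    have e: "u (mop (\<lambda>\<xi>. hs h p \<xi> - hs h q \<xi>) f) = u (mop (hs h p) f) - u (mop (hs h q) f)" for p q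
      unfolding mop_symbol_diff[OF hs_schwartz[OF h] hs_schwartz[OF h] f] by (rule linear_functional_diff[OF u m m])
    show ?thesis unfolding e P_eq_mop by (simp add: add_ac)
  qed
  then have "represents (\<lambda>x. G x + G' x) (\<lambda>f. u (mop (\<lambda>\<xi>. hs h (a + int (Suc k)) \<xi> - hs h a \<xi>) f))"
    using represents_add[OF G(1) G'(1)]
      represents_cong[of "\<lambda>f. u (mop (\<lambda>\<xi>. hs h (a + int k) \<xi> - hs h a \<xi>) f) + P_eq h (a + int k) u f"
        "\<lambda>f. u (mop (\<lambda>\<xi>. hs h (a + int (Suc k)) \<xi> - hs h a \<xi>) f)"] by simp
  moreover have "l2 (\<lambda>x. G x + G' x) < \<infinity>"
    using l2_add[OF represents_borel[OF G(1)] represents_borel[OF G'(1)]] G(2) G'(2)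
    by (auto simp: ennreal_mult_less_top elim!: order.strict_trans1)
  ultimately show ?case by metis
qed

text \<open>A spatial cutoff turns a square integrable function into an integrable one, whose
  Fourier transform is given by the integral, at arbitrarily small cost in norm.\<close>

lemma l2_truncation:
  assumes G: "G \<in> borel_measurable borel" "l2 G < \<infinity>"
  defines "Gn \<equiv> \<lambda>n x. if norm x \<le> real n then G x else 0"
  shows "(\<lambda>n. l2 (\<lambda>x. Gn n x - G x)) \<longlonglongrightarrow> 0"
    and "integrable lborel (Gn n)"
proof -
  note [measurable] = G(1)
  have Gm [measurable]: "Gn n \<in> borel_measurable borel" for n unfolding Gn_def by measurable
  have "(\<lambda>n. \<integral>\<^sup>+x. ennreal ((norm (Gn n x - G x))\<^sup>2) \<partial>lborel) \<longlonglongrightarrow> (\<integral>\<^sup>+(x::plane). 0 \<partial>lborel)"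
  proof (rule nn_integral_dominated_convergence[where w = "\<lambda>x. ennreal ((norm (G x))\<^sup>2)"])
    show "AE x in lborel. ennreal ((norm (Gn n x - G x))\<^sup>2) \<le> ennreal ((norm (G x))\<^sup>2)" for n
      by (intro AE_I2) (auto simp: Gn_def)
    show "(\<integral>\<^sup>+x. ennreal ((norm (G x))\<^sup>2) \<partial>lborel) < \<infinity>" using G(2) by (simp add: l2_def)
    show "AE x in lborel. (\<lambda>n. ennreal ((norm (Gn n x - G x))\<^sup>2)) \<longlonglongrightarrow> 0"
    proof (intro AE_I2 tendsto_eventually)
      fix x :: plane
      obtain m :: nat where "norm x \<le> real m" using real_arch_simple by metis
      then show "eventually (\<lambda>n. ennreal ((norm (Gn n x - G x))\<^sup>2) = 0) sequentially"
        by (intro eventually_sequentiallyI[of m]) (simp add: Gn_def)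
    qed
  qed measurable
  then show "(\<lambda>n. l2 (\<lambda>x. Gn n x - G x)) \<longlonglongrightarrow> 0" by (simp add: l2_def)
  show "integrable lborel (Gn n)"
  proof (rule integrableI_bounded)
    have [measurable]: "cball (0::plane) (real n) \<in> sets borel" by (intro borel_closed) simp
    have "ennreal (norm (Gn n x)) \<le> ennreal ((norm (G x))\<^sup>2) + indicator (cball 0 (real n)) x" for x
    proof (cases "norm x \<le> real n")
      case True
      have "norm (G x) \<le> (norm (G x))\<^sup>2 + 1"
        using sum_squares_bound[of "norm (G x)" 1] norm_ge_zero[of "G x"] by (smt (verit) mult_1_right one_power2)
      then have "ennreal (norm (G x)) \<le> ennreal ((norm (G x))\<^sup>2 + 1)" by (rule ennreal_leI)
      then show ?thesis using True by (simp add: Gn_def)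
    qed (simp add: Gn_def)
    then have "(\<integral>\<^sup>+x. ennreal (norm (Gn n x)) \<partial>lborel) \<le> (\<integral>\<^sup>+x. ennreal ((norm (G x))\<^sup>2) + indicator (cball 0 (real n)) x \<partial>lborel)"
      by (intro nn_integral_mono)
    also have "\<dots> = l2 G + emeasure lborel (cball (0::plane) (real n))"
      unfolding l2_def by (subst nn_integral_add) simp_all
    also have "\<dots> < \<infinity>" using G(2) emeasure_bounded_finite[of "cball (0::plane) (real n)"] by (simp add: less_top)
    finally show "(\<integral>\<^sup>+x. ennreal (norm (Gn n x)) \<partial>lborel) < \<infinity>" .
  qed measurable
qed

definition tail :: "functional \<Rightarrow> nat \<Rightarrow> ennreal" where
  "tail u N = (\<integral>\<^sup>+q. (if \<bar>q\<bar> < int N then 0 else wt s q * L2_norm_sq (P_eq h q u)) \<partial>count_space UNIV)"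

lemma tail_tendsto:
  assumes "Hdot_norm_sq h s u < \<infinity>" shows "tail u \<longlonglongrightarrow> 0"
proof -
  have "(\<lambda>N. \<integral>\<^sup>+q. (if \<bar>q\<bar> < int N then 0 else wt s q * L2_norm_sq (P_eq h q u)) \<partial>count_space UNIV) \<longlonglongrightarrow> (\<integral>\<^sup>+(q::int). 0 \<partial>count_space UNIV)"
  proof (rule nn_integral_dominated_convergence[where w = "\<lambda>q. wt s q * L2_norm_sq (P_eq h q u)"])
    show "AE q in count_space UNIV. (\<lambda>N. if \<bar>q\<bar> < int N then 0 else wt s q * L2_norm_sq (P_eq h q u)) \<longlonglongrightarrow> 0"
    proof (intro AE_I2 tendsto_eventually)
      fix q :: int
      show "eventually (\<lambda>N. (if \<bar>q\<bar> < int N then 0 else wt s q * L2_norm_sq (P_eq h q u)) = 0) sequentially"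
        by (intro eventually_sequentiallyI[of "Suc (nat \<bar>q\<bar>)"]) simp
    qed
  qed (use assms in \<open>auto simp: Hdot_norm_sq_nn\<close>)
  then show ?thesis by (simp add: tail_def[abs_def])
qed

text \<open>The approximant arises in four moves: restrict \<open>u\<close> to the band
  \<open>ms h N\<close>, which gives a function \<open>G\<close>; cut \<open>G\<close> off in space;
  take the Fourier transform, which is now smooth; cut off in frequency by the next wider band,
  which lands in \<open>schwartz0\<close>. The error consists of the frequency tail of
  \<open>u\<close> and of the spatial truncation, which reaches only finitely many annuli. In the
  constant, the outer 2 splits these two errors, and \<open>2 + 16 * \<kappa>\<close> comes from
  comparing a piece with its band-limited version, where \<open>ms\<close> consists of two cutoffs
  of operator bound \<open>2 * \<kappa>\<close>.\<close>

lemma approx_step: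
  assumes u: "linear_functional_on schwartz u" and fin: "Hdot_norm_sq h s u < \<infinity>" and e: "0 < e"
  shows "\<exists>f\<in>schwartz0. Hdot_norm_sq h s (\<lambda>g. of_function f g - u g)
     \<le> ennreal (2 * (2 + 16 * ((kmass h)\<^sup>2 + 1))) * tail u N + ennreal e"
proof -
  define \<kappa> where "\<kappa> = (kmass h)\<^sup>2 + 1"
  have \<kappa>: "0 < \<kappa>" "(kmass h)\<^sup>2 \<le> \<kappa>" unfolding \<kappa>_def by (simp_all add: add_nonneg_pos)
  let ?N = "int N" and ?M = "int N + 1"
  note L2f = Hdot_L2_finite[OF fin]
  have msN: "(\<lambda>\<xi>. hs h (- ?N + int (2 * N + 1)) \<xi> - hs h (- ?N) \<xi>) = ms h ?N"
    by (rule ext) (simp add: ms_def add.commute)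
  obtain G where G: "represents G (\<lambda>f. u (mop (ms h ?N) f))" "l2 G < \<infinity>"
    using represents_partial_sum[OF u L2f, of "- ?N" "2 * N + 1"] unfolding msN by metis
  note Gm [measurable] = represents_borel[OF G(1)]
  define Gn where "Gn = (\<lambda>(n::nat) x. if norm x \<le> real n then G x else 0)"
  let ?L = "\<lambda>n. l2 (\<lambda>x. Gn n x - G x)"
  have trunc: "(\<lambda>n. ?L n) \<longlonglongrightarrow> 0" "integrable lborel (Gn n)" for n
    unfolding Gn_def by (rule l2_truncation[OF Gm G(2)])+
  have Gnm [measurable]: "Gn n \<in> borel_measurable borel" for n by (intro integrable_borel trunc(2))
  note S = ms_schwartz[OF h] ps_schwartz[OF h] hs_schwartz[OF h]
  define m\<^sub>j where "m\<^sub>j j \<xi> = ms h ?M \<xi> * ps h j \<xi>" for j \<xi>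
  have mjS: "m\<^sub>j j \<in> schwartz" for j unfolding m\<^sub>j_def[abs_def] by (intro schwartz_mult S)
  \<comment> \<open>Beyond \<open>?M + 2\<close> the annulus misses the band and the piece is zero;
    thus \<open>c\<close> has finite support and the weighted sum \<open>A\<close> is
    finite.\<close>
  define c where "c j = (if ?M + 2 < \<bar>j\<bar> then 0 else 2 * ((kmass (m\<^sub>j j))\<^sup>2 + 1))" for j
  define A where "A = (\<integral>\<^sup>+j. wt s j * ennreal (c j) \<partial>count_space UNIV)"
  have Afin: "A < \<infinity>"
  proof -
    have "A = (\<Sum>j\<in>{-(?M + 2)..?M + 2}. wt s j * ennreal (c j))"
      unfolding A_def by (rule nn_integral_count_space') (auto simp: c_def)
    also have "\<dots> < \<infinity>" using wt_fin by (auto simp: ennreal_mult_less_top)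
    finally show ?thesis .
  qed
  have "(\<lambda>n. (2 * A) * ?L n) \<longlonglongrightarrow> (2 * A) * 0"
    using Afin by (intro ennreal_tendsto_cmult trunc(1)) (auto simp: ennreal_mult_less_top)
  then have "eventually (\<lambda>n. (2 * A) * ?L n < ennreal e) sequentially"
    using e by (intro order_tendstoD(2)) auto
  \<comment> \<open>\<open>A\<close> does not depend on the spatial truncation, so the radius
    \<open>n\<close> may be chosen after it.\<close>
  then obtain n where n: "(2 * A) * ?L n < ennreal e"
    using eventually_happens[of _ sequentially] by auto
  define g where "g \<xi> = ms h ?M \<xi> * fourier (Gn n) \<xi>" for \<xi>
  have g0: "2 powr (- real_of_int ?M - 1) \<le> norm \<xi> \<and> norm \<xi> \<le> 2 powr (real_of_int ?M + 1)" if "g \<xi> \<noteq> 0" for \<xi>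
    using that ms_zero_low[OF h, of ?M \<xi>] ms_zero_high[OF h, of ?M \<xi>] unfolding g_def by force
  have gS: "g \<in> schwartz"
  proof (rule compact_support_schwartz[of _ "cball 0 (2 powr (real_of_int ?M + 1))"])
    show "smooth g" unfolding g_def[abs_def]
      by (rule smooth_mult[OF schwartz_smooth[OF S(1)] smooth_fourier_compact[OF trunc(2), of "real n"]]) (simp add: Gn_def)
    show "g x = 0" if "x \<notin> cball 0 (2 powr (real_of_int ?M + 1))" for x using that g0[of x] by auto
  qed simp
  define f where "f = inv_fourier g"
  have f0: "f \<in> schwartz0" unfolding f_def by (rule schwartz0I[OF gS _ g0]) simp_all
  have off: "of_function f k = (LINT x|lborel. Gn n x * mop (ms h ?M) k x)" if k: "k \<in> schwartz" for k
  proof -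
    have "of_function f k = (LINT \<xi>|lborel. g \<xi> * inv_fourier k \<xi>)"
      unfolding of_function_def f_def by (intro inv_fourier_transfer schwartz_integrable gS k)
    also have "\<dots> = (LINT \<xi>|lborel. fourier (Gn n) \<xi> * (ms h ?M \<xi> * inv_fourier k \<xi>))"
      unfolding g_def by (simp only: mult_ac)
    also have "\<dots> = (LINT x|lborel. Gn n x * mop (ms h ?M) k x)"
      unfolding mop_def by (rule fourier_transfer[OF trunc(2) schwartz_integrable[OF schwartz_mult[OF S(1) schwartz_inv_fourier[OF k]]]])
    finally show ?thesis .
  qed
  define r where "r = (\<lambda>k. LINT x|lborel. (Gn n x - G x) * k x)"
  have Gint: "integrable lborel (\<lambda>x. G x * k x)" if "k \<in> schwartz" for k
    using G(1) that by (simp add: represents_def)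
  have Gnint: "integrable lborel (\<lambda>x. Gn n x * k x)" if "k \<in> schwartz" for k
  proof (rule Bochner_Integration.integrable_bound[OF Gint[OF that]])
    have [measurable]: "k \<in> borel_measurable borel" by (rule schwartz_borel[OF that])
    show "(\<lambda>x. Gn n x * k x) \<in> borel_measurable lborel" by measurable
  qed (auto simp: Gn_def)
  have rr: "represents (\<lambda>x. Gn n x - G x) r"
    unfolding represents_def r_def of_function_def using Gint Gnint by (simp add: left_diff_distrib)
  have r_eq: "r k = (LINT x|lborel. Gn n x * k x) - u (mop (ms h ?N) k)" if "k \<in> schwartz" for k
    using G(1) that Gint[OF that] Gnint[OF that] by (simp add: r_def represents_def of_function_def left_diff_distrib)
  let ?d = "\<lambda>k. of_function f k - u k"
  have lin_d: "linear_functional_on schwartz ?d"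
  proof -
    have "f \<in> schwartz" using f0 by (simp add: schwartz0_def)
    from linear_of_schwartz[OF this] u show ?thesis
      unfolding linear_functional_on_def by (auto simp: algebra_simps)
  qed
  \<comment> \<open>By \<open>ms_mult_ms\<close> the second frequency cutoff leaves the contribution
    of \<open>u\<close> unchanged and acts only on the truncation error \<open>r\<close>. What
    remains of \<open>u\<close> is the difference between a piece and its band-limited
    version.\<close>
  have Pd: "P_eq h j ?d k = r (mop (m\<^sub>j j) k) - (P_eq h j u k - P_eq h j u (mop (ms h ?N) k))"
    if k: "k \<in> schwartz" for j k
  proof -
    have e1: "mop (ms h ?M) (mop (ps h j) k) = mop (m\<^sub>j j) k"
      unfolding m\<^sub>j_def by (rule mop_mop[OF S(1) S(2) k])
    have e2: "mop (ms h ?N) (mop (m\<^sub>j j) k) = mop (ps h j) (mop (ms h ?N) k)"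
    proof -
      have "ms h ?N \<xi> * ms h ?M \<xi> = ms h ?N \<xi>" for \<xi> by (rule ms_mult_ms[OF h]) simp
      then have "(\<lambda>\<xi>. ms h ?N \<xi> * m\<^sub>j j \<xi>) = (\<lambda>\<xi>. ps h j \<xi> * ms h ?N \<xi>)"
        unfolding m\<^sub>j_def mult.assoc[symmetric] by (simp only: mult.commute)
      then show ?thesis unfolding mop_mop[OF S(1) mjS k] mop_mop[OF S(2) S(1) k] by simp
    qed
    have "P_eq h j ?d k = ?d (mop (ps h j) k)" by (rule P_eq_ps[OF h lin_d k])
    also have "\<dots> = r (mop (m\<^sub>j j) k) + u (mop (ms h ?N) (mop (m\<^sub>j j) k)) - u (mop (ps h j) k)"
      unfolding off[OF mop_schwartz[OF S(2) k]] e1 r_eq[OF mop_schwartz[OF mjS k]] by simp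
    finally show ?thesis unfolding e2 P_eq_ps[OF h u k] P_eq_ps[OF h u mop_schwartz[OF S(1) k]] by simp
  qed
  have D1: "L2_norm_sq (\<lambda>k. r (mop (m\<^sub>j j) k)) \<le> ennreal (c j) * ?L n" for j
  proof (cases "?M + 2 < \<bar>j\<bar>")
    case True
    have "m\<^sub>j j = (\<lambda>\<xi>. 0)" unfolding m\<^sub>j_def[abs_def] using ms_mult_ps_far[OF h True] by auto
    then have "L2_norm_sq (\<lambda>k. r (mop (m\<^sub>j j) k)) = 0"
      by (intro L2_norm_sq_zero) (simp add: r_def)
    then show ?thesis by simp
  next
    case False
    have "L2_norm_sq (\<lambda>k. r (mop (m\<^sub>j j) k)) \<le> ennreal (2 * ((kmass (m\<^sub>j j))\<^sup>2 + 1)) * L2_norm_sq r"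
      by (rule L2_norm_sq_mop[OF mjS]) (auto simp: add_nonneg_pos)
    also have "\<dots> \<le> ennreal (c j) * ?L n"
      using False by (auto simp: c_def intro!: mult_left_mono L2_norm_sq_le[OF rr])
    finally show ?thesis .
  qed
  have D2: "L2_norm_sq (\<lambda>k. P_eq h j u k - P_eq h j u (mop (ms h ?N) k)) \<le> (if \<bar>j\<bar> < int N then 0 else ennreal (2 + 16 * \<kappa>) * L2_norm_sq (P_eq h j u))" for j
  proof (cases "\<bar>j\<bar> < int N")
    case True
    have "(\<lambda>\<xi>. ps h j \<xi> * ms h ?N \<xi>) = ps h j"
      by (rule ext) (simp only: mult.commute[of "ps h j _"] ms_mult_ps[OF h True])
    then have "P_eq h j u (mop (ms h ?N) k) = P_eq h j u k" if "k \<in> schwartz" for k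
      unfolding P_eq_ps[OF h u that] P_eq_ps[OF h u mop_schwartz[OF S(1) that]] mop_mop[OF S(2) S(1) that] by simp
    then have "L2_norm_sq (\<lambda>k. P_eq h j u k - P_eq h j u (mop (ms h ?N) k)) = 0"
      by (intro L2_norm_sq_zero) simp
    then show ?thesis by simp
  next
    case False
    let ?w = "P_eq h j u"
    have w_lin: "linear_functional_on schwartz ?w"
      unfolding linear_functional_on_def
    proof (intro ballI allI)
      fix f k a b assume fk: "f \<in> schwartz" "k \<in> schwartz"
      show "P_eq h j u (\<lambda>x. a * f x + b * k x) = a * P_eq h j u f + b * P_eq h j u k"
        using u mop_schwartz[OF S(2) fk(1), of j] mop_schwartz[OF S(2) fk(2), of j]
        unfolding P_eq_ps[OF h u fk(1)] P_eq_ps[OF h u fk(2)]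
          P_eq_ps[OF h u schwartz_add[OF schwartz_cmult[OF fk(1)] schwartz_cmult[OF fk(2)]]] mop_linear[OF S(2) fk]
        by (simp add: linear_functional_on_def)
    qed
    have hsb: "L2_norm_sq (\<lambda>k. ?w (mop (hs h q) k)) \<le> ennreal (2 * \<kappa>) * L2_norm_sq ?w" for q
      by (rule L2_norm_sq_mop[OF S(3)]) (use \<kappa> kmass_hs[OF h] in auto)
    have "?w (mop (ms h ?N) k) = ?w (mop (hs h (?N + 1)) k) - ?w (mop (hs h (- ?N)) k)" if k: "k \<in> schwartz" for k
      unfolding ms_def[abs_def] mop_symbol_diff[OF S(3) S(3) k]
      by (rule linear_functional_diff[OF w_lin mop_schwartz[OF S(3) k] mop_schwartz[OF S(3) k]])
    then have "L2_norm_sq (\<lambda>k. ?w (mop (ms h ?N) k)) = L2_norm_sq (\<lambda>k. ?w (mop (hs h (?N + 1)) k) - ?w (mop (hs h (- ?N)) k))"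
      by (rule L2_norm_sq_cong)
    also have "\<dots> \<le> 2 * L2_norm_sq (\<lambda>k. ?w (mop (hs h (?N + 1)) k)) + 2 * L2_norm_sq (\<lambda>k. ?w (mop (hs h (- ?N)) k))"
      by (rule L2_norm_sq_diff)
    also have "\<dots> \<le> 2 * (ennreal (2 * \<kappa>) * L2_norm_sq ?w) + 2 * (ennreal (2 * \<kappa>) * L2_norm_sq ?w)"
      by (intro add_mono mult_left_mono hsb) auto
    finally have b: "L2_norm_sq (\<lambda>k. ?w (mop (ms h ?N) k)) \<le> 4 * (ennreal (2 * \<kappa>) * L2_norm_sq ?w)"
      by (simp add: distrib_right[symmetric])
    have "L2_norm_sq (\<lambda>k. ?w k - ?w (mop (ms h ?N) k)) \<le> 2 * L2_norm_sq ?w + 2 * (4 * (ennreal (2 * \<kappa>) * L2_norm_sq ?w))"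
      by (rule order_trans[OF L2_norm_sq_diff]) (intro add_mono mult_left_mono b order_refl zero_le)
    also have "\<dots> = ennreal (2 + 16 * \<kappa>) * L2_norm_sq ?w"
      using \<kappa>(1) by (simp add: ennreal_mult distrib_right mult.assoc)
    finally show ?thesis using False by simp
  qed
  have "Hdot_norm_sq h s ?d \<le> (\<integral>\<^sup>+j. (2 * ?L n) * (wt s j * ennreal (c j)) +
      ennreal (2 * (2 + 16 * \<kappa>)) * (if \<bar>j\<bar> < int N then 0 else wt s j * L2_norm_sq (P_eq h j u)) \<partial>count_space UNIV)"
    unfolding Hdot_norm_sq_nn
  proof (intro nn_integral_mono)
    fix j :: int
    have "L2_norm_sq (P_eq h j ?d) = L2_norm_sq (\<lambda>k. r (mop (m\<^sub>j j) k) - (P_eq h j u k - P_eq h j u (mop (ms h ?N) k)))"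
      by (intro L2_norm_sq_cong Pd)
    also have "\<dots> \<le> 2 * L2_norm_sq (\<lambda>k. r (mop (m\<^sub>j j) k)) + 2 * L2_norm_sq (\<lambda>k. P_eq h j u k - P_eq h j u (mop (ms h ?N) k))"
      by (rule L2_norm_sq_diff)
    also have "\<dots> \<le> 2 * (ennreal (c j) * ?L n) + 2 * (if \<bar>j\<bar> < int N then 0 else ennreal (2 + 16 * \<kappa>) * L2_norm_sq (P_eq h j u))"
      by (intro add_mono mult_left_mono D1 D2) auto
    finally have "wt s j * L2_norm_sq (P_eq h j ?d) \<le> wt s j * (2 * (ennreal (c j) * ?L n) + 2 * (if \<bar>j\<bar> < int N then 0 else ennreal (2 + 16 * \<kappa>) * L2_norm_sq (P_eq h j u)))"
      by (rule mult_left_mono) simp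
    also have "\<dots> = (2 * ?L n) * (wt s j * ennreal (c j)) + ennreal (2 * (2 + 16 * \<kappa>)) * (if \<bar>j\<bar> < int N then 0 else wt s j * L2_norm_sq (P_eq h j u))"
    proof -
      have "ennreal (2 * (2 + 16 * \<kappa>)) = 2 * ennreal (2 + 16 * \<kappa>)" using \<kappa>(1) by (subst ennreal_mult) auto
      then show ?thesis by (simp add: distrib_left mult_ac)
    qed
    finally show "wt s j * L2_norm_sq (P_eq h j ?d) \<le> (2 * ?L n) * (wt s j * ennreal (c j)) +
      ennreal (2 * (2 + 16 * \<kappa>)) * (if \<bar>j\<bar> < int N then 0 else wt s j * L2_norm_sq (P_eq h j u))" .
  qed
  also have "\<dots> = (2 * ?L n) * A + ennreal (2 * (2 + 16 * \<kappa>)) * tail u N"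
    unfolding A_def tail_def by (simp add: nn_integral_add nn_integral_cmult)
  also have "\<dots> \<le> ennreal (2 * (2 + 16 * \<kappa>)) * tail u N + ennreal e"
    using n by (subst add.commute) (intro add_left_mono less_imp_le, simp add: mult_ac)
  finally show ?thesis using f0 unfolding \<kappa>_def by blast
qed

lemma schwartz0_dense:
  assumes u: "linear_functional_on schwartz u" and fin: "Hdot_norm_sq h s u < \<infinity>"
  shows "\<exists>f. (\<forall>n. f n \<in> schwartz0) \<and> tendsto_Hdot h s (\<lambda>n. of_function (f n)) u"
proof -
  define C where "C = ennreal (2 * (2 + 16 * ((kmass h)\<^sup>2 + 1)))"
  have "\<forall>N. \<exists>f\<in>schwartz0. Hdot_norm_sq h s (\<lambda>g. of_function f g - u g) \<le> C * tail u N + ennreal (1 / real (Suc N))"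
    unfolding C_def by (intro allI approx_step[OF u fin]) simp
  then obtain f where f: "\<And>N. f N \<in> schwartz0" "\<And>N. Hdot_norm_sq h s (\<lambda>g. of_function (f N) g - u g) \<le> C * tail u N + ennreal (1 / real (Suc N))"
    by metis
  have "(\<lambda>N. C * tail u N + ennreal (1 / real (Suc N))) \<longlonglongrightarrow> C * 0 + ennreal 0"
    by (intro tendsto_add ennreal_tendsto_cmult tail_tendsto[OF fin] tendsto_ennrealI LIMSEQ_Suc[OF lim_1_over_n]) (simp add: C_def)
  then have lim: "(\<lambda>N. C * tail u N + ennreal (1 / real (Suc N))) \<longlonglongrightarrow> 0" by simp
  have "(\<lambda>N. Hdot_norm_sq h s (\<lambda>g. of_function (f N) g - u g)) \<longlonglongrightarrow> 0"
    by (rule tendsto_sandwich[OF always_eventually always_eventually tendsto_const lim]) (intro allI zero_le f(2))+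
  then show ?thesis using f(1) unfolding tendsto_Hdot_def by blast
qed

end

section \<open>The nonlinearity on the Fourier side\<close>

text \<open>Minus the determinant of the two frequencies. The sign combines \<open>eps\<close>, the
  minus sign in \<open>velocity\<close> and the two factors \<i> of the derivatives.\<close>

definition cross2 :: "plane \<Rightarrow> plane \<Rightarrow> real" where
  "cross2 \<xi> \<eta> = \<xi> $ 2 * \<eta> $ 1 - \<xi> $ 1 * \<eta> $ 2"

text \<open>Symbol of the quadratic form, symmetrised in the two frequencies. The symmetrisation gains
  the second factor of the total frequency \<open>\<xi> + \<eta>\<close>.\<close>

definition kap :: "real \<Rightarrow> plane \<Rightarrow> plane \<Rightarrow> real" where
  "kap \<sigma> \<xi> \<eta> = cross2 \<xi> \<eta> * (norm \<xi> powr (2 * \<sigma>) - norm \<eta> powr (2 * \<sigma>)) / 2"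

lemma borel_measurable_vec_nth_plane [measurable]: "(\<lambda>x::plane. x $ i) \<in> borel_measurable borel"
  by (intro borel_measurable_continuous_onI continuous_intros)

lemma cross2_borel [measurable]:
  "(\<lambda>p. cross2 (fst p) (snd p)) \<in> borel_measurable (borel \<Otimes>\<^sub>M borel)"
  unfolding cross2_def by measurable

lemma kap_borel [measurable]:
  "(\<lambda>p. kap \<sigma> (fst p) (snd p)) \<in> borel_measurable (borel \<Otimes>\<^sub>M borel)"
  unfolding kap_def by measurable

lemma kap_commute: "kap \<sigma> \<xi> \<eta> = kap \<sigma> \<eta> \<xi>"
  by (simp add: kap_def cross2_def algebra_simps)

lemma norm_plane: "(norm (x::plane))\<^sup>2 = (x $ 1)\<^sup>2 + (x $ 2)\<^sup>2"
  unfolding power2_norm_eq_inner inner_vec_def sum_2 by (simp add: power2_eq_square)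

lemma abs_cross2_le: "\<bar>cross2 \<xi> \<eta>\<bar> \<le> norm \<xi> * norm \<eta>"
proof -
  have "(cross2 \<xi> \<eta>)\<^sup>2 + (\<xi> $ 1 * \<eta> $ 1 + \<xi> $ 2 * \<eta> $ 2)\<^sup>2 = (norm \<xi>)\<^sup>2 * (norm \<eta>)\<^sup>2"
    unfolding norm_plane cross2_def by (simp add: power2_eq_square algebra_simps)
  then have "(cross2 \<xi> \<eta>)\<^sup>2 \<le> (norm \<xi> * norm \<eta>)\<^sup>2"
    unfolding power_mult_distrib using zero_le_power2[of "\<xi> $ 1 * \<eta> $ 1 + \<xi> $ 2 * \<eta> $ 2"] by linarith
  then show ?thesis by (metis abs_le_square_iff abs_of_nonneg mult_nonneg_nonneg norm_ge_zero)
qed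

text \<open>By homogeneity only the ratio \<open>r = y / x\<close> matters, and it is at least 1.
  The claim becomes \<open>r powr (- \<sigma>) - r powr \<sigma> \<le> 2 * (r - 1)\<close>, which
  the range of \<sigma> reduces to \<open>r - 1 / r \<le> 2 * (r - 1)\<close>.\<close>

lemma powr_difference_bound:
  fixes x y \<sigma> :: real
  assumes x: "0 < x" and xy: "x \<le> y" and \<sigma>: "- 1 \<le> \<sigma>" "\<sigma> \<le> 0"
  shows "x * \<bar>x powr (2 * \<sigma>) - y powr (2 * \<sigma>)\<bar> \<le> 2 * (y - x) * (x powr \<sigma> * y powr \<sigma>)"
proof -
  have y: "0 < y" using x xy by linarith
  define r where "r = y / x"
  have r: "1 \<le> r" and yr: "y = r * x" using x xy by (auto simp: r_def)
  have "r powr (- \<sigma>) \<le> r" using powr_mono[of "- \<sigma>" 1 r] r \<sigma> by simp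
  moreover have "1 / r \<le> r powr \<sigma>" using powr_mono[of "- 1" \<sigma> r] r \<sigma> by (simp add: powr_minus_divide)
  moreover have "r - 1 / r \<le> 2 * (r - 1)"
  proof -
    have "(r - 1) * (1 + 1 / r) \<le> (r - 1) * 2" using r by (intro mult_left_mono) auto
    moreover have "(r - 1) * (1 + 1 / r) = r - 1 / r" using r by (simp add: field_simps)
    ultimately show ?thesis by simp
  qed
  ultimately have *: "r powr (- \<sigma>) - r powr \<sigma> \<le> 2 * (r - 1)" by linarith
  have "y powr (2 * \<sigma>) \<le> x powr (2 * \<sigma>)" using powr_mono2'[of "2 * \<sigma>" x y] x xy \<sigma> by simp
  then have "\<bar>x powr (2 * \<sigma>) - y powr (2 * \<sigma>)\<bar> = x powr (2 * \<sigma>) - y powr (2 * \<sigma>)" by simp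
  also have "\<dots> = (x powr \<sigma> * y powr \<sigma>) * (r powr (- \<sigma>) - r powr \<sigma>)"
  proof -
    have "x powr (2 * \<sigma>) = x powr \<sigma> * y powr \<sigma> * r powr (- \<sigma>)" "y powr (2 * \<sigma>) = x powr \<sigma> * y powr \<sigma> * r powr \<sigma>"
      unfolding yr using x r by (simp_all add: powr_mult powr_minus powr_add[symmetric] field_simps mult_2)
    then show ?thesis by (simp add: right_diff_distrib)
  qed
  also have "x * \<dots> \<le> x * ((x powr \<sigma> * y powr \<sigma>) * (2 * (r - 1)))"
    using x by (intro mult_left_mono *) auto
  also have "\<dots> = 2 * (y - x) * (x powr \<sigma> * y powr \<sigma>)" by (simp add: yr algebra_simps)
  finally show ?thesis .
qed

text \<open>One factor \<open>norm (\<xi> + \<eta>)\<close> comes from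
  \<open>cross2 \<xi> \<eta> = cross2 \<xi> (\<xi> + \<eta>)\<close>, the other from the difference
  of powers, because the norms of \<xi> and \<eta> differ by at most that of the sum. The first step
  leaves the norm of \<xi> over, which \<open>powr_difference_bound\<close> absorbs if \<xi> is the
  smaller frequency; by symmetry this may be assumed.\<close>

lemma abs_kap_le:
  assumes "\<xi> \<noteq> 0" "\<eta> \<noteq> 0" and \<sigma>: "- 1 \<le> \<sigma>" "\<sigma> \<le> 0"
  shows "\<bar>kap \<sigma> \<xi> \<eta>\<bar> \<le> (norm (\<xi> + \<eta>))\<^sup>2 * (norm \<xi> powr \<sigma> * norm \<eta> powr \<sigma>)"
proof -
  have main: "\<bar>kap \<sigma> \<xi> \<eta>\<bar> \<le> (norm (\<xi> + \<eta>))\<^sup>2 * (norm \<xi> powr \<sigma> * norm \<eta> powr \<sigma>)"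
    if "\<xi> \<noteq> 0" "\<eta> \<noteq> 0" and le: "norm \<xi> \<le> norm \<eta>" for \<xi> \<eta> :: plane
  proof -
    have "cross2 \<xi> \<eta> = cross2 \<xi> (\<xi> + \<eta>)" by (simp add: cross2_def algebra_simps)
    then have c: "\<bar>cross2 \<xi> \<eta>\<bar> \<le> norm (\<xi> + \<eta>) * norm \<xi>"
      using abs_cross2_le[of \<xi> "\<xi> + \<eta>"] by (simp add: mult.commute)
    have d: "norm \<eta> - norm \<xi> \<le> norm (\<xi> + \<eta>)" using norm_triangle_ineq4[of "\<xi> + \<eta>" \<xi>] by simp
    have "2 * \<bar>kap \<sigma> \<xi> \<eta>\<bar> = \<bar>cross2 \<xi> \<eta>\<bar> * \<bar>norm \<xi> powr (2 * \<sigma>) - norm \<eta> powr (2 * \<sigma>)\<bar>"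
      by (simp add: kap_def abs_mult)
    also have "\<dots> \<le> (norm (\<xi> + \<eta>) * norm \<xi>) * \<bar>norm \<xi> powr (2 * \<sigma>) - norm \<eta> powr (2 * \<sigma>)\<bar>"
      by (intro mult_right_mono c) simp
    also have "\<dots> \<le> norm (\<xi> + \<eta>) * (2 * (norm \<eta> - norm \<xi>) * (norm \<xi> powr \<sigma> * norm \<eta> powr \<sigma>))"
      unfolding mult.assoc[of "norm (\<xi> + \<eta>)"] using that \<sigma> by (intro mult_left_mono powr_difference_bound) auto
    also have "\<dots> \<le> norm (\<xi> + \<eta>) * (2 * norm (\<xi> + \<eta>) * (norm \<xi> powr \<sigma> * norm \<eta> powr \<sigma>))"
      using d by (intro mult_left_mono mult_right_mono) auto
    finally show ?thesis by (simp add: power2_eq_square)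
  qed
  show ?thesis
  proof (cases "norm \<xi> \<le> norm \<eta>")
    case False
    then show ?thesis using main[of \<eta> \<xi>] assms by (simp add: kap_commute[of \<sigma> \<xi> \<eta>] add.commute mult.commute)
  qed (use main assms in auto)
qed

text \<open>The Fourier side of \<open>schwartz0\<close>: support in an annulus, on which powers of
  the norm with any real exponent are bounded.\<close>

definition cs0 :: "(plane \<Rightarrow> complex) \<Rightarrow> bool" where
  "cs0 a \<longleftrightarrow> a \<in> schwartz \<and> (\<exists>r>0. \<exists>R. \<forall>\<xi>. a \<xi> \<noteq> 0 \<longrightarrow> r \<le> norm \<xi> \<and> norm \<xi> \<le> R)"

lemma cs0_schwartz: "cs0 a \<Longrightarrow> a \<in> schwartz" by (simp add: cs0_def)

lemma cs0_zero: "cs0 a \<Longrightarrow> a 0 = 0" unfolding cs0_def by force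

lemma cs0_linear:
  assumes "cs0 a" "cs0 b" shows "cs0 (\<lambda>\<xi>. c * a \<xi> + d * b \<xi>)"
proof -
  obtain r R r' R' where 1: "r > 0" "\<And>\<xi>. a \<xi> \<noteq> 0 \<Longrightarrow> r \<le> norm \<xi> \<and> norm \<xi> \<le> R"
    and 2: "r' > 0" "\<And>\<xi>. b \<xi> \<noteq> 0 \<Longrightarrow> r' \<le> norm \<xi> \<and> norm \<xi> \<le> R'"
    using assms unfolding cs0_def by metis
  have "min r r' \<le> norm \<xi> \<and> norm \<xi> \<le> max R R'" if "c * a \<xi> + d * b \<xi> \<noteq> 0" for \<xi>
  proof (cases "a \<xi> = 0")
    case True
    then have "b \<xi> \<noteq> 0" using that by auto
    then show ?thesis using 2(2)[of \<xi>] by auto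
  qed (use 1(2)[of \<xi>] in auto)
  moreover have "0 < min r r'" using 1 2 by simp
  moreover have "(\<lambda>\<xi>. c * a \<xi> + d * b \<xi>) \<in> schwartz"
    by (intro schwartz_add schwartz_cmult cs0_schwartz assms)
  ultimately show ?thesis unfolding cs0_def by (intro conjI exI[of _ "min r r'"] exI[of _ "max R R'"]) auto
qed

lemma schwartz0_schwartz: "f \<in> schwartz0 \<Longrightarrow> f \<in> schwartz" by (simp add: schwartz0_def)

lemma schwartz0_cs0:
  assumes "f \<in> schwartz0" shows "cs0 (fourier f)"
proof -
  have f: "f \<in> schwartz" "compact (supp (fourier f))" "0 \<notin> supp (fourier f)" using assms by (auto simp: schwartz0_def)
  obtain R where R: "\<And>\<xi>. \<xi> \<in> supp (fourier f) \<Longrightarrow> norm \<xi> \<le> R"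
    using compact_imp_bounded[OF f(2)] unfolding bounded_iff by metis
  have "open (- supp (fourier f))" by (simp add: open_Compl)
  then obtain r where r: "r > 0" "ball 0 r \<subseteq> - supp (fourier f)" using f(3) open_contains_ball by (metis ComplI)
  have "r \<le> norm \<xi> \<and> norm \<xi> \<le> R" if "fourier f \<xi> \<noteq> 0" for \<xi>
  proof -
    have s: "\<xi> \<in> supp (fourier f)" using that zero_outside_supp by metis
    then have "\<xi> \<notin> ball 0 r" using r(2) by auto
    then show ?thesis using R[OF s] by auto
  qed
  then show ?thesis unfolding cs0_def using schwartz_fourier[OF f(1)] r(1) by metis
qed

lemma cs0_powr_bound:
  assumes "cs0 a" shows "\<exists>K\<ge>0. \<forall>\<xi>. norm \<xi> powr t * norm (a \<xi>) \<le> K * norm (a \<xi>)"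
proof -
  obtain r R where r: "r > 0" "\<And>\<xi>. a \<xi> \<noteq> 0 \<Longrightarrow> r \<le> norm \<xi> \<and> norm \<xi> \<le> R"
    using assms unfolding cs0_def by metis
  have "norm \<xi> powr t * norm (a \<xi>) \<le> (r powr t + R powr t) * norm (a \<xi>)" for \<xi>
  proof (cases "a \<xi> = 0")
    case False
    then have n: "r \<le> norm \<xi>" "norm \<xi> \<le> R" using r(2) by auto
    have "norm \<xi> powr t \<le> r powr t + R powr t"
    proof (cases "0 \<le> t")
      case True
      then have "norm \<xi> powr t \<le> R powr t" using n r(1) by (intro powr_mono2) auto
      then show ?thesis by (simp add: add_increasing)
    next
      case False
      then have "norm \<xi> powr t \<le> r powr t" using n r(1) by (intro powr_mono2') auto
      then show ?thesis by (simp add: add_increasing2)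
    qed
    then show ?thesis by (rule mult_right_mono) simp
  qed simp
  then show ?thesis by (intro exI[of _ "r powr t + R powr t"]) simp
qed

lemma cs0_powr_integrable:
  assumes a: "cs0 a" shows "integrable lborel (\<lambda>\<xi>. norm \<xi> powr t * norm (a \<xi>))"
proof -
  obtain K where K: "\<And>\<xi>. norm \<xi> powr t * norm (a \<xi>) \<le> K * norm (a \<xi>)" "0 \<le> K" using cs0_powr_bound[OF a] by metis
  have [measurable]: "a \<in> borel_measurable borel" by (intro schwartz_borel cs0_schwartz a)
  show ?thesis
    by (rule Bochner_Integration.integrable_bound[OF integrable_mult_right[OF integrable_norm[OF schwartz_integrable[OF cs0_schwartz[OF a]]], of K]])
      (use K in \<open>auto simp: abs_mult\<close>)
qed

text \<open>The squared homogeneous Sobolev norm on the Fourier side, with the exact weight in place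
  of dyadic blocks and without the Plancherel constant.\<close>

definition wn :: "real \<Rightarrow> (plane \<Rightarrow> complex) \<Rightarrow> ennreal" where
  "wn \<sigma> a = (\<integral>\<^sup>+\<xi>. ennreal (norm \<xi> powr (2 * \<sigma>) * (norm (a \<xi>))\<^sup>2) \<partial>lborel)"

text \<open>Replaces the supremum of the second derivatives in the bound of the nonlinearity.\<close>

definition wiener :: "(plane \<Rightarrow> complex) \<Rightarrow> real" where
  "wiener \<psi> = (LINT k|lborel. (norm k)\<^sup>2 * norm (fourier \<psi> k))"

lemma wiener_integrable: "\<psi> \<in> schwartz \<Longrightarrow> integrable lborel (\<lambda>k. (norm k)\<^sup>2 * norm (fourier \<psi> k))"
proof -
  assume p: "\<psi> \<in> schwartz"
  have [measurable]: "fourier \<psi> \<in> borel_measurable borel" by (intro schwartz_borel schwartz_fourier p)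
  show ?thesis
    by (rule Bochner_Integration.integrable_bound[OF schwartz_weight_integrable[OF schwartz_fourier[OF p], of 2]])
      (auto intro!: mult_right_mono power_mono)
qed

lemma wiener_nn: "\<psi> \<in> schwartz \<Longrightarrow> (\<integral>\<^sup>+k. ennreal ((norm k)\<^sup>2 * norm (fourier \<psi> k)) \<partial>lborel) = ennreal (wiener \<psi>)"
  unfolding wiener_def by (rule nn_integral_eq_integral[OF wiener_integrable]) auto

lemma wiener_nonneg: "0 \<le> wiener \<psi>" by (simp add: wiener_def)

definition bil :: "real \<Rightarrow> (plane \<Rightarrow> complex) \<Rightarrow> (plane \<Rightarrow> complex) \<Rightarrow> (plane \<Rightarrow> complex) \<Rightarrow> plane \<times> plane \<Rightarrow> complex" where
  "bil \<sigma> \<psi> a b p = fourier \<psi> (- (fst p + snd p)) * complex_of_real (kap \<sigma> (fst p) (snd p)) * a (fst p) * b (snd p)"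

lemma bil_bound:
  assumes \<sigma>: "- 1 \<le> \<sigma>" "\<sigma> \<le> 0" and a: "cs0 a" and b: "cs0 b"
  shows "norm (bil \<sigma> \<psi> a b (\<xi>, \<eta>)) \<le> ((norm (\<xi> + \<eta>))\<^sup>2 * norm (fourier \<psi> (- (\<xi> + \<eta>)))) * (norm \<xi> powr \<sigma> * norm (a \<xi>)) * (norm \<eta> powr \<sigma> * norm (b \<eta>))"
proof (cases "\<xi> = 0 \<or> \<eta> = 0")
  case True
  then show ?thesis using cs0_zero[OF a] cs0_zero[OF b] by (auto simp: bil_def)
next
  case False
  have "\<bar>kap \<sigma> \<xi> \<eta>\<bar> * (norm (fourier \<psi> (- (\<xi> + \<eta>))) * norm (a \<xi>) * norm (b \<eta>)) \<le>
    ((norm (\<xi> + \<eta>))\<^sup>2 * (norm \<xi> powr \<sigma> * norm \<eta> powr \<sigma>)) * (norm (fourier \<psi> (- (\<xi> + \<eta>))) * norm (a \<xi>) * norm (b \<eta>))"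
    using False by (intro mult_right_mono abs_kap_le \<sigma>) auto
  then show ?thesis by (simp add: bil_def norm_mult mult_ac)
qed

lemma bil_borel [measurable (raw)]:
  assumes "\<psi> \<in> schwartz" "a \<in> schwartz" "b \<in> schwartz"
  shows "bil \<sigma> \<psi> a b \<in> borel_measurable (borel \<Otimes>\<^sub>M borel)"
proof -
  have [measurable]: "fourier \<psi> \<in> borel_measurable borel" "a \<in> borel_measurable borel" "b \<in> borel_measurable borel"
    by (intro schwartz_borel schwartz_fourier assms)+
  show ?thesis unfolding bil_def[abs_def] by measurable
qed

text \<open>A Schur-type estimate. The weight \<open>w (\<xi> + \<eta>)\<close> is split into two
  square roots, one for each factor, and Cauchy--Schwarz is applied on the product space. In each
  resulting integral one of the variables enters only through \<open>\<xi> + \<eta>\<close>;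
  integrating it out gives \<open>wiener \<psi>\<close> by translation invariance.\<close>

lemma bil_nn_bound:
  assumes \<sigma>: "- 1 \<le> \<sigma>" "\<sigma> \<le> 0" and p: "\<psi> \<in> schwartz" and a: "cs0 a" and b: "cs0 b"
  shows "(\<integral>\<^sup>+q. ennreal (norm (bil \<sigma> \<psi> a b q)) \<partial>LL)\<^sup>2 \<le> ennreal ((wiener \<psi>)\<^sup>2) * wn \<sigma> a * wn \<sigma> b"
proof -
  have [measurable]: "fourier \<psi> \<in> borel_measurable borel" "a \<in> borel_measurable borel" "b \<in> borel_measurable borel"
    by (intro schwartz_borel schwartz_fourier p cs0_schwartz a b)+
  define w where "w k = (norm k)\<^sup>2 * norm (fourier \<psi> (- k))" for k
  have w0: "0 \<le> w k" for k by (simp add: w_def)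
  have wm [measurable]: "w \<in> borel_measurable borel" unfolding w_def[abs_def] by measurable
  have wint: "(\<integral>\<^sup>+\<eta>. ennreal (w (\<xi> + \<eta>)) \<partial>lborel) = ennreal (wiener \<psi>)" "(\<integral>\<^sup>+\<xi>. ennreal (w (\<xi> + \<eta>)) \<partial>lborel) = ennreal (wiener \<psi>)" for \<xi> \<eta>
  proof -
    have "(\<integral>\<^sup>+k. ennreal (w k) \<partial>lborel) = ennreal (wiener \<psi>)"
      using nn_integral_plane_affine[of "\<lambda>k. ennreal ((norm k)\<^sup>2 * norm (fourier \<psi> k))" "- 1" 0] wiener_nn[OF p]
      by (simp add: w_def)
    then show "(\<integral>\<^sup>+\<eta>. ennreal (w (\<xi> + \<eta>)) \<partial>lborel) = ennreal (wiener \<psi>)" "(\<integral>\<^sup>+\<xi>. ennreal (w (\<xi> + \<eta>)) \<partial>lborel) = ennreal (wiener \<psi>)"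
      using nn_integral_plane_affine[of "\<lambda>k. ennreal (w k)" 1 \<xi>] nn_integral_plane_affine[of "\<lambda>k. ennreal (w k)" 1 \<eta>]
      by (simp_all add: add.commute)
  qed
  let ?A = "\<lambda>q. ennreal (sqrt (w (fst q + snd q)) * (norm (fst q) powr \<sigma> * norm (a (fst q))))"
  let ?B = "\<lambda>q. ennreal (sqrt (w (fst q + snd q)) * (norm (snd q) powr \<sigma> * norm (b (snd q))))"
  have Am [measurable]: "?A \<in> borel_measurable LL" "?B \<in> borel_measurable LL" by measurable
  have "(\<integral>\<^sup>+q. ennreal (norm (bil \<sigma> \<psi> a b q)) \<partial>LL) \<le> (\<integral>\<^sup>+q. ?A q * ?B q \<partial>LL)"
  proof (intro nn_integral_mono)
    fix q :: "plane \<times> plane"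
    obtain \<xi> \<eta> where q: "q = (\<xi>, \<eta>)" by (cases q)
    have "norm (bil \<sigma> \<psi> a b q) \<le> w (\<xi> + \<eta>) * (norm \<xi> powr \<sigma> * norm (a \<xi>)) * (norm \<eta> powr \<sigma> * norm (b \<eta>))"
      unfolding q w_def by (rule bil_bound[OF \<sigma> a b])
    also have "\<dots> = (sqrt (w (\<xi> + \<eta>)) * (norm \<xi> powr \<sigma> * norm (a \<xi>))) * (sqrt (w (\<xi> + \<eta>)) * (norm \<eta> powr \<sigma> * norm (b \<eta>)))"
    proof -
      have "t * t * x * y = (t * x) * (t * y)" for t x y :: real by simp
      from this[of "sqrt (w (\<xi> + \<eta>))"] show ?thesis using w0[of "\<xi> + \<eta>"] by simp
    qed
    finally show "ennreal (norm (bil \<sigma> \<psi> a b q)) \<le> ?A q * ?B q"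
      using w0 by (simp add: q ennreal_leI flip: ennreal_mult)
  qed
  then have "(\<integral>\<^sup>+q. ennreal (norm (bil \<sigma> \<psi> a b q)) \<partial>LL)\<^sup>2 \<le> (\<integral>\<^sup>+q. ?A q * ?B q \<partial>LL)\<^sup>2"
    by (rule power_mono) simp
  also have "\<dots> \<le> (\<integral>\<^sup>+q. (?A q)\<^sup>2 \<partial>LL) * (\<integral>\<^sup>+q. (?B q)\<^sup>2 \<partial>LL)"
    by (rule Cauchy_Schwarz_nn_integral[OF Am])
  also have "(\<integral>\<^sup>+q. (?A q)\<^sup>2 \<partial>LL) = ennreal (wiener \<psi>) * wn \<sigma> a"
  proof -
    have "(\<integral>\<^sup>+q. (?A q)\<^sup>2 \<partial>LL) = (\<integral>\<^sup>+\<xi>. \<integral>\<^sup>+\<eta>. (?A (\<xi>, \<eta>))\<^sup>2 \<partial>lborel \<partial>lborel)"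
      by (rule lborel.nn_integral_fst[symmetric]) measurable
    also have "\<dots> = (\<integral>\<^sup>+\<xi>. \<integral>\<^sup>+\<eta>. ennreal (w (\<xi> + \<eta>)) * ennreal (norm \<xi> powr (2 * \<sigma>) * (norm (a \<xi>))\<^sup>2) \<partial>lborel \<partial>lborel)"
      using w0 by (simp add: ennreal_power power_mult_distrib ennreal_mult powr_add[symmetric] power2_eq_square[of "_ powr _"])
    also have "\<dots> = ennreal (wiener \<psi>) * wn \<sigma> a"
      unfolding wn_def by (simp add: nn_integral_multc wint nn_integral_cmult)
    finally show ?thesis .
  qed
  also have "(\<integral>\<^sup>+q. (?B q)\<^sup>2 \<partial>LL) = ennreal (wiener \<psi>) * wn \<sigma> b"
  proof -
    have "(\<integral>\<^sup>+q. (?B q)\<^sup>2 \<partial>LL) = (\<integral>\<^sup>+\<eta>. \<integral>\<^sup>+\<xi>. (?B (\<xi>, \<eta>))\<^sup>2 \<partial>lborel \<partial>lborel)"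
      by (rule lborel_pair.nn_integral_snd[symmetric]) measurable
    also have "\<dots> = (\<integral>\<^sup>+\<eta>. \<integral>\<^sup>+\<xi>. ennreal (w (\<xi> + \<eta>)) * ennreal (norm \<eta> powr (2 * \<sigma>) * (norm (b \<eta>))\<^sup>2) \<partial>lborel \<partial>lborel)"
      using w0 by (simp add: ennreal_power power_mult_distrib ennreal_mult powr_add[symmetric] power2_eq_square[of "_ powr _"])
    also have "\<dots> = ennreal (wiener \<psi>) * wn \<sigma> b"
      unfolding wn_def by (simp add: nn_integral_multc wint nn_integral_cmult)
    finally show ?thesis .
  qed
  also have "ennreal (wiener \<psi>) * wn \<sigma> a * (ennreal (wiener \<psi>) * wn \<sigma> b) = ennreal ((wiener \<psi>)\<^sup>2) * wn \<sigma> a * wn \<sigma> b"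
    by (simp add: power2_eq_square ennreal_mult wiener_nonneg mult_ac)
  finally show ?thesis .
qed

lemma bil_integrable:
  assumes \<sigma>: "- 1 \<le> \<sigma>" "\<sigma> \<le> 0" and p: "\<psi> \<in> schwartz" and a: "cs0 a" and b: "cs0 b"
  shows "integrable LL (bil \<sigma> \<psi> a b)"
proof -
  obtain K where K: "\<And>k. (1 + norm k) ^ 2 * norm (fourier \<psi> k) \<le> K"
    using schwartz_weight_bound[OF schwartz_fourier[OF p], of "[]" 2] by auto
  have "norm (bil \<sigma> \<psi> a b (\<xi>, \<eta>)) \<le> (K * (norm \<xi> powr \<sigma> * norm (a \<xi>))) * (norm \<eta> powr \<sigma> * norm (b \<eta>))" for \<xi> \<eta>
  proof -
    have "(norm (\<xi> + \<eta>))\<^sup>2 * norm (fourier \<psi> (- (\<xi> + \<eta>))) \<le> (1 + norm (- (\<xi> + \<eta>)))\<^sup>2 * norm (fourier \<psi> (- (\<xi> + \<eta>)))"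
      unfolding norm_minus_cancel by (intro mult_right_mono power_mono) auto
    also have "\<dots> \<le> K" by (rule K)
    finally have "((norm (\<xi> + \<eta>))\<^sup>2 * norm (fourier \<psi> (- (\<xi> + \<eta>)))) * (norm \<xi> powr \<sigma> * norm (a \<xi>)) * (norm \<eta> powr \<sigma> * norm (b \<eta>))
       \<le> K * (norm \<xi> powr \<sigma> * norm (a \<xi>)) * (norm \<eta> powr \<sigma> * norm (b \<eta>))"
      by (intro mult_right_mono) auto
    with bil_bound[OF \<sigma> a b, of \<psi> \<xi> \<eta>] show ?thesis by linarith
  qed
  then show ?thesis
    by (intro integrable_pair_bound[OF integrable_mult_right[OF cs0_powr_integrable[OF a]] cs0_powr_integrable[OF b]])
      (use bil_borel[OF p cs0_schwartz[OF a] cs0_schwartz[OF b]] in simp_all)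
qed

definition Bil :: "real \<Rightarrow> (plane \<Rightarrow> complex) \<Rightarrow> (plane \<Rightarrow> complex) \<Rightarrow> (plane \<Rightarrow> complex) \<Rightarrow> complex" where
  "Bil \<sigma> \<psi> a b = (LINT p|LL. bil \<sigma> \<psi> a b p)"

lemma Bil_bound:
  assumes "- 1 \<le> \<sigma>" "\<sigma> \<le> 0" "\<psi> \<in> schwartz" "cs0 a" "cs0 b"
  shows "(ennreal (norm (Bil \<sigma> \<psi> a b)))\<^sup>2 \<le> ennreal ((wiener \<psi>)\<^sup>2) * wn \<sigma> a * wn \<sigma> b"
  unfolding Bil_def
  by (rule order_trans[OF power_mono[OF integral_norm_bound_ennreal[OF bil_integrable[OF assms]]] bil_nn_bound[OF assms]]) simp

lemma Bil_swap:
  assumes "- 1 \<le> \<sigma>" "\<sigma> \<le> 0" "\<psi> \<in> schwartz" "cs0 a" "cs0 b"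
  shows "Bil \<sigma> \<psi> a b = Bil \<sigma> \<psi> b a"
proof -
  have "Bil \<sigma> \<psi> a b = (LINT (x, y)|LL. bil \<sigma> \<psi> a b (y, x))"
    unfolding Bil_def
    by (rule lborel_pair.integral_product_swap[symmetric]) (use bil_borel[of \<psi> a b] assms cs0_schwartz in simp)
  also have "(\<lambda>(x, y). bil \<sigma> \<psi> a b (y, x)) = bil \<sigma> \<psi> b a"
    by (auto simp: bil_def kap_commute add.commute mult_ac)
  finally show ?thesis by (simp add: Bil_def)
qed

text \<open>Symmetry of the form cancels the mixed terms. In this shape the bilinear bound yields
  continuity of the quadratic form.\<close>

lemma Bil_diff_squares:
  assumes "- 1 \<le> \<sigma>" "\<sigma> \<le> 0" "\<psi> \<in> schwartz" "cs0 a" "cs0 b"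
  shows "Bil \<sigma> \<psi> a a - Bil \<sigma> \<psi> b b = Bil \<sigma> \<psi> (\<lambda>\<xi>. a \<xi> - b \<xi>) (\<lambda>\<xi>. a \<xi> + b \<xi>)"
proof -
  note i = bil_integrable[OF assms(1-3)]
  have "bil \<sigma> \<psi> (\<lambda>\<xi>. a \<xi> - b \<xi>) (\<lambda>\<xi>. a \<xi> + b \<xi>) = (\<lambda>p. bil \<sigma> \<psi> a a p + bil \<sigma> \<psi> a b p - bil \<sigma> \<psi> b a p - bil \<sigma> \<psi> b b p)"
    by (rule ext) (simp add: bil_def algebra_simps)
  then have "Bil \<sigma> \<psi> (\<lambda>\<xi>. a \<xi> - b \<xi>) (\<lambda>\<xi>. a \<xi> + b \<xi>) = Bil \<sigma> \<psi> a a + Bil \<sigma> \<psi> a b - Bil \<sigma> \<psi> b a - Bil \<sigma> \<psi> b b"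
    unfolding Bil_def using assms i by simp
  then show ?thesis using Bil_swap[OF assms] by simp
qed

lemma Bil_linear_test:
  assumes "- 1 \<le> \<sigma>" "\<sigma> \<le> 0" "\<psi> \<in> schwartz" "\<phi> \<in> schwartz" "cs0 a" "cs0 b"
  shows "Bil \<sigma> (\<lambda>x. c * \<psi> x + d * \<phi> x) a b = c * Bil \<sigma> \<psi> a b + d * Bil \<sigma> \<phi> a b"
proof -
  note i = bil_integrable[OF assms(1,2) _ assms(5,6)]
  have "bil \<sigma> (\<lambda>x. c * \<psi> x + d * \<phi> x) a b = (\<lambda>p. c * bil \<sigma> \<psi> a b p + d * bil \<sigma> \<phi> a b p)"
    unfolding bil_def fourier_linear[OF assms(3,4)] by (rule ext) (simp add: algebra_simps)
  then show ?thesis unfolding Bil_def using i[OF assms(3)] i[OF assms(4)] by simp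
qed

section \<open>From the form in physical space to the form in frequency space\<close>

lemma has_derivative_inv_fourier:
  assumes "g \<in> borel_measurable borel" "integrable lborel (\<lambda>x. (1 + norm x)\<^sup>2 * norm (g x))"
  shows "(inv_fourier g has_derivative (\<lambda>v. inv_fourier (\<lambda>\<xi>. \<i> * complex_of_real (\<xi> \<bullet> v) * g \<xi>) x)) (at x)"
proof -
  let ?c = "complex_of_real (1 / (2 * pi)\<^sup>2)"
  have "((\<lambda>x. fourier g (- x)) has_derivative (\<lambda>v. fourier (\<lambda>\<xi>. - \<i> * complex_of_real (\<xi> \<bullet> (- v)) * g \<xi>) (- x))) (at x)"
    by (rule has_derivative_compose[of "\<lambda>x. - x" "\<lambda>x. - x", OF _ fourier_has_derivative[OF assms]])
      (auto intro!: derivative_eq_intros)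
  then have "((\<lambda>x. ?c * fourier g (- x)) has_derivative (\<lambda>v. ?c * fourier (\<lambda>\<xi>. - \<i> * complex_of_real (\<xi> \<bullet> (- v)) * g \<xi>) (- x))) (at x)"
    by (rule has_derivative_mult_right)
  then show ?thesis unfolding inv_fourier_eq[abs_def] by simp
qed

lemma norm_inv_fourier_le: "norm (inv_fourier g x) \<le> (1 / (2 * pi)\<^sup>2) * (LINT x|lborel. norm (g x))"
  unfolding inv_fourier_eq norm_mult norm_of_real by (intro mult_mono norm_fourier_le) auto

lemma inv_fourier_borel [measurable (raw)]:
  assumes [measurable]: "g \<in> borel_measurable borel" shows "inv_fourier g \<in> borel_measurable borel"
  unfolding inv_fourier_def[abs_def] by measurable

lemma integral_bounded_mult:
  fixes \<psi> X :: "plane \<Rightarrow> complex"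
  assumes "integrable lborel \<psi>" "X \<in> borel_measurable borel" "\<And>x. norm (X x) \<le> K"
  shows "integrable lborel (\<lambda>x. \<psi> x * X x)"
proof (rule Bochner_Integration.integrable_bound[OF integrable_mult_left[OF integrable_norm[OF assms(1)], of K]])
  show "(\<lambda>x. \<psi> x * X x) \<in> borel_measurable lborel" using integrable_borel[OF assms(1)] assms(2) by measurable
  have *: "norm (\<psi> x * X x) \<le> norm (\<psi> x) * K" for x
    unfolding norm_mult by (intro mult_left_mono assms(3)) simp
  show "AE x in lborel. norm (\<psi> x * X x) \<le> norm (norm (\<psi> x) * K)"
    by (intro AE_I2 order_trans[OF *]) (simp only: real_norm_def abs_ge_self)
qed

text \<open>A product in space is a convolution in frequency. The two inverse transforms are moved
  to the remaining factors one after the other, and each contributes one factor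
  \<open>1 / (2 * pi)\<^sup>2\<close>.\<close>

lemma triple_product:
  assumes \<psi>: "integrable lborel \<psi>" and p: "integrable lborel p" and q: "integrable lborel q"
  shows "integrable lborel (\<lambda>x. \<psi> x * (inv_fourier p x * inv_fourier q x))"
    and "(LINT x|lborel. \<psi> x * (inv_fourier p x * inv_fourier q x)) =
      complex_of_real ((1 / (2 * pi)\<^sup>2)\<^sup>2) * (LINT z|LL. fourier \<psi> (- (fst z + snd z)) * p (fst z) * q (snd z))"
proof -
  have [measurable]: "p \<in> borel_measurable borel" "q \<in> borel_measurable borel" "\<psi> \<in> borel_measurable borel"
    using \<psi> p q by (auto intro: integrable_borel)
  let ?c = "complex_of_real (1 / (2 * pi)\<^sup>2)"
  have \<psi>q: "integrable lborel (\<lambda>x. \<psi> x * inv_fourier q x)"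
    by (rule integral_bounded_mult[OF \<psi> _ norm_inv_fourier_le]) measurable
  have \<psi>qp: "integrable lborel (\<lambda>x. (\<psi> x * inv_fourier q x) * inv_fourier p x)"
    by (rule integral_bounded_mult[OF \<psi>q _ norm_inv_fourier_le]) measurable
  then show "integrable lborel (\<lambda>x. \<psi> x * (inv_fourier p x * inv_fourier q x))" by (simp only: mult_ac)
  have inner: "inv_fourier (\<lambda>x. \<psi> x * inv_fourier q x) \<xi> = ?c * (?c * (LINT \<eta>|lborel. fourier \<psi> (- (\<xi> + \<eta>)) * q \<eta>))" for \<xi>
  proof -
    have e: "integrable lborel (\<lambda>x. expi (x \<bullet> \<xi>) * \<psi> x)"
      using fourier_integrable[OF \<psi>, of "- \<xi>"] by simp
    have s: "inv_fourier (\<lambda>x. expi (x \<bullet> \<xi>) * \<psi> x) \<eta> = ?c * fourier \<psi> (- (\<xi> + \<eta>))" for \<eta>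
    proof -
      have "expni (x \<bullet> - \<eta>) * (expi (x \<bullet> \<xi>) * \<psi> x) = expni (x \<bullet> - (\<xi> + \<eta>)) * \<psi> x" for x
        by (simp add: inner_add_right exp_add algebra_simps)
      then show ?thesis unfolding inv_fourier_eq fourier_def by (simp only:)
    qed
    have "inv_fourier (\<lambda>x. \<psi> x * inv_fourier q x) \<xi> = ?c * (LINT x|lborel. (expi (x \<bullet> \<xi>) * \<psi> x) * inv_fourier q x)"
      unfolding inv_fourier_def[of "\<lambda>x. \<psi> x * inv_fourier q x"] by (simp add: scaleR_conv_of_real inner_commute mult.assoc)
    also have "\<dots> = ?c * (LINT \<eta>|lborel. ?c * fourier \<psi> (- (\<xi> + \<eta>)) * q \<eta>)"
      unfolding inv_fourier_transfer[OF e q, symmetric] s ..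
    finally show ?thesis by (simp only: mult.assoc integral_mult_right_zero)
  qed
  have Fm [measurable]: "fourier \<psi> \<in> borel_measurable borel" unfolding fourier_def[abs_def] by measurable
  have int: "integrable LL (\<lambda>z. fourier \<psi> (- (fst z + snd z)) * p (fst z) * q (snd z))"
  proof (rule integrable_pair_bound[OF integrable_mult_right[OF integrable_norm[OF p], of "LINT x|lborel. norm (\<psi> x)"] integrable_norm[OF q]])
    show "norm (fourier \<psi> (- (fst (x, y) + snd (x, y))) * p (fst (x, y)) * q (snd (x, y))) \<le> (LINT x|lborel. norm (\<psi> x)) * norm (p x) * norm (q y)" for x y
      unfolding norm_mult fst_conv snd_conv by (intro mult_right_mono norm_fourier_le) auto
  qed measurable
  have "(LINT x|lborel. \<psi> x * (inv_fourier p x * inv_fourier q x)) = (LINT x|lborel. inv_fourier p x * (\<psi> x * inv_fourier q x))"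
    by (simp only: mult_ac)
  also have "\<dots> = (LINT \<xi>|lborel. p \<xi> * (?c * (?c * (LINT \<eta>|lborel. fourier \<psi> (- (\<xi> + \<eta>)) * q \<eta>))))"
    unfolding inv_fourier_transfer[OF p \<psi>q] inner ..
  also have "\<dots> = (LINT \<xi>|lborel. ?c * (?c * (LINT \<eta>|lborel. fourier \<psi> (- (\<xi> + \<eta>)) * p \<xi> * q \<eta>)))"
  proof (intro Bochner_Integration.integral_cong refl)
    fix \<xi>
    have "(LINT \<eta>|lborel. fourier \<psi> (- (\<xi> + \<eta>)) * p \<xi> * q \<eta>) = p \<xi> * (LINT \<eta>|lborel. fourier \<psi> (- (\<xi> + \<eta>)) * q \<eta>)"
      unfolding integral_mult_right_zero[symmetric] by (simp only: mult_ac)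
    then show "p \<xi> * (?c * (?c * (LINT \<eta>|lborel. fourier \<psi> (- (\<xi> + \<eta>)) * q \<eta>))) = ?c * (?c * (LINT \<eta>|lborel. fourier \<psi> (- (\<xi> + \<eta>)) * p \<xi> * q \<eta>))"
      by (simp only: mult_ac)
  qed
  also have "\<dots> = ?c * (?c * (LINT \<xi>|lborel. LINT \<eta>|lborel. fourier \<psi> (- (\<xi> + \<eta>)) * p \<xi> * q \<eta>))"
    by (simp only: integral_mult_right_zero)
  also have "(LINT \<xi>|lborel. LINT \<eta>|lborel. fourier \<psi> (- (\<xi> + \<eta>)) * p \<xi> * q \<eta>) = (LINT z|LL. fourier \<psi> (- (fst z + snd z)) * p (fst z) * q (snd z))"
    using lborel_pair.integral_fst'[OF int] by simp
  finally show "(LINT x|lborel. \<psi> x * (inv_fourier p x * inv_fourier q x)) =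
      complex_of_real ((1 / (2 * pi)\<^sup>2)\<^sup>2) * (LINT z|LL. fourier \<psi> (- (fst z + snd z)) * p (fst z) * q (snd z))"
    by (simp only: power2_eq_square[of "1 / (2 * pi)\<^sup>2"] of_real_mult mult.assoc)
qed

lemma inner_axis_one: "(\<xi>::plane) \<bullet> axis l 1 = \<xi> $ l"
  by (simp add: inner_axis)

lemma cs0_bounded_mult:
  assumes a: "cs0 a" and m: "m \<in> borel_measurable borel" and K: "\<And>\<xi>. norm (m \<xi>) * norm (a \<xi>) \<le> K * norm (a \<xi>)"
  shows "integrable lborel (\<lambda>\<xi>. (1 + norm \<xi>) ^ N * norm (m \<xi> * a \<xi>))"
proof (rule Bochner_Integration.integrable_bound[OF integrable_mult_right[OF schwartz_weight_integrable[OF cs0_schwartz[OF a], of N], of K]])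
  have [measurable]: "a \<in> borel_measurable borel" "m \<in> borel_measurable borel" using m by (auto intro: schwartz_borel cs0_schwartz a)
  show "(\<lambda>\<xi>. (1 + norm \<xi>) ^ N * norm (m \<xi> * a \<xi>)) \<in> borel_measurable lborel" by measurable
  have "norm ((1 + norm \<xi>) ^ N * norm (m \<xi> * a \<xi>)) \<le> norm (K * ((1 + norm \<xi>) ^ N * norm (a \<xi>)))" for \<xi>
  proof -
    have "(1 + norm \<xi>) ^ N * (norm (m \<xi>) * norm (a \<xi>)) \<le> (1 + norm \<xi>) ^ N * (K * norm (a \<xi>))"
      by (intro mult_left_mono K) simp
    also have "\<dots> \<le> \<bar>K * ((1 + norm \<xi>) ^ N * norm (a \<xi>))\<bar>" by (simp add: mult_ac abs_ge_self)
    finally show ?thesis by (simp add: norm_mult abs_mult)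
  qed
  then show "AE \<xi> in lborel. norm ((1 + norm \<xi>) ^ N * norm (m \<xi> * a \<xi>)) \<le> norm (K * ((1 + norm \<xi>) ^ N * norm (a \<xi>)))" by simp
qed

lemma integrable_of_weight:
  assumes [measurable]: "g \<in> borel_measurable borel" and int: "integrable lborel (\<lambda>\<xi>. (1 + norm \<xi>) ^ N * norm (g \<xi>))"
    and p: "p \<in> borel_measurable borel" "\<And>\<xi>. norm (p \<xi>) \<le> (1 + norm \<xi>) ^ N"
  shows "integrable lborel (\<lambda>\<xi>::plane. p \<xi> * g \<xi> :: complex)"
proof (rule Bochner_Integration.integrable_bound[OF int])
  show "(\<lambda>\<xi>. p \<xi> * g \<xi>) \<in> borel_measurable lborel" using p(1) by measurable
  show "AE \<xi> in lborel. norm (p \<xi> * g \<xi>) \<le> norm ((1 + norm \<xi>) ^ N * norm (g \<xi>))"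
    using p(2) by (intro AE_I2) (simp add: norm_mult abs_mult mult_right_mono)
qed

text \<open>Derivatives and the power of the Laplacian turn into the symbols \<open>p\<close> and
  \<open>q\<close>, so \<open>B0\<close> is a difference of two triple products. The kernel found in
  this way carries the power of the norm on one frequency only; averaging with the swapped variables
  yields \<open>kap\<close>.\<close>

lemma B0_formula:
  assumes \<delta>: "0 \<le> \<delta>" "\<delta> \<le> 1" and \<psi>: "\<psi> \<in> schwartz" and f: "f \<in> schwartz0"
  shows "B0 \<delta> \<psi> f = complex_of_real ((1 / (2 * pi)\<^sup>2)\<^sup>2) * Bil (- 1 + \<delta>) \<psi> (fourier f) (fourier f)"
proof -
  define \<sigma> where "\<sigma> = - 1 + \<delta>"
  have \<sigma>: "- 1 \<le> \<sigma>" "\<sigma> \<le> 0" using \<delta> by (auto simp: \<sigma>_def)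
  define a where "a = fourier f"
  have a: "cs0 a" unfolding a_def by (rule schwartz0_cs0[OF f])
  have fa: "f = inv_fourier a" unfolding a_def by (rule ext) (rule fourier_inversion[OF schwartz0_schwartz[OF f], symmetric])
  have am [measurable]: "a \<in> borel_measurable borel" by (intro schwartz_borel cs0_schwartz a)
  define m where "m \<xi> = complex_of_real (norm \<xi> powr (2 * \<sigma>))" for \<xi> :: plane
  have mm [measurable]: "m \<in> borel_measurable borel" unfolding m_def[abs_def] by measurable
  obtain K where K: "\<And>\<xi>. norm (m \<xi>) * norm (a \<xi>) \<le> K * norm (a \<xi>)"
    using cs0_powr_bound[OF a, of "2 * \<sigma>"] unfolding m_def by auto
  have w1: "integrable lborel (\<lambda>\<xi>. (1 + norm \<xi>) ^ N * norm (a \<xi>))" for N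
    by (rule schwartz_weight_integrable[OF cs0_schwartz[OF a]])
  have w2: "integrable lborel (\<lambda>\<xi>. (1 + norm \<xi>) ^ N * norm (m \<xi> * a \<xi>))" for N
    by (rule cs0_bounded_mult[OF a mm K])
  define p where "p l \<xi> = \<i> * complex_of_real (\<xi> $ l) * (m \<xi> * a \<xi>)" for l \<xi>
  define q where "q l \<xi> = \<i> * complex_of_real (\<xi> $ l) * a \<xi>" for l \<xi>
  have comp: "norm (\<i> * complex_of_real (\<xi> $ l)) \<le> (1 + norm \<xi>) ^ 1" for l and \<xi> :: plane
    using component_le_norm_cart[of \<xi> l] by (simp add: norm_mult)
  have pint: "integrable lborel (p l)" for l
    unfolding p_def[abs_def] by (rule integrable_of_weight[OF _ w2 _ comp]) measurable
  have qint: "integrable lborel (q l)" for l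
    unfolding q_def[abs_def] by (rule integrable_of_weight[OF _ w1 _ comp]) measurable
  have Y: "partial l f x = inv_fourier (q l) x" for l x
  proof -
    have "dir_deriv (axis l 1) (inv_fourier a) x = inv_fourier (\<lambda>\<xi>. \<i> * complex_of_real (\<xi> \<bullet> axis l 1) * a \<xi>) x"
      by (rule dir_deriv_eq[OF has_derivative_inv_fourier[OF am w1]])
    then show ?thesis unfolding partial_def fa[symmetric] q_def[abs_def] inner_axis_one .
  qed
  have X: "partial l (neg_laplacian_power \<sigma> f) x = inv_fourier (p l) x" for l x
  proof -
    have "neg_laplacian_power \<sigma> f = inv_fourier (\<lambda>\<xi>. m \<xi> * a \<xi>)"
      unfolding neg_laplacian_power_def multiplier_def m_def a_def ..
    moreover have "dir_deriv (axis l 1) (inv_fourier (\<lambda>\<xi>. m \<xi> * a \<xi>)) x = inv_fourier (\<lambda>\<xi>. \<i> * complex_of_real (\<xi> \<bullet> axis l 1) * (m \<xi> * a \<xi>)) x"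
      by (rule dir_deriv_eq[OF has_derivative_inv_fourier[OF _ w2]]) measurable
    ultimately show ?thesis unfolding partial_def p_def[abs_def] inner_axis_one by simp
  qed
  have V: "(\<Sum>l\<in>UNIV. velocity \<delta> l f x * partial l f x) = inv_fourier (p 1) x * inv_fourier (q 2) x - inv_fourier (p 2) x * inv_fourier (q 1) x" for x
    unfolding velocity_def sum_2 X[unfolded \<sigma>_def] Y eps_def by simp
  note T = triple_product[OF schwartz_integrable[OF \<psi>] pint qint]
  define c2 where "c2 = complex_of_real ((1 / (2 * pi)\<^sup>2)\<^sup>2)"
  let ?t = "\<lambda>l k z. fourier \<psi> (- (fst z + snd z)) * p l (fst z) * q k (snd z)"
  have Fm [measurable]: "fourier \<psi> \<in> borel_measurable borel" by (intro schwartz_borel schwartz_fourier \<psi>)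
  have tint: "integrable LL (?t l k)" for l k
  proof (rule integrable_pair_bound[OF integrable_mult_right[OF integrable_norm[OF pint], of "LINT x|lborel. norm (\<psi> x)"] integrable_norm[OF qint]])
    show "norm (fourier \<psi> (- (fst (x, y) + snd (x, y))) * p l (fst (x, y)) * q k (snd (x, y))) \<le> (LINT x|lborel. norm (\<psi> x)) * norm (p l x) * norm (q k y)" for x y
      unfolding norm_mult fst_conv snd_conv by (intro mult_right_mono norm_fourier_le) auto
    show "?t l k \<in> borel_measurable LL" unfolding p_def q_def by measurable
  qed
  let ?T = "\<lambda>z. ?t 1 2 z - ?t 2 1 z"
  have Tint: "integrable LL ?T" by (intro Bochner_Integration.integrable_diff tint)
  have "B0 \<delta> \<psi> f = (LINT x|lborel. \<psi> x * (inv_fourier (p 1) x * inv_fourier (q 2) x) - \<psi> x * (inv_fourier (p 2) x * inv_fourier (q 1) x))"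
    unfolding B0_def V by (simp only: right_diff_distrib)
  also have "\<dots> = c2 * (LINT z|LL. ?t 1 2 z) - c2 * (LINT z|LL. ?t 2 1 z)"
    unfolding Bochner_Integration.integral_diff[OF T(1) T(1)] T(2) c2_def ..
  also have "\<dots> = c2 * (LINT z|LL. ?T z)"
    by (simp only: Bochner_Integration.integral_diff[OF tint tint] right_diff_distrib)
  finally have B: "B0 \<delta> \<psi> f = c2 * (LINT z|LL. ?T z)" .
  have swap_int: "integrable LL (\<lambda>(x, y). ?T (y, x))" by (rule lborel_pair.integrable_product_swap[OF Tint])
  have swap: "(LINT (x, y)|LL. ?T (y, x)) = (LINT z|LL. ?T z)"
    by (rule lborel_pair.integral_product_swap) (use Tint in \<open>rule borel_measurable_integrable\<close>)
  \<comment> \<open>Swapping the variables preserves the integral and reverses the sign of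
    \<open>cross2\<close>, so the sum contains the difference of the two powers. The factor 2
    compensates the half in \<open>kap\<close>.\<close>
  have "2 * bil \<sigma> \<psi> a a z = ?T z + (case z of (x, y) \<Rightarrow> ?T (y, x))" for z
  proof (cases z)
    case (Pair \<xi> \<eta>)
    have i: "\<i> * x * y * (\<i> * z * w) = - (x * y * z * w)" for x y z w :: complex
      by (simp add: complex_eq_iff algebra_simps)
    define F where "F = fourier \<psi> (- (\<xi> + \<eta>))"
    have F2: "fourier \<psi> (- (\<eta> + \<xi>)) = F" unfolding F_def by (simp only: add.commute)
    show ?thesis unfolding Pair bil_def kap_def cross2_def p_def q_def m_def fst_conv snd_conv prod.case F_def[symmetric] F2
      by (simp add: i mult.assoc[of F]) (simp add: algebra_simps)
  qed
  then have "2 * Bil \<sigma> \<psi> a a = (LINT z|LL. ?T z + (case z of (x, y) \<Rightarrow> ?T (y, x)))"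
    unfolding Bil_def integral_mult_right_zero[symmetric] by simp
  also have "\<dots> = (LINT z|LL. ?T z) + (LINT z|LL. ?T z)"
    unfolding Bochner_Integration.integral_add[OF Tint swap_int] swap ..
  finally have "Bil \<sigma> \<psi> a a = (LINT z|LL. ?T z)" by simp
  then show ?thesis unfolding B c2_def \<sigma>_def a_def by simp
qed

section \<open>Comparison of the Littlewood--Paley norm with the weighted Fourier norm\<close>

context
  fixes h :: "plane \<Rightarrow> complex"
  assumes h: "LP_symbol h"
begin

text \<open>Plancherel for one annular piece. The constant stands on the left to avoid a division in
  \<open>ennreal\<close>.\<close>

lemma L2_P_eq_schwartz:
  assumes f: "f \<in> schwartz"
  shows "ennreal ((2 * pi)\<^sup>2) * L2_norm_sq (P_eq h q (of_function f)) = (\<integral>\<^sup>+\<xi>. ennreal ((norm (ps h q \<xi>))\<^sup>2 * (norm (fourier f \<xi>))\<^sup>2) \<partial>lborel)"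
proof -
  let ?g = "\<lambda>\<xi>. ps h q \<xi> * fourier f \<xi>"
  note S = ps_schwartz[OF h, of q]
  have gS: "?g \<in> schwartz" by (intro schwartz_mult S schwartz_fourier f)
  have "P_eq h q (of_function f) k = of_function (inv_fourier ?g) k" if k: "k \<in> schwartz" for k
  proof -
    have "P_eq h q (of_function f) k = (LINT x|lborel. f x * mop (ps h q) k x)"
      unfolding P_eq_ps[OF h linear_of_schwartz[OF f] k] by (simp only: of_function_def)
    also have "\<dots> = (LINT \<xi>|lborel. fourier f \<xi> * (ps h q \<xi> * inv_fourier k \<xi>))"
      unfolding mop_def by (rule fourier_transfer[OF schwartz_integrable[OF f] schwartz_integrable[OF schwartz_mult[OF S schwartz_inv_fourier[OF k]]], symmetric])
    also have "\<dots> = (LINT \<xi>|lborel. ?g \<xi> * inv_fourier k \<xi>)" by (simp only: mult_ac)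
    also have "\<dots> = of_function (inv_fourier ?g) k"
      unfolding of_function_def by (rule inv_fourier_transfer[OF schwartz_integrable[OF gS] schwartz_integrable[OF k], symmetric])
    finally show ?thesis .
  qed
  then have "L2_norm_sq (P_eq h q (of_function f)) = l2 (inv_fourier ?g)"
    by (rule L2_norm_sq_schwartz[OF schwartz_inv_fourier[OF gS]])
  also have "\<dots> = ennreal ((LINT \<xi>|lborel. (norm (?g \<xi>))\<^sup>2) / (2 * pi)\<^sup>2)"
    unfolding schwartz_l2[OF schwartz_inv_fourier[OF gS]] plancherel_inv[OF gS] ..
  finally have "ennreal ((2 * pi)\<^sup>2) * L2_norm_sq (P_eq h q (of_function f)) = ennreal (LINT \<xi>|lborel. (norm (?g \<xi>))\<^sup>2)"
    by (simp flip: ennreal_mult)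
  also have "\<dots> = (\<integral>\<^sup>+\<xi>. ennreal ((norm (?g \<xi>))\<^sup>2) \<partial>lborel)"
    by (rule nn_integral_eq_integral[OF schwartz_square_integrable[OF gS], symmetric]) simp
  finally show ?thesis by (simp add: norm_mult power_mult_distrib)
qed

lemma two_terms_le_count_space:
  fixes F :: "int \<Rightarrow> ennreal"
  shows "F q + F (q - 1) \<le> (\<integral>\<^sup>+j. F j \<partial>count_space UNIV)"
proof -
  have "F q + F (q - 1) = (\<integral>\<^sup>+j. F j \<partial>count_space {q, q - 1})"
    by (subst nn_integral_count_space_finite) auto
  also have "\<dots> = (\<integral>\<^sup>+j. F j * indicator {q, q - 1} j \<partial>count_space UNIV)"
    by (rule nn_integral_count_space_indicator) simp
  also have "\<dots> \<le> (\<integral>\<^sup>+j. F j \<partial>count_space UNIV)"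
    by (intro nn_integral_mono) (auto simp: indicator_def)
  finally show ?thesis .
qed

lemma wt_powr: "wt s q = ennreal (2 powr (2 * s * real_of_int q))"
proof -
  have "(2::real) powr (2 * s * real_of_int q) = 2 powr (s * real_of_int q) * 2 powr (s * real_of_int q)"
    by (simp only: powr_add[symmetric] mult_2 distrib_right)
  then show ?thesis unfolding wt_def by (simp only: power2_eq_square) (rule ennreal_mult[symmetric], simp_all)
qed

text \<open>Two neighbouring annuli cover each frequency, so the Littlewood--Paley norm controls the weighted norm.\<close>

lemma wn_pointwise:
  assumes \<sigma>: "- 1 \<le> \<sigma>" "\<sigma> \<le> 0" and \<xi>: "\<xi> \<noteq> 0"
  shows "ennreal (norm \<xi> powr (2 * \<sigma>)) \<le> 8 * (\<integral>\<^sup>+q. wt \<sigma> q * ennreal ((norm (ps h q \<xi>))\<^sup>2) \<partial>count_space UNIV)"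
proof -
  \<comment> \<open>Rounding the logarithm up makes \<open>hs h (q + 1)\<close> one and
    \<open>hs h (q - 1)\<close> zero at \<xi>; the two pieces between these levels therefore add up
    to one.\<close>
  define q where "q = \<lceil>log 2 (norm \<xi>)\<rceil>"
  have n: "0 < norm \<xi>" using \<xi> by simp
  have q1: "real_of_int q - 1 < log 2 (norm \<xi>)" "log 2 (norm \<xi>) \<le> real_of_int q"
    unfolding q_def by linarith+
  have q: "2 powr (real_of_int q - 1) < norm \<xi>" "norm \<xi> \<le> 2 powr real_of_int q"
    using q1 n by (simp_all add: less_log_iff log_le_iff)
  have "hs h (q + 1) \<xi> = 1" by (rule hs_one[OF h]) (use q in simp)
  moreover have "hs h (q - 1) \<xi> = 0" by (rule hs_zero[OF h]) (use q in simp)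
  ultimately have "ps h q \<xi> + ps h (q - 1) \<xi> = 1" by (simp add: ps_def)
  then have "1 = (norm (ps h q \<xi> + ps h (q - 1) \<xi>))\<^sup>2" by simp
  also have "\<dots> \<le> (norm (ps h q \<xi>) + norm (ps h (q - 1) \<xi>))\<^sup>2"
    by (intro power_mono norm_triangle_ineq) simp
  also have "\<dots> \<le> 2 * (norm (ps h q \<xi>))\<^sup>2 + 2 * (norm (ps h (q - 1) \<xi>))\<^sup>2"
    using zero_le_power2[of "norm (ps h q \<xi>) - norm (ps h (q - 1) \<xi>)"] by (simp add: power2_sum power2_diff)
  finally have one: "1 \<le> 2 * (norm (ps h q \<xi>))\<^sup>2 + 2 * (norm (ps h (q - 1) \<xi>))\<^sup>2" .
  define W where "W j = 2 powr (2 * \<sigma> * real_of_int j)" for j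
  have W0: "0 \<le> W j" for j by (simp add: W_def)
  have "norm \<xi> powr (2 * \<sigma>) \<le> (2 powr (real_of_int q - 1)) powr (2 * \<sigma>)"
    using q \<sigma> by (intro powr_mono2') auto
  also have "\<dots> = W (q - 1)" by (simp add: W_def powr_powr mult.commute)
  finally have up: "norm \<xi> powr (2 * \<sigma>) \<le> W (q - 1)" .
  have "W (q - 1) = 2 powr (- 2 * \<sigma>) * W q" by (simp add: W_def powr_add[symmetric] algebra_simps)
  also have "\<dots> \<le> 2 powr 2 * W q" using \<sigma> by (intro mult_right_mono W0 powr_mono) auto
  finally have W4: "W (q - 1) \<le> 4 * W q" by simp
  have "norm \<xi> powr (2 * \<sigma>) \<le> W (q - 1) * (2 * (norm (ps h q \<xi>))\<^sup>2 + 2 * (norm (ps h (q - 1) \<xi>))\<^sup>2)"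
    using mult_mono[OF up one W0[of "q - 1"]] by simp
  \<comment> \<open>The 8 is 2 from squaring a sum of two pieces, times 4, which bounds the ratio of
    neighbouring weights because \<open>- \<sigma> \<le> 1\<close>.\<close>
  also have "\<dots> \<le> 8 * (W q * (norm (ps h q \<xi>))\<^sup>2 + W (q - 1) * (norm (ps h (q - 1) \<xi>))\<^sup>2)"
  proof -
    have "W (q - 1) * (norm (ps h q \<xi>))\<^sup>2 \<le> 4 * W q * (norm (ps h q \<xi>))\<^sup>2" by (intro mult_right_mono W4) simp
    moreover have "0 \<le> W (q - 1) * (norm (ps h (q - 1) \<xi>))\<^sup>2" using W0 by simp
    ultimately show ?thesis by (simp add: algebra_simps)
  qed
  finally have "ennreal (norm \<xi> powr (2 * \<sigma>)) \<le> ennreal (8 * (W q * (norm (ps h q \<xi>))\<^sup>2 + W (q - 1) * (norm (ps h (q - 1) \<xi>))\<^sup>2))"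
    by (rule ennreal_leI)
  also have "\<dots> = 8 * (wt \<sigma> q * ennreal ((norm (ps h q \<xi>))\<^sup>2) + wt \<sigma> (q - 1) * ennreal ((norm (ps h (q - 1) \<xi>))\<^sup>2))"
  proof -
    have "wt \<sigma> j = ennreal (W j)" for j by (simp only: wt_powr W_def)
    then show ?thesis using W0 by (simp add: ennreal_mult)
  qed
  also have "\<dots> \<le> 8 * (\<integral>\<^sup>+q. wt \<sigma> q * ennreal ((norm (ps h q \<xi>))\<^sup>2) \<partial>count_space UNIV)"
    by (intro mult_left_mono two_terms_le_count_space) simp
  finally show ?thesis .
qed

text \<open>\<open>wn_pointwise\<close> integrated over all frequencies, with Tonelli exchanging the
  sum over annuli and the integral. The origin causes no trouble because the transform vanishes
  there.\<close>

lemma wn_le_Hdot: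
  assumes \<sigma>: "- 1 \<le> \<sigma>" "\<sigma> \<le> 0" and f: "f \<in> schwartz0"
  shows "wn \<sigma> (fourier f) \<le> ennreal (8 * (2 * pi)\<^sup>2) * Hdot_norm_sq h \<sigma> (of_function f)"
proof -
  note fS = schwartz0_schwartz[OF f]
  let ?a = "fourier f"
  have [measurable]: "?a \<in> borel_measurable borel" "ps h q \<in> borel_measurable borel" for q
    by (intro schwartz_borel schwartz_fourier fS ps_schwartz[OF h])+
  have "wn \<sigma> ?a \<le> (\<integral>\<^sup>+\<xi>. \<integral>\<^sup>+q. 8 * (wt \<sigma> q * ennreal ((norm (ps h q \<xi>))\<^sup>2 * (norm (?a \<xi>))\<^sup>2)) \<partial>count_space UNIV \<partial>lborel)"
    unfolding wn_def
  proof (intro nn_integral_mono)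
    fix \<xi> :: plane
    show "ennreal (norm \<xi> powr (2 * \<sigma>) * (norm (?a \<xi>))\<^sup>2) \<le> (\<integral>\<^sup>+q. 8 * (wt \<sigma> q * ennreal ((norm (ps h q \<xi>))\<^sup>2 * (norm (?a \<xi>))\<^sup>2)) \<partial>count_space UNIV)"
    proof (cases "\<xi> = 0")
      case True
      then show ?thesis using cs0_zero[OF schwartz0_cs0[OF f]] by simp
    next
      case False
      have "ennreal (norm \<xi> powr (2 * \<sigma>) * (norm (?a \<xi>))\<^sup>2) = ennreal (norm \<xi> powr (2 * \<sigma>)) * ennreal ((norm (?a \<xi>))\<^sup>2)"
        by (rule ennreal_mult) auto
      also have "\<dots> \<le> (8 * (\<integral>\<^sup>+q. wt \<sigma> q * ennreal ((norm (ps h q \<xi>))\<^sup>2) \<partial>count_space UNIV)) * ennreal ((norm (?a \<xi>))\<^sup>2)"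
        by (intro mult_right_mono wn_pointwise[OF \<sigma> False]) simp
      also have "\<dots> = (\<integral>\<^sup>+q. 8 * (wt \<sigma> q * ennreal ((norm (ps h q \<xi>))\<^sup>2)) * ennreal ((norm (?a \<xi>))\<^sup>2) \<partial>count_space UNIV)"
        by (simp add: nn_integral_cmult nn_integral_multc)
      finally show ?thesis by (simp add: ennreal_mult mult.assoc)
    qed
  qed
  also have "\<dots> = (\<integral>\<^sup>+q. \<integral>\<^sup>+\<xi>. 8 * (wt \<sigma> q * ennreal ((norm (ps h q \<xi>))\<^sup>2 * (norm (?a \<xi>))\<^sup>2)) \<partial>lborel \<partial>count_space UNIV)"
    by (rule nn_integral_count_space_nn_integral) simp_all
  also have "\<dots> = (\<integral>\<^sup>+q. 8 * (wt \<sigma> q * (ennreal ((2 * pi)\<^sup>2) * L2_norm_sq (P_eq h q (of_function f)))) \<partial>count_space UNIV)"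
    unfolding L2_P_eq_schwartz[OF fS] by (simp add: nn_integral_cmult)
  also have "\<dots> = (\<integral>\<^sup>+q. ennreal (8 * (2 * pi)\<^sup>2) * (wt \<sigma> q * L2_norm_sq (P_eq h q (of_function f))) \<partial>count_space UNIV)"
    by (simp add: ennreal_mult mult_ac)
  also have "\<dots> = ennreal (8 * (2 * pi)\<^sup>2) * Hdot_norm_sq h \<sigma> (of_function f)"
    unfolding Hdot_norm_sq_nn by (rule nn_integral_cmult) simp
  finally show ?thesis .
qed

lemma wn_add:
  assumes [measurable]: "a \<in> borel_measurable borel" "b \<in> borel_measurable borel"
  shows "wn \<sigma> (\<lambda>\<xi>. a \<xi> + b \<xi>) \<le> 2 * wn \<sigma> a + 2 * wn \<sigma> b"
proof -
  have "norm \<xi> powr (2 * \<sigma>) * (norm (a \<xi> + b \<xi>))\<^sup>2 \<le> 2 * (norm \<xi> powr (2 * \<sigma>) * (norm (a \<xi>))\<^sup>2) + 2 * (norm \<xi> powr (2 * \<sigma>) * (norm (b \<xi>))\<^sup>2)" for \<xi>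
  proof -
    have "(norm (a \<xi> + b \<xi>))\<^sup>2 \<le> (norm (a \<xi>) + norm (b \<xi>))\<^sup>2"
      by (intro power_mono norm_triangle_ineq) simp
    also have "\<dots> \<le> 2 * (norm (a \<xi>))\<^sup>2 + 2 * (norm (b \<xi>))\<^sup>2"
      using zero_le_power2[of "norm (a \<xi>) - norm (b \<xi>)"] by (simp add: power2_sum power2_diff)
    finally have "norm \<xi> powr (2 * \<sigma>) * (norm (a \<xi> + b \<xi>))\<^sup>2 \<le> norm \<xi> powr (2 * \<sigma>) * (2 * (norm (a \<xi>))\<^sup>2 + 2 * (norm (b \<xi>))\<^sup>2)"
      by (rule mult_left_mono) simp
    then show ?thesis by (simp add: algebra_simps)
  qed
  then have "wn \<sigma> (\<lambda>\<xi>. a \<xi> + b \<xi>) \<le> (\<integral>\<^sup>+\<xi>. ennreal (2 * (norm \<xi> powr (2 * \<sigma>) * (norm (a \<xi>))\<^sup>2) + 2 * (norm \<xi> powr (2 * \<sigma>) * (norm (b \<xi>))\<^sup>2)) \<partial>lborel)"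
    unfolding wn_def by (intro nn_integral_mono ennreal_leI)
  also have "\<dots> = (\<integral>\<^sup>+\<xi>. 2 * ennreal (norm \<xi> powr (2 * \<sigma>) * (norm (a \<xi>))\<^sup>2) + 2 * ennreal (norm \<xi> powr (2 * \<sigma>) * (norm (b \<xi>))\<^sup>2) \<partial>lborel)"
    by (intro nn_integral_cong) (simp add: ennreal_mult'[of 2, simplified])
  also have "\<dots> = 2 * wn \<sigma> a + 2 * wn \<sigma> b"
    unfolding wn_def by (simp add: nn_integral_add nn_integral_cmult)
  finally show ?thesis .
qed

text \<open>Each of the two arguments of the form contributes \<open>8 * (2 * pi)\<^sup>2\<close>
  from \<open>wn_le_Hdot\<close>; the extra 2 comes from the bound of \<open>wn\<close> for a
  sum.\<close>

definition CB :: real where "CB = 2 * (8 * (2 * pi)\<^sup>2)\<^sup>2"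

lemma CB_pos: "0 < CB" by (simp add: CB_def)

lemma norm_c2_le: "(norm (complex_of_real ((1 / (2 * pi)\<^sup>2)\<^sup>2)))\<le> 1"
proof -
  have "1 \<le> (2 * pi)\<^sup>2" using pi_gt3 by (intro one_le_power) simp
  then have "1 / (2 * pi)\<^sup>2 \<le> 1" by simp
  then have "(1 / (2 * pi)\<^sup>2)\<^sup>2 \<le> 1\<^sup>2" by (intro power_mono) auto
  then show ?thesis unfolding norm_of_real by simp
qed

text \<open>The difference of two values of the quadratic form is the bilinear form at the
  difference and the sum of the transforms. Since \<open>schwartz0\<close> is closed under
  differences, the first argument is controlled by the norm of the difference of the functionals.
  This makes the quadratic form Lipschitz on bounded sets.\<close>

lemma B0_difference_bound:
  assumes \<delta>: "0 \<le> \<delta>" "\<delta> \<le> 1" and \<psi>: "\<psi> \<in> schwartz" and f: "f \<in> schwartz0" and g: "g \<in> schwartz0"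
  shows "(ennreal (norm (B0 \<delta> \<psi> f - B0 \<delta> \<psi> g)))\<^sup>2 \<le> ennreal (CB * (wiener \<psi>)\<^sup>2)
     * (Hdot_norm_sq h (- 1 + \<delta>) (\<lambda>k. of_function f k - of_function g k)
     * (Hdot_norm_sq h (- 1 + \<delta>) (of_function f) + Hdot_norm_sq h (- 1 + \<delta>) (of_function g)))"
proof -
  let ?s = "- 1 + \<delta>"
  have s: "- 1 \<le> ?s" "?s \<le> 0" using \<delta> by auto
  let ?a = "fourier f" and ?b = "fourier g"
  let ?H = "\<lambda>u. Hdot_norm_sq h ?s u"
  let ?C = "ennreal (8 * (2 * pi)\<^sup>2)" and ?m = "\<lambda>\<xi>. ?a \<xi> - ?b \<xi>" and ?p = "\<lambda>\<xi>. ?a \<xi> + ?b \<xi>"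
  let ?d = "\<lambda>k. of_function f k - of_function g k"
  note a = schwartz0_cs0[OF f] and b = schwartz0_cs0[OF g]
  have d: "cs0 ?m" and p: "cs0 ?p"
    using cs0_linear[OF a b, of 1 "- 1"] cs0_linear[OF a b, of 1 1] by simp_all
  define e where "e = (\<lambda>x. f x - g x)"
  have Fe: "fourier e = ?m"
    unfolding e_def by (rule ext) (rule fourier_diff[OF schwartz_integrable[OF schwartz0_schwartz[OF f]] schwartz_integrable[OF schwartz0_schwartz[OF g]]])
  have eS: "e \<in> schwartz" unfolding e_def by (intro schwartz_diff schwartz0_schwartz f g)
  have e0: "e \<in> schwartz0"
  proof -
    obtain r R where "r > 0" "\<And>\<xi>. fourier e \<xi> \<noteq> 0 \<Longrightarrow> r \<le> norm \<xi> \<and> norm \<xi> \<le> R"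
      using d unfolding cs0_def Fe[symmetric] by metis
    from schwartz0I[OF schwartz_fourier[OF eS] this] show ?thesis
      using fourier_inversion[OF eS] by (metis ext)
  qed
  have "?H (of_function e) = ?H ?d"
  proof (rule Hdot_norm_sq_cong[OF _ h])
    fix k assume k: "k \<in> schwartz"
    have i: "integrable lborel (\<lambda>x. f x * k x)" "integrable lborel (\<lambda>x. g x * k x)"
      by (intro schwartz_integrable schwartz_mult schwartz0_schwartz f g k)+
    show "of_function e k = of_function f k - of_function g k"
      unfolding of_function_def e_def left_diff_distrib by (rule Bochner_Integration.integral_diff[OF i])
  qed
  then have wd: "wn ?s ?m \<le> ?C * ?H ?d"
    using wn_le_Hdot[OF s e0] unfolding Fe by simp
  have "wn ?s ?p \<le> 2 * wn ?s ?a + 2 * wn ?s ?b"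
    by (intro wn_add schwartz_borel cs0_schwartz a b)
  also have "\<dots> \<le> 2 * (?C * ?H (of_function f)) + 2 * (?C * ?H (of_function g))"
    by (intro add_mono mult_left_mono wn_le_Hdot s f g) auto
  also have "\<dots> = 2 * ?C * (?H (of_function f) + ?H (of_function g))"
    by (simp only: distrib_left mult.assoc)
  finally have wp: "wn ?s ?p \<le> 2 * ?C * (?H (of_function f) + ?H (of_function g))" .
  have "B0 \<delta> \<psi> f - B0 \<delta> \<psi> g = complex_of_real ((1 / (2 * pi)\<^sup>2)\<^sup>2) * Bil ?s \<psi> ?m ?p"
    unfolding B0_formula[OF \<delta> \<psi> f] B0_formula[OF \<delta> \<psi> g] right_diff_distrib[symmetric] Bil_diff_squares[OF s \<psi> a b] ..
  then have "norm (B0 \<delta> \<psi> f - B0 \<delta> \<psi> g) \<le> norm (Bil ?s \<psi> ?m ?p)"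
    using mult_right_mono[OF norm_c2_le norm_ge_zero[of "Bil ?s \<psi> ?m ?p"]]
    by (simp only: norm_mult mult_1)
  then have "(ennreal (norm (B0 \<delta> \<psi> f - B0 \<delta> \<psi> g)))\<^sup>2 \<le> (ennreal (norm (Bil ?s \<psi> ?m ?p)))\<^sup>2"
    by (intro power_mono ennreal_leI) auto
  also have "\<dots> \<le> ennreal ((wiener \<psi>)\<^sup>2) * wn ?s ?m * wn ?s ?p"
    by (rule Bil_bound[OF s \<psi> d p])
  also have "\<dots> \<le> ennreal ((wiener \<psi>)\<^sup>2) * (?C * ?H ?d) * (2 * ?C * (?H (of_function f) + ?H (of_function g)))"
    by (intro mult_mono wd wp order_refl) auto
  also have "\<dots> = (ennreal ((wiener \<psi>)\<^sup>2) * (2 * (?C * ?C))) * (?H ?d * (?H (of_function f) + ?H (of_function g)))"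
    by (simp only: mult_ac)
  also have "ennreal ((wiener \<psi>)\<^sup>2) * (2 * (?C * ?C)) = ennreal (CB * (wiener \<psi>)\<^sup>2)"
  proof -
    have "?C * ?C = ennreal ((8 * (2 * pi)\<^sup>2)\<^sup>2)"
      unfolding power2_eq_square[of "8 * (2 * pi)\<^sup>2"] by (rule ennreal_mult[symmetric]) auto
    moreover have "2 * ennreal ((8 * (2 * pi)\<^sup>2)\<^sup>2) = ennreal CB"
      unfolding CB_def by (subst ennreal_mult) auto
    ultimately show ?thesis using CB_pos by (simp add: ennreal_mult mult.commute)
  qed
  finally show ?thesis .
qed

lemma B0_linear:
  assumes \<delta>: "0 \<le> \<delta>" "\<delta> \<le> 1" and \<psi>: "\<psi> \<in> schwartz" "\<phi> \<in> schwartz" and f: "f \<in> schwartz0"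
  shows "B0 \<delta> (\<lambda>x. c * \<psi> x + d * \<phi> x) f = c * B0 \<delta> \<psi> f + d * B0 \<delta> \<phi> f"
  unfolding B0_formula[OF \<delta> \<psi>(1) f] B0_formula[OF \<delta> \<psi>(2) f]
    B0_formula[OF \<delta> schwartz_add[OF schwartz_cmult[OF \<psi>(1)] schwartz_cmult[OF \<psi>(2)]] f]
  using Bil_linear_test[of "- 1 + \<delta>", OF _ _ \<psi> schwartz0_cs0[OF f] schwartz0_cs0[OF f], of c d] \<delta>
  by (simp add: distrib_left mult.left_commute)

end

section \<open>The nonlinearity on the homogeneous Sobolev space\<close>

lemma ennreal_power2_le_imp:
  assumes "(ennreal x)\<^sup>2 \<le> ennreal c * (a * b)" "a \<le> ennreal A" "b \<le> ennreal B'" "0 \<le> x" "0 \<le> c" "0 \<le> A" "0 \<le> B'"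
  shows "x\<^sup>2 \<le> c * (A * B')"
proof -
  have "ennreal (x\<^sup>2) = (ennreal x)\<^sup>2" using assms by (simp add: ennreal_power)
  also have "\<dots> \<le> ennreal c * (ennreal A * ennreal B')"
    by (rule order_trans[OF assms(1)]) (intro mult_left_mono mult_mono assms, simp_all)
  also have "\<dots> = ennreal (c * (A * B'))" using assms by (simp add: ennreal_mult)
  finally show ?thesis using assms by (simp add: ennreal_le_iff)
qed

lemma half_cancel: "0 < d \<Longrightarrow> d * (r / d / 2) = r / 2" for d r :: real
  by simp

locale msqg =
  fixes h :: "plane \<Rightarrow> complex" and \<delta> :: real
  assumes h: "LP_symbol h" and \<delta>0: "0 \<le> \<delta>" and \<delta>1: "\<delta> \<le> 1"
begin

abbreviation EE :: "functional \<Rightarrow> ennreal" where "EE u \<equiv> Hdot_norm_sq h (- 1 + \<delta>) u"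
abbreviation HH :: "functional set" where "HH \<equiv> Hdot h (- 1 + \<delta>)"

lemma CB0: "0 < CB" by (rule CB_pos[OF h])

lemma HH_D: "u \<in> HH \<Longrightarrow> linear_functional_on schwartz u" "u \<in> HH \<Longrightarrow> EE u < \<infinity>"
  by (auto simp: Hdot_def tempered_linear)

lemma EE_triangle: "EE (\<lambda>k. u k - w k) \<le> 2 * EE (\<lambda>k. u k - v k) + 2 * EE (\<lambda>k. w k - v k)"
  using Hdot_norm_sq_diff[of h "- 1 + \<delta>" "\<lambda>k. u k - v k" "\<lambda>k. w k - v k"] by simp

lemma EE_le: "EE u \<le> 2 * EE v + 2 * EE (\<lambda>k. u k - v k)"
  using Hdot_norm_sq_diff[of h "- 1 + \<delta>" v "\<lambda>k. v k - u k"] Hdot_norm_sq_swap[of h "- 1 + \<delta>" u v] by simp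

lemma EE_triangle_real:
  assumes "EE (\<lambda>k. u k - v k) \<le> ennreal x" "EE (\<lambda>k. w k - v k) \<le> ennreal y" "0 \<le> x" "0 \<le> y"
  shows "EE (\<lambda>k. u k - w k) \<le> ennreal (2 * x + 2 * y)"
proof -
  have "EE (\<lambda>k. u k - w k) \<le> 2 * ennreal x + 2 * ennreal y"
    by (rule order_trans[OF EE_triangle[of u w v]]) (intro add_mono mult_left_mono assms, simp_all)
  also have "\<dots> = ennreal (2 * x + 2 * y)" using assms by (simp add: ennreal_mult)
  finally show ?thesis .
qed

lemma EE_le_real:
  assumes "EE v \<le> ennreal y" "EE (\<lambda>k. u k - v k) \<le> ennreal x" "0 \<le> x" "0 \<le> y"
  shows "EE u \<le> ennreal (2 * y + 2 * x)"
proof -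
  have "EE u \<le> 2 * ennreal y + 2 * ennreal x"
    by (rule order_trans[OF EE_le[of u v]]) (intro add_mono mult_left_mono assms, simp_all)
  also have "\<dots> = ennreal (2 * y + 2 * x)" using assms by (simp add: ennreal_mult)
  finally show ?thesis .
qed

lemma B0_difference_real:
  assumes \<psi>: "\<psi> \<in> schwartz" and f: "f \<in> schwartz0" and g: "g \<in> schwartz0"
    and fg: "EE (\<lambda>k. of_function f k - of_function g k) \<le> ennreal x"
    and "EE (of_function f) \<le> ennreal y" "EE (of_function g) \<le> ennreal y" and x: "0 \<le> x" and y: "0 \<le> y"
  shows "(norm (B0 \<delta> \<psi> f - B0 \<delta> \<psi> g))\<^sup>2 \<le> (CB * (wiener \<psi>)\<^sup>2) * (x * (2 * y))"
proof (rule ennreal_power2_le_imp[OF B0_difference_bound[OF h \<delta>0 \<delta>1 \<psi> f g] fg])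
  have "EE (of_function f) + EE (of_function g) \<le> ennreal y + ennreal y" by (intro add_mono assms)
  then show "EE (of_function f) + EE (of_function g) \<le> ennreal (2 * y)" using y by (simp flip: ennreal_plus)
qed (use x y CB0 in \<open>auto simp: less_imp_le\<close>)

lemma zero_schwartz0: "(\<lambda>x. 0) \<in> schwartz0"
proof -
  have z: "(\<lambda>x::plane. 0::complex) \<in> schwartz" by (rule compact_support_schwartz[of _ "{}"]) (auto intro: smooth_const)
  moreover have "fourier (\<lambda>x::plane. 0) = (\<lambda>\<xi>. 0)" by (rule ext) (simp add: fourier_def)
  ultimately show ?thesis by (simp add: schwartz0_def supp_def)
qed

lemma B0_bound_real:
  assumes \<psi>: "\<psi> \<in> schwartz" and f: "f \<in> schwartz0" and E: "EE (of_function f) \<le> ennreal y" and y: "0 \<le> y"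
  shows "(norm (B0 \<delta> \<psi> f))\<^sup>2 \<le> (CB * (wiener \<psi>)\<^sup>2) * (y * (2 * y))"
proof -
  have z: "EE (of_function (\<lambda>x. 0)) \<le> ennreal y"
  proof -
    have "EE (of_function (\<lambda>x. 0)) = 0"
      unfolding Hdot_norm_sq_nn by (simp add: P_eq_mop of_function_def L2_norm_sq_zero)
    then show ?thesis by simp
  qed
  have "B0 \<delta> \<psi> (\<lambda>x. 0) = 0"
    unfolding B0_def by (simp add: partial_def)
  then show ?thesis
    using B0_difference_real[OF \<psi> f zero_schwartz0 _ E z y y] E by (simp add: of_function_def)
qed

definition approx :: "(nat \<Rightarrow> plane \<Rightarrow> complex) \<Rightarrow> functional \<Rightarrow> bool" where
  "approx f u \<longleftrightarrow> (\<forall>n. f n \<in> schwartz0) \<and> tendsto_Hdot h (- 1 + \<delta>) (\<lambda>n. of_function (f n)) u"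

lemma approx_exists: "u \<in> HH \<Longrightarrow> \<exists>f. approx f u"
  unfolding approx_def by (rule schwartz0_dense[OF h HH_D(1) HH_D(2)])

lemma approx_eventually:
  assumes "approx f u" "0 < e"
  shows "eventually (\<lambda>n. EE (\<lambda>k. of_function (f n) k - u k) \<le> ennreal e) sequentially"
proof -
  have "(\<lambda>n. EE (\<lambda>k. of_function (f n) k - u k)) \<longlonglongrightarrow> 0" using assms(1) by (simp add: approx_def tendsto_Hdot_def)
  then have "eventually (\<lambda>n. EE (\<lambda>k. of_function (f n) k - u k) < ennreal e) sequentially"
    by (rule order_tendstoD(2)) (use assms in simp)
  then show ?thesis by (rule eventually_mono) simp
qed

text \<open>Two functions within \<open>x\<close> of \<open>u\<close> are within
  \<open>4 * x\<close> of each other and have squared norm at most \<open>2 * y + 2 * x\<close>, all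
  by \<open>EE_triangle_real\<close> and \<open>EE_le_real\<close>; here \<open>u\<close> need not
  be given by a function.\<close>

lemma B0_close:
  assumes \<psi>: "\<psi> \<in> schwartz" and u: "EE u \<le> ennreal y" and f: "f \<in> schwartz0" and g: "g \<in> schwartz0"
    and fu: "EE (\<lambda>k. of_function f k - u k) \<le> ennreal x" and gu: "EE (\<lambda>k. of_function g k - u k) \<le> ennreal x"
    and x: "0 \<le> x" and y: "0 \<le> y"
  shows "(norm (B0 \<delta> \<psi> f - B0 \<delta> \<psi> g))\<^sup>2 \<le> (CB * (wiener \<psi>)\<^sup>2) * ((4 * x) * (2 * (2 * y + 2 * x)))"
proof -
  have "EE (\<lambda>k. of_function f k - of_function g k) \<le> ennreal (4 * x)"
    using EE_triangle_real[OF fu gu x x] by simp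
  from B0_difference_real[OF \<psi> f g this EE_le_real[OF u fu x y] EE_le_real[OF u gu x y]] x y
  show ?thesis by simp
qed

lemma B0_tendsto_unique:
  assumes \<psi>: "\<psi> \<in> schwartz" and u: "EE u < \<infinity>" and f: "approx f u" and g: "approx g u" and b: "(\<lambda>n. B0 \<delta> \<psi> (f n)) \<longlonglongrightarrow> b"
  shows "(\<lambda>n. B0 \<delta> \<psi> (g n)) \<longlonglongrightarrow> b"
proof -
  obtain y where y: "0 \<le> y" "EE u = ennreal y" using u by (cases "EE u") auto
  define C where "C = CB * (wiener \<psi>)\<^sup>2"
  have C: "0 \<le> C" using CB0 by (simp add: C_def)
  have "(\<lambda>n. (norm (B0 \<delta> \<psi> (g n) - B0 \<delta> \<psi> (f n)))\<^sup>2) \<longlonglongrightarrow> 0"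
  proof (rule LIMSEQ_I)
    fix r :: real assume r: "0 < r"
    \<comment> \<open>For \<open>x \<le> 1\<close> the right side of \<open>B0_close\<close> is at
      most \<open>16 * (C + 1) * (y + 1) * x\<close>, and the second entry of the minimum makes this
      at most \<open>r / 2\<close>. Adding 1 to \<open>C\<close> and \<open>y\<close> keeps the
      divisor positive.\<close>
    define x where "x = min 1 (r / (16 * (C + 1) * (y + 1)) / 2)"
    have d: "0 < 16 * (C + 1) * (y + 1)" using C y by simp
    have x: "0 < x" "x \<le> 1" "x \<le> r / (16 * (C + 1) * (y + 1)) / 2" using r d by (auto simp: x_def)
    have "C * ((4 * x) * (2 * (2 * y + 2 * x))) \<le> (C + 1) * ((4 * x) * (2 * (2 * y + 2 * 1)))"
      using C x y by (intro mult_mono) auto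
    also have "\<dots> = (16 * (C + 1) * (y + 1)) * x" by (simp add: algebra_simps)
    also have "\<dots> \<le> (16 * (C + 1) * (y + 1)) * (r / (16 * (C + 1) * (y + 1)) / 2)"
      by (rule mult_left_mono[OF x(3)]) (use d in simp)
    also have "\<dots> = r / 2" by (rule half_cancel[OF d])
    also have "\<dots> < r" using r by simp
    finally have small: "C * ((4 * x) * (2 * (2 * y + 2 * x))) < r" .
    have "eventually (\<lambda>n. EE (\<lambda>k. of_function (f n) k - u k) \<le> ennreal x \<and> EE (\<lambda>k. of_function (g n) k - u k) \<le> ennreal x) sequentially"
      by (intro eventually_conj approx_eventually f g x(1))
    then obtain N where N: "\<And>n. n \<ge> N \<Longrightarrow> EE (\<lambda>k. of_function (f n) k - u k) \<le> ennreal x \<and> EE (\<lambda>k. of_function (g n) k - u k) \<le> ennreal x"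
      unfolding eventually_sequentially by metis
    have "norm ((norm (B0 \<delta> \<psi> (g n) - B0 \<delta> \<psi> (f n)))\<^sup>2 - 0) < r" if "n \<ge> N" for n
    proof -
      have "(norm (B0 \<delta> \<psi> (g n) - B0 \<delta> \<psi> (f n)))\<^sup>2 \<le> C * ((4 * x) * (2 * (2 * y + 2 * x)))"
        unfolding C_def using N[OF that] f g x y by (intro B0_close[OF \<psi>, of u]) (auto simp: approx_def)
      with small show ?thesis by simp
    qed
    then show "\<exists>N. \<forall>n\<ge>N. norm ((norm (B0 \<delta> \<psi> (g n) - B0 \<delta> \<psi> (f n)))\<^sup>2 - 0) < r" by blast
  qed
  then have "(\<lambda>n. sqrt ((norm (B0 \<delta> \<psi> (g n) - B0 \<delta> \<psi> (f n)))\<^sup>2)) \<longlonglongrightarrow> sqrt 0" by (rule tendsto_real_sqrt)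
  then have "(\<lambda>n. B0 \<delta> \<psi> (g n) - B0 \<delta> \<psi> (f n)) \<longlonglongrightarrow> 0" by (simp add: tendsto_norm_zero_iff)
  from tendsto_add[OF this b] show ?thesis by simp
qed

lemma B0_convergent:
  assumes \<psi>: "\<psi> \<in> schwartz" and u: "EE u < \<infinity>" and f: "approx f u"
  shows "convergent (\<lambda>n. B0 \<delta> \<psi> (f n))"
proof -
  obtain y where y: "0 \<le> y" "EE u = ennreal y" using u by (cases "EE u") auto
  define C where "C = CB * (wiener \<psi>)\<^sup>2"
  have C: "0 \<le> C" using CB0 by (simp add: C_def)
  have "Cauchy (\<lambda>n. B0 \<delta> \<psi> (f n))"
  proof (rule CauchyI)
    fix r :: real assume r: "0 < r"
    define x where "x = min 1 (r\<^sup>2 / (16 * (C + 1) * (y + 1)) / 2)"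
    have d: "0 < 16 * (C + 1) * (y + 1)" using C y by simp
    have x: "0 < x" "x \<le> 1" "x \<le> r\<^sup>2 / (16 * (C + 1) * (y + 1)) / 2" using r d by (auto simp: x_def)
    have "C * ((4 * x) * (2 * (2 * y + 2 * x))) \<le> (C + 1) * ((4 * x) * (2 * (2 * y + 2 * 1)))"
      using C x y by (intro mult_mono) auto
    also have "\<dots> = (16 * (C + 1) * (y + 1)) * x" by (simp add: algebra_simps)
    also have "\<dots> \<le> (16 * (C + 1) * (y + 1)) * (r\<^sup>2 / (16 * (C + 1) * (y + 1)) / 2)"
      by (rule mult_left_mono[OF x(3)]) (use d in simp)
    also have "\<dots> = r\<^sup>2 / 2" by (rule half_cancel[OF d])
    also have "\<dots> < r\<^sup>2" using r by simp
    finally have small: "C * ((4 * x) * (2 * (2 * y + 2 * x))) < r\<^sup>2" .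
    obtain N where N: "\<And>n. n \<ge> N \<Longrightarrow> EE (\<lambda>k. of_function (f n) k - u k) \<le> ennreal x"
      using approx_eventually[OF f x(1)] unfolding eventually_sequentially by metis
    have "norm (B0 \<delta> \<psi> (f m) - B0 \<delta> \<psi> (f n)) < r" if "m \<ge> N" "n \<ge> N" for m n
    proof -
      have "(norm (B0 \<delta> \<psi> (f m) - B0 \<delta> \<psi> (f n)))\<^sup>2 \<le> C * ((4 * x) * (2 * (2 * y + 2 * x)))"
        unfolding C_def using N[OF that(1)] N[OF that(2)] f x y by (intro B0_close[OF \<psi>, of u]) (auto simp: approx_def)
      with small have "(norm (B0 \<delta> \<psi> (f m) - B0 \<delta> \<psi> (f n)))\<^sup>2 < r\<^sup>2" by linarith
      then show ?thesis by (rule power2_less_imp_less) (use r in simp)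
    qed
    then show "\<exists>M. \<forall>m\<ge>M. \<forall>n\<ge>M. norm (B0 \<delta> \<psi> (f m) - B0 \<delta> \<psi> (f n)) < r" by blast
  qed
  then show ?thesis by (rule Cauchy_convergent)
qed

text \<open>The limit exists by completeness and is independent of the sequence by
  \<open>B0_tendsto_unique\<close>. That \<open>THE\<close> describes a single number uses the
  presence of the approximating sequence \<open>f\<close>: with none, the condition would hold
  vacuously for every number.\<close>

lemma B_limit:
  assumes \<psi>: "\<psi> \<in> schwartz" and u: "u \<in> HH" and f: "approx f u"
  shows "(\<lambda>n. B0 \<delta> \<psi> (f n)) \<longlonglongrightarrow> B h \<delta> \<psi> u"
proof -
  note fin = HH_D(2)[OF u]
  obtain b where b: "(\<lambda>n. B0 \<delta> \<psi> (f n)) \<longlonglongrightarrow> b" using B0_convergent[OF \<psi> fin f] by (auto simp: convergent_def)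
  have all: "\<forall>g. (\<forall>n. g n \<in> schwartz0) \<and> tendsto_Hdot h (- 1 + \<delta>) (\<lambda>n. of_function (g n)) u \<longrightarrow> (\<lambda>n. B0 \<delta> \<psi> (g n)) \<longlonglongrightarrow> b"
  proof (intro allI impI)
    fix g assume "(\<forall>n. g n \<in> schwartz0) \<and> tendsto_Hdot h (- 1 + \<delta>) (\<lambda>n. of_function (g n)) u"
    then have "approx g u" by (simp add: approx_def)
    then show "(\<lambda>n. B0 \<delta> \<psi> (g n)) \<longlonglongrightarrow> b" by (rule B0_tendsto_unique[OF \<psi> fin f _ b])
  qed
  have "B h \<delta> \<psi> u = b"
    unfolding B_def
  proof (rule the_equality)
    show "\<forall>g. (\<forall>n. g n \<in> schwartz0) \<and> tendsto_Hdot h (- 1 + \<delta>) (\<lambda>n. of_function (g n)) u \<longrightarrow> (\<lambda>n. B0 \<delta> \<psi> (g n)) \<longlonglongrightarrow> b"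
      by (rule all)
    fix c assume c: "\<forall>g. (\<forall>n. g n \<in> schwartz0) \<and> tendsto_Hdot h (- 1 + \<delta>) (\<lambda>n. of_function (g n)) u \<longrightarrow> (\<lambda>n. B0 \<delta> \<psi> (g n)) \<longlonglongrightarrow> c"
    have "(\<lambda>n. B0 \<delta> \<psi> (f n)) \<longlonglongrightarrow> c" by (rule c[rule_format]) (use f in \<open>simp add: approx_def\<close>)
    then show "c = b" using b by (rule LIMSEQ_unique)
  qed
  with b show ?thesis by simp
qed

lemma B_linear:
  assumes \<psi>: "\<psi> \<in> schwartz" "\<phi> \<in> schwartz" and u: "u \<in> HH"
  shows "B h \<delta> (\<lambda>x. c * \<psi> x + d * \<phi> x) u = c * B h \<delta> \<psi> u + d * B h \<delta> \<phi> u"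
proof -
  obtain f where f: "approx f u" using approx_exists[OF u] by blast
  have "(\<lambda>n. B0 \<delta> (\<lambda>x. c * \<psi> x + d * \<phi> x) (f n)) \<longlonglongrightarrow> B h \<delta> (\<lambda>x. c * \<psi> x + d * \<phi> x) u"
    by (intro B_limit schwartz_add schwartz_cmult \<psi> u f)
  moreover have "(\<lambda>n. c * B0 \<delta> \<psi> (f n) + d * B0 \<delta> \<phi> (f n)) \<longlonglongrightarrow> c * B h \<delta> \<psi> u + d * B h \<delta> \<phi> u"
    by (intro tendsto_intros B_limit \<psi> u f)
  moreover have "B0 \<delta> (\<lambda>x. c * \<psi> x + d * \<phi> x) (f n) = c * B0 \<delta> \<psi> (f n) + d * B0 \<delta> \<phi> (f n)" for n
    by (rule B0_linear[OF h \<delta>0 \<delta>1 \<psi>]) (use f in \<open>simp add: approx_def\<close>)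
  ultimately show ?thesis using LIMSEQ_unique by simp
qed

text \<open>The error depends on the test function only through \<open>wiener \<psi>\<close>. One
  approximant can therefore serve a whole family of test functions with equal \<open>wiener\<close>
  value, as in \<open>B_angular_limit\<close>.\<close>

lemma B_close_B0:
  assumes \<psi>: "\<psi> \<in> schwartz" and u: "u \<in> HH" "EE u \<le> ennreal y" and g: "g \<in> schwartz0"
    and gu: "EE (\<lambda>k. of_function g k - u k) \<le> ennreal x" and x: "0 < x" and y: "0 \<le> y"
  shows "(norm (B h \<delta> \<psi> u - B0 \<delta> \<psi> g))\<^sup>2 \<le> (CB * (wiener \<psi>)\<^sup>2) * ((4 * x) * (2 * (2 * y + 2 * x)))"
proof -
  obtain f where f: "approx f u" using approx_exists[OF u(1)] by blast
  have l: "(\<lambda>n. (norm (B0 \<delta> \<psi> (f n) - B0 \<delta> \<psi> g))\<^sup>2) \<longlonglongrightarrow> (norm (B h \<delta> \<psi> u - B0 \<delta> \<psi> g))\<^sup>2"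
    by (intro tendsto_intros B_limit \<psi> u(1) f)
  have "eventually (\<lambda>n. (norm (B0 \<delta> \<psi> (f n) - B0 \<delta> \<psi> g))\<^sup>2 \<le> (CB * (wiener \<psi>)\<^sup>2) * ((4 * x) * (2 * (2 * y + 2 * x)))) sequentially"
    using approx_eventually[OF f x]
  proof (rule eventually_mono)
    fix n assume "EE (\<lambda>k. of_function (f n) k - u k) \<le> ennreal x"
    then show "(norm (B0 \<delta> \<psi> (f n) - B0 \<delta> \<psi> g))\<^sup>2 \<le> (CB * (wiener \<psi>)\<^sup>2) * ((4 * x) * (2 * (2 * y + 2 * x)))"
      using f x by (intro B0_close[OF \<psi> u(2) _ g _ gu _ y]) (auto simp: approx_def)
  qed
  then show ?thesis by (intro tendsto_upperbound[OF l]) auto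
qed

text \<open>An approximant within \<open>y\<close> of \<open>u\<close> has squared norm at most
  \<open>4 * y\<close>, and the product \<open>4 * y * (2 * (4 * y))\<close> is the origin of 32.
  Positivity of \<open>y\<close> guarantees that approximants within \<open>y\<close> exist;
  \<open>B_bound\<close> removes it by a small enlargement of \<open>y\<close>.\<close>

lemma B_bound_aux:
  assumes \<psi>: "\<psi> \<in> schwartz" and u: "u \<in> HH" "EE u \<le> ennreal y" and y: "0 < y"
  shows "norm (B h \<delta> \<psi> u) \<le> sqrt (32 * CB) * wiener \<psi> * y"
proof -
  obtain f where f: "approx f u" using approx_exists[OF u(1)] by blast
  have l: "(\<lambda>n. (norm (B0 \<delta> \<psi> (f n)))\<^sup>2) \<longlonglongrightarrow> (norm (B h \<delta> \<psi> u))\<^sup>2"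
    by (intro tendsto_intros B_limit \<psi> u(1) f)
  have "eventually (\<lambda>n. (norm (B0 \<delta> \<psi> (f n)))\<^sup>2 \<le> (CB * (wiener \<psi>)\<^sup>2) * (4 * y * (2 * (4 * y)))) sequentially"
    using approx_eventually[OF f y]
  proof (rule eventually_mono)
    fix n assume "EE (\<lambda>k. of_function (f n) k - u k) \<le> ennreal y"
    then have "EE (of_function (f n)) \<le> ennreal (4 * y)" using EE_le_real[OF u(2), of "of_function (f n)" y] y by simp
    then show "(norm (B0 \<delta> \<psi> (f n)))\<^sup>2 \<le> (CB * (wiener \<psi>)\<^sup>2) * (4 * y * (2 * (4 * y)))"
      using f y by (intro B0_bound_real[OF \<psi>]) (auto simp: approx_def)
  qed
  then have "(norm (B h \<delta> \<psi> u))\<^sup>2 \<le> (CB * (wiener \<psi>)\<^sup>2) * (4 * y * (2 * (4 * y)))"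
    by (intro tendsto_upperbound[OF l]) auto
  also have "\<dots> = (sqrt (32 * CB) * wiener \<psi> * y)\<^sup>2"
    using CB0 by (simp add: power_mult_distrib) (simp add: power2_eq_square)
  finally show ?thesis
    by (rule power2_le_imp_le) (use CB0 y wiener_nonneg[of \<psi>] in simp)
qed

lemma B_bound:
  assumes \<psi>: "\<psi> \<in> schwartz" and u: "u \<in> HH" "EE u \<le> ennreal y" and y: "0 \<le> y"
  shows "norm (B h \<delta> \<psi> u) \<le> sqrt (32 * CB) * wiener \<psi> * y"
proof (rule field_le_epsilon)
  fix e :: real assume e: "0 < e"
  define K where "K = sqrt (32 * CB) * wiener \<psi>"
  have K: "0 \<le> K" using CB0 wiener_nonneg[of \<psi>] by (simp add: K_def)
  define z where "z = y + e / (K + 1)"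
  have eK: "0 < e / (K + 1)" using e K by simp
  have z: "0 < z" "EE u \<le> ennreal z"
    using y eK by (simp add: z_def) (rule order_trans[OF u(2) ennreal_leI], use eK in \<open>simp add: z_def\<close>)
  have "norm (B h \<delta> \<psi> u) \<le> K * z" unfolding K_def by (rule B_bound_aux[OF \<psi> u(1) z(2,1)])
  also have "\<dots> = K * y + e * (K / (K + 1))" by (simp add: z_def distrib_left)
  also have "\<dots> \<le> K * y + e * 1" using e K by (intro add_left_mono mult_left_mono) auto
  finally show "norm (B h \<delta> \<psi> u) \<le> sqrt (32 * CB) * wiener \<psi> * y + e" by (simp add: K_def)
qed

text \<open>A diagonal choice: for each \<open>n\<close> a function from \<open>schwartz0\<close> is
  close to \<open>v n\<close> both in norm and in the value of the form. These functions approximate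
  \<open>u\<close>, so \<open>B_limit\<close> applies to them.\<close>

lemma B_continuous:
  assumes \<psi>: "\<psi> \<in> schwartz" and u: "u \<in> HH" and v: "\<And>n. v n \<in> HH" and lim: "(\<lambda>n. EE (\<lambda>k. v n k - u k)) \<longlonglongrightarrow> 0"
  shows "(\<lambda>n. B h \<delta> \<psi> (v n)) \<longlonglongrightarrow> B h \<delta> \<psi> u"
proof -
  have "\<exists>g. g \<in> schwartz0 \<and> EE (\<lambda>k. of_function g k - v n k) \<le> ennreal (1 / real (Suc n)) \<and> norm (B h \<delta> \<psi> (v n) - B0 \<delta> \<psi> g) \<le> 1 / real (Suc n)" for n
  proof -
    obtain f where f: "approx f (v n)" using approx_exists[OF v] by blast
    have "eventually (\<lambda>m. dist (B0 \<delta> \<psi> (f m)) (B h \<delta> \<psi> (v n)) < 1 / real (Suc n)) sequentially"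
      by (rule tendstoD[OF B_limit[OF \<psi> v f]]) simp
    then have "eventually (\<lambda>m. EE (\<lambda>k. of_function (f m) k - v n k) \<le> ennreal (1 / real (Suc n)) \<and> dist (B0 \<delta> \<psi> (f m)) (B h \<delta> \<psi> (v n)) < 1 / real (Suc n)) sequentially"
      by (intro eventually_conj approx_eventually[OF f]) simp_all
    then obtain m where m: "EE (\<lambda>k. of_function (f m) k - v n k) \<le> ennreal (1 / real (Suc n))" "dist (B0 \<delta> \<psi> (f m)) (B h \<delta> \<psi> (v n)) < 1 / real (Suc n)"
      using eventually_happens[of _ sequentially] by auto
    have "norm (B h \<delta> \<psi> (v n) - B0 \<delta> \<psi> (f m)) \<le> 1 / real (Suc n)"
      using m(2) by (simp add: dist_norm norm_minus_commute del: of_nat_Suc)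
    then show ?thesis using m(1) f by (auto simp: approx_def)
  qed
  then obtain g where g: "\<And>n. g n \<in> schwartz0" "\<And>n. EE (\<lambda>k. of_function (g n) k - v n k) \<le> ennreal (1 / real (Suc n))"
    "\<And>n. norm (B h \<delta> \<psi> (v n) - B0 \<delta> \<psi> (g n)) \<le> 1 / real (Suc n)" by metis
  have l1: "(\<lambda>n. 1 / real (Suc n)) \<longlonglongrightarrow> 0" by (rule LIMSEQ_Suc[OF lim_1_over_n])
  have "EE (\<lambda>k. of_function (g n) k - u k) \<le> 2 * ennreal (1 / real (Suc n)) + 2 * EE (\<lambda>k. v n k - u k)" for n
  proof -
    have "EE (\<lambda>k. of_function (g n) k - u k) \<le> 2 * EE (\<lambda>k. of_function (g n) k - v n k) + 2 * EE (\<lambda>k. u k - v n k)"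
      by (rule EE_triangle)
    also have "EE (\<lambda>k. u k - v n k) = EE (\<lambda>k. v n k - u k)" by (rule Hdot_norm_sq_swap)
    finally show ?thesis using g(2)[of n] by (meson add_right_mono mult_left_mono order_trans zero_le)
  qed
  moreover have "(\<lambda>n. 2 * ennreal (1 / real (Suc n)) + 2 * EE (\<lambda>k. v n k - u k)) \<longlonglongrightarrow> 2 * ennreal 0 + 2 * 0"
    by (intro tendsto_add ennreal_tendsto_cmult tendsto_ennrealI l1 lim) simp_all
  then have l: "(\<lambda>n. 2 * ennreal (1 / real (Suc n)) + 2 * EE (\<lambda>k. v n k - u k)) \<longlonglongrightarrow> 0" by simp
  ultimately have "(\<lambda>n. EE (\<lambda>k. of_function (g n) k - u k)) \<longlonglongrightarrow> 0"
    by (intro tendsto_sandwich[OF always_eventually always_eventually tendsto_const l] allI zero_le)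
  then have "approx g u" using g(1) by (simp add: approx_def tendsto_Hdot_def)
  then have B: "(\<lambda>n. B0 \<delta> \<psi> (g n)) \<longlonglongrightarrow> B h \<delta> \<psi> u" by (rule B_limit[OF \<psi> u])
  have "(\<lambda>n. B h \<delta> \<psi> (v n) - B0 \<delta> \<psi> (g n)) \<longlonglongrightarrow> 0"
    by (rule Lim_null_comparison[OF always_eventually l1]) (intro allI g(3))
  from tendsto_add[OF this B] show ?thesis by simp
qed

end

section \<open>Rescaled test functions\<close>

lemma smooth_scale: "smooth f \<Longrightarrow> smooth (\<lambda>x. f (x /\<^sub>R r))" for f :: "plane \<Rightarrow> complex"
  using smooth_compose_affine[of f "\<lambda>x. x /\<^sub>R r" 0] bounded_linear_scaleR_right[of "inverse r"] by simp

lemma test_function_scale: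
  assumes f: "f \<in> test_functions UNIV" and r: "0 < r"
  shows "(\<lambda>x::plane. f (x /\<^sub>R r)) \<in> test_functions UNIV"
proof -
  obtain K where K: "\<And>x. x \<in> supp f \<Longrightarrow> norm x \<le> K"
    using f compact_imp_bounded[of "supp f"] unfolding test_functions_def bounded_iff by auto
  have "f (x /\<^sub>R r) = 0" if "x \<notin> cball 0 (r * K)" for x
  proof (rule zero_outside_supp[of "x /\<^sub>R r" f])
    show "x /\<^sub>R r \<notin> supp f"
    proof
      assume "x /\<^sub>R r \<in> supp f"
      then have "norm x / r \<le> K" using K[of "x /\<^sub>R r"] r by (simp add: divide_inverse mult.commute)
      then show False using that r by (simp add: field_simps)
    qed
  qed
  then have "compact (supp (\<lambda>x. f (x /\<^sub>R r)))" by (rule compact_supp[OF compact_cball])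
  then show ?thesis using f smooth_scale[of f r] by (simp add: test_functions_def)
qed

lemma test_function_mult:
  assumes f: "f \<in> test_functions UNIV" and g: "smooth g"
  shows "(\<lambda>x::plane. f x * g x) \<in> test_functions UNIV"
proof -
  have "compact (supp (\<lambda>x. f x * g x))"
    by (rule compact_supp[of "supp f"]) (use f zero_outside_supp[of _ f] in \<open>auto simp: test_functions_def\<close>)
  then show ?thesis using f g by (simp add: test_functions_def smooth_mult)
qed

lemma fourier_scale:
  assumes \<psi>: "\<psi> \<in> schwartz" and r: "0 < r"
  shows "fourier (\<lambda>x. \<psi> (x /\<^sub>R r)) k = complex_of_real (r\<^sup>2) * fourier \<psi> (r *\<^sub>R k)"
proof -
  have [measurable]: "\<psi> \<in> borel_measurable borel" by (rule schwartz_borel[OF \<psi>])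
  have m: "(\<lambda>x. expni (x \<bullet> k) * \<psi> (x /\<^sub>R r)) \<in> borel_measurable borel" by measurable
  have e: "(0 + r *\<^sub>R x) /\<^sub>R r = x" for x :: plane using r by simp
  show ?thesis unfolding fourier_def
    using integral_plane_affine[OF m, of r 0] r unfolding e by (simp add: scaleR_conv_of_real[where 'a = complex])
qed

text \<open>The factor \<open>r\<^sup>2\<close> in the transform of a dilate cancels the Jacobian of
  the substitution; the quadratic weight is left and supplies the division by
  \<open>r\<^sup>2\<close>.\<close>

lemma wiener_scale:
  assumes \<psi>: "\<psi> \<in> schwartz" and r: "0 < r"
  shows "wiener (\<lambda>x. \<psi> (x /\<^sub>R r)) = wiener \<psi> / r\<^sup>2"
proof -
  have [measurable]: "fourier \<psi> \<in> borel_measurable borel" by (intro schwartz_borel schwartz_fourier \<psi>)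
  have "wiener \<psi> = r\<^sup>2 *\<^sub>R (LINT k|lborel. (norm (0 + r *\<^sub>R k))\<^sup>2 * norm (fourier \<psi> (0 + r *\<^sub>R k)))"
    unfolding wiener_def by (rule integral_plane_affine) (use r in \<open>measurable, simp\<close>)
  also have "\<dots> = r\<^sup>2 * (LINT k|lborel. (norm k)\<^sup>2 * norm (fourier (\<lambda>x. \<psi> (x /\<^sub>R r)) k))"
    using r by (simp add: fourier_scale[OF \<psi> r] norm_mult norm_power power_mult_distrib mult_ac)
  finally show ?thesis using r by (simp add: wiener_def)
qed

lemma wiener_cmult: "wiener (\<lambda>x. c * \<psi> x) = norm c * wiener \<psi>"
  unfolding wiener_def fourier_cmult by (simp add: norm_mult mult.left_commute)

text \<open>Inversion at the origin, applied to a second derivative. It converts the isotropy of the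
  Hessian at zero into the moment conditions of \<open>Bil_rescaled_limit\<close>.\<close>

lemma fourier_second_moment:
  assumes \<psi>: "\<psi> \<in> schwartz"
  shows "(LINT k|lborel. complex_of_real (k $ i * k $ j) * fourier \<psi> k) = - (complex_of_real ((2 * pi)\<^sup>2) * dir_deriv (axis i 1) (dir_deriv (axis j 1) \<psi>) 0)"
proof -
  have b: "axis l (1::real) \<in> (Basis :: plane set)" for l by (simp add: axis_in_Basis_iff)
  let ?g = "dir_deriv (axis i 1) (dir_deriv (axis j 1) \<psi>)"
  have gS: "?g \<in> schwartz" by (intro schwartz_deriv \<psi> b)
  have r: "\<i> * a * (\<i> * b * z) = - (a * b * z)" for a b z :: complex
    by (simp add: complex_eq_iff algebra_simps)
  have Fg: "fourier ?g k = - (complex_of_real (k $ i * k $ j) * fourier \<psi> k)" for k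
    unfolding fourier_dir_deriv[OF schwartz_deriv[OF \<psi> b] b] fourier_dir_deriv[OF \<psi> b]
    by (simp only: inner_axis_one r of_real_mult)
  have "?g 0 = inv_fourier (fourier ?g) 0" by (rule fourier_inversion[OF gS, symmetric])
  also have "\<dots> = complex_of_real (1 / (2 * pi)\<^sup>2) * - (LINT k|lborel. complex_of_real (k $ i * k $ j) * fourier \<psi> k)"
    unfolding inv_fourier_def Fg by (simp add: scaleR_conv_of_real)
  finally have "complex_of_real ((2 * pi)\<^sup>2) * ?g 0 = complex_of_real ((2 * pi)\<^sup>2) * (complex_of_real (1 / (2 * pi)\<^sup>2) * - (LINT k|lborel. complex_of_real (k $ i * k $ j) * fourier \<psi> k))"
    by simp
  also have "\<dots> = - (LINT k|lborel. complex_of_real (k $ i * k $ j) * fourier \<psi> k)"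
    unfolding mult.assoc[symmetric] of_real_mult[symmetric] by simp
  finally show ?thesis by simp
qed

section \<open>Asymptotics of the form for widely dilated test functions\<close>

lemma norm_powr_difference_quotient:
  fixes \<xi> k :: plane
  assumes "\<xi> \<noteq> 0"
  shows "((\<lambda>R. R * (norm (\<xi> + k /\<^sub>R R) powr (2 * \<sigma>) - norm \<xi> powr (2 * \<sigma>))) \<longlongrightarrow> 2 * \<sigma> * (\<xi> \<bullet> \<xi>) powr (\<sigma> - 1) * (\<xi> \<bullet> k)) at_top"
proof -
  have n: "norm x powr (2 * \<sigma>) = (x \<bullet> x) powr \<sigma>" for x :: plane
  proof (cases "x = 0")
    case False
    have "x \<bullet> x = norm x powr 2" using False by (simp add: powr_numeral power2_norm_eq_inner[symmetric])
    then show ?thesis by (simp only: powr_powr)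
  qed simp
  \<comment> \<open>With \<open>t = inverse R\<close> the quotient is the difference quotient at
    zero of a power of a quadratic polynomial in \<open>t\<close>, whose base is positive at zero.
    Writing the norm through the inner product makes the chain rule applicable.\<close>
  define \<phi> where "\<phi> t = ((\<xi> + t *\<^sub>R k) \<bullet> (\<xi> + t *\<^sub>R k)) powr \<sigma>" for t
  have p: "0 < \<xi> \<bullet> \<xi>" using assms by simp
  have q: "((\<lambda>t. (\<xi> + t *\<^sub>R k) \<bullet> (\<xi> + t *\<^sub>R k)) has_real_derivative 2 * (\<xi> \<bullet> k)) (at 0)"
  proof -
    have "(\<lambda>t. (\<xi> + t *\<^sub>R k) \<bullet> (\<xi> + t *\<^sub>R k)) = (\<lambda>t. \<xi> \<bullet> \<xi> + 2 * (\<xi> \<bullet> k) * t + (k \<bullet> k) * t\<^sup>2)"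
      by (rule ext) (simp add: inner_add_left inner_add_right inner_commute power2_eq_square algebra_simps)
    moreover have "((\<lambda>t. \<xi> \<bullet> \<xi> + 2 * (\<xi> \<bullet> k) * t + (k \<bullet> k) * t\<^sup>2) has_real_derivative 2 * (\<xi> \<bullet> k)) (at 0)"
      by (auto intro!: derivative_eq_intros)
    ultimately show ?thesis by simp
  qed
  have "((\<lambda>z. z powr \<sigma>) has_real_derivative \<sigma> * (\<xi> \<bullet> \<xi>) powr (\<sigma> - 1)) (at ((\<xi> + 0 *\<^sub>R k) \<bullet> (\<xi> + 0 *\<^sub>R k)))"
    using has_real_derivative_powr[OF p, of \<sigma>] by simp
  from DERIV_chain2[OF this q]
  have "(\<phi> has_real_derivative \<sigma> * (\<xi> \<bullet> \<xi>) powr (\<sigma> - 1) * (2 * (\<xi> \<bullet> k))) (at 0)"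
    by (simp add: \<phi>_def[abs_def])
  then have "((\<lambda>t. (\<phi> (0 + t) - \<phi> 0) / t) \<longlongrightarrow> \<sigma> * (\<xi> \<bullet> \<xi>) powr (\<sigma> - 1) * (2 * (\<xi> \<bullet> k))) (at 0)"
    by (simp only: DERIV_def)
  moreover have "filterlim inverse (at (0::real)) at_top"
    unfolding filterlim_at by (auto intro: tendsto_inverse_0_at_top filterlim_ident eventually_mono[OF eventually_gt_at_top[of 0]])
  ultimately have "((\<lambda>R. (\<phi> (0 + inverse R) - \<phi> 0) / inverse R) \<longlongrightarrow> \<sigma> * (\<xi> \<bullet> \<xi>) powr (\<sigma> - 1) * (2 * (\<xi> \<bullet> k))) at_top"
    by (rule filterlim_compose)
  moreover have "(\<phi> (0 + inverse R) - \<phi> 0) / inverse R = R * (norm (\<xi> + k /\<^sub>R R) powr (2 * \<sigma>) - norm \<xi> powr (2 * \<sigma>))" for R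
    unfolding n by (simp add: \<phi>_def divide_inverse mult.commute)
  ultimately show ?thesis by (simp add: mult_ac)
qed

text \<open>The limit kernel is a multiple of \<open>(\<xi> \<bullet> k) cross2 \<xi> k\<close>, a trace-free quadratic form in \<open>k\<close>, so it is
  annihilated by an isotropic matrix of second moments.\<close>

lemma Bil_rescaled_limit:
  assumes \<sigma>: "- 1 \<le> \<sigma>" "\<sigma> \<le> 0" and \<psi>: "\<psi> \<in> schwartz" and a: "cs0 a"
    and sc: "\<And>R. 0 < R \<Longrightarrow> (\<lambda>x. \<psi> (x /\<^sub>R R)) \<in> schwartz"
    and m1: "(LINT k|lborel. complex_of_real (k $ 1 * k $ 1) * fourier \<psi> k) = (LINT k|lborel. complex_of_real (k $ 2 * k $ 2) * fourier \<psi> k)"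
    and m2: "(LINT k|lborel. complex_of_real (k $ 1 * k $ 2) * fourier \<psi> k) = 0"
  shows "((\<lambda>R. Bil \<sigma> (\<lambda>x. complex_of_real (R\<^sup>2) * \<psi> (x /\<^sub>R R)) a a) \<longlongrightarrow> 0) at_top"
proof -
  note F\<psi> = schwartz_fourier[OF \<psi>] and aS = cs0_schwartz[OF a]
  have [measurable]: "fourier \<psi> \<in> borel_measurable borel" "a \<in> borel_measurable borel"
    by (intro schwartz_borel F\<psi> aS)+
  have kapm: "(\<lambda>p. kap \<sigma> (f p) (g p)) \<in> borel_measurable LL" if "f \<in> LL \<rightarrow>\<^sub>M borel" "g \<in> LL \<rightarrow>\<^sub>M borel" for f g
    using measurable_compose[OF measurable_Pair[OF that] kap_borel] by simp
  \<comment> \<open>The integrand after the substitution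
    \<open>\<eta> = - \<xi> - k /\<^sub>R R\<close>. The transform of the rescaled test function
    contributes R to the power 4 and the Jacobian R to the power -2, so \<open>R\<^sup>2\<close>
    remains.\<close>
  define G where "G R p = complex_of_real (R\<^sup>2) * fourier \<psi> (snd p) * complex_of_real (kap \<sigma> (fst p) (- fst p - snd p /\<^sub>R R)) * a (fst p) * a (- fst p - snd p /\<^sub>R R)" for R p
  have Gm: "G R \<in> borel_measurable LL" for R
  proof -
    have [measurable]: "(\<lambda>p. kap \<sigma> (fst p) (- fst p - snd p /\<^sub>R R)) \<in> borel_measurable LL" by (rule kapm) measurable
    show ?thesis unfolding G_def[abs_def] by measurable
  qed
  \<comment> \<open>The pointwise limit of \<open>R\<^sup>2\<close> times the symbol: one factor R
    is absorbed by \<open>cross2\<close>, which is linear in the small displacement, the other by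
    the difference quotient of the powers.\<close>
  define L where "L \<xi> k = \<sigma> * (\<xi> \<bullet> \<xi>) powr (\<sigma> - 1) * (\<xi> \<bullet> k) * cross2 \<xi> k" for \<xi> k
  define G0 where "G0 p = fourier \<psi> (snd p) * complex_of_real (L (fst p) (snd p)) * a (fst p) * a (- fst p)" for p
  have Lm [measurable]: "(\<lambda>p. L (fst p) (snd p)) \<in> borel_measurable (borel \<Otimes>\<^sub>M borel)" unfolding L_def by measurable
  have G0m: "G0 \<in> borel_measurable LL" unfolding G0_def[abs_def] by measurable
  obtain K1 where K1: "\<And>\<xi>. norm \<xi> powr \<sigma> * norm (a \<xi>) \<le> K1 * norm (a \<xi>)" "0 \<le> K1" using cs0_powr_bound[OF a] by metis
  obtain K2 where K2: "\<And>\<xi>. norm (a \<xi>) \<le> K2" using schwartz_bound[OF aS, of 0] by auto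
  have K: "norm \<xi> powr \<sigma> * norm (a \<xi>) \<le> K1 * K2" for \<xi>
    using K1(1)[of \<xi>] mult_left_mono[OF K2[of \<xi>] K1(2)] by linarith
  \<comment> \<open>A dominating function free of R. The factor \<open>R\<^sup>2\<close> cancels
    against the squared norm of \<open>k /\<^sub>R R\<close> in \<open>abs_kap_le\<close>, and the
    second copy of \<open>a\<close> with its weight is replaced by the bound
    \<open>K1 * K2\<close>.\<close>
  define W where "W p = (norm (fst p) powr \<sigma> * norm (a (fst p))) * ((K1 * K2) * ((norm (snd p))\<^sup>2 * norm (fourier \<psi> (snd p))))" for p
  have Wm: "W \<in> borel_measurable LL" unfolding W_def[abs_def] by measurable
  have Wint: "integrable LL W"
    by (rule integrable_pair_bound[OF cs0_powr_integrable[OF a, of \<sigma>] integrable_mult_right[OF wiener_integrable[OF \<psi>], of "K1 * K2"]])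
      (use Wm K1(2) order_trans[OF norm_ge_zero K2[of 0]] in \<open>auto simp: W_def abs_mult\<close>)
  have GW: "norm (G R p) \<le> W p" if R: "0 < R" for R p
  proof -
    obtain \<xi> k where p: "p = (\<xi>, k)" by (cases p)
    define \<eta> where "\<eta> = - \<xi> - k /\<^sub>R R"
    show ?thesis
    proof (cases "\<xi> = 0 \<or> \<eta> = 0")
      case True
      then have "G R p = 0" using cs0_zero[OF a] by (auto simp: G_def p \<eta>_def)
      moreover have "0 \<le> W p" unfolding W_def using K1(2) order_trans[OF norm_ge_zero K2[of 0]] by simp
      ultimately show ?thesis by simp
    next
      case False
      have "\<bar>kap \<sigma> \<xi> \<eta>\<bar> \<le> (norm (\<xi> + \<eta>))\<^sup>2 * (norm \<xi> powr \<sigma> * norm \<eta> powr \<sigma>)"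
        using False by (intro abs_kap_le \<sigma>) auto
      also have "\<xi> + \<eta> = - (k /\<^sub>R R)" by (simp add: \<eta>_def)
      also have "(norm (- (k /\<^sub>R R)))\<^sup>2 = (norm k)\<^sup>2 / R\<^sup>2"
        using R by (simp add: power_mult_distrib divide_inverse power_inverse mult.commute)
      finally have "R\<^sup>2 * \<bar>kap \<sigma> \<xi> \<eta>\<bar> \<le> R\<^sup>2 * ((norm k)\<^sup>2 / R\<^sup>2 * (norm \<xi> powr \<sigma> * norm \<eta> powr \<sigma>))"
        by (rule mult_left_mono) simp
      then have "R\<^sup>2 * \<bar>kap \<sigma> \<xi> \<eta>\<bar> \<le> (norm k)\<^sup>2 * (norm \<xi> powr \<sigma> * norm \<eta> powr \<sigma>)"
        using R by simp
      from mult_right_mono[OF this, of "norm (fourier \<psi> k) * norm (a \<xi>) * norm (a \<eta>)"]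
      have "norm (G R p) \<le> (norm \<xi> powr \<sigma> * norm (a \<xi>)) * ((norm \<eta> powr \<sigma> * norm (a \<eta>)) * ((norm k)\<^sup>2 * norm (fourier \<psi> k)))"
        by (simp add: G_def p \<eta>_def[symmetric] norm_mult norm_power mult_ac)
      also have "\<dots> \<le> W p"
        unfolding W_def p fst_conv snd_conv by (intro mult_left_mono mult_right_mono K) auto
      finally show ?thesis .
    qed
  qed
  have Gint: "integrable LL (G R)" if "0 < R" for R
    by (rule Bochner_Integration.integrable_bound[OF Wint Gm]) (use GW[OF that] in \<open>auto intro!: AE_I2 order_trans[OF _ abs_ge_self]\<close>)
  have eq: "Bil \<sigma> (\<lambda>x. complex_of_real (R\<^sup>2) * \<psi> (x /\<^sub>R R)) a a = (LINT p|LL. G R p)" if R: "0 < R" for R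
  proof -
    let ?\<psi>R = "\<lambda>x. complex_of_real (R\<^sup>2) * \<psi> (x /\<^sub>R R)"
    have S: "?\<psi>R \<in> schwartz" by (intro schwartz_cmult sc R)
    note bi = bil_integrable[OF \<sigma> S a a]
    have Fm: "fourier ?\<psi>R \<in> borel_measurable borel" by (intro schwartz_borel schwartz_fourier S)
    have "Bil \<sigma> ?\<psi>R a a = (LINT \<xi>|lborel. LINT \<eta>|lborel. bil \<sigma> ?\<psi>R a a (\<xi>, \<eta>))"
      unfolding Bil_def by (rule lborel_pair.integral_fst'[OF bi, symmetric])
    also have "\<dots> = (LINT \<xi>|lborel. LINT k|lborel. G R (\<xi>, k))"
    proof (rule Bochner_Integration.integral_cong[OF refl])
      fix \<xi> :: plane
      have m: "(\<lambda>\<eta>. bil \<sigma> ?\<psi>R a a (\<xi>, \<eta>)) \<in> borel_measurable borel"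
        using measurable_Pair2[OF bil_borel[OF S aS aS], of \<xi>] by simp
      have e: "(1 / R\<^sup>2) *\<^sub>R bil \<sigma> ?\<psi>R a a (\<xi>, - \<xi> + (- 1 / R) *\<^sub>R k) = G R (\<xi>, k)" for k
      proof -
        have 1: "- \<xi> + (- 1 / R) *\<^sub>R k = - \<xi> - k /\<^sub>R R" by (simp add: divide_inverse)
        have 2: "- (\<xi> + (- \<xi> - k /\<^sub>R R)) = k /\<^sub>R R" by simp
        have 3: "fourier ?\<psi>R (k /\<^sub>R R) = complex_of_real (R\<^sup>2) * (complex_of_real (R\<^sup>2) * fourier \<psi> k)"
          unfolding fourier_cmult fourier_scale[OF \<psi> R] using R by simp
        have 4: "complex_of_real (1 / R\<^sup>2) * (complex_of_real (R\<^sup>2) * z) = z" for z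
          using R by (simp flip: mult.assoc of_real_mult)
        show ?thesis unfolding bil_def G_def fst_conv snd_conv 1 2 3 by (simp only: scaleR_conv_of_real[where 'a = complex] mult.assoc 4)
      qed
      have "(LINT \<eta>|lborel. bil \<sigma> ?\<psi>R a a (\<xi>, \<eta>)) = (- 1 / R)\<^sup>2 *\<^sub>R (LINT k|lborel. bil \<sigma> ?\<psi>R a a (\<xi>, - \<xi> + (- 1 / R) *\<^sub>R k))"
        by (rule integral_plane_affine[OF m]) (use R in simp)
      also have "\<dots> = (LINT k|lborel. G R (\<xi>, k))"
        unfolding e[symmetric] by (simp add: power_divide)
      finally show "(LINT \<eta>|lborel. bil \<sigma> ?\<psi>R a a (\<xi>, \<eta>)) = (LINT k|lborel. G R (\<xi>, k))" .
    qed
    also have "\<dots> = (LINT p|LL. G R p)" by (rule lborel_pair.integral_fst'[OF Gint[OF R]])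
    finally show ?thesis .
  qed
  have lim: "((\<lambda>R. G R p) \<longlongrightarrow> G0 p) at_top" for p
  proof -
    obtain \<xi> k where p: "p = (\<xi>, k)" by (cases p)
    show ?thesis
    proof (cases "\<xi> = 0")
      case True
      then show ?thesis using cs0_zero[OF a] by (simp add: G_def G0_def p)
    next
      case False
      have inv0: "((\<lambda>R. - \<xi> - k /\<^sub>R R) \<longlongrightarrow> - \<xi> - 0 *\<^sub>R k) at_top"
        by (intro tendsto_intros tendsto_inverse_0_at_top filterlim_ident)
      moreover have "isCont a (- \<xi>)" using smooth_differentiable[OF schwartz_smooth[OF aS]] differentiable_imp_continuous_within by metis
      ultimately have al: "((\<lambda>R. a (- \<xi> - k /\<^sub>R R)) \<longlongrightarrow> a (- \<xi>)) at_top"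
        using isCont_tendsto_compose[of "- \<xi>" a "\<lambda>R. - \<xi> - k /\<^sub>R R" at_top] by simp
      have kl: "((\<lambda>R. R\<^sup>2 * kap \<sigma> \<xi> (- \<xi> - k /\<^sub>R R)) \<longlongrightarrow> L \<xi> k) at_top"
      proof (rule Lim_transform_eventually)
        show "((\<lambda>R. (cross2 \<xi> k / 2) * (R * (norm (\<xi> + k /\<^sub>R R) powr (2 * \<sigma>) - norm \<xi> powr (2 * \<sigma>)))) \<longlongrightarrow> L \<xi> k) at_top"
          using tendsto_mult[OF tendsto_const norm_powr_difference_quotient[OF False, of k \<sigma>], of "cross2 \<xi> k / 2"]
          by (simp add: L_def mult_ac)
        show "eventually (\<lambda>R. (cross2 \<xi> k / 2) * (R * (norm (\<xi> + k /\<^sub>R R) powr (2 * \<sigma>) - norm \<xi> powr (2 * \<sigma>))) = R\<^sup>2 * kap \<sigma> \<xi> (- \<xi> - k /\<^sub>R R)) at_top"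
          using eventually_gt_at_top[of 0]
        proof (rule eventually_mono)
          fix R :: real assume R: "0 < R"
          have c: "cross2 \<xi> (- \<xi> - k /\<^sub>R R) = - cross2 \<xi> k / R" using R by (simp add: cross2_def field_simps)
          have n: "norm (- \<xi> - k /\<^sub>R R) = norm (\<xi> + k /\<^sub>R R)" by (metis minus_add_distrib norm_minus_cancel uminus_add_conv_diff add.commute)
          show "(cross2 \<xi> k / 2) * (R * (norm (\<xi> + k /\<^sub>R R) powr (2 * \<sigma>) - norm \<xi> powr (2 * \<sigma>))) = R\<^sup>2 * kap \<sigma> \<xi> (- \<xi> - k /\<^sub>R R)"
            unfolding kap_def c n using R by (simp add: power2_eq_square field_simps)
        qed
      qed
      have "((\<lambda>R. fourier \<psi> k * complex_of_real (R\<^sup>2 * kap \<sigma> \<xi> (- \<xi> - k /\<^sub>R R)) * a \<xi> * a (- \<xi> - k /\<^sub>R R)) \<longlongrightarrow> fourier \<psi> k * complex_of_real (L \<xi> k) * a \<xi> * a (- \<xi>)) at_top"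
        by (intro tendsto_mult tendsto_const tendsto_of_real kl al)
      then show ?thesis unfolding G_def G0_def p by (simp add: mult_ac)
    qed
  qed
  have conv: "((\<lambda>R. LINT p|LL. G R p) \<longlongrightarrow> (LINT p|LL. G0 p)) at_top"
  proof (rule integral_dominated_convergence_at_top[OF G0m Gm Wint])
    show "eventually (\<lambda>R. AE p in LL. norm (G R p) \<le> W p) at_top"
      using eventually_gt_at_top[of 0] by (rule eventually_mono) (simp add: GW)
  qed (simp add: lim)
  have G0W: "norm (G0 p) \<le> W p" for p
    by (rule tendsto_upperbound[OF tendsto_norm[OF lim]]) (auto intro: eventually_mono[OF eventually_gt_at_top[of 0]] GW)
  have G0int: "integrable LL G0"
    by (rule Bochner_Integration.integrable_bound[OF Wint G0m]) (use G0W in \<open>auto intro!: AE_I2 order_trans[OF _ abs_ge_self]\<close>)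
  have "(LINT p|LL. G0 p) = (LINT \<xi>|lborel. LINT k|lborel. G0 (\<xi>, k))"
    by (rule lborel_pair.integral_fst'[OF G0int, symmetric])
  also have "\<dots> = (LINT (\<xi>::plane)|lborel. 0)"
  proof (rule Bochner_Integration.integral_cong[OF refl])
    fix \<xi> :: plane
    have mint: "integrable lborel (\<lambda>k. complex_of_real (k $ i * k $ j) * fourier \<psi> k)" for i j
    proof (rule Bochner_Integration.integrable_bound[OF wiener_integrable[OF \<psi>]])
      have "\<bar>k $ i * k $ j\<bar> \<le> (norm k)\<^sup>2" for k :: plane
        unfolding abs_mult power2_eq_square by (intro mult_mono component_le_norm_cart) auto
      then show "AE k in lborel. norm (complex_of_real (k $ i * k $ j) * fourier \<psi> k) \<le> norm ((norm k)\<^sup>2 * norm (fourier \<psi> k))"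
        by (intro AE_I2) (simp add: norm_mult abs_mult mult_right_mono del: of_real_mult)
    qed measurable
    define c where "c = complex_of_real (\<sigma> * (\<xi> \<bullet> \<xi>) powr (\<sigma> - 1)) * (a \<xi> * a (- \<xi>))"
    have "G0 (\<xi>, k) = c * (complex_of_real (\<xi> $ 1 * \<xi> $ 2) * (complex_of_real (k $ 1 * k $ 1) * fourier \<psi> k)
        - complex_of_real (\<xi> $ 1 * \<xi> $ 2) * (complex_of_real (k $ 2 * k $ 2) * fourier \<psi> k)
        + complex_of_real (\<xi> $ 2 * \<xi> $ 2 - \<xi> $ 1 * \<xi> $ 1) * (complex_of_real (k $ 1 * k $ 2) * fourier \<psi> k))" for k
    proof -
      have "(\<xi> \<bullet> k) * cross2 \<xi> k = \<xi> $ 1 * \<xi> $ 2 * (k $ 1 * k $ 1) - \<xi> $ 1 * \<xi> $ 2 * (k $ 2 * k $ 2) + (\<xi> $ 2 * \<xi> $ 2 - \<xi> $ 1 * \<xi> $ 1) * (k $ 1 * k $ 2)"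
        unfolding cross2_def inner_vec_def sum_2 by (simp add: algebra_simps)
      then have "complex_of_real (L \<xi> k) = complex_of_real (\<sigma> * (\<xi> \<bullet> \<xi>) powr (\<sigma> - 1)) * complex_of_real (\<xi> $ 1 * \<xi> $ 2 * (k $ 1 * k $ 1) - \<xi> $ 1 * \<xi> $ 2 * (k $ 2 * k $ 2) + (\<xi> $ 2 * \<xi> $ 2 - \<xi> $ 1 * \<xi> $ 1) * (k $ 1 * k $ 2))"
        unfolding L_def of_real_mult[symmetric] by (simp only: mult.assoc)
      then show ?thesis unfolding G0_def c_def fst_conv snd_conv
        by (simp only: of_real_add of_real_diff of_real_mult) (simp only: algebra_simps)
    qed
    then have "(LINT k|lborel. G0 (\<xi>, k)) = c * (complex_of_real (\<xi> $ 1 * \<xi> $ 2) * (LINT k|lborel. complex_of_real (k $ 1 * k $ 1) * fourier \<psi> k)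
        - complex_of_real (\<xi> $ 1 * \<xi> $ 2) * (LINT k|lborel. complex_of_real (k $ 2 * k $ 2) * fourier \<psi> k)
        + complex_of_real (\<xi> $ 2 * \<xi> $ 2 - \<xi> $ 1 * \<xi> $ 1) * (LINT k|lborel. complex_of_real (k $ 1 * k $ 2) * fourier \<psi> k))"
      by (simp only: integral_mult_right_zero Bochner_Integration.integral_add[OF Bochner_Integration.integrable_diff[OF integrable_mult_right[OF mint] integrable_mult_right[OF mint]] integrable_mult_right[OF mint]]
          Bochner_Integration.integral_diff[OF integrable_mult_right[OF mint] integrable_mult_right[OF mint]])
    then show "(LINT k|lborel. G0 (\<xi>, k)) = 0" unfolding m1 m2 by simp
  qed
  finally have "(LINT p|LL. G0 p) = 0" by simp
  with conv have "((\<lambda>R. LINT p|LL. G R p) \<longlongrightarrow> 0) at_top" by simp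
  then show ?thesis
    by (rule Lim_transform_eventually) (rule eventually_mono[OF eventually_gt_at_top[of 0]], rule eq[symmetric])
qed

lemma hessian_at_0:
  assumes ev: "eventually (\<lambda>x. \<psi> x = complex_of_real ((norm x)\<^sup>2)) (nhds (0::plane))"
  shows "dir_deriv b (dir_deriv b' \<psi>) 0 = complex_of_real (2 * (b \<bullet> b'))"
proof -
  obtain U where U: "open U" "0 \<in> U" "\<And>x. x \<in> U \<Longrightarrow> \<psi> x = complex_of_real ((norm x)\<^sup>2)"
    using ev unfolding eventually_nhds by blast
  have 1: "dir_deriv b' \<psi> x = complex_of_real (2 * (x \<bullet> b'))" if x: "x \<in> U" for x
  proof (rule dir_deriv_eq)
    have "((\<lambda>x. complex_of_real ((norm x)\<^sup>2)) has_derivative (\<lambda>v. complex_of_real (2 * (x \<bullet> v)))) (at x)"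
      unfolding power2_norm_eq_inner by (auto intro!: derivative_eq_intros simp: inner_commute)
    then show "(\<psi> has_derivative (\<lambda>v. complex_of_real (2 * (x \<bullet> v)))) (at x)"
      by (rule has_derivative_transform_within_open[OF _ U(1) x]) (simp add: U(3))
  qed
  show ?thesis
  proof (rule dir_deriv_eq)
    have "((\<lambda>x. complex_of_real (2 * (x \<bullet> b'))) has_derivative (\<lambda>v. complex_of_real (2 * (v \<bullet> b')))) (at 0)"
      by (auto intro!: derivative_eq_intros)
    then show "(dir_deriv b' \<psi> has_derivative (\<lambda>v. complex_of_real (2 * (v \<bullet> b')))) (at 0)"
      by (rule has_derivative_transform_within_open[OF _ U(1,2)]) (simp add: 1)
  qed
qed

context msqg
begin

lemma B0_angular_limit:
  assumes \<psi>: "\<psi> \<in> test_functions UNIV" and ev: "eventually (\<lambda>x. \<psi> x = complex_of_real ((norm x)\<^sup>2)) (nhds 0)" and f: "f \<in> schwartz0"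
  shows "((\<lambda>R. B0 \<delta> (\<lambda>x. complex_of_real (R\<^sup>2) * \<psi> (x /\<^sub>R R)) f) \<longlongrightarrow> 0) at_top"
proof -
  note \<psi>S = test_functions_schwartz[OF \<psi>]
  have sc: "(\<lambda>x. \<psi> (x /\<^sub>R R)) \<in> schwartz" if "0 < R" for R
    by (rule test_functions_schwartz[OF test_function_scale[OF \<psi> that]])
  have "((\<lambda>R. Bil (- 1 + \<delta>) (\<lambda>x. complex_of_real (R\<^sup>2) * \<psi> (x /\<^sub>R R)) (fourier f) (fourier f)) \<longlongrightarrow> 0) at_top"
  proof (rule Bil_rescaled_limit[OF _ _ \<psi>S schwartz0_cs0[OF f] sc])
    show "(LINT k|lborel. complex_of_real (k $ 1 * k $ 1) * fourier \<psi> k) = (LINT k|lborel. complex_of_real (k $ 2 * k $ 2) * fourier \<psi> k)"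
      unfolding fourier_second_moment[OF \<psi>S] hessian_at_0[OF ev] by (simp add: inner_axis_axis)
    show "(LINT k|lborel. complex_of_real (k $ 1 * k $ 2) * fourier \<psi> k) = 0"
      unfolding fourier_second_moment[OF \<psi>S] hessian_at_0[OF ev] by (simp add: inner_axis_axis)
  qed (use \<delta>0 \<delta>1 in auto)
  from tendsto_mult[OF tendsto_const this, of "complex_of_real ((1 / (2 * pi)\<^sup>2)\<^sup>2)"]
  have "((\<lambda>R. complex_of_real ((1 / (2 * pi)\<^sup>2)\<^sup>2) * Bil (- 1 + \<delta>) (\<lambda>x. complex_of_real (R\<^sup>2) * \<psi> (x /\<^sub>R R)) (fourier f) (fourier f)) \<longlongrightarrow> 0) at_top"
    by simp
  then show ?thesis
    by (rule Lim_transform_eventually)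
      (rule eventually_mono[OF eventually_gt_at_top[of 0]], rule B0_formula[OF \<delta>0 \<delta>1 schwartz_cmult[OF sc] f, symmetric])
qed

text \<open>The rescaled test functions all have the same \<open>wiener\<close> value, so a single
  approximant of \<open>u\<close> is good uniformly in R, and for it \<open>B0_angular_limit\<close>
  gives the limit.\<close>

lemma B_angular_limit:
  assumes \<psi>: "\<psi> \<in> test_functions UNIV" and ev: "eventually (\<lambda>x. \<psi> x = complex_of_real ((norm x)\<^sup>2)) (nhds 0)" and u: "u \<in> HH"
  shows "((\<lambda>R. B h \<delta> (\<lambda>x. complex_of_real (R\<^sup>2) * \<psi> (x /\<^sub>R R)) u) \<longlongrightarrow> 0) at_top"
proof (rule tendstoI)
  fix e :: real assume e: "0 < e"
  note \<psi>S = test_functions_schwartz[OF \<psi>]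
  obtain y where y: "0 \<le> y" "EE u = ennreal y" using HH_D(2)[OF u] by (cases "EE u") auto
  define C where "C = CB * (wiener \<psi>)\<^sup>2"
  have C: "0 \<le> C" using CB0 by (simp add: C_def)
  define x where "x = min 1 ((e / 2)\<^sup>2 / (16 * (C + 1) * (y + 1)) / 2)"
  have d: "0 < 16 * (C + 1) * (y + 1)" using C y by simp
  have x: "0 < x" "x \<le> 1" "x \<le> (e / 2)\<^sup>2 / (16 * (C + 1) * (y + 1)) / 2" using e d by (auto simp: x_def)
  have "C * ((4 * x) * (2 * (2 * y + 2 * x))) \<le> (C + 1) * ((4 * x) * (2 * (2 * y + 2 * 1)))"
    using C x y by (intro mult_mono) auto
  also have "\<dots> = (16 * (C + 1) * (y + 1)) * x" by (simp add: algebra_simps)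
  also have "\<dots> \<le> (16 * (C + 1) * (y + 1)) * ((e / 2)\<^sup>2 / (16 * (C + 1) * (y + 1)) / 2)"
    by (rule mult_left_mono[OF x(3)]) (use d in simp)
  also have "\<dots> = (e / 2)\<^sup>2 / 2" by (rule half_cancel[OF d])
  also have "\<dots> < (e / 2)\<^sup>2" using e by simp
  finally have small: "C * ((4 * x) * (2 * (2 * y + 2 * x))) < (e / 2)\<^sup>2" .
  obtain f where f: "approx f u" using approx_exists[OF u] by blast
  obtain n where n: "EE (\<lambda>k. of_function (f n) k - u k) \<le> ennreal x"
    using eventually_happens[OF approx_eventually[OF f x(1)]] by auto
  have fn: "f n \<in> schwartz0" using f by (simp add: approx_def)
  have "eventually (\<lambda>R. dist (B0 \<delta> (\<lambda>x. complex_of_real (R\<^sup>2) * \<psi> (x /\<^sub>R R)) (f n)) 0 < e / 2) at_top"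
    by (rule tendstoD[OF B0_angular_limit[OF \<psi> ev fn]]) (use e in simp)
  then show "eventually (\<lambda>R. dist (B h \<delta> (\<lambda>x. complex_of_real (R\<^sup>2) * \<psi> (x /\<^sub>R R)) u) 0 < e) at_top"
    using eventually_gt_at_top[of 0]
  proof eventually_elim
    case (elim R)
    let ?\<psi>R = "\<lambda>x. complex_of_real (R\<^sup>2) * \<psi> (x /\<^sub>R R)"
    have S: "?\<psi>R \<in> schwartz"
      by (intro schwartz_cmult test_functions_schwartz[OF test_function_scale[OF \<psi>]] elim)
    have w: "wiener ?\<psi>R = wiener \<psi>"
      unfolding wiener_cmult wiener_scale[OF \<psi>S elim(2)] using elim(2) by (simp add: norm_power)
    have "(norm (B h \<delta> ?\<psi>R u - B0 \<delta> ?\<psi>R (f n)))\<^sup>2 \<le> C * ((4 * x) * (2 * (2 * y + 2 * x)))"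
      using B_close_B0[OF S u _ fn n x(1) y(1)] y(2) unfolding w C_def by simp
    with small have "(norm (B h \<delta> ?\<psi>R u - B0 \<delta> ?\<psi>R (f n)))\<^sup>2 < (e / 2)\<^sup>2" by linarith
    then have "norm (B h \<delta> ?\<psi>R u - B0 \<delta> ?\<psi>R (f n)) < e / 2" by (rule power2_less_imp_less) (use e in simp)
    moreover have "norm (B0 \<delta> ?\<psi>R (f n)) < e / 2" using elim(1) by simp
    ultimately show ?case
      using norm_triangle_ineq[of "B h \<delta> ?\<psi>R u - B0 \<delta> ?\<psi>R (f n)" "B0 \<delta> ?\<psi>R (f n)"] by simp
  qed
qed

end

section \<open>Time-dependent test functions\<close>

text \<open>Used for a family whose derivatives are of a simpler kind than its members, so that no
  common invariant is at hand.\<close>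

lemma dfam_step:
  assumes "\<And>i x. f i differentiable at x" "D f" "\<And>b. b \<in> Basis \<Longrightarrow> dfam D (\<lambda>i. dir_deriv b (f i))"
  shows "dfam D f"
  unfolding dfam_def
proof (intro allI impI)
  fix vs :: "'b list" assume vs: "set vs \<subseteq> Basis"
  show "(\<forall>i x. iter_deriv vs (f i) differentiable at x) \<and> D (\<lambda>i. iter_deriv vs (f i))"
  proof (cases vs rule: rev_cases)
    case Nil
    then show ?thesis using assms by simp
  next
    case (snoc ws b)
    then have "dfam D (\<lambda>i. dir_deriv b (f i))" "set ws \<subseteq> Basis" using assms(3) vs by auto
    then show ?thesis unfolding snoc iter_deriv_snoc by (simp add: dfam_def)
  qed
qed

section \<open>Seminorms of families, and functionals bounded on families\<close>

lemma finite_deriv_lists: "finite {vs. set vs \<subseteq> (Basis::plane set) \<and> length vs \<le> N}"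
  by (rule finite_lists_length_le) simp

definition wsup :: "nat \<Rightarrow> nat \<Rightarrow> (plane \<Rightarrow> complex) \<Rightarrow> real" where
  "wsup M N f = (SUP (vs, x) \<in> {vs. set vs \<subseteq> Basis \<and> length vs \<le> N} \<times> UNIV. (1 + norm x) ^ M * norm (iter_deriv vs f x))"

lemma schwartz_seminorm_wsup: "schwartz_seminorm N = wsup N N"
  and Ck_seminorm_wsup: "Ck_seminorm N = wsup 0 N"
  by (simp_all add: fun_eq_iff schwartz_seminorm_def Ck_seminorm_def wsup_def)

lemma sfam_deriv_bound:
  assumes "sfam \<phi>"
  shows "\<exists>K. \<forall>i. \<forall>p\<in>{vs. set vs \<subseteq> Basis \<and> length vs \<le> N} \<times> UNIV. (case p of (vs, x) \<Rightarrow> (1 + norm x) ^ M * norm (iter_deriv vs (\<phi> i) x)) \<le> K"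
proof -
  let ?S = "{vs. set vs \<subseteq> (Basis::plane set) \<and> length vs \<le> N}"
  have "\<forall>vs\<in>?S. \<exists>K. \<forall>i x. (1 + norm x) ^ M * norm (iter_deriv vs (\<phi> i) x) \<le> K"
  proof
    fix vs assume "vs \<in> ?S"
    then have "wb (\<lambda>i. iter_deriv vs (\<phi> i))" using assms by (simp add: dfam_def)
    then show "\<exists>K. \<forall>i x. (1 + norm x) ^ M * norm (iter_deriv vs (\<phi> i) x) \<le> K" unfolding wb_def by (rule spec)
  qed
  from bchoice[OF this] obtain K where K: "\<And>vs i x. vs \<in> ?S \<Longrightarrow> (1 + norm x) ^ M * norm (iter_deriv vs (\<phi> i) x) \<le> K vs" by blast
  have "(1 + norm x) ^ M * norm (iter_deriv vs (\<phi> i) x) \<le> Max (K ` ?S)" if "vs \<in> ?S" for vs i x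
    using K[OF that, of x i] Max_ge[OF finite_imageI[OF finite_deriv_lists] imageI[OF that], of K] by linarith
  then show ?thesis by (intro exI[of _ "Max (K ` ?S)"]) auto
qed

lemma wsup_upper:
  assumes f: "f \<in> schwartz" and vs: "set vs \<subseteq> Basis" "length vs \<le> N"
  shows "(1 + norm x) ^ M * norm (iter_deriv vs f x) \<le> wsup M N f"
proof -
  let ?A = "{vs. set vs \<subseteq> (Basis::plane set) \<and> length vs \<le> N} \<times> (UNIV::plane set)"
  obtain K where "\<forall>p\<in>?A. (case p of (vs, x) \<Rightarrow> (1 + norm x) ^ M * norm (iter_deriv vs f x)) \<le> K"
    using sfam_deriv_bound[of "\<lambda>_::unit. f" N M] f unfolding schwartz_iff_sfam by blast
  then have bdd: "bdd_above ((\<lambda>(vs, x). (1 + norm x) ^ M * norm (iter_deriv vs f x)) ` ?A)"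
    by (intro bdd_aboveI2[of _ _ K]) blast
  have "(vs, x) \<in> ?A" using vs by simp
  from cSUP_upper[OF this bdd] show ?thesis unfolding wsup_def by simp
qed

lemma wsup_nonneg: "f \<in> schwartz \<Longrightarrow> 0 \<le> wsup M N f"
  by (rule order_trans[OF _ wsup_upper[of f "[]" N 0]]) simp_all

lemma wsup_leI:
  assumes "\<And>vs x. set vs \<subseteq> Basis \<Longrightarrow> length vs \<le> N \<Longrightarrow> (1 + norm x) ^ M * norm (iter_deriv vs f x) \<le> K"
  shows "wsup M N f \<le> K"
  unfolding wsup_def
proof (rule cSUP_least)
  have "[] \<in> {vs. set vs \<subseteq> (Basis::plane set) \<and> length vs \<le> N}" by simp
  then show "{vs. set vs \<subseteq> (Basis::plane set) \<and> length vs \<le> N} \<times> (UNIV::plane set) \<noteq> {}" by blast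
qed (use assms in auto)

lemma wsup_mono: "f \<in> schwartz \<Longrightarrow> n \<le> N \<Longrightarrow> wsup M n f \<le> wsup M N f"
  by (intro wsup_leI wsup_upper) auto

lemma functional_sfam_bound:
  assumes \<phi>: "sfam \<phi>" and u: "\<And>i. norm (u (\<phi> i)) \<le> C * wsup M N (\<phi> i)"
  shows "\<exists>K\<ge>0. \<forall>i. norm (u (\<phi> i)) \<le> K"
proof -
  obtain K where K: "\<forall>i. \<forall>p\<in>{vs. set vs \<subseteq> Basis \<and> length vs \<le> N} \<times> UNIV. (case p of (vs, x) \<Rightarrow> (1 + norm x) ^ M * norm (iter_deriv vs (\<phi> i) x)) \<le> K"
    using sfam_deriv_bound[OF \<phi>] by blast
  have "norm (u (\<phi> i)) \<le> \<bar>C\<bar> * \<bar>K\<bar>" for i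
  proof -
    have "wsup M N (\<phi> i) \<le> K" by (rule wsup_leI) (use K in auto)
    then have "C * wsup M N (\<phi> i) \<le> \<bar>C\<bar> * \<bar>K\<bar>" using wsup_nonneg[OF sfam_member[OF \<phi>]] by (intro mult_mono) auto
    with u show ?thesis by (rule order_trans)
  qed
  then show ?thesis by (intro exI[of _ "\<bar>C\<bar> * \<bar>K\<bar>"]) simp
qed

lemma tempered_sfam_bound:
  assumes u: "tempered_distribution u" and \<phi>: "sfam \<phi>"
  shows "\<exists>K\<ge>0. \<forall>i. norm (u (\<phi> i)) \<le> K"
proof -
  obtain C N where C: "\<And>f. f \<in> schwartz \<Longrightarrow> norm (u f) \<le> C * wsup N N f"
    using u unfolding tempered_distribution_def schwartz_seminorm_wsup by metis
  show ?thesis by (rule functional_sfam_bound[OF \<phi> C[OF sfam_member[OF \<phi>]]])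
qed

lemma wiener_sfam:
  assumes \<phi>: "sfam \<phi>" shows "\<exists>K\<ge>0. \<forall>i. wiener (\<phi> i) \<le> K"
proof -
  \<comment> \<open>Decay of order 6: two powers compensate the quadratic weight in
    \<open>wiener\<close>, and the remaining four are integrable.\<close>
  obtain K where K: "0 \<le> K" "\<And>i x. norm (fourier (\<phi> i) x) \<le> K * inverse ((1 + norm x) ^ 6)"
    using sfam_bound[OF sfam_fourier[OF \<phi>], of 6] by metis
  have "wiener (\<phi> i) \<le> (LINT k::plane|lborel. K * inverse ((1 + norm k) ^ 4))" for i
    unfolding wiener_def
  proof (rule integral_mono[OF wiener_integrable[OF sfam_member[OF \<phi>]]])
    show "integrable lborel (\<lambda>k::plane. K * inverse ((1 + norm k) ^ 4))" by (intro integrable_mult_right integrable_decay)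
    fix k :: plane
    have p: "0 < 1 + norm k" by (simp add: add_pos_nonneg)
    have "(norm k)\<^sup>2 * norm (fourier (\<phi> i) k) \<le> (1 + norm k)\<^sup>2 * (K * inverse ((1 + norm k) ^ 6))"
      by (intro mult_mono K(2) power_mono) auto
    also have "\<dots> = K * inverse ((1 + norm k) ^ 4)"
    proof -
      have "(1 + norm k) ^ 6 = (1 + norm k)\<^sup>2 * (1 + norm k) ^ 4" by (simp flip: power_add)
      then show ?thesis using p by (simp add: field_simps)
    qed
    finally show "(norm k)\<^sup>2 * norm (fourier (\<phi> i) k) \<le> K * inverse ((1 + norm k) ^ 4)" .
  qed
  then show ?thesis
    by (intro exI[of _ "\<bar>LINT k::plane|lborel. K * inverse ((1 + norm k) ^ 4)\<bar>"]) (auto intro: order_trans[OF _ abs_ge_self])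
qed

text \<open>On a common bounded support the polynomial weights are bounded, so uniform bounds for
  the derivatives alone are enough.\<close>

lemma sfam_compactI:
  assumes s: "\<And>i. smooth (\<phi> i)" and r: "\<And>i x. r < norm x \<Longrightarrow> \<phi> i x = 0"
    and bd: "\<And>vs. set vs \<subseteq> Basis \<Longrightarrow> \<exists>C. \<forall>i x. norm (iter_deriv vs (\<phi> i) x) \<le> C"
  shows "sfam \<phi>"
  unfolding dfam_def
proof (intro allI impI conjI)
  fix vs :: "plane list" assume vs: "set vs \<subseteq> Basis"
  show "iter_deriv vs (\<phi> i) differentiable at x" for i x
    by (rule smooth_differentiable[OF smooth_iter[OF s vs]])
  obtain C where C: "\<And>i x. norm (iter_deriv vs (\<phi> i) x) \<le> C" using bd[OF vs] by metis
  show "wb (\<lambda>i. iter_deriv vs (\<phi> i))" unfolding wb_def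
  proof
    fix N
    have "(1 + norm x) ^ N * norm (iter_deriv vs (\<phi> i) x) \<le> (1 + \<bar>r\<bar>) ^ N * \<bar>C\<bar>" for i x
    proof (cases "norm x \<le> r")
      case True
      then show ?thesis using C[of i x] by (intro mult_mono power_mono) auto
    next
      case False
      have "iter_deriv vs (\<phi> i) x = 0"
        by (rule iter_deriv_zero_outside[of "cball 0 r"]) (use False r in auto)
      then show ?thesis by simp
    qed
    then show "\<exists>K. \<forall>i x. (1 + norm x) ^ N * norm (iter_deriv vs (\<phi> i) x) \<le> K" by blast
  qed
qed

lemma compact_support_deriv_bounded:
  fixes f :: "'a::euclidean_space \<Rightarrow> complex"
  assumes "smooth f" "compact (supp f)" "set vs \<subseteq> Basis"
  shows "\<exists>C. \<forall>x. norm (iter_deriv vs f x) \<le> C"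
proof -
  have "continuous_on (supp f) (\<lambda>x. norm (iter_deriv vs f x))"
    by (intro continuous_intros smooth_continuous smooth_iter assms)
  from compact_imp_bounded[OF compact_continuous_image[OF this assms(2)]]
  obtain C where C: "\<And>x. x \<in> supp f \<Longrightarrow> norm (norm (iter_deriv vs f x)) \<le> C" unfolding bounded_iff by blast
  have "norm (iter_deriv vs f x) \<le> \<bar>C\<bar>" for x
  proof (cases "x \<in> supp f")
    case True
    then show ?thesis using C[of x] by simp
  next
    case False
    have "iter_deriv vs f x = 0"
      by (rule iter_deriv_zero_outside[OF closed_supp zero_outside_supp False])
    then show ?thesis by simp
  qed
  then show ?thesis by blast
qed

lemma iter_deriv_linear:
  fixes f g :: "'a::euclidean_space \<Rightarrow> complex"
  assumes "smooth f" "smooth g" "set vs \<subseteq> Basis"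
  shows "iter_deriv vs (\<lambda>x. a * f x + b * g x) = (\<lambda>x. a * iter_deriv vs f x + b * iter_deriv vs g x)"
  using assms(3)
proof (induction vs)
  case (Cons v vs)
  have d: "iter_deriv vs f differentiable at x" "iter_deriv vs g differentiable at x" for x
    using Cons.prems by (auto intro!: smooth_differentiable smooth_iter assms)
  have "dir_deriv v (\<lambda>x. a * iter_deriv vs f x + b * iter_deriv vs g x) x = a * dir_deriv v (iter_deriv vs f) x + b * dir_deriv v (iter_deriv vs g) x" for x
    by (subst dir_deriv_add, intro differentiable_mult differentiable_const d, intro differentiable_mult differentiable_const d)
      (simp only: dir_deriv_cmult[OF d(1)] dir_deriv_cmult[OF d(2)])
  with Cons show ?case by (simp add: iter_deriv_Cons)
qed simp

section \<open>Time slices of test functions and their difference quotients\<close>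

lemma smooth_slice:
  fixes \<phi> :: "real \<times> plane \<Rightarrow> complex"
  assumes "smooth \<phi>" shows "smooth (\<lambda>x. \<phi> (t, x))"
proof -
  have "bounded_linear (\<lambda>x::plane. (0::real, x))" by (rule bounded_linear_Pair[OF bounded_linear_zero bounded_linear_ident])
  from smooth_compose_affine[OF assms this, of "(t, 0)"] show ?thesis by simp
qed

lemma smooth_linear_comb: "smooth f \<Longrightarrow> smooth g \<Longrightarrow> smooth (\<lambda>x. a * f x + b * g x)" for f :: "'a::euclidean_space \<Rightarrow> complex"
  by (intro smooth_add smooth_mult smooth_const)

lemma set_map_Pair_Basis: "set vs \<subseteq> Basis \<Longrightarrow> set (map (Pair 0) vs) \<subseteq> (Basis :: (real \<times> plane) set)"
  by (auto simp: Basis_prod_def)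

text \<open>The difference quotient in time. For \<open>t = t'\<close> division by zero yields the
  zero function, so pairs of equal times may stay in the index set.\<close>

abbreviation dq :: "(real \<times> plane \<Rightarrow> complex) \<Rightarrow> real \<Rightarrow> real \<Rightarrow> plane \<Rightarrow> complex" where
  "dq \<phi> t t' \<equiv> \<lambda>x. complex_of_real (1 / (t - t')) * \<phi> (t, x) + complex_of_real (- 1 / (t - t')) * \<phi> (t', x)"

text \<open>Compact support in space-time makes all bounds uniform in time. For the difference
  quotients, the mean value theorem in the time direction trades the quotient for one more
  derivative. A linear functional that is bounded on the second family is Lipschitz along the
  slices, which is how continuity in time is obtained.\<close>

lemma sfam_slices:
  fixes \<phi> :: "real \<times> plane \<Rightarrow> complex"
  assumes \<phi>: "\<phi> \<in> test_functions \<Omega>"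
  shows "sfam (\<lambda>t x. \<phi> (t, x))"
    and "sfam (\<lambda>(t, t'). dq \<phi> t t')"
proof -
  have s: "smooth \<phi>" and c: "compact (supp \<phi>)" using \<phi> by (auto simp: test_functions_def)
  obtain r where r: "\<And>p. p \<in> supp \<phi> \<Longrightarrow> norm p \<le> r" using compact_imp_bounded[OF c] unfolding bounded_iff by metis
  have z: "\<phi> (t, x) = 0" if "r < norm x" for t x
  proof (rule zero_outside_supp[of "(t, x)" \<phi>])
    have "norm x \<le> norm (t, x)" by (simp add: norm_Pair real_le_rsqrt)
    then show "(t, x) \<notin> supp \<phi>" using r[of "(t, x)"] that by auto
  qed
  show "sfam (\<lambda>t x. \<phi> (t, x))"
  proof (rule sfam_compactI[OF smooth_slice[OF s] z])
    fix vs :: "plane list" assume vs: "set vs \<subseteq> Basis"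
    show "\<exists>C. \<forall>t x. norm (iter_deriv vs (\<lambda>x. \<phi> (t, x)) x) \<le> C"
      using compact_support_deriv_bounded[OF s c set_map_Pair_Basis[OF vs]]
      unfolding iter_deriv_compose_snd[OF s vs] by metis
  qed
  show "sfam (\<lambda>(t, t'). dq \<phi> t t')"
  proof (rule sfam_compactI)
    show "smooth (case i of (t, t') \<Rightarrow> (dq \<phi> t t'))" for i
      by (cases i) (simp only: prod.case, intro smooth_linear_comb smooth_slice s)
    show "(case i of (t, t') \<Rightarrow> (dq \<phi> t t')) x = 0" if "r < norm x" for i x
      by (cases i) (simp add: z[OF that])
    fix vs :: "plane list" assume vs: "set vs \<subseteq> Basis"
    define \<zeta> where "\<zeta> = iter_deriv (map (Pair 0) vs) \<phi>"
    have \<zeta>s: "smooth \<zeta>" unfolding \<zeta>_def by (rule smooth_iter[OF s set_map_Pair_Basis[OF vs]])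
    have e1: "((1::real), (0::plane)) \<in> Basis" by (simp add: Basis_prod_def)
    have "set (((1::real), (0::plane)) # map (Pair 0) vs) \<subseteq> Basis" using e1 set_map_Pair_Basis[OF vs] by simp
    from compact_support_deriv_bounded[OF s c this]
    obtain M where M: "\<And>p. norm (dir_deriv (1, 0) \<zeta> p) \<le> M" unfolding iter_deriv_Cons \<zeta>_def[symmetric] by metis
    have lip: "norm (\<zeta> (t, x) - \<zeta> (t', x)) \<le> M * \<bar>t - t'\<bar>" for t t' x
    proof -
      have *: "norm (\<zeta> (t' + d, x) - \<zeta> (t', x)) \<le> M * d" if "0 \<le> d" for t' d
        using mean_value_bound[OF smooth_differentiable[OF \<zeta>s] that, of "(1, 0)" "(t', x)" M] M by simp
      show ?thesis
        using *[of "t - t'" t'] *[of "t' - t" t] by (cases "t' \<le> t") (simp_all add: norm_minus_commute)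
    qed
    have "norm (iter_deriv vs (case i of (t, t') \<Rightarrow> (dq \<phi> t t')) x) \<le> \<bar>M\<bar>" for i x
    proof -
      obtain t t' where i: "i = (t, t')" by (cases i)
      have "iter_deriv vs (dq \<phi> t t') x
        = complex_of_real (1 / (t - t')) * (\<zeta> (t, x) - \<zeta> (t', x))"
        unfolding iter_deriv_linear[OF smooth_slice[OF s] smooth_slice[OF s] vs] iter_deriv_compose_snd[OF s vs] \<zeta>_def
        by (simp add: right_diff_distrib)
      also have "norm \<dots> \<le> \<bar>M\<bar>"
      proof (cases "t = t'")
        case False
        have "norm (complex_of_real (1 / (t - t')) * (\<zeta> (t, x) - \<zeta> (t', x))) = norm (\<zeta> (t, x) - \<zeta> (t', x)) / \<bar>t - t'\<bar>"
          unfolding norm_mult norm_of_real by (simp add: abs_divide)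
        also have "\<dots> \<le> M" using lip[of t x t'] False by (simp add: pos_divide_le_eq)
        finally show ?thesis by simp
      qed simp
      finally show ?thesis by (simp add: i)
    qed
    then show "\<exists>C. \<forall>i x. norm (iter_deriv vs (case i of (t, t') \<Rightarrow> (dq \<phi> t t')) x) \<le> C"
      by blast
  qed
qed

lemma slice_continuous:
  fixes \<phi> :: "real \<times> plane \<Rightarrow> complex" and u :: "functional"
  assumes u: "linear_functional_on V u" and V: "\<And>t. (\<lambda>x. \<phi> (t, x)) \<in> V"
    and K: "\<And>i. norm (u ((\<lambda>(t, t'). dq \<phi> t t') i)) \<le> K"
  shows "continuous_on UNIV (\<lambda>t. u (\<lambda>x. \<phi> (t, x)))"
proof -
  have "norm (u (\<lambda>x. \<phi> (t, x)) - u (\<lambda>x. \<phi> (t', x))) \<le> K * \<bar>t - t'\<bar>" for t t'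
  proof (cases "t = t'")
    case False
    have "u (dq \<phi> t t') = complex_of_real (1 / (t - t')) * u (\<lambda>x. \<phi> (t, x)) + complex_of_real (- 1 / (t - t')) * u (\<lambda>x. \<phi> (t', x))"
      by (rule u[unfolded linear_functional_on_def, rule_format, OF V V])
    also have "\<dots> = complex_of_real (1 / (t - t')) * (u (\<lambda>x. \<phi> (t, x)) - u (\<lambda>x. \<phi> (t', x)))"
      by (simp add: right_diff_distrib)
    finally have "norm (complex_of_real (1 / (t - t')) * (u (\<lambda>x. \<phi> (t, x)) - u (\<lambda>x. \<phi> (t', x)))) \<le> K" using K[of "(t, t')"] by simp
    then have "norm (u (\<lambda>x. \<phi> (t, x)) - u (\<lambda>x. \<phi> (t', x))) / \<bar>t - t'\<bar> \<le> K"
      unfolding norm_mult norm_of_real by (simp add: abs_divide)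
    then show ?thesis using False by (simp add: pos_divide_le_eq)
  qed simp
  moreover have "0 \<le> K" by (rule order_trans[OF norm_ge_zero K])
  ultimately have "K-lipschitz_on UNIV (\<lambda>t. u (\<lambda>x. \<phi> (t, x)))"
    by (intro lipschitz_onI) (auto simp: dist_norm)
  then show ?thesis by (rule lipschitz_on_continuous_on)
qed

lemma tempered_slice_continuous:
  assumes u: "tempered_distribution u" and \<phi>: "\<phi> \<in> test_functions \<Omega>"
  shows "continuous_on UNIV (\<lambda>t::real. u (\<lambda>x. \<phi> (t, x)))"
proof -
  obtain K where "\<And>i. norm (u ((\<lambda>(t, t'). dq \<phi> t t') i)) \<le> K"
    using tempered_sfam_bound[OF u sfam_slices(2)[OF \<phi>]] by blast
  then show ?thesis by (rule slice_continuous[OF tempered_linear[OF u] sfam_member[OF sfam_slices(1)[OF \<phi>]]])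
qed

section \<open>Pairing the homogeneous Sobolev space with Schwartz functions\<close>

lemma L2_norm_sq_affine:
  assumes "\<And>a. represents a u \<Longrightarrow> l2 a < \<infinity> \<Longrightarrow> X \<le> ennreal c * l2 a + K"
    and c: "c > 0" and fin: "L2_norm_sq u < \<infinity>"
  shows "X \<le> ennreal c * L2_norm_sq u + K"
proof (rule ennreal_le_epsilon)
  fix e :: real assume e: "0 < e"
  have "L2_norm_sq u < L2_norm_sq u + ennreal (e / c)"
    using fin e c by (simp add: ennreal_add_less_top less_top[symmetric] ennreal_lessI)
  then obtain a where a: "represents a u" "l2 a < L2_norm_sq u + ennreal (e / c)"
    using L2_norm_sq_lessD by metis
  have "l2 a < \<infinity>" using a(2) fin by (auto intro: less_trans simp: ennreal_add_less_top top.not_eq_extremum)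
  from assms(1)[OF a(1) this] have "X \<le> ennreal c * l2 a + K" .
  also have "\<dots> \<le> ennreal c * (L2_norm_sq u + ennreal (e / c)) + K"
    by (intro add_mono mult_left_mono less_imp_le[OF a(2)]) auto
  also have "\<dots> = ennreal c * L2_norm_sq u + K + ennreal c * ennreal (e / c)"
    by (simp only: distrib_left add_ac)
  also have "ennreal c * ennreal (e / c) = ennreal e" using e c by (simp flip: ennreal_mult)
  finally show "X \<le> ennreal c * L2_norm_sq u + K + ennreal e" .
qed

text \<open>Cauchy--Schwarz in additive form with a free parameter. In this form it can be weighted
  differently on each annulus and summed without square roots in \<open>ennreal\<close>.\<close>

lemma L2_pairing_bound:
  assumes c: "0 < c" and fin: "L2_norm_sq w < \<infinity>" and k: "k \<in> schwartz"
  shows "ennreal (norm (w k)) \<le> ennreal c * L2_norm_sq w + ennreal (1 / c) * l2 k"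
proof (rule L2_norm_sq_affine[OF _ c fin])
  fix G assume G: "represents G w"
  have [measurable]: "G \<in> borel_measurable borel" "k \<in> borel_measurable borel"
    using represents_borel[OF G] schwartz_borel[OF k] .
  have pw: "norm (G x * k x) \<le> c * (norm (G x))\<^sup>2 + (1 / c) * (norm (k x))\<^sup>2" for x
  proof -
    have "2 * (sqrt c * norm (G x)) * (norm (k x) / sqrt c) \<le> (sqrt c * norm (G x))\<^sup>2 + (norm (k x) / sqrt c)\<^sup>2"
      by (rule sum_squares_bound)
    then have "2 * (norm (G x) * norm (k x)) \<le> c * (norm (G x))\<^sup>2 + (1 / c) * (norm (k x))\<^sup>2"
      using c by (simp add: power_mult_distrib power_divide)
    moreover have "0 \<le> norm (G x) * norm (k x)" by simp
    ultimately show ?thesis by (simp only: norm_mult)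
  qed
  have "w k = (LINT x|lborel. G x * k x)" "integrable lborel (\<lambda>x. G x * k x)"
    using G k by (auto simp: represents_def of_function_def)
  then have "ennreal (norm (w k)) \<le> (\<integral>\<^sup>+x. ennreal (norm (G x * k x)) \<partial>lborel)"
    using integral_norm_bound_ennreal by metis
  also have "\<dots> \<le> (\<integral>\<^sup>+x. ennreal (c * (norm (G x))\<^sup>2 + (1 / c) * (norm (k x))\<^sup>2) \<partial>lborel)"
    by (intro nn_integral_mono ennreal_leI pw)
  also have "\<dots> = (\<integral>\<^sup>+x. ennreal c * ennreal ((norm (G x))\<^sup>2) + ennreal (1 / c) * ennreal ((norm (k x))\<^sup>2) \<partial>lborel)"
  proof (intro nn_integral_cong)
    fix x
    have "ennreal (c * (norm (G x))\<^sup>2) = ennreal c * ennreal ((norm (G x))\<^sup>2)" "ennreal ((1 / c) * (norm (k x))\<^sup>2) = ennreal (1 / c) * ennreal ((norm (k x))\<^sup>2)"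
      using c by (intro ennreal_mult; simp)+
    moreover have "0 \<le> c * (norm (G x))\<^sup>2" "0 \<le> (1 / c) * (norm (k x))\<^sup>2" using c by simp_all
    ultimately show "ennreal (c * (norm (G x))\<^sup>2 + (1 / c) * (norm (k x))\<^sup>2) = ennreal c * ennreal ((norm (G x))\<^sup>2) + ennreal (1 / c) * ennreal ((norm (k x))\<^sup>2)"
      by (simp only: ennreal_plus)
  qed
  also have "\<dots> = ennreal c * l2 G + ennreal (1 / c) * l2 k"
    unfolding l2_def by (simp add: nn_integral_add nn_integral_cmult)
  finally show "ennreal (norm (w k)) \<le> ennreal c * l2 G + ennreal (1 / c) * l2 k" .
qed

text \<open>The dilates spread out, so only \<open>pb\<close> can be expected. Each derivative
  divides the scalar by \<open>2 ^ M\<close>, which keeps it bounded by one; scalars and profile are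
  therefore both part of the invariant.\<close>

lemma sfam_dilations:
  assumes k: "k \<in> schwartz" and c: "\<And>M::nat. \<bar>c M\<bar> \<le> 1"
  shows "dfam pb (\<lambda>M \<xi>. complex_of_real (c M) * k (\<xi> /\<^sub>R 2 ^ M))"
proof -
  let ?C = "\<lambda>f :: nat \<Rightarrow> plane \<Rightarrow> complex. \<exists>c k. k \<in> schwartz \<and> (\<forall>M. \<bar>c M\<bar> \<le> 1) \<and> f = (\<lambda>M \<xi>. complex_of_real (c M) * k (\<xi> /\<^sub>R 2 ^ M))"
  have pbz: "pb (\<lambda>(i::nat) x. 0)" by (rule pb_const)
  have pba: "pb (\<lambda>i x. f i x + g i x)" if "pb f" "pb g" for f g :: "nat \<Rightarrow> plane \<Rightarrow> complex"
  proof -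
    obtain N K N' K' where f: "\<And>i x. norm (f i x) \<le> K * (1 + norm x) ^ N" and g: "\<And>i x. norm (g i x) \<le> K' * (1 + norm x) ^ N'"
      using \<open>pb f\<close> \<open>pb g\<close> unfolding pb_def by blast
    have "norm (f i x + g i x) \<le> (\<bar>K\<bar> + \<bar>K'\<bar>) * (1 + norm x) ^ (N + N')" for i x
    proof -
      have m: "(1 + norm x) ^ N \<le> (1 + norm x) ^ (N + N')" "(1 + norm x) ^ N' \<le> (1 + norm x) ^ (N + N')"
        by (intro power_increasing; simp)+
      have "K * (1 + norm x) ^ N \<le> \<bar>K\<bar> * (1 + norm x) ^ (N + N')" "K' * (1 + norm x) ^ N' \<le> \<bar>K'\<bar> * (1 + norm x) ^ (N + N')"
        by (intro mult_mono m; simp)+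
      then show ?thesis using f[of i x] g[of i x] norm_triangle_ineq[of "f i x" "g i x"] by (simp add: distrib_right)
    qed
    then show ?thesis unfolding pb_def by blast
  qed
  show ?thesis
  proof (rule dfam_coinduct[of ?C, OF _ _ _ _ pbz pba])
    show "?C (\<lambda>M \<xi>. complex_of_real (c M) * k (\<xi> /\<^sub>R 2 ^ M))"
      using k c by (intro exI[of _ c] exI[of _ k]) simp
    fix f assume "?C f"
    then obtain c k where k: "k \<in> schwartz" and c: "\<And>M::nat. \<bar>c M\<bar> \<le> 1" and f: "f = (\<lambda>M \<xi>. complex_of_real (c M) * k (\<xi> /\<^sub>R 2 ^ M))" by blast
    have L: "bounded_linear (\<lambda>\<xi>::plane. \<xi> /\<^sub>R 2 ^ M)" for M by (rule bounded_linear_scaleR_right)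
    note kd = smooth_differentiable[OF schwartz_smooth[OF k]]
    have der: "((\<lambda>\<xi>. k (\<xi> /\<^sub>R 2 ^ M)) has_derivative (\<lambda>v. dir_deriv (v /\<^sub>R 2 ^ M) k (\<xi> /\<^sub>R 2 ^ M))) (at \<xi>)" for M \<xi>
      by (rule has_derivative_compose[OF bounded_linear_imp_has_derivative[OF L] has_derivative_dir_deriv[OF kd]])
    show "f i differentiable at x" for i x unfolding f
      by (intro differentiable_mult differentiable_const differentiableI[OF der])
    obtain K where K: "\<And>x. norm (k x) \<le> K" using schwartz_bound[OF k, of 0] by auto
    have "norm (f M x) \<le> K * (1 + norm x) ^ 0" for M x
      using mult_mono[OF c[of M] K[of "x /\<^sub>R 2 ^ M"]] by (simp add: f norm_mult)
    then show "pb f" unfolding pb_def by blast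
    fix b :: plane assume b: "b \<in> Basis"
    have "dir_deriv b (f M) \<xi> = complex_of_real (c M / 2 ^ M) * dir_deriv b k (\<xi> /\<^sub>R 2 ^ M)" for M \<xi>
      unfolding f dir_deriv_cmult[OF differentiableI[OF der]] dir_deriv_eq[OF der] dir_deriv_scaleR[OF kd]
      by (simp add: scaleR_conv_of_real[where 'a = complex] divide_inverse)
    then have e: "(\<lambda>i. dir_deriv b (f i)) = (\<lambda>M \<xi>. complex_of_real (c M / 2 ^ M) * dir_deriv b k (\<xi> /\<^sub>R 2 ^ M))" by (intro ext)
    have "\<bar>c M / 2 ^ M\<bar> \<le> 1" for M
    proof -
      have "\<bar>c M\<bar> \<le> 2 ^ M" using c[of M] one_le_power[of "2::real" M] by linarith
      then show ?thesis by (simp add: abs_divide)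
    qed
    then show "add_closure ?C (\<lambda>i. dir_deriv b (f i))"
      unfolding e using schwartz_deriv[OF k b]
      by (intro add_closure.base exI[of _ "\<lambda>M. c M / 2 ^ M"] exI[of _ "dir_deriv b k"]) simp
  qed
qed

context
  fixes h :: "plane \<Rightarrow> complex"
  assumes h: "LP_symbol h"
begin

lemma hs_nat: "hs h (int M) \<xi> = h (\<xi> /\<^sub>R 2 ^ M)"
  unfolding hs_def by (simp add: power_int_minus)

text \<open>The factor \<open>2 ^ M\<close> is affordable: \<open>1 - hs h M\<close> vanishes up to
  norm \<open>2 ^ M / 2\<close>, so the product grows at most linearly, and a first derivative of
  the dilated symbol cancels the factor.\<close>

lemma high_frequency_family: "dfam pb (\<lambda>M \<xi>. complex_of_real (2 ^ M) * (1 - hs h (int M) \<xi>))"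
proof (rule dfam_step)
  note hS = h_schwartz[OF h]
  note hd = smooth_differentiable[OF schwartz_smooth[OF hS]]
  have L: "bounded_linear (\<lambda>\<xi>::plane. \<xi> /\<^sub>R 2 ^ M)" for M by (rule bounded_linear_scaleR_right)
  have der: "((\<lambda>\<xi>. complex_of_real (2 ^ M) * (1 - h (\<xi> /\<^sub>R 2 ^ M))) has_derivative (\<lambda>v. complex_of_real (2 ^ M) * (0 - dir_deriv (v /\<^sub>R 2 ^ M) h (\<xi> /\<^sub>R 2 ^ M)))) (at \<xi>)" for M \<xi>
    by (intro has_derivative_mult_right has_derivative_diff has_derivative_const
        has_derivative_compose[OF bounded_linear_imp_has_derivative[OF L] has_derivative_dir_deriv[OF hd]])
  show "(\<lambda>\<xi>. complex_of_real (2 ^ M) * (1 - hs h (int M) \<xi>)) differentiable at x" for M x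
    unfolding hs_nat by (rule differentiableI[OF der])
  obtain K where K: "0 \<le> K" "\<And>x. norm (h x) \<le> K" using schwartz_bound[OF hS, of 0] by auto
  have "norm (complex_of_real (2 ^ M) * (1 - hs h (int M) \<xi>)) \<le> (2 * (1 + K)) * (1 + norm \<xi>) ^ 1" for M \<xi>
  proof (cases "norm \<xi> \<le> 2 powr (real_of_int (int M) - 1)")
    case True
    then have "hs h (int M) \<xi> = 1" by (rule hs_one[OF h])
    then show ?thesis using K by simp
  next
    case False
    have "2 powr (real_of_int (int M) - 1) = 2 ^ M / 2" by (simp add: powr_diff powr_realpow)
    then have "2 ^ M \<le> 2 * norm \<xi>" using False by simp
    moreover have "norm (1 - hs h (int M) \<xi>) \<le> 1 + K"
      using norm_triangle_ineq4[of 1 "hs h (int M) \<xi>"] K(2)[of "\<xi> /\<^sub>R 2 ^ M"] by (simp add: hs_nat)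
    ultimately have "2 ^ M * norm (1 - hs h (int M) \<xi>) \<le> (2 * norm \<xi>) * (1 + K)" by (intro mult_mono) auto
    also have "\<dots> \<le> (2 * (1 + K)) * (1 + norm \<xi>)" using K by (simp add: algebra_simps)
    finally show ?thesis by (simp add: norm_mult norm_power)
  qed
  then show "pb (\<lambda>M \<xi>. complex_of_real (2 ^ M) * (1 - hs h (int M) \<xi>))" unfolding pb_def by blast
  fix b :: plane assume b: "b \<in> Basis"
  have "dir_deriv b (\<lambda>\<xi>. complex_of_real (2 ^ M) * (1 - hs h (int M) \<xi>)) \<xi> = complex_of_real (- 1) * dir_deriv b h (\<xi> /\<^sub>R 2 ^ M)" for M \<xi>
    unfolding hs_nat dir_deriv_eq[OF der] dir_deriv_scaleR[OF hd] by (simp add: scaleR_conv_of_real[where 'a = complex])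
  then have "(\<lambda>M. dir_deriv b (\<lambda>\<xi>. complex_of_real (2 ^ M) * (1 - hs h (int M) \<xi>))) = (\<lambda>M \<xi>. complex_of_real (- 1) * dir_deriv b h (\<xi> /\<^sub>R 2 ^ M))"
    by (intro ext)
  then show "dfam pb (\<lambda>M. dir_deriv b (\<lambda>\<xi>. complex_of_real (2 ^ M) * (1 - hs h (int M) \<xi>)))"
    using sfam_dilations[OF schwartz_deriv[OF hS b], of "\<lambda>_. - 1"] by simp
qed

text \<open>Instead of a convergence in the Schwartz space, the remainder multiplied by
  \<open>2 ^ M\<close> is shown to be a bounded Schwartz family. A tempered distribution is bounded
  on it, which gives convergence at the rate \<open>(1 / 2) ^ M\<close>.\<close>

lemma high_frequency_limit:
  assumes u: "tempered_distribution u" and f: "f \<in> schwartz"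
  shows "(\<lambda>M. P_le h (int M) u f) \<longlonglongrightarrow> u f"
proof -
  let ?F = "\<lambda>M. fourier (\<lambda>\<xi>. complex_of_real (2 ^ M) * (1 - hs h (int M) \<xi>) * inv_fourier f \<xi>)"
  note i = schwartz_inv_fourier[OF f]
  have "sfam ?F"
    by (intro sfam_fourier sfam_mult[OF high_frequency_family]) (use sfam_fourier schwartz_iff_sfam[of "inv_fourier f"] i in \<open>simp add: dfam_def wb_def\<close>)
  from tempered_sfam_bound[OF u this] obtain K where
    K: "\<And>M. norm (u (?F M)) \<le> K" by blast
  have "norm (P_le h (int M) u f - u f) \<le> K * (1 / 2) ^ M" for M
  proof -
    note m = mop_schwartz[OF hs_schwartz[OF h] f, of "int M"]
    have "?F M = (\<lambda>x. complex_of_real (2 ^ M) * (f x - mop (hs h (int M)) f x))"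
    proof (rule ext)
      fix x
      have "(\<lambda>\<xi>. complex_of_real (2 ^ M) * (1 - hs h (int M) \<xi>) * inv_fourier f \<xi>) = (\<lambda>\<xi>. complex_of_real (2 ^ M) * (inv_fourier f \<xi> - hs h (int M) \<xi> * inv_fourier f \<xi>))"
        by (rule ext) (simp add: algebra_simps)
      then have "?F M x = complex_of_real (2 ^ M) * fourier (\<lambda>\<xi>. inv_fourier f \<xi> - hs h (int M) \<xi> * inv_fourier f \<xi>) x"
        by (simp only: fourier_cmult)
      also have "fourier (\<lambda>\<xi>. inv_fourier f \<xi> - hs h (int M) \<xi> * inv_fourier f \<xi>) x = f x - mop (hs h (int M)) f x"
        unfolding fourier_diff[OF schwartz_integrable[OF i] schwartz_integrable[OF schwartz_mult[OF hs_schwartz[OF h] i]]] fourier_inv_fourier[OF f] mop_def ..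
      finally show "?F M x = complex_of_real (2 ^ M) * (f x - mop (hs h (int M)) f x)" .
    qed
    then have "u (?F M) = complex_of_real (2 ^ M) * (u f - P_le h (int M) u f)"
      by (simp add: linear_functional_cmult[OF tempered_linear[OF u] schwartz_diff[OF f m]] linear_functional_diff[OF tempered_linear[OF u] f m] P_le_mop)
    with K[of M] have "2 ^ M * norm (u f - P_le h (int M) u f) \<le> K" by (simp add: norm_mult norm_power)
    then show ?thesis by (simp add: norm_minus_commute power_one_over field_simps)
  qed
  then have ev: "eventually (\<lambda>M. norm (P_le h (int M) u f - u f) \<le> K * (1 / 2) ^ M) sequentially"
    by (intro always_eventually allI)
  have "(\<lambda>M. K * (1 / 2) ^ M) \<longlonglongrightarrow> 0"
    by (intro tendsto_mult_right_zero LIMSEQ_power_zero) simp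
  with ev have "(\<lambda>M. P_le h (int M) u f - u f) \<longlonglongrightarrow> 0"
    by (rule Lim_null_comparison)
  then show ?thesis by (rule LIM_zero_cancel)
qed

text \<open>A fattened annulus symbol, equal to one on the support of \<open>ps h q\<close>.\<close>

definition pt :: "int \<Rightarrow> plane \<Rightarrow> complex" where "pt q \<xi> = hs h (q + 2) \<xi> - hs h (q - 1) \<xi>"

lemma pt_schwartz: "pt q \<in> schwartz"
  unfolding pt_def[abs_def] by (intro schwartz_diff hs_schwartz[OF h])

lemma ps_mult_pt: "ps h q \<xi> * pt q \<xi> = ps h q \<xi>"
proof (cases "2 powr (real_of_int q - 1) < norm \<xi> \<and> norm \<xi> \<le> 2 powr (real_of_int q + 1)")
  case True
  have "hs h (q + 2) \<xi> = 1" by (rule hs_one[OF h]) (use True in \<open>simp add: add.commute\<close>)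
  moreover have "hs h (q - 1) \<xi> = 0" by (rule hs_zero[OF h]) (use True in simp)
  ultimately show ?thesis by (simp add: pt_def)
next
  case False
  then show ?thesis using ps_zero_low[OF h] ps_zero_high[OF h] by force
qed

lemma pt_nonzero:
  assumes "pt q \<xi> \<noteq> 0" shows "2 powr (real_of_int q - 2) < norm \<xi>" "norm \<xi> \<le> 2 powr (real_of_int q + 2)"
proof -
  show "2 powr (real_of_int q - 2) < norm \<xi>"
  proof (rule ccontr)
    assume "\<not> 2 powr (real_of_int q - 2) < norm \<xi>"
    then have n: "norm \<xi> \<le> 2 powr (real_of_int q - 2)" by simp
    have "2 powr (real_of_int q - 2) \<le> 2 powr (real_of_int (q + 2) - 1)" by simp
    with n have "norm \<xi> \<le> 2 powr (real_of_int (q + 2) - 1)" by linarith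
    then have "hs h (q + 2) \<xi> = 1" by (rule hs_one[OF h])
    moreover have "hs h (q - 1) \<xi> = 1" by (rule hs_one[OF h]) (use n in simp)
    ultimately show False using assms by (simp add: pt_def)
  qed
  show "norm \<xi> \<le> 2 powr (real_of_int q + 2)"
  proof (rule ccontr)
    assume "\<not> norm \<xi> \<le> 2 powr (real_of_int q + 2)"
    then have n: "2 powr (real_of_int q + 2) < norm \<xi>" by simp
    have "2 powr real_of_int (q - 1) \<le> 2 powr (real_of_int q + 2)" by simp
    with n have "2 powr real_of_int (q - 1) < norm \<xi>" by linarith
    then have "hs h (q - 1) \<xi> = 0" by (rule hs_zero[OF h])
    moreover have "hs h (q + 2) \<xi> = 0" by (rule hs_zero[OF h]) (use n in simp)
    ultimately show False using assms by (simp add: pt_def)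
  qed
qed

text \<open>At each frequency at most four annuli contribute, those with index from
  \<open>Q - 2\<close> to \<open>Q + 1\<close>. There \<open>2 powr q\<close> is at most
  \<open>4 * (1 + norm \<xi>)\<close> and the exponent is at most 2, which gives 16;
  \<open>(2 * H)\<^sup>2\<close> bounds the squared symbol.\<close>

lemma dual_weight_pointwise:
  assumes s: "- 1 \<le> s" "s \<le> 0"
  shows "\<exists>K\<ge>0. \<forall>\<xi>. (\<integral>\<^sup>+q. wt (- s) q * ennreal ((norm (pt q \<xi>))\<^sup>2) \<partial>count_space UNIV) \<le> ennreal (K * (1 + norm \<xi>)\<^sup>2)"
proof -
  obtain H where H: "0 \<le> H" "\<And>x. norm (h x) \<le> H" using schwartz_bound[OF h_schwartz[OF h], of 0] by auto
  have ptH: "(norm (pt q \<xi>))\<^sup>2 \<le> (2 * H)\<^sup>2" for q \<xi>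
  proof (rule power_mono)
    show "norm (pt q \<xi>) \<le> 2 * H"
      using norm_triangle_ineq4[of "hs h (q + 2) \<xi>" "hs h (q - 1) \<xi>"] H(2) unfolding pt_def hs_def by (smt (verit))
  qed simp
  have "(\<integral>\<^sup>+q. wt (- s) q * ennreal ((norm (pt q \<xi>))\<^sup>2) \<partial>count_space UNIV) \<le> ennreal (4 * (16 * (2 * H)\<^sup>2) * (1 + norm \<xi>)\<^sup>2)" for \<xi>
  proof (cases "\<xi> = 0")
    case True
    have "pt q 0 = 0" for q using hs_one[OF h, of 0] by (simp add: pt_def)
    then show ?thesis using True by simp
  next
    case False
    define Q where "Q = \<lceil>log 2 (norm \<xi>)\<rceil>"
    have n: "0 < norm \<xi>" using False by simp
    have Q1: "real_of_int Q - 1 < log 2 (norm \<xi>)" "log 2 (norm \<xi>) \<le> real_of_int Q" unfolding Q_def by linarith+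
    have Q: "2 powr (real_of_int Q - 1) < norm \<xi>" "norm \<xi> \<le> 2 powr real_of_int Q"
      using Q1 n by (simp_all add: less_log_iff log_le_iff)
    have rng: "q \<in> {Q - 2..Q + 1}" if "pt q \<xi> \<noteq> 0" for q
    proof -
      have "(2::real) powr (real_of_int Q - 1) < 2 powr (real_of_int q + 2)" "(2::real) powr (real_of_int q - 2) < 2 powr real_of_int Q"
        using Q pt_nonzero[OF that] by linarith+
      then have "real_of_int Q - 1 < real_of_int q + 2" "real_of_int q - 2 < real_of_int Q" by simp_all
      then show ?thesis by simp
    qed
    have each: "wt (- s) q * ennreal ((norm (pt q \<xi>))\<^sup>2) \<le> ennreal (16 * (2 * H)\<^sup>2 * (1 + norm \<xi>)\<^sup>2)" if q: "q \<in> {Q - 2..Q + 1}" for q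
    proof -
      have "2 powr (2 * (- s) * real_of_int q) = (2 powr real_of_int q) powr (2 * (- s))" by (simp add: powr_powr mult.commute)
      also have "\<dots> \<le> (4 * (1 + norm \<xi>)) powr (2 * (- s))"
      proof (rule powr_mono2)
        have "2 powr real_of_int q \<le> 2 powr (real_of_int Q - 1 + 2)" using q by (intro powr_mono) auto
        also have "\<dots> = 4 * 2 powr (real_of_int Q - 1)" by (simp only: powr_add) simp
        also have "\<dots> \<le> 4 * (1 + norm \<xi>)" using Q by simp
        finally show "2 powr real_of_int q \<le> 4 * (1 + norm \<xi>)" .
      qed (use s in auto)
      also have "\<dots> \<le> (4 * (1 + norm \<xi>)) powr 2" using s by (intro powr_mono) auto
      also have "\<dots> = 16 * (1 + norm \<xi>)\<^sup>2"
        by (subst powr_numeral, simp add: add_pos_nonneg) (simp only: power_mult_distrib, simp)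
      finally have w: "2 powr (2 * (- s) * real_of_int q) \<le> 16 * (1 + norm \<xi>)\<^sup>2" .
      have "wt (- s) q * ennreal ((norm (pt q \<xi>))\<^sup>2) = ennreal (2 powr (2 * (- s) * real_of_int q) * (norm (pt q \<xi>))\<^sup>2)"
        unfolding wt_powr[OF h] by (rule ennreal_mult[symmetric]) auto
      also have "\<dots> \<le> ennreal ((16 * (1 + norm \<xi>)\<^sup>2) * (2 * H)\<^sup>2)" by (intro ennreal_leI mult_mono w ptH) auto
      finally show ?thesis by (simp add: mult_ac)
    qed
    have "(\<integral>\<^sup>+q. wt (- s) q * ennreal ((norm (pt q \<xi>))\<^sup>2) \<partial>count_space UNIV) = (\<Sum>q\<in>{Q - 2..Q + 1}. wt (- s) q * ennreal ((norm (pt q \<xi>))\<^sup>2))"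
      by (rule nn_integral_count_space') (use rng in auto)
    also have "\<dots> \<le> (\<Sum>q\<in>{Q - 2..Q + 1}. ennreal (16 * (2 * H)\<^sup>2 * (1 + norm \<xi>)\<^sup>2))" by (intro sum_mono each)
    also have "\<dots> = ennreal (\<Sum>q\<in>{Q - 2..Q + 1}. 16 * (2 * H)\<^sup>2 * (1 + norm \<xi>)\<^sup>2)" by (rule sum_ennreal) simp
    also have "(\<Sum>q\<in>{Q - 2..Q + 1}. 16 * (2 * H)\<^sup>2 * (1 + norm \<xi>)\<^sup>2) = 4 * (16 * (2 * H)\<^sup>2) * (1 + norm \<xi>)\<^sup>2" by simp
    finally show ?thesis .
  qed
  then show ?thesis by (intro exI[of _ "4 * (16 * (2 * H)\<^sup>2)"]) simp
qed

lemma dual_norm_bound: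
  assumes s: "- 1 \<le> s" "s \<le> 0" and \<phi>: "sfam \<phi>"
  shows "\<exists>D\<ge>0. \<forall>i. (\<integral>\<^sup>+q. wt (- s) q * l2 (mop (pt q) (\<phi> i)) \<partial>count_space UNIV) \<le> ennreal D"
proof -
  obtain K where K: "0 \<le> K" "\<And>\<xi>. (\<integral>\<^sup>+q. wt (- s) q * ennreal ((norm (pt q \<xi>))\<^sup>2) \<partial>count_space UNIV) \<le> ennreal (K * (1 + norm \<xi>)\<^sup>2)"
    using dual_weight_pointwise[OF s] by blast
  \<comment> \<open>Order 3, because its square, of order 6, has to absorb the quadratic growth of
    the dual weight and still leave the integrable order 4.\<close>
  obtain A where A: "0 \<le> A" "\<And>i \<xi>. norm (inv_fourier (\<phi> i) \<xi>) \<le> A * inverse ((1 + norm \<xi>) ^ 3)"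
    using sfam_bound[OF sfam_inv_fourier[OF \<phi>], of 3] by blast
  define J where "J = (LINT \<xi>::plane|lborel. inverse ((1 + norm \<xi>) ^ 4))"
  have J: "(\<integral>\<^sup>+(\<xi>::plane). ennreal (inverse ((1 + norm \<xi>) ^ 4)) \<partial>lborel) = ennreal J"
    unfolding J_def by (rule nn_integral_eq_integral[OF integrable_decay]) simp
  have J0: "0 \<le> J" unfolding J_def by (rule integral_nonneg_AE) simp
  have "(\<integral>\<^sup>+q. wt (- s) q * l2 (mop (pt q) (\<phi> i)) \<partial>count_space UNIV) \<le> ennreal ((2 * pi)\<^sup>2 * (K * A\<^sup>2 * J))" for i
  proof -
    let ?g = "inv_fourier (\<phi> i)"
    let ?w = "\<lambda>q \<xi>. wt (- s) q * ennreal ((norm (pt q \<xi>))\<^sup>2)" and ?n = "\<lambda>\<xi>. ennreal ((norm (?g \<xi>))\<^sup>2)"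
    have gS: "?g \<in> schwartz" by (intro schwartz_inv_fourier sfam_member[OF \<phi>])
    have [measurable]: "?g \<in> borel_measurable borel" "pt q \<in> borel_measurable borel" for q
      by (intro schwartz_borel gS pt_schwartz)+
    have l2q: "l2 (mop (pt q) (\<phi> i)) = ennreal ((2 * pi)\<^sup>2) * (\<integral>\<^sup>+\<xi>. ennreal ((norm (pt q \<xi>))\<^sup>2 * (norm (?g \<xi>))\<^sup>2) \<partial>lborel)" for q
    proof -
      have S: "(\<lambda>\<xi>. pt q \<xi> * ?g \<xi>) \<in> schwartz" by (intro schwartz_mult pt_schwartz gS)
      have "l2 (mop (pt q) (\<phi> i)) = ennreal ((2 * pi)\<^sup>2 * (LINT \<xi>|lborel. (norm (pt q \<xi> * ?g \<xi>))\<^sup>2))"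
        unfolding mop_def schwartz_l2[OF schwartz_fourier[OF S]] plancherel[OF S] ..
      also have "\<dots> = ennreal ((2 * pi)\<^sup>2) * l2 (\<lambda>\<xi>. pt q \<xi> * ?g \<xi>)"
        unfolding schwartz_l2[OF S] by (rule ennreal_mult) auto
      finally show ?thesis by (simp add: l2_def norm_mult power_mult_distrib)
    qed
    have "(\<integral>\<^sup>+q. wt (- s) q * l2 (mop (pt q) (\<phi> i)) \<partial>count_space UNIV) = (\<integral>\<^sup>+q. \<integral>\<^sup>+\<xi>. ennreal ((2 * pi)\<^sup>2) * ((?w q \<xi>) * ?n \<xi>) \<partial>lborel \<partial>count_space UNIV)"
      unfolding l2q by (simp add: nn_integral_cmult ennreal_mult mult.left_commute mult.assoc)
    also have "\<dots> = (\<integral>\<^sup>+\<xi>. \<integral>\<^sup>+q. ennreal ((2 * pi)\<^sup>2) * ((?w q \<xi>) * ?n \<xi>) \<partial>count_space UNIV \<partial>lborel)"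
      by (rule nn_integral_count_space_nn_integral[symmetric]) simp_all
    also have "\<dots> = (\<integral>\<^sup>+\<xi>. ennreal ((2 * pi)\<^sup>2) * ((\<integral>\<^sup>+q. ?w q \<xi> \<partial>count_space UNIV) * ?n \<xi>) \<partial>lborel)"
      by (simp add: nn_integral_cmult nn_integral_multc)
    also have "\<dots> \<le> (\<integral>\<^sup>+(\<xi>::plane). ennreal ((2 * pi)\<^sup>2 * (K * A\<^sup>2)) * ennreal (inverse ((1 + norm \<xi>) ^ 4)) \<partial>lborel)"
    proof (intro nn_integral_mono)
      fix \<xi> :: plane
      have p: "0 < 1 + norm \<xi>" by (simp add: add_pos_nonneg)
      have "(norm (?g \<xi>))\<^sup>2 \<le> (A * inverse ((1 + norm \<xi>) ^ 3))\<^sup>2" by (intro power_mono A(2)) simp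
      then have "(K * (1 + norm \<xi>)\<^sup>2) * (norm (?g \<xi>))\<^sup>2 \<le> (K * (1 + norm \<xi>)\<^sup>2) * (A * inverse ((1 + norm \<xi>) ^ 3))\<^sup>2"
        using K(1) by (intro mult_left_mono) auto
      also have "\<dots> = K * A\<^sup>2 * inverse ((1 + norm \<xi>) ^ 4)"
      proof -
        have "((1 + norm \<xi>) ^ 3)\<^sup>2 = (1 + norm \<xi>)\<^sup>2 * (1 + norm \<xi>) ^ 4" by (simp flip: power_add power_mult)
        then show ?thesis using p by (simp add: power_mult_distrib power_inverse field_simps)
      qed
      finally have b: "(K * (1 + norm \<xi>)\<^sup>2) * (norm (?g \<xi>))\<^sup>2 \<le> K * A\<^sup>2 * inverse ((1 + norm \<xi>) ^ 4)" .
      have "ennreal ((2 * pi)\<^sup>2) * ((\<integral>\<^sup>+q. ?w q \<xi> \<partial>count_space UNIV) * ?n \<xi>)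
         \<le> ennreal ((2 * pi)\<^sup>2) * (ennreal (K * (1 + norm \<xi>)\<^sup>2) * ?n \<xi>)"
        by (intro mult_left_mono mult_right_mono K(2)) auto
      also have "\<dots> = ennreal ((2 * pi)\<^sup>2 * ((K * (1 + norm \<xi>)\<^sup>2) * (norm (?g \<xi>))\<^sup>2))"
        using K(1) by (simp only: ennreal_mult[symmetric] zero_le_power2 mult_nonneg_nonneg)
      also have "\<dots> \<le> ennreal ((2 * pi)\<^sup>2 * (K * A\<^sup>2 * inverse ((1 + norm \<xi>) ^ 4)))"
        by (intro ennreal_leI mult_left_mono b) simp
      also have "\<dots> = ennreal ((2 * pi)\<^sup>2 * (K * A\<^sup>2)) * ennreal (inverse ((1 + norm \<xi>) ^ 4))"
        using K(1) by (subst ennreal_mult[symmetric]) (auto simp: mult.assoc)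
      finally show "ennreal ((2 * pi)\<^sup>2) * ((\<integral>\<^sup>+q. ?w q \<xi> \<partial>count_space UNIV) * ?n \<xi>)
         \<le> ennreal ((2 * pi)\<^sup>2 * (K * A\<^sup>2)) * ennreal (inverse ((1 + norm \<xi>) ^ 4))" .
    qed
    also have "\<dots> = ennreal ((2 * pi)\<^sup>2 * (K * A\<^sup>2)) * ennreal J" by (simp add: nn_integral_cmult J)
    also have "\<dots> = ennreal ((2 * pi)\<^sup>2 * (K * A\<^sup>2 * J))"
      using K(1) J0 by (subst ennreal_mult[symmetric]) (auto simp: mult.assoc)
    finally show ?thesis .
  qed
  moreover have "0 \<le> (2 * pi)\<^sup>2 * (K * A\<^sup>2 * J)" using K(1) J0 by simp
  ultimately show ?thesis by blast
qed

text \<open>Duality between orders \<open>s\<close> and \<open>- s\<close>, in additive form. The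
  pieces telescope, and the two limit hypotheses identify the limit of the band sums as
  \<open>w f\<close>; the one at low frequencies is the vanishing condition built into
  \<open>Hdot\<close>. The free parameter \<open>c\<close> lets \<open>D / c\<close> be made small
  first and \<open>c * x\<close> afterwards.\<close>

lemma pairing_bound:
  assumes s: "- 1 \<le> s" "s \<le> 0" and w: "linear_functional_on schwartz w" and f: "f \<in> schwartz"
    and low: "(\<lambda>m. P_le h (- int m) w f) \<longlonglongrightarrow> 0" and high: "(\<lambda>m. P_le h (int m) w f) \<longlonglongrightarrow> w f"
    and E: "Hdot_norm_sq h s w \<le> ennreal x" and x: "0 \<le> x" and c: "0 < c"
    and D: "(\<integral>\<^sup>+q. wt (- s) q * l2 (mop (pt q) f) \<partial>count_space UNIV) \<le> ennreal D" "0 \<le> D"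
  shows "norm (w f) \<le> c * x + D / c"
proof -
  have fin: "L2_norm_sq (P_eq h q w) < \<infinity>" for q
    by (rule Hdot_L2_finite[of h s]) (use E in \<open>auto intro: order.strict_trans1\<close>)
  have each: "ennreal (norm (P_eq h q w f)) \<le> ennreal c * (wt s q * L2_norm_sq (P_eq h q w)) + ennreal (1 / c) * (wt (- s) q * l2 (mop (pt q) f))" for q
  proof -
    \<comment> \<open>Using \<open>c * W\<close> as the parameter of \<open>L2_pairing_bound\<close>
      distributes the weight \<open>wt s q\<close> to the distribution and \<open>wt (- s) q\<close>
      to the test function.\<close>
    define W where "W = 2 powr (2 * s * real_of_int q)"
    have W: "0 < W" by (simp add: W_def)
    have "P_eq h q w f = P_eq h q w (mop (pt q) f)"
    proof -
      have "(\<lambda>\<xi>. ps h q \<xi> * pt q \<xi>) = ps h q" using ps_mult_pt by auto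
      then show ?thesis
        unfolding P_eq_ps[OF h w f] P_eq_ps[OF h w mop_schwartz[OF pt_schwartz f]] mop_mop[OF ps_schwartz[OF h] pt_schwartz f] by simp
    qed
    then have "ennreal (norm (P_eq h q w f)) \<le> ennreal (c * W) * L2_norm_sq (P_eq h q w) + ennreal (1 / (c * W)) * l2 (mop (pt q) f)"
      using L2_pairing_bound[of "c * W", OF _ fin mop_schwartz[OF pt_schwartz f], of q q] c W by simp
    also have "ennreal (c * W) = ennreal c * wt s q" unfolding wt_powr[OF h] W_def using c by (simp add: ennreal_mult)
    also have "ennreal (1 / (c * W)) = ennreal (1 / c) * wt (- s) q"
    proof -
      have "1 / (c * W) = (1 / c) * 2 powr (2 * (- s) * real_of_int q)" by (simp add: W_def powr_minus divide_inverse)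
      then show ?thesis unfolding wt_powr[OF h] using c by (simp only: ennreal_mult[symmetric] zero_le_divide_1_iff less_imp_le powr_ge_zero)
    qed
    finally show ?thesis by (simp only: mult.assoc)
  qed
  have bound: "norm (P_le h (int m) w f - P_le h (- int m) w f) \<le> c * x + D / c" for m
  proof -
    have tele: "(\<Sum>q\<in>{- int m..<- int m + int k}. P_eq h q w f) = P_le h (- int m + int k) w f - P_le h (- int m) w f" for k
    proof (induction k)
      case (Suc k)
      have "{- int m..<- int m + int (Suc k)} = insert (- int m + int k) {- int m..<- int m + int k}" by auto
      then show ?case using Suc by (simp add: P_eq_def add_ac)
    qed simp
    have "ennreal (norm (P_le h (int m) w f - P_le h (- int m) w f)) = ennreal (norm (\<Sum>q\<in>{- int m..<int m}. P_eq h q w f))"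
      using tele[of "2 * m"] by simp
    also have "\<dots> \<le> ennreal (\<Sum>q\<in>{- int m..<int m}. norm (P_eq h q w f))" by (intro ennreal_leI norm_sum)
    also have "\<dots> = (\<Sum>q\<in>{- int m..<int m}. ennreal (norm (P_eq h q w f)))" by (rule sum_ennreal[symmetric]) simp
    also have "\<dots> = (\<integral>\<^sup>+q. ennreal (norm (P_eq h q w f)) * indicator {- int m..<int m} q \<partial>count_space UNIV)"
      by (simp add: nn_integral_count_space_finite flip: nn_integral_count_space_indicator)
    also have "\<dots> \<le> (\<integral>\<^sup>+q. ennreal c * (wt s q * L2_norm_sq (P_eq h q w)) + ennreal (1 / c) * (wt (- s) q * l2 (mop (pt q) f)) \<partial>count_space UNIV)"
      by (intro nn_integral_mono) (auto simp: indicator_def each)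
    also have "\<dots> = ennreal c * Hdot_norm_sq h s w + ennreal (1 / c) * (\<integral>\<^sup>+q. wt (- s) q * l2 (mop (pt q) f) \<partial>count_space UNIV)"
      unfolding Hdot_norm_sq_nn by (simp add: nn_integral_add nn_integral_cmult)
    also have "\<dots> \<le> ennreal c * ennreal x + ennreal (1 / c) * ennreal D" by (intro add_mono mult_left_mono E D) auto
    also have "\<dots> = ennreal (c * x + D / c)" using c x D by (simp add: ennreal_mult[symmetric] ennreal_plus[symmetric] del: ennreal_plus)
    finally show ?thesis using c x D by (subst (asm) ennreal_le_iff) auto
  qed
  have "(\<lambda>m. norm (P_le h (int m) w f - P_le h (- int m) w f)) \<longlonglongrightarrow> norm (w f - 0)" by (intro tendsto_intros low high)
  then show ?thesis using LIMSEQ_le_const2[of _ "norm (w f - 0)" "c * x + D / c"] bound by auto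
qed

end

section \<open>Distributions and test functions\<close>

lemma Ck_seminorm_upper:
  assumes "f \<in> test_functions \<Omega>" "set vs \<subseteq> Basis" "length vs \<le> N"
  shows "norm (iter_deriv vs f x) \<le> Ck_seminorm N f"
  using wsup_upper[OF test_functions_schwartz[OF assms(1)] assms(2,3), of x 0] by (simp add: Ck_seminorm_wsup)

lemma distribution_slice_continuous:
  assumes u: "distribution u" and \<phi>: "\<phi> \<in> test_functions \<Omega>"
  shows "continuous_on UNIV (\<lambda>t::real. u (\<lambda>x. \<phi> (t, x)))"
proof -
  let ?d = "\<lambda>(t, t'). dq \<phi> t t'"
  have c: "compact (supp \<phi>)" and s: "smooth \<phi>" using \<phi> by (auto simp: test_functions_def)
  define K where "K = snd ` supp \<phi>"
  have Kc: "compact K" unfolding K_def by (intro compact_continuous_image continuous_intros c)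
  have z: "\<phi> (t, x) = 0" if "x \<notin> K" for t x
    by (rule zero_outside_supp) (use that in \<open>force simp: K_def\<close>)
  have T: "(\<lambda>x. \<phi> (t, x)) \<in> test_functions UNIV" for t
    unfolding test_functions_def using compact_supp[OF Kc z] smooth_slice[OF s] by simp
  have dT: "?d i \<in> test_functions UNIV" "supp (?d i) \<subseteq> K" for i
  proof -
    have z': "?d i x = 0" if "x \<notin> K" for x by (cases i) (simp add: z[OF that])
    show "supp (?d i) \<subseteq> K" by (rule supp_subset[OF compact_imp_closed[OF Kc] z'])
    have "smooth (?d i)" by (rule schwartz_smooth[OF sfam_member[OF sfam_slices(2)[OF \<phi>]]])
    then show "?d i \<in> test_functions UNIV" using compact_supp[OF Kc z'] by (simp add: test_functions_def)
  qed
  obtain C N where C: "\<And>f. f \<in> test_functions UNIV \<Longrightarrow> supp f \<subseteq> K \<Longrightarrow> norm (u f) \<le> C * Ck_seminorm N f"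
    using conjunct2[OF u[unfolded distribution_def], rule_format, OF Kc] by auto
  have "norm (u (?d i)) \<le> C * wsup 0 N (?d i)" for i using C[OF dT] unfolding Ck_seminorm_wsup .
  then obtain A where "\<And>i. norm (u (?d i)) \<le> A" using functional_sfam_bound[OF sfam_slices(2)[OF \<phi>]] by blast
  then show ?thesis by (rule slice_continuous[OF _ T, rotated]) (use u in \<open>simp add: distribution_def\<close>)
qed

lemma iter_deriv_cmult:
  fixes f :: "plane \<Rightarrow> complex"
  assumes "smooth f" "set vs \<subseteq> Basis"
  shows "iter_deriv vs (\<lambda>x. c * f x) = (\<lambda>x. c * iter_deriv vs f x)"
  using iter_deriv_linear[OF assms(1,1,2), of c 0] by simp

text \<open>By contradiction: functions \<open>f n\<close> violating the bound with constant and order \<open>n\<close>, divided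
  by their \<open>n\<close>-th seminorm, would be bounded in every seminorm.\<close>

lemma wiener_Ck_bound:
  assumes K: "compact K"
  shows "\<exists>C N. \<forall>f\<in>test_functions UNIV. supp f \<subseteq> K \<longrightarrow> wiener f \<le> C * Ck_seminorm N f"
proof (rule ccontr)
  assume "\<not> ?thesis"
  then have "\<forall>n. \<exists>f. f \<in> test_functions UNIV \<and> supp f \<subseteq> K \<and> real n * Ck_seminorm n f < wiener f" by (meson not_le)
  from choice[OF this] obtain f where "\<forall>n. f n \<in> test_functions UNIV \<and> supp (f n) \<subseteq> K \<and> real n * Ck_seminorm n (f n) < wiener (f n)" by blast
  then have fT: "\<And>n. f n \<in> test_functions UNIV" and fK: "\<And>n. supp (f n) \<subseteq> K" and fw: "\<And>n. real n * Ck_seminorm n (f n) < wiener (f n)" by auto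
  have fs: "smooth (f n)" "compact (supp (f n))" for n using fT[of n] by (auto simp: test_functions_def)
  define a where "a n = Ck_seminorm n (f n)" for n
  have nonneg: "0 \<le> a n" for n unfolding a_def by (rule order_trans[OF norm_ge_zero Ck_seminorm_upper[OF fT, of "[]"]]) auto
  have a: "0 < a n" for n
  proof -
    have "a n \<noteq> 0"
    proof
      assume "a n = 0"
      then have "f n x = 0" for x using Ck_seminorm_upper[OF fT, of "[]" n n x] by (simp add: a_def iter_deriv_def)
      then have "f n = (\<lambda>x. 0 * 0)" by auto
      then have "wiener (f n) = 0" using wiener_cmult[of 0 "\<lambda>_. 0"] by simp
      then show False using fw[of n] \<open>a n = 0\<close> by (simp add: a_def)
    qed
    with nonneg[of n] show ?thesis by simp
  qed
  define g where "g n x = complex_of_real (1 / a n) * f n x" for n x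
  obtain r where r: "\<And>x. x \<in> K \<Longrightarrow> norm x \<le> r" using compact_imp_bounded[OF K] unfolding bounded_iff by metis
  have "sfam g"
  proof (rule sfam_compactI)
    show "smooth (g n)" for n unfolding g_def[abs_def] by (intro smooth_mult smooth_const fs)
    show "g n x = 0" if "r < norm x" for n x
      using zero_outside_supp[of x "f n"] fK[of n] r[of x] that by (auto simp: g_def)
    fix vs :: "plane list" assume vs: "set vs \<subseteq> Basis"
    have gd: "norm (iter_deriv vs (g n) x) = norm (iter_deriv vs (f n) x) / a n" for n x
    proof -
      have "g n = (\<lambda>x. complex_of_real (1 / a n) * f n x)" by (rule ext) (rule g_def)
      then show ?thesis using a[of n] iter_deriv_cmult[OF fs(1) vs, of "complex_of_real (1 / a n)" n]
        by (simp add: norm_mult norm_divide)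
    qed
    have "\<forall>n. \<exists>C. \<forall>x. norm (iter_deriv vs (f n) x) \<le> C" using compact_support_deriv_bounded[OF fs vs] by blast
    from choice[OF this] obtain C where C: "\<And>n x. norm (iter_deriv vs (f n) x) \<le> C n" by blast
    \<comment> \<open>For \<open>n \<ge> length vs\<close> the normalisation gives the bound 1; the
      finitely many other members are bounded one by one, and the sum collects their bounds.\<close>
    have "norm (iter_deriv vs (g n) x) \<le> 1 + (\<Sum>k<length vs. \<bar>C k / a k\<bar>)" for n x
    proof (cases "n < length vs")
      case True
      have "norm (iter_deriv vs (g n) x) \<le> C n / a n" unfolding gd using C[of n x] a[of n] by (simp add: divide_right_mono)
      also have "\<dots> \<le> \<bar>C n / a n\<bar>" by (rule abs_ge_self)
      also have "\<dots> \<le> (\<Sum>k<length vs. \<bar>C k / a k\<bar>)" by (rule member_le_sum) (use True in auto)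
      finally show ?thesis by simp
    next
      case False
      have "norm (iter_deriv vs (f n) x) \<le> a n" unfolding a_def by (rule Ck_seminorm_upper[OF fT vs]) (use False in simp)
      then have "norm (iter_deriv vs (g n) x) \<le> 1" unfolding gd using a[of n] by simp
      moreover have "0 \<le> (\<Sum>k<length vs. \<bar>C k / a k\<bar>)" by (rule sum_nonneg) simp
      ultimately show ?thesis by linarith
    qed
    then show "\<exists>C. \<forall>n x. norm (iter_deriv vs (g n) x) \<le> C" by blast
  qed
  then obtain A where A: "\<And>n. wiener (g n) \<le> A" using wiener_sfam by blast
  obtain n where n: "A < real n" using reals_Archimedean2 by blast
  have "wiener (g n) = norm (complex_of_real (1 / a n)) * wiener (f n)"
    unfolding g_def[abs_def] by (rule wiener_cmult)
  also have "\<dots> = wiener (f n) / a n" unfolding norm_of_real using a[of n] by simp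
  also have "\<dots> > real n" using fw[of n] a[of n] by (simp add: a_def pos_less_divide_eq)
  finally show False using A[of n] n by simp
qed

lemma distribution_wienerI:
  assumes "linear_functional_on (test_functions UNIV) W" "0 \<le> c"
    and "\<And>f. f \<in> test_functions UNIV \<Longrightarrow> norm (W f) \<le> c * wiener f"
  shows "distribution W"
  unfolding distribution_def
proof (intro conjI allI impI assms(1))
  fix K :: "plane set" assume "compact K"
  then obtain C N where C: "\<And>f. f \<in> test_functions UNIV \<Longrightarrow> supp f \<subseteq> K \<Longrightarrow> wiener f \<le> C * Ck_seminorm N f"
    using wiener_Ck_bound[of K] by auto
  have "norm (W f) \<le> (c * C) * Ck_seminorm N f" if "f \<in> test_functions UNIV" "supp f \<subseteq> K" for f
    using assms(3)[OF that(1)] mult_left_mono[OF C[OF that] assms(2)] by (simp add: mult.assoc)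
  then show "\<exists>C N. \<forall>f\<in>test_functions UNIV. supp f \<subseteq> K \<longrightarrow> norm (W f) \<le> C * Ck_seminorm N f" by blast
qed

lemma test_functions_tensor:
  fixes a :: "real \<Rightarrow> complex"
  assumes a: "a \<in> test_functions I" and \<psi>: "\<psi> \<in> test_functions (UNIV :: plane set)"
  shows "(\<lambda>p. a (fst p) * \<psi> (snd p)) \<in> test_functions (I \<times> UNIV)"
proof -
  have s: "smooth a" "smooth \<psi>" "compact (supp a)" "compact (supp \<psi>)" "supp a \<subseteq> I" using a \<psi> by (auto simp: test_functions_def)
  have 1: "smooth (\<lambda>p::real \<times> plane. a (fst p))" using smooth_compose_affine[OF s(1) bounded_linear_fst, of 0] by simp
  have 2: "smooth (\<lambda>p::real \<times> plane. \<psi> (snd p))" using smooth_compose_affine[OF s(2) bounded_linear_snd, of 0] by simp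
  have z: "a (fst p) * \<psi> (snd p) = 0" if "p \<notin> supp a \<times> supp \<psi>" for p
    using that zero_outside_supp[of "fst p" a] zero_outside_supp[of "snd p" \<psi>] by (cases p) auto
  have c: "compact (supp a \<times> supp \<psi>)" by (intro compact_Times s)
  show ?thesis
    unfolding test_functions_def
  proof (intro CollectI conjI smooth_mult[OF 1 2] compact_supp[OF c] z)
    have "supp (\<lambda>p. a (fst p) * \<psi> (snd p)) \<subseteq> supp a \<times> supp \<psi>" by (rule supp_subset[OF compact_imp_closed[OF c] z])
    then show "supp (\<lambda>p. a (fst p) * \<psi> (snd p)) \<subseteq> I \<times> UNIV" using s(5) by auto
  qed
qed

text \<open>The bump is the Littlewood--Paley symbol along a line. As \<open>h\<close> is complex
  valued, its squared modulus is taken: it is smooth, nonnegative and equal to one on the concentric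
  interval of half the radius, so its integral is positive.\<close>

lemma bump_exists:
  fixes I :: "real set"
  assumes h: "LP_symbol h" and I: "open I" "t0 \<in> I"
  shows "\<exists>a. (\<lambda>t. complex_of_real (a t)) \<in> test_functions I \<and> (LINT t:I|lebesgue. complex_of_real (a t)) \<noteq> 0"
proof -
  obtain r where r: "0 < r" "cball t0 r \<subseteq> I" using I open_contains_cball by metis
  define e :: plane where "e = axis 1 1"
  have e: "norm e = 1" by (simp add: e_def norm_axis_1)
  define g where "g t = h (((t - t0) / r) *\<^sub>R e)" for t
  have hs: "smooth h" "supp h \<subseteq> cball 0 1" "\<And>\<xi>. norm \<xi> \<le> 1 / 2 \<Longrightarrow> h \<xi> = 1" using h by (auto simp: LP_symbol_def)
  have L: "bounded_linear (\<lambda>t::real. (t / r) *\<^sub>R e)"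
    by (intro bounded_linear_scaleR_const bounded_linear_divide)
  have "g = (\<lambda>t. h ((- t0 / r) *\<^sub>R e + (t / r) *\<^sub>R e))"
    by (rule ext) (simp only: g_def scaleR_left_distrib[symmetric] diff_divide_distrib, simp)
  then have gs: "smooth g" by (simp only: smooth_compose_affine[OF hs(1) L])
  define a where "a t = (norm (g t))\<^sup>2" for t
  have ag: "(\<lambda>t. complex_of_real (a t)) = (\<lambda>t. g t * cnj (g t))" by (rule ext) (simp add: a_def complex_norm_square[symmetric])
  have as: "smooth (\<lambda>t. complex_of_real (a t))" unfolding ag by (intro smooth_mult smooth_cnj gs)
  have z: "a t = 0" if "t \<notin> cball t0 r" for t
  proof -
    have "((t - t0) / r) *\<^sub>R e \<notin> supp h" using that hs(2) r e by (auto simp: dist_real_def)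
    then have "g t = 0" unfolding g_def by (rule zero_outside_supp)
    then show ?thesis by (simp add: a_def)
  qed
  have T: "(\<lambda>t. complex_of_real (a t)) \<in> test_functions I"
    unfolding test_functions_def
    using as compact_supp[of "cball t0 r" "\<lambda>t. complex_of_real (a t)"] supp_subset[of "cball t0 r" "\<lambda>t. complex_of_real (a t)"] z r(2) by auto
  have cont: "continuous_on UNIV a"
    using continuous_on_Re[OF smooth_continuous[OF as, of UNIV]] by simp
  have int: "integrable lebesgue (\<lambda>t. indicator I t *\<^sub>R a t)"
  proof -
    have "integrable lborel (\<lambda>t. indicator (cball t0 r) t *\<^sub>R a t)"
      using borel_integrable_compact[OF compact_cball continuous_on_subset[OF cont]] by (simp add: mult.commute)
    moreover have "(\<lambda>t. indicator (cball t0 r) t *\<^sub>R a t) = (\<lambda>t. indicator I t *\<^sub>R a t)"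
      by (rule ext) (use z r(2) in \<open>auto simp: indicator_def\<close>)
    ultimately show ?thesis by (simp add: integrable_completion)
  qed
  have "r = (LINT t|lebesgue. indicator (cball t0 (r / 2)) t)"
    using r by (simp add: cball_eq_atLeastAtMost)
  also have "\<dots> \<le> (LINT t|lebesgue. indicator I t *\<^sub>R a t)"
  proof (rule Bochner_Integration.integral_mono[OF _ int])
    show "integrable lebesgue (indicator (cball t0 (r / 2)) :: real \<Rightarrow> real)"
      by (rule integrable_real_indicator) (use r in \<open>simp_all add: cball_eq_atLeastAtMost\<close>)
    fix t
    have "g t = 1" if "t \<in> cball t0 (r / 2)"
      unfolding g_def by (rule hs(3)) (use that r e in \<open>simp add: dist_real_def abs_minus_commute field_simps\<close>)
    moreover have "t \<in> I" if "t \<in> cball t0 (r / 2)" using that r by (auto simp: subset_iff)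
    ultimately show "indicator (cball t0 (r / 2)) t \<le> indicator I t *\<^sub>R a t"
      by (auto simp: indicator_def a_def)
  qed
  finally have "0 < (LINT t|lebesgue. indicator I t *\<^sub>R a t)" using r by linarith
  moreover have "(LINT t:I|lebesgue. complex_of_real (a t)) = complex_of_real (LINT t|lebesgue. indicator I t *\<^sub>R a t)"
    unfolding set_lebesgue_integral_def by (simp only: scaleR_conv_of_real of_real_mult[symmetric] integral_complex_of_real) simp
  ultimately show ?thesis using T by (intro exI[of _ a]) simp
qed

section \<open>Measurability in time\<close>

lemma linear_functional_pointwise_diff:
  assumes "linear_functional_on V u" "linear_functional_on V v"
  shows "linear_functional_on V (\<lambda>f. u f - v f)"
  using assms unfolding linear_functional_on_def by (simp add: algebra_simps)

context msqg
begin

lemma HH_tempered: "u \<in> HH \<Longrightarrow> tempered_distribution u" by (simp add: Hdot_def)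

lemma HH_low: "u \<in> HH \<Longrightarrow> f \<in> schwartz \<Longrightarrow> (\<lambda>m. P_le h (- int m) u f) \<longlonglongrightarrow> 0" by (simp add: Hdot_def)

lemma HH_pairing_bound:
  assumes \<phi>: "sfam \<phi>"
  obtains D where "0 \<le> D" "\<And>i u y. u \<in> HH \<Longrightarrow> EE u \<le> ennreal y \<Longrightarrow> 0 \<le> y \<Longrightarrow> norm (u (\<phi> i)) \<le> y + D"
    "\<And>i u v x c. u \<in> HH \<Longrightarrow> v \<in> HH \<Longrightarrow> EE (\<lambda>k. u k - v k) \<le> ennreal x \<Longrightarrow> 0 \<le> x \<Longrightarrow> 0 < c \<Longrightarrow> norm (u (\<phi> i) - v (\<phi> i)) \<le> c * x + D / c"
proof -
  have s: "- 1 \<le> - 1 + \<delta>" "- 1 + \<delta> \<le> 0" using \<delta>0 \<delta>1 by auto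
  obtain D where D: "0 \<le> D" "\<And>i. (\<integral>\<^sup>+q. wt (- (- 1 + \<delta>)) q * l2 (mop (pt h q) (\<phi> i)) \<partial>count_space UNIV) \<le> ennreal D"
    using dual_norm_bound[OF h s \<phi>] by blast
  note S = sfam_member[OF \<phi>]
  show ?thesis
  proof (rule that[OF D(1)])
    fix i u y assume u: "u \<in> HH" "EE u \<le> ennreal y" "0 \<le> y"
    show "norm (u (\<phi> i)) \<le> y + D"
      using pairing_bound[OF h s HH_D(1)[OF u(1)] S HH_low[OF u(1) S] high_frequency_limit[OF h HH_tempered[OF u(1)] S] u(2,3) zero_less_one D(2) D(1)]
      by simp
  next
    fix i u v x c assume u: "u \<in> HH" and v: "v \<in> HH" and E: "EE (\<lambda>k. u k - v k) \<le> ennreal x" "0 \<le> x" and c: "0 < (c::real)"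
    have P: "P_le h q (\<lambda>k. u k - v k) f = P_le h q u f - P_le h q v f" for q f by (simp add: P_le_mop)
    have lo: "(\<lambda>m. P_le h (- int m) (\<lambda>k. u k - v k) (\<phi> i)) \<longlonglongrightarrow> 0"
      unfolding P using tendsto_diff[OF HH_low[OF u S] HH_low[OF v S]] by simp
    have hi: "(\<lambda>m. P_le h (int m) (\<lambda>k. u k - v k) (\<phi> i)) \<longlonglongrightarrow> u (\<phi> i) - v (\<phi> i)"
      unfolding P by (intro tendsto_diff high_frequency_limit[OF h] HH_tempered u v S)
    show "norm (u (\<phi> i) - v (\<phi> i)) \<le> c * x + D / c"
      by (rule pairing_bound[OF h s linear_functional_pointwise_diff[OF HH_D(1)[OF u] HH_D(1)[OF v]] S lo hi E c D(2) D(1)])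
  qed
qed

lemma HH_pairing_continuous:
  assumes f: "f \<in> schwartz" and u: "u \<in> HH" and v: "\<And>n. v n \<in> HH" and lim: "(\<lambda>n. EE (\<lambda>k. v n k - u k)) \<longlonglongrightarrow> 0"
  shows "(\<lambda>n. v n f) \<longlonglongrightarrow> u f"
proof (rule LIMSEQ_I)
  fix r :: real assume r: "0 < r"
  have "sfam (\<lambda>_::unit. f)" using f unfolding schwartz_iff_sfam .
  then obtain D where D: "0 \<le> D" "\<And>u v x c. u \<in> HH \<Longrightarrow> v \<in> HH \<Longrightarrow> EE (\<lambda>k. u k - v k) \<le> ennreal x \<Longrightarrow> 0 \<le> x \<Longrightarrow> 0 < c \<Longrightarrow> norm (u f - v f) \<le> c * x + D / c"
    by (rule HH_pairing_bound) blast
  \<comment> \<open>\<open>c\<close> is fixed first, so that the constant part \<open>D / c\<close>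
    falls below \<open>r / 2\<close>; convergence then makes the part \<open>c * x\<close>
    small.\<close>
  define c where "c = (2 * D + 1) / r"
  have c: "0 < c" using D(1) r by (simp add: c_def)
  have Dc: "D / c < r / 2" using D(1) r by (simp add: c_def field_simps)
  have "eventually (\<lambda>n. EE (\<lambda>k. v n k - u k) < ennreal (r / 2 / c)) sequentially"
    by (rule order_tendstoD(2)[OF lim]) (use r c in simp)
  then obtain N where N: "\<And>n. n \<ge> N \<Longrightarrow> EE (\<lambda>k. v n k - u k) < ennreal (r / 2 / c)"
    unfolding eventually_sequentially by metis
  have "norm (v n f - u f) < r" if "n \<ge> N" for n
  proof -
    have "norm (v n f - u f) \<le> c * (r / 2 / c) + D / c"
      by (rule D(2)[OF v u less_imp_le[OF N[OF that]] _ c]) (use r c in simp)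
    also have "c * (r / 2 / c) = r / 2" using c by simp
    also have "r / 2 + D / c < r" using Dc by linarith
    finally show ?thesis .
  qed
  then show "\<exists>N. \<forall>n\<ge>N. norm (v n f - u f) < r" by blast
qed

text \<open>The norm of a strongly measurable function need not be measurable for the extended seminorm
  used here, so it is replaced by the lower limit of the norms of approximating simple functions.\<close>

lemma L2t_dominating:
  assumes \<theta>: "\<theta> \<in> L2t_Hdot h (- 1 + \<delta>) I" and I: "I \<in> sets lebesgue"
  obtains M where "integrable lebesgue M" "\<And>s. 0 \<le> M s" "AE s in lebesgue. s \<in> I \<longrightarrow> EE (\<theta> s) \<le> ennreal (M s)"
proof -
  have fin: "(\<integral>\<^sup>+ t\<in>I. EE (\<theta> t) \<partial>lebesgue) < \<infinity>" using \<theta> by (simp add: L2t_Hdot_def)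
  obtain u where u: "\<And>n. simple_Hdot h (- 1 + \<delta>) I (u n)"
    and ae: "AE t in lebesgue. t \<in> I \<longrightarrow> tendsto_Hdot h (- 1 + \<delta>) (\<lambda>n. u n t) (\<theta> t)"
    using \<theta> unfolding L2t_Hdot_def strongly_measurable_Hdot_def by blast
  define m where "m s = liminf (\<lambda>n. EE (u n s) * indicator I s)" for s
  have [measurable]: "(\<lambda>s. EE (u n s) * indicator I s) \<in> borel_measurable lebesgue" for n
  proof -
    have f: "finite (u n ` I)" and S: "\<And>v. {t \<in> I. u n t = v} \<in> sets lebesgue" using u[of n] by (auto simp: simple_Hdot_def)
    have "(\<lambda>s. EE (u n s) * indicator I s) = (\<lambda>s. \<Sum>v\<in>u n ` I. EE v * indicator {t \<in> I. u n t = v} s)"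
    proof
      fix s show "EE (u n s) * indicator I s = (\<Sum>v\<in>u n ` I. EE v * indicator {t \<in> I. u n t = v} s)"
      proof (cases "s \<in> I")
        case True
        have "(\<Sum>v\<in>u n ` I. EE v * indicator {t \<in> I. u n t = v} s) = (\<Sum>v\<in>u n ` I. if v = u n s then EE v else 0)"
          using True by (intro sum.cong) (auto simp: indicator_def)
        also have "\<dots> = EE (u n s)" using f True by (simp add: sum.delta)
        finally show ?thesis using True by simp
      qed simp
    qed
    moreover have "(\<lambda>s. \<Sum>v\<in>u n ` I. EE v * indicator {t \<in> I. u n t = v} s) \<in> borel_measurable lebesgue"
      by (intro borel_measurable_sum borel_measurable_times_ennreal borel_measurable_const borel_measurable_indicator S)
    ultimately show ?thesis by simp
  qed
  have [measurable]: "m \<in> borel_measurable lebesgue" unfolding m_def[abs_def] by measurable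
  \<comment> \<open>\<open>up\<close> makes the lower limit integrable, and \<open>lo\<close> turns
    twice the lower limit into a majorant. Both factors 2 come from \<open>EE_le\<close>.\<close>
  have up: "m s \<le> 2 * EE (\<theta> s)" and lo: "m s < \<infinity> \<longrightarrow> EE (\<theta> s) \<le> 2 * m s" if s: "s \<in> I" "tendsto_Hdot h (- 1 + \<delta>) (\<lambda>n. u n s) (\<theta> s)" for s
  proof -
    have lim: "(\<lambda>n. EE (\<lambda>k. u n s k - \<theta> s k)) \<longlonglongrightarrow> 0" using s by (simp add: tendsto_Hdot_def)
    have mm: "m s = liminf (\<lambda>n. EE (u n s))" using s by (simp add: m_def)
    have ev: "eventually (\<lambda>n. EE (\<lambda>k. u n s k - \<theta> s k) < ennreal e) sequentially" if "0 < e" for e :: real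
      by (rule order_tendstoD(2)[OF lim]) (use that in simp)
    show "m s \<le> 2 * EE (\<theta> s)"
    proof (rule ennreal_le_epsilon)
      fix e :: real assume e: "0 < e"
      have "eventually (\<lambda>n. EE (u n s) \<le> 2 * EE (\<theta> s) + ennreal e) sequentially"
        using ev[of "e / 2"]
      proof (rule eventually_mono)
        show "0 < e / 2" using e by simp
        fix n assume n: "EE (\<lambda>k. u n s k - \<theta> s k) < ennreal (e / 2)"
        have "2 * EE (\<lambda>k. u n s k - \<theta> s k) \<le> 2 * ennreal (e / 2)" by (intro mult_left_mono less_imp_le[OF n]) simp
        also have "\<dots> = ennreal e" using e by (simp flip: ennreal_numeral ennreal_mult)
        finally show "EE (u n s) \<le> 2 * EE (\<theta> s) + ennreal e"
          by (intro order_trans[OF EE_le[of "u n s" "\<theta> s"]] add_mono) auto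
      qed
      then have "liminf (\<lambda>n. EE (u n s)) \<le> liminf (\<lambda>n::nat. 2 * EE (\<theta> s) + ennreal e)" by (rule Liminf_mono)
      also have "\<dots> = 2 * EE (\<theta> s) + ennreal e" by (rule Liminf_const) simp
      finally show "m s \<le> 2 * EE (\<theta> s) + ennreal e" by (simp add: mm)
    qed
    show "m s < \<infinity> \<longrightarrow> EE (\<theta> s) \<le> 2 * m s"
    proof
      assume mfin: "m s < \<infinity>"
      show "EE (\<theta> s) \<le> 2 * m s"
      proof (rule ennreal_le_epsilon)
        fix e :: real assume e: "0 < e"
        have e4: "0 < e / 4" using e by simp
        have "\<not> eventually (\<lambda>n. m s + ennreal (e / 4) \<le> EE (u n s)) sequentially"
        proof
          assume "eventually (\<lambda>n. m s + ennreal (e / 4) \<le> EE (u n s)) sequentially"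
          then have "m s + ennreal (e / 4) \<le> m s" unfolding mm by (rule Liminf_bounded)
          then have "m s + ennreal (e / 4) \<le> m s + 0" by simp
          then show False using mfin e by (subst (asm) ennreal_add_left_cancel_le) auto
        qed
        then have "frequently (\<lambda>n. EE (u n s) < m s + ennreal (e / 4)) sequentially" by (simp add: frequently_def not_less)
        then have "frequently (\<lambda>n. EE (u n s) < m s + ennreal (e / 4) \<and> EE (\<lambda>k. u n s k - \<theta> s k) < ennreal (e / 4)) sequentially"
          using ev[OF e4] by (rule frequently_eventually_frequently)
        then obtain n where n: "EE (u n s) < m s + ennreal (e / 4)" "EE (\<lambda>k. u n s k - \<theta> s k) < ennreal (e / 4)"
          using frequently_ex by blast
        have "EE (\<theta> s) \<le> 2 * EE (u n s) + 2 * EE (\<lambda>k. u n s k - \<theta> s k)"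
          unfolding Hdot_norm_sq_swap[of h "- 1 + \<delta>" "u n s" "\<theta> s"] by (rule EE_le)
        also have "\<dots> \<le> 2 * (m s + ennreal (e / 4)) + 2 * ennreal (e / 4)"
          by (intro add_mono mult_left_mono less_imp_le n) auto
        also have "\<dots> = 2 * m s + (2 * ennreal (e / 4) + 2 * ennreal (e / 4))" by (simp add: distrib_left add.assoc)
        also have "2 * ennreal (e / 4) + 2 * ennreal (e / 4) = ennreal e"
        proof -
          have "2 * ennreal (e / 4) = ennreal (e / 2)" using e by (simp flip: ennreal_numeral ennreal_mult)
          then show ?thesis using e by (simp flip: ennreal_plus)
        qed
        finally show "EE (\<theta> s) \<le> 2 * m s + ennreal e" .
      qed
    qed
  qed
  \<comment> \<open>The factor 2 is divided out of the measurable \<open>m\<close>. Taking it out of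
    the integral of \<open>EE (\<theta> s)\<close> would require measurability of that function,
    whereas monotonicity of the integral does not.\<close>
  have half: "(\<integral>\<^sup>+ s. m s / 2 \<partial>lebesgue) \<le> (\<integral>\<^sup>+ t\<in>I. EE (\<theta> t) \<partial>lebesgue)"
  proof (rule nn_integral_mono_AE)
    show "AE s in lebesgue. m s / 2 \<le> EE (\<theta> s) * indicator I s"
      using ae
    proof eventually_elim
      case (elim s)
      show ?case
      proof (cases "s \<in> I")
        case True
        then have "m s / 2 \<le> (2 * EE (\<theta> s)) / 2" using up[of s] elim by (intro divide_right_mono_ennreal) auto
        also have "\<dots> = EE (\<theta> s)" by (simp add: mult.commute[of 2] ennreal_times_divide[symmetric] mult_divide_eq_ennreal)
        finally show ?thesis using True by simp
      next
        case False
        have "m s = 0" unfolding m_def using False by (simp add: Liminf_const)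
        then show ?thesis by simp
      qed
    qed
  qed
  have "(\<integral>\<^sup>+ s. 2 * m s \<partial>lebesgue) = (\<integral>\<^sup>+ s. 4 * (m s / 2) \<partial>lebesgue)"
  proof (rule nn_integral_cong)
    fix s
    have "4 * (m s / 2) = 2 * (2 * (m s / 2))" by (simp add: mult.assoc[symmetric])
    also have "2 * (m s / 2) = m s" by (simp add: ennreal_times_divide mult.commute[of 2] mult_divide_eq_ennreal)
    finally show "2 * m s = 4 * (m s / 2)" by simp
  qed
  also have "\<dots> = 4 * (\<integral>\<^sup>+ s. m s / 2 \<partial>lebesgue)" by (rule nn_integral_cmult) simp
  also have "\<dots> < \<infinity>" using order.strict_trans1[OF half fin] by (simp add: ennreal_mult_less_top)
  finally have mfin: "(\<integral>\<^sup>+ s. 2 * m s \<partial>lebesgue) < \<infinity>" .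
  have mae: "AE s in lebesgue. 2 * m s \<noteq> \<infinity>" by (rule nn_integral_noteq_infinite) (use mfin in auto)
  define M where "M s = enn2real (2 * m s)" for s
  show ?thesis
  proof (rule that[of M])
    have "(\<integral>\<^sup>+ s. ennreal (norm (M s)) \<partial>lebesgue) \<le> (\<integral>\<^sup>+ s. 2 * m s \<partial>lebesgue)"
      by (rule nn_integral_mono) (simp add: M_def enn2real_leI ennreal_enn2real_if)
    then show "integrable lebesgue M"
      by (intro integrableI_bounded) (use mfin in \<open>auto simp: M_def[abs_def] intro: order.strict_trans1\<close>)
    show "0 \<le> M s" for s by (simp add: M_def)
    show "AE s in lebesgue. s \<in> I \<longrightarrow> EE (\<theta> s) \<le> ennreal (M s)"
      using ae mae
    proof eventually_elim
      case (elim s)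
      show ?case
      proof
        assume s: "s \<in> I"
        have t: "2 * m s < \<top>" using elim(2) by (simp add: less_top)
        then have "m s < \<infinity>" by (auto simp: ennreal_mult_less_top)
        then have "EE (\<theta> s) \<le> 2 * m s" using lo[of s] elim(1) s by blast
        then show "EE (\<theta> s) \<le> ennreal (M s)" using t by (simp add: M_def)
      qed
    qed
  qed
qed

text \<open>For simple functions the composition is a finite sum of functions measurable in time,
  and continuity of \<Phi> along the norm passes to the limit off a null set. The dependence of
  \<Phi> on time serves the pairing with a test function that varies in time.\<close>

lemma strongly_measurable_compose:
  fixes \<Phi> :: "real \<Rightarrow> functional \<Rightarrow> complex"
  assumes \<theta>: "\<theta> \<in> L2t_Hdot h (- 1 + \<delta>) I" and I: "I \<in> sets lebesgue"
    and m: "\<And>v. v \<in> HH \<Longrightarrow> (\<lambda>t. \<Phi> t v) \<in> borel_measurable borel"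
    and c: "\<And>t v w. w \<in> HH \<Longrightarrow> (\<And>n. v n \<in> HH) \<Longrightarrow> (\<lambda>n. EE (\<lambda>k. v n k - w k)) \<longlonglongrightarrow> 0 \<Longrightarrow> (\<lambda>n. \<Phi> t (v n)) \<longlonglongrightarrow> \<Phi> t w"
  shows "(\<lambda>t. indicator I t *\<^sub>R \<Phi> t (\<theta> t)) \<in> borel_measurable lebesgue"
proof -
  have \<theta>H: "\<theta> t \<in> HH" if "t \<in> I" for t using \<theta> that by (auto simp: L2t_Hdot_def strongly_measurable_Hdot_def)
  obtain u where u: "\<And>n. simple_Hdot h (- 1 + \<delta>) I (u n)"
    and ae: "AE t in lebesgue. t \<in> I \<longrightarrow> tendsto_Hdot h (- 1 + \<delta>) (\<lambda>n. u n t) (\<theta> t)"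
    using \<theta> unfolding L2t_Hdot_def strongly_measurable_Hdot_def by blast
  have uH: "u n t \<in> HH" if "t \<in> I" for n t using u[of n] that by (auto simp: simple_Hdot_def)
  obtain N where N: "N \<in> null_sets lebesgue" "\<And>t. t \<notin> N \<Longrightarrow> t \<in> I \<Longrightarrow> tendsto_Hdot h (- 1 + \<delta>) (\<lambda>n. u n t) (\<theta> t)"
    using ae unfolding completion.AE_iff_null_sets by auto
  have NI: "I - N \<in> sets lebesgue" using N(1) I by auto
  define f where "f n t = indicator (I - N) t *\<^sub>R \<Phi> t (u n t)" for n t
  have fm: "f n \<in> borel_measurable lebesgue" for n
  proof -
    have fi: "finite (u n ` I)" and S: "\<And>v. {t \<in> I. u n t = v} \<in> sets lebesgue" using u[of n] by (auto simp: simple_Hdot_def)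
    have "f n = (\<lambda>s. \<Sum>v\<in>u n ` I. indicator ({t \<in> I. u n t = v} \<inter> (I - N)) s *\<^sub>R \<Phi> s v)"
    proof
      fix s show "f n s = (\<Sum>v\<in>u n ` I. indicator ({t \<in> I. u n t = v} \<inter> (I - N)) s *\<^sub>R \<Phi> s v)"
      proof (cases "s \<in> I - N")
        case True
        have "(\<Sum>v\<in>u n ` I. indicator ({t \<in> I. u n t = v} \<inter> (I - N)) s *\<^sub>R \<Phi> s v) = (\<Sum>v\<in>u n ` I. if v = u n s then \<Phi> s v else 0)"
          using True by (intro sum.cong) (auto simp: indicator_def)
        also have "\<dots> = \<Phi> s (u n s)" using fi True by (simp add: sum.delta)
        finally show ?thesis using True by (simp add: f_def)
      qed (auto simp: f_def)
    qed
    moreover have "(\<lambda>s. \<Sum>v\<in>u n ` I. indicator ({t \<in> I. u n t = v} \<inter> (I - N)) s *\<^sub>R \<Phi> s v) \<in> borel_measurable lebesgue"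
    proof (intro borel_measurable_sum borel_measurable_scaleR borel_measurable_indicator sets.Int S NI)
      fix v assume "v \<in> u n ` I"
      then have "v \<in> HH" using uH by auto
      then show "(\<lambda>s. \<Phi> s v) \<in> borel_measurable lebesgue" using m measurable_completion[of "\<lambda>s. \<Phi> s v" lborel borel] by simp
    qed
    ultimately show ?thesis by simp
  qed
  have "(\<lambda>t. indicator (I - N) t *\<^sub>R \<Phi> t (\<theta> t)) \<in> borel_measurable lebesgue"
  proof (rule borel_measurable_LIMSEQ_metric[of f, OF fm])
    fix t
    show "(\<lambda>n. f n t) \<longlonglongrightarrow> indicator (I - N) t *\<^sub>R \<Phi> t (\<theta> t)"
    proof (cases "t \<in> I - N")
      case True
      have "(\<lambda>n. EE (\<lambda>k. u n t k - \<theta> t k)) \<longlonglongrightarrow> 0" using N(2)[of t] True by (simp add: tendsto_Hdot_def)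
      then show ?thesis using c[of "\<theta> t" "\<lambda>n. u n t" t] \<theta>H uH True by (simp add: f_def)
    qed (simp add: f_def)
  qed
  then show ?thesis
    by (rule borel_measurable_AE) (use AE_not_in[OF N(1)] in \<open>auto simp: indicator_def elim: eventually_mono\<close>)
qed

end

section \<open>Time integrals of the nonlinearity\<close>

text \<open>The signed indicator of the interval between two times. Integration against it is
  additive in the endpoints whatever their order.\<close>

definition oriented :: "real \<Rightarrow> real \<Rightarrow> real \<Rightarrow> real" where
  "oriented a b s = (if a < s \<and> s < b then 1 else if b < s \<and> s < a then - 1 else 0)"

lemma oriented_measurable [measurable]: "oriented a b \<in> borel_measurable lebesgue"
proof -
  have "oriented a b \<in> borel_measurable lborel" unfolding oriented_def[abs_def] by measurable
  then show ?thesis by (rule measurable_completion)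
qed

lemma oriented_bound: "\<bar>oriented a b s\<bar> \<le> 1" by (simp add: oriented_def)

lemma interval_integral_oriented:
  fixes g :: "real \<Rightarrow> complex"
  assumes I: "is_interval I" "a \<in> I" "b \<in> I"
  shows "(LINT s=ereal a..ereal b|lebesgue. g s) = (LINT s|lebesgue. oriented a b s *\<^sub>R (indicator I s *\<^sub>R g s))"
proof -
  have mem: "s \<in> I" if "a < s \<and> s < b \<or> b < s \<and> s < a" for s
    using I that unfolding is_interval_1 by (meson less_imp_le)
  have *: "oriented a b s *\<^sub>R (indicator I s *\<^sub>R g s) = oriented a b s *\<^sub>R g s" for s
    using mem[of s] by (auto simp: oriented_def)
  have "einterval (ereal x) (ereal y) = {x<..<y}" for x y by (auto simp: einterval_def)
  moreover have "oriented a b s *\<^sub>R g s = indicator {a<..<b} s *\<^sub>R g s" if "a \<le> b" for s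
    using that by (auto simp: oriented_def indicator_def)
  moreover have "oriented a b s *\<^sub>R g s = - (indicator {b<..<a} s *\<^sub>R g s)" if "\<not> a \<le> b" for s
    using that by (auto simp: oriented_def indicator_def)
  ultimately show ?thesis
    unfolding * interval_lebesgue_integral_def set_lebesgue_integral_def by (cases "a \<le> b") (simp_all del: scaleR_cancel_right)
qed

lemma AE_neq_lebesgue: "AE s in lebesgue. s \<noteq> (c::real)"
  using AE_completion[OF AE_lborel_singleton[of c]] .

lemma oriented_add: "AE s in lebesgue. oriented a c s = oriented a b s + oriented b c s"
  using AE_neq_lebesgue[of a] AE_neq_lebesgue[of b] AE_neq_lebesgue[of c]
  by eventually_elim (auto simp: oriented_def)

lemma integrable_continuous_compact:
  fixes f :: "real \<Rightarrow> complex"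
  assumes f: "continuous_on UNIV f" and z: "\<And>t. t \<notin> K \<Longrightarrow> f t = 0" and K: "compact K" and I: "I \<in> sets lebesgue"
  shows "integrable lebesgue (\<lambda>t. indicator I t *\<^sub>R f t)"
proof -
  have "integrable lborel (\<lambda>t. indicator K t *\<^sub>R f t)"
    using borel_integrable_compact[OF K continuous_on_subset[OF f]] by (simp add: set_integrable_def)
  moreover have "(\<lambda>t. indicator K t *\<^sub>R f t) = f" using z by (auto simp: indicator_def)
  ultimately have "integrable lebesgue f" by (simp add: integrable_completion)
  from integrable_mult_indicator[OF I this] show ?thesis .
qed

lemma distribution_zero: "distribution u \<Longrightarrow> u (\<lambda>x. 0) = 0"
proof -
  assume "distribution u"
  then have l: "linear_functional_on (test_functions UNIV) u" by (simp add: distribution_def)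
  have "(\<lambda>x::plane. 0::complex) \<in> test_functions UNIV" by (simp add: test_functions_def smooth_const supp_def)
  from l[unfolded linear_functional_on_def, rule_format, OF this this, of 0 0] show ?thesis by simp
qed

lemma test_function_slice:
  fixes \<phi> :: "real \<times> plane \<Rightarrow> complex"
  assumes \<phi>: "\<phi> \<in> test_functions \<Omega>"
  shows "(\<lambda>x. \<phi> (t, x)) \<in> test_functions UNIV" and "t \<notin> fst ` supp \<phi> \<Longrightarrow> (\<lambda>x. \<phi> (t, x)) = (\<lambda>x. 0)" and "compact (fst ` supp \<phi>)"
proof -
  have c: "compact (supp \<phi>)" and s: "smooth \<phi>" using \<phi> by (auto simp: test_functions_def)
  have Kc: "compact (snd ` supp \<phi>)" by (intro compact_continuous_image continuous_intros c)
  have z: "\<phi> (t, x) = 0" if "x \<notin> snd ` supp \<phi>" for x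
    by (rule zero_outside_supp) (use that in force)
  show "(\<lambda>x. \<phi> (t, x)) \<in> test_functions UNIV"
    unfolding test_functions_def using compact_supp[OF Kc z] smooth_slice[OF s] by simp
  show "compact (fst ` supp \<phi>)" by (intro compact_continuous_image continuous_intros c)
  show "(\<lambda>x. \<phi> (t, x)) = (\<lambda>x. 0)" if "t \<notin> fst ` supp \<phi>"
    by (rule ext, rule zero_outside_supp) (use that in force)
qed

section \<open>Time integrals of the nonlinearity along a fixed solution\<close>

locale msqg_flow = msqg +
  fixes I :: "real set" and \<theta> :: "real \<Rightarrow> functional"
  assumes I_open: "open I" and I_interval: "is_interval I" and \<theta>: "\<theta> \<in> L2t_Hdot h (- 1 + \<delta>) I"
begin

lemma I_sets: "I \<in> sets lebesgue" using I_open by (simp add: borel_open)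

lemma \<theta>_HH: "t \<in> I \<Longrightarrow> \<theta> t \<in> HH"
  using \<theta> by (auto simp: L2t_Hdot_def strongly_measurable_Hdot_def)

text \<open>Extended by zero outside \<open>I\<close>, where \<theta> is arbitrary; \<open>W\<close>
  then has its good properties for any two real times.\<close>

definition flux :: "(plane \<Rightarrow> complex) \<Rightarrow> real \<Rightarrow> complex" where
  "flux \<psi> s = indicator I s *\<^sub>R B h \<delta> \<psi> (\<theta> s)"

definition W :: "real \<Rightarrow> real \<Rightarrow> functional" where
  "W a b \<psi> = (LINT s|lebesgue. oriented a b s *\<^sub>R flux \<psi> s)"

text \<open>The exceptional null set does not depend on the test function. This order of quantifiers
  is what later limits need, in which the test function varies with time or with the dilation
  parameter.\<close>

lemma flux_dominated:
  obtains M where "integrable lebesgue M" "\<And>s. 0 \<le> M s" "AE s in lebesgue. \<forall>\<psi>\<in>schwartz. norm (flux \<psi> s) \<le> wiener \<psi> * M s"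
proof -
  obtain M where M: "integrable lebesgue M" "\<And>s. 0 \<le> M s" "AE s in lebesgue. s \<in> I \<longrightarrow> EE (\<theta> s) \<le> ennreal (M s)"
    using L2t_dominating[OF \<theta> I_sets] by blast
  show ?thesis
  proof (rule that[of "\<lambda>s. sqrt (32 * CB) * M s"])
    show "integrable lebesgue (\<lambda>s. sqrt (32 * CB) * M s)" using M(1) by simp
    show "0 \<le> sqrt (32 * CB) * M s" for s using M(2) CB0 by simp
    show "AE s in lebesgue. \<forall>\<psi>\<in>schwartz. norm (flux \<psi> s) \<le> wiener \<psi> * (sqrt (32 * CB) * M s)"
      using M(3)
    proof eventually_elim
      case (elim s)
      show ?case
      proof
        fix \<psi> :: "plane \<Rightarrow> complex" assume \<psi>: "\<psi> \<in> schwartz"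
        show "norm (flux \<psi> s) \<le> wiener \<psi> * (sqrt (32 * CB) * M s)"
        proof (cases "s \<in> I")
          case True
          then show ?thesis using B_bound[OF \<psi> \<theta>_HH[OF True] _ M(2)[of s]] elim by (simp add: flux_def mult_ac)
        next
          case False
          then show ?thesis using wiener_nonneg M(2) CB0 by (simp add: flux_def)
        qed
      qed
    qed
  qed
qed

lemma flux_measurable: assumes \<psi>: "\<psi> \<in> schwartz" shows "flux \<psi> \<in> borel_measurable lebesgue"
proof -
  have "(\<lambda>t. indicator I t *\<^sub>R B h \<delta> \<psi> (\<theta> t)) \<in> borel_measurable lebesgue"
    by (rule strongly_measurable_compose[OF \<theta> I_sets, where \<Phi> = "\<lambda>_. B h \<delta> \<psi>"]) (simp_all add: B_continuous[OF \<psi>])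
  then show ?thesis unfolding flux_def[abs_def] .
qed

lemma flux_integrable:
  assumes \<psi>: "\<psi> \<in> schwartz" shows "integrable lebesgue (\<lambda>s. oriented a b s *\<^sub>R flux \<psi> s)"
proof -
  note [measurable] = flux_measurable[OF \<psi>]
  obtain M where M: "integrable lebesgue M" "\<And>s. 0 \<le> M s" "AE s in lebesgue. \<forall>\<psi>\<in>schwartz. norm (flux \<psi> s) \<le> wiener \<psi> * M s"
    by (rule flux_dominated) (rule that)
  show ?thesis
  proof (rule Bochner_Integration.integrable_bound)
    show "integrable lebesgue (\<lambda>s. wiener \<psi> * M s)" using M(1) by simp
    show "AE s in lebesgue. norm (oriented a b s *\<^sub>R flux \<psi> s) \<le> norm (wiener \<psi> * M s)"
      using M(3)
    proof eventually_elim
      case (elim s)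
      have "norm (oriented a b s *\<^sub>R flux \<psi> s) \<le> 1 * (wiener \<psi> * M s)"
        unfolding norm_scaleR by (intro mult_mono) (use elim \<psi> oriented_bound in auto)
      also have "\<dots> \<le> norm (wiener \<psi> * M s)" by simp
      finally show ?case .
    qed
  qed simp
qed

lemma W_bound: "\<exists>c\<ge>0. \<forall>a b. \<forall>\<psi>\<in>schwartz. norm (W a b \<psi>) \<le> c * wiener \<psi>"
proof -
  obtain M where M: "integrable lebesgue M" "\<And>s. 0 \<le> M s" "AE s in lebesgue. \<forall>\<psi>\<in>schwartz. norm (flux \<psi> s) \<le> wiener \<psi> * M s"
    by (rule flux_dominated) (rule that)
  have "norm (W a b \<psi>) \<le> (LINT s|lebesgue. M s) * wiener \<psi>" if \<psi>: "\<psi> \<in> schwartz" for a b \<psi>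
  proof -
    have "norm (W a b \<psi>) \<le> (LINT s|lebesgue. norm (oriented a b s *\<^sub>R flux \<psi> s))"
      unfolding W_def by (rule integral_norm_bound)
    also have "\<dots> \<le> (LINT s|lebesgue. wiener \<psi> * M s)"
    proof (rule integral_mono_AE)
      show "integrable lebesgue (\<lambda>s. norm (oriented a b s *\<^sub>R flux \<psi> s))" by (rule integrable_norm[OF flux_integrable[OF \<psi>]])
      show "integrable lebesgue (\<lambda>s. wiener \<psi> * M s)" using M(1) by simp
      show "AE s in lebesgue. norm (oriented a b s *\<^sub>R flux \<psi> s) \<le> wiener \<psi> * M s"
        using M(3)
      proof eventually_elim
        case (elim s)
        have "norm (oriented a b s *\<^sub>R flux \<psi> s) \<le> 1 * (wiener \<psi> * M s)"
          unfolding norm_scaleR by (intro mult_mono) (use elim \<psi> oriented_bound in auto)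
        then show ?case by simp
      qed
    qed
    finally show ?thesis by (simp add: mult.commute)
  qed
  moreover have "0 \<le> (LINT s|lebesgue. M s)" by (rule integral_nonneg_AE) (simp add: M(2))
  ultimately show ?thesis by blast
qed

lemma flux_linear:
  assumes "\<psi> \<in> schwartz" "\<phi> \<in> schwartz"
  shows "flux (\<lambda>x. c * \<psi> x + d * \<phi> x) s = c * flux \<psi> s + d * flux \<phi> s"
  using B_linear[OF assms \<theta>_HH, of s c d] by (cases "s \<in> I") (simp_all add: flux_def)

lemma W_linear:
  assumes "\<psi> \<in> schwartz" "\<phi> \<in> schwartz"
  shows "W a b (\<lambda>x. c * \<psi> x + d * \<phi> x) = c * W a b \<psi> + d * W a b \<phi>"
proof -
  have "W a b (\<lambda>x. c * \<psi> x + d * \<phi> x) = (LINT s|lebesgue. c * (oriented a b s *\<^sub>R flux \<psi> s) + d * (oriented a b s *\<^sub>R flux \<phi> s))"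
    unfolding W_def flux_linear[OF assms] by (rule Bochner_Integration.integral_cong[OF refl]) (simp add: scaleR_right_distrib)
  also have "\<dots> = c * W a b \<psi> + d * W a b \<phi>"
    unfolding W_def by (subst Bochner_Integration.integral_add) (simp_all add: flux_integrable assms del: mult_scaleR_right)
  finally show ?thesis .
qed

lemma W_distribution: "distribution (W a b)"
proof -
  obtain c where c: "0 \<le> c" "\<forall>a b. \<forall>\<psi>\<in>schwartz. norm (W a b \<psi>) \<le> c * wiener \<psi>" using W_bound by blast
  show ?thesis
  proof (rule distribution_wienerI[OF _ c(1)])
    show "linear_functional_on (test_functions UNIV) (W a b)"
      unfolding linear_functional_on_def by (intro ballI allI W_linear test_functions_schwartz)
    show "norm (W a b f) \<le> c * wiener f" if "f \<in> test_functions UNIV" for f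
      using c(2) test_functions_schwartz[OF that] by blast
  qed
qed

lemma W_add: assumes \<psi>: "\<psi> \<in> schwartz" shows "W a c \<psi> = W a b \<psi> + W b c \<psi>"
proof -
  note [measurable] = flux_measurable[OF \<psi>]
  have "W a c \<psi> = (LINT s|lebesgue. oriented a b s *\<^sub>R flux \<psi> s + oriented b c s *\<^sub>R flux \<psi> s)"
    unfolding W_def
  proof (rule integral_cong_AE)
    show "AE s in lebesgue. oriented a c s *\<^sub>R flux \<psi> s = oriented a b s *\<^sub>R flux \<psi> s + oriented b c s *\<^sub>R flux \<psi> s"
      using oriented_add[of a c b] by eventually_elim (simp add: scaleR_left_distrib)
  qed simp_all
  also have "\<dots> = W a b \<psi> + W b c \<psi>" unfolding W_def by (rule Bochner_Integration.integral_add[OF flux_integrable[OF \<psi>] flux_integrable[OF \<psi>]])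
  finally show ?thesis .
qed

lemma flux_slice_continuous:
  assumes \<phi>: "\<phi> \<in> test_functions \<Omega>"
  shows "continuous_on UNIV (\<lambda>t::real. flux (\<lambda>x. \<phi> (t, x)) s)"
proof (cases "s \<in> I")
  case True
  let ?d = "\<lambda>(t, t'). dq \<phi> t t'"
  let ?u = "\<lambda>\<psi>. B h \<delta> \<psi> (\<theta> s)"
  obtain A where A: "0 \<le> A" "\<And>i. wiener (?d i) \<le> A" using wiener_sfam[OF sfam_slices(2)[OF \<phi>]] by blast
  obtain y where y: "0 \<le> y" "EE (\<theta> s) = ennreal y" using HH_D(2)[OF \<theta>_HH[OF True]] by (cases "EE (\<theta> s)") auto
  have bd: "norm (?u (?d i)) \<le> sqrt (32 * CB) * A * y" for i
  proof -
    have "norm (?u (?d i)) \<le> sqrt (32 * CB) * wiener (?d i) * y"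
      by (rule B_bound[OF sfam_member[OF sfam_slices(2)[OF \<phi>]] \<theta>_HH[OF True] _ y(1)]) (simp only: y(2) order_refl)
    also have "\<dots> \<le> sqrt (32 * CB) * A * y" using y(1) CB0 by (intro mult_right_mono mult_left_mono A(2)) auto
    finally show ?thesis .
  qed
  have "linear_functional_on schwartz ?u"
    unfolding linear_functional_on_def by (intro ballI allI B_linear \<theta>_HH[OF True])
  from slice_continuous[OF this test_functions_schwartz[OF test_function_slice(1)[OF \<phi>]] bd]
  show ?thesis using True by (simp add: flux_def)
qed (simp add: flux_def)

text \<open>The end of the time interval and the test function move together. Along a sequence of
  times the integrands converge except possibly at the limit time, and \<open>flux_dominated\<close>
  with the uniform \<open>wiener\<close> bound of the slices dominates them.\<close>

lemma W_slice_continuous: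
  assumes \<phi>: "\<phi> \<in> test_functions \<Omega>"
  shows "continuous_on UNIV (\<lambda>t::real. W a t (\<lambda>x. \<phi> (t, x)))"
proof (rule continuous_on_sequentiallyI)
  fix X :: "nat \<Rightarrow> real" and t assume X: "X \<longlonglongrightarrow> t"
  have S: "(\<lambda>x. \<phi> (t, x)) \<in> schwartz" for t by (rule test_functions_schwartz[OF test_function_slice(1)[OF \<phi>]])
  note [measurable] = flux_measurable[OF S]
  obtain M where M: "integrable lebesgue M" "\<And>s. 0 \<le> M s" "AE s in lebesgue. \<forall>\<psi>\<in>schwartz. norm (flux \<psi> s) \<le> wiener \<psi> * M s"
    by (rule flux_dominated) (rule that)
  obtain A where A: "0 \<le> A" "\<And>t. wiener (\<lambda>x. \<phi> (t, x)) \<le> A" using wiener_sfam[OF sfam_slices(1)[OF \<phi>]] by blast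
  show "(\<lambda>n. W a (X n) (\<lambda>x. \<phi> (X n, x))) \<longlonglongrightarrow> W a t (\<lambda>x. \<phi> (t, x))"
    unfolding W_def
  proof (rule integral_dominated_convergence)
    show "integrable lebesgue (\<lambda>s. A * M s)" using M(1) by simp
    show "AE s in lebesgue. (\<lambda>n. oriented a (X n) s *\<^sub>R flux (\<lambda>x. \<phi> (X n, x)) s) \<longlonglongrightarrow> oriented a t s *\<^sub>R flux (\<lambda>x. \<phi> (t, x)) s"
      using AE_neq_lebesgue[of t]
    proof eventually_elim
      case (elim s)
      have "(\<lambda>n. flux (\<lambda>x. \<phi> (X n, x)) s) \<longlonglongrightarrow> flux (\<lambda>x. \<phi> (t, x)) s"
        using continuous_on_tendsto_compose[OF flux_slice_continuous[OF \<phi>] X] by simp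
      moreover have "(\<lambda>n. oriented a (X n) s) \<longlonglongrightarrow> oriented a t s"
      proof (rule tendsto_eventually)
        show "eventually (\<lambda>n. oriented a (X n) s = oriented a t s) sequentially"
        proof (cases "s < t")
          case True
          show ?thesis using order_tendstoD(1)[OF X True] by eventually_elim (use True in \<open>auto simp: oriented_def\<close>)
        next
          case False
          then have "t < s" using elim by simp
          show ?thesis using order_tendstoD(2)[OF X \<open>t < s\<close>] by eventually_elim (use \<open>t < s\<close> in \<open>auto simp: oriented_def\<close>)
        qed
      qed
      ultimately show ?case by (intro tendsto_scaleR)
    qed
    show "AE s in lebesgue. norm (oriented a (X n) s *\<^sub>R flux (\<lambda>x. \<phi> (X n, x)) s) \<le> A * M s" for n
      using M(3)
    proof eventually_elim
      case (elim s)
      have "norm (flux (\<lambda>x. \<phi> (X n, x)) s) \<le> wiener (\<lambda>x. \<phi> (X n, x)) * M s" using elim S by blast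
      also have "\<dots> \<le> A * M s" by (intro mult_right_mono A M)
      finally have "norm (oriented a (X n) s *\<^sub>R flux (\<lambda>x. \<phi> (X n, x)) s) \<le> 1 * (A * M s)"
        unfolding norm_scaleR by (intro mult_mono) (use oriented_bound in auto)
      then show ?case by simp
    qed
  qed simp_all
qed

text \<open>Needed to separate the two parts of \<open>transported\<close> under the space-time
  integral. The bound is the majorant of the squared norm plus a constant on the compact set of
  times met by the support of \<phi>.\<close>

lemma \<theta>_slice_integrable:
  assumes \<phi>: "\<phi> \<in> test_functions \<Omega>"
  shows "integrable lebesgue (\<lambda>t. indicator I t *\<^sub>R \<theta> t (\<lambda>x. \<phi> (t, x)))"
proof -
  note T = test_function_slice[OF \<phi>]
  note S = test_functions_schwartz[OF T(1)]
  obtain M where M: "integrable lebesgue M" "\<And>s. 0 \<le> M s" "AE s in lebesgue. s \<in> I \<longrightarrow> EE (\<theta> s) \<le> ennreal (M s)"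
    using L2t_dominating[OF \<theta> I_sets] by blast
  obtain D where D: "0 \<le> D" "\<And>t u y. u \<in> HH \<Longrightarrow> EE u \<le> ennreal y \<Longrightarrow> 0 \<le> y \<Longrightarrow> norm (u (\<lambda>x. \<phi> (t, x))) \<le> y + D"
    by (rule HH_pairing_bound[OF sfam_slices(1)[OF \<phi>]]) blast
  let ?J = "fst ` supp \<phi>"
  show ?thesis
  proof (rule Bochner_Integration.integrable_bound)
    have "integrable lebesgue (indicator ?J :: real \<Rightarrow> real)"
    proof (rule integrable_real_indicator)
      show "?J \<in> sets lebesgue" using T(3) by (simp add: borel_compact)
      show "emeasure lebesgue ?J < \<infinity>" using emeasure_compact_finite[OF T(3)] T(3) by (simp add: borel_compact)
    qed
    then show "integrable lebesgue (\<lambda>t. M t + D * indicator ?J t)" using M(1) by simp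
    show "(\<lambda>t. indicator I t *\<^sub>R \<theta> t (\<lambda>x. \<phi> (t, x))) \<in> borel_measurable lebesgue"
    proof (rule strongly_measurable_compose[OF \<theta> I_sets, where \<Phi> = "\<lambda>t v. v (\<lambda>x. \<phi> (t, x))"])
      show "(\<lambda>t. v (\<lambda>x. \<phi> (t, x))) \<in> borel_measurable borel" if "v \<in> HH" for v
        by (rule borel_measurable_continuous_onI[OF tempered_slice_continuous[OF HH_tempered[OF that] \<phi>]])
      show "(\<lambda>n. v n (\<lambda>x. \<phi> (t, x))) \<longlonglongrightarrow> w (\<lambda>x. \<phi> (t, x))"
        if "w \<in> HH" "\<And>n. v n \<in> HH" "(\<lambda>n. EE (\<lambda>k. v n k - w k)) \<longlonglongrightarrow> 0" for t v w
        by (rule HH_pairing_continuous[OF S that])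
    qed
    show "AE t in lebesgue. norm (indicator I t *\<^sub>R \<theta> t (\<lambda>x. \<phi> (t, x))) \<le> norm (M t + D * indicator ?J t)"
      using M(3)
    proof eventually_elim
      case (elim t)
      show ?case
      proof (cases "t \<in> I \<and> t \<in> ?J")
        case True
        then show ?thesis using D(2)[OF \<theta>_HH, of t "M t" t] elim M(2)[of t] D(1) by simp
      next
        case False
        have "indicator I t *\<^sub>R \<theta> t (\<lambda>x. \<phi> (t, x)) = 0"
        proof (cases "t \<in> I")
          case True
          then have "(\<lambda>x. \<phi> (t, x)) = (\<lambda>x. 0)" using False T(2) by blast
          moreover have "\<theta> t (\<lambda>x. 0) = 0"
            by (rule linear_functional_zero[OF HH_D(1)[OF \<theta>_HH[OF True]] S])
          ultimately show ?thesis by simp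
        qed simp
        then show ?thesis by (metis norm_ge_zero norm_zero)
      qed
    qed
  qed
qed

end

section \<open>Time slices and generalized moments\<close>

context msqg_flow
begin

definition is_slice :: "real \<Rightarrow> functional \<Rightarrow> bool" where
  "is_slice a u \<longleftrightarrow> u \<in> extensional (test_functions UNIV) \<and> distribution u \<and>
     (\<forall>\<phi>\<in>test_functions (I \<times> UNIV).
        spacetime_pairing I (transported h \<delta> \<theta> a) \<phi> = spacetime_pairing I (\<lambda>_. u) \<phi>)"

lemma time_slice_THE: "time_slice h \<delta> I \<theta> a = (THE u. is_slice a u)"
  unfolding time_slice_def is_slice_def ..

lemma transported_W:
  assumes "a \<in> I" "t \<in> I"
  shows "transported h \<delta> \<theta> a t \<psi> = \<theta> t \<psi> + W a t \<psi>"
  unfolding transported_def W_def flux_def using interval_integral_oriented[OF I_interval assms] by simp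

lemma distribution_slice_integrable:
  assumes u: "distribution u" and \<phi>: "\<phi> \<in> test_functions \<Omega>"
  shows "integrable lebesgue (\<lambda>t. indicator I t *\<^sub>R u (\<lambda>x. \<phi> (t, x)))"
proof (rule integrable_continuous_compact[OF distribution_slice_continuous[OF u \<phi>] _ test_function_slice(3)[OF \<phi>] I_sets])
  show "u (\<lambda>x. \<phi> (t, x)) = 0" if "t \<notin> fst ` supp \<phi>" for t
    by (simp only: test_function_slice(2)[OF \<phi> that] distribution_zero[OF u])
qed

lemma transported_slice_integrable:
  assumes \<phi>: "\<phi> \<in> test_functions \<Omega>" and a: "a \<in> I"
  shows "integrable lebesgue (\<lambda>t. indicator I t *\<^sub>R transported h \<delta> \<theta> a t (\<lambda>x. \<phi> (t, x)))"
proof -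
  have "integrable lebesgue (\<lambda>t. indicator I t *\<^sub>R W a t (\<lambda>x. \<phi> (t, x)))"
  proof (rule integrable_continuous_compact[OF W_slice_continuous[OF \<phi>] _ test_function_slice(3)[OF \<phi>] I_sets])
    show "W a t (\<lambda>x. \<phi> (t, x)) = 0" if "t \<notin> fst ` supp \<phi>" for t
      by (simp only: test_function_slice(2)[OF \<phi> that] distribution_zero[OF W_distribution])
  qed
  then have "integrable lebesgue (\<lambda>t. indicator I t *\<^sub>R \<theta> t (\<lambda>x. \<phi> (t, x)) + indicator I t *\<^sub>R W a t (\<lambda>x. \<phi> (t, x)))"
    by (rule Bochner_Integration.integrable_add[OF \<theta>_slice_integrable[OF \<phi>]])
  moreover have "indicator I t *\<^sub>R transported h \<delta> \<theta> a t (\<lambda>x. \<phi> (t, x)) = indicator I t *\<^sub>R \<theta> t (\<lambda>x. \<phi> (t, x)) + indicator I t *\<^sub>R W a t (\<lambda>x. \<phi> (t, x))" for t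
    using transported_W[OF a] by (cases "t \<in> I") auto
  ultimately show ?thesis by simp
qed

text \<open>By additivity of \<open>W\<close> in time, \<open>transported\<close> from
  \<open>b\<close> and from \<open>a\<close> differ by \<open>W b a\<close>, a distribution that
  does not depend on the running time. The restriction puts the sum back among the extensional
  functions.\<close>

lemma is_slice_transfer:
  assumes u: "is_slice a u" and a: "a \<in> I" and b: "b \<in> I"
  shows "is_slice b (restrict (\<lambda>\<psi>. u \<psi> + W b a \<psi>) (test_functions UNIV))" (is "is_slice b ?v")
  unfolding is_slice_def
proof (intro conjI ballI)
  have du: "distribution u" using u by (simp add: is_slice_def)
  show "?v \<in> extensional (test_functions UNIV)" by simp
  show dv: "distribution ?v"
    unfolding distribution_def
  proof (intro conjI allI impI)
    show "linear_functional_on (test_functions UNIV) ?v"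
      unfolding linear_functional_on_def
    proof (intro ballI allI)
      fix f g :: "plane \<Rightarrow> complex" and c d assume f: "f \<in> test_functions UNIV" and g: "g \<in> test_functions UNIV"
      have "(\<lambda>x. c * f x + d * g x) \<in> test_functions UNIV"
      proof -
        have "compact (supp f \<union> supp g)" using f g by (auto simp: test_functions_def intro: compact_Un)
        then have "compact (supp (\<lambda>x. c * f x + d * g x))"
          by (rule compact_supp) (use zero_outside_supp[of _ f] zero_outside_supp[of _ g] in auto)
        then show ?thesis using f g by (simp add: test_functions_def smooth_linear_comb)
      qed
      moreover have "u (\<lambda>x. c * f x + d * g x) = c * u f + d * u g"
        using du f g unfolding distribution_def linear_functional_on_def by blast
      ultimately show "?v (\<lambda>x. c * f x + d * g x) = c * ?v f + d * ?v g"
        using f g W_linear[OF test_functions_schwartz[OF f] test_functions_schwartz[OF g]] by (simp add: algebra_simps)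
    qed
  next
    fix K :: "plane set" assume K: "compact K"
    obtain C N where C: "\<forall>f\<in>test_functions UNIV. supp f \<subseteq> K \<longrightarrow> norm (u f) \<le> C * Ck_seminorm N f"
      using du K unfolding distribution_def by blast
    obtain C' N' where C': "\<forall>f\<in>test_functions UNIV. supp f \<subseteq> K \<longrightarrow> norm (W b a f) \<le> C' * Ck_seminorm N' f"
      using W_distribution[of b a] K unfolding distribution_def by blast
    have "norm (?v f) \<le> (\<bar>C\<bar> + \<bar>C'\<bar>) * Ck_seminorm (max N N') f" if f: "f \<in> test_functions UNIV" and fK: "supp f \<subseteq> K" for f
    proof -
      note fS = test_functions_schwartz[OF f]
      have m: "0 \<le> Ck_seminorm N f" "Ck_seminorm N f \<le> Ck_seminorm (max N N') f" "0 \<le> Ck_seminorm N' f" "Ck_seminorm N' f \<le> Ck_seminorm (max N N') f"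
        unfolding Ck_seminorm_wsup by (intro wsup_nonneg wsup_mono fS; simp)+
      have "norm (?v f) \<le> norm (u f) + norm (W b a f)" using f by (simp add: norm_triangle_ineq)
      also have "\<dots> \<le> C * Ck_seminorm N f + C' * Ck_seminorm N' f" using C C' f fK by (intro add_mono) auto
      also have "\<dots> \<le> \<bar>C\<bar> * Ck_seminorm (max N N') f + \<bar>C'\<bar> * Ck_seminorm (max N N') f"
        using m by (intro add_mono mult_mono) auto
      finally show ?thesis by (simp add: distrib_right)
    qed
    then show "\<exists>C N. \<forall>f\<in>test_functions UNIV. supp f \<subseteq> K \<longrightarrow> norm (?v f) \<le> C * Ck_seminorm N f" by blast
  qed
  fix \<phi> :: "real \<times> plane \<Rightarrow> complex" assume \<phi>: "\<phi> \<in> test_functions (I \<times> UNIV)"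
  note T = test_function_slice(1)[OF \<phi>]
  have "spacetime_pairing I (transported h \<delta> \<theta> b) \<phi>
    = (LINT t|lebesgue. indicator I t *\<^sub>R transported h \<delta> \<theta> a t (\<lambda>x. \<phi> (t, x)) + indicator I t *\<^sub>R W b a (\<lambda>x. \<phi> (t, x)))"
    unfolding spacetime_pairing_def set_lebesgue_integral_def
  proof (rule Bochner_Integration.integral_cong[OF refl])
    fix t
    show "indicator I t *\<^sub>R transported h \<delta> \<theta> b t (\<lambda>x. \<phi> (t, x)) = indicator I t *\<^sub>R transported h \<delta> \<theta> a t (\<lambda>x. \<phi> (t, x)) + indicator I t *\<^sub>R W b a (\<lambda>x. \<phi> (t, x))"
      using transported_W[OF a] transported_W[OF b] W_add[OF test_functions_schwartz[OF T], of b t t a] by (cases "t \<in> I") auto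
  qed
  also have "\<dots> = spacetime_pairing I (transported h \<delta> \<theta> a) \<phi> + spacetime_pairing I (\<lambda>_. W b a) \<phi>"
    unfolding spacetime_pairing_def set_lebesgue_integral_def
    by (rule Bochner_Integration.integral_add[OF transported_slice_integrable[OF \<phi> a] distribution_slice_integrable[OF W_distribution \<phi>]])
  also have "spacetime_pairing I (transported h \<delta> \<theta> a) \<phi> = spacetime_pairing I (\<lambda>_. u) \<phi>" using u \<phi> by (simp add: is_slice_def)
  also have "spacetime_pairing I (\<lambda>_. u) \<phi> + spacetime_pairing I (\<lambda>_. W b a) \<phi> = (LINT t|lebesgue. indicator I t *\<^sub>R u (\<lambda>x. \<phi> (t, x)) + indicator I t *\<^sub>R W b a (\<lambda>x. \<phi> (t, x)))"
    unfolding spacetime_pairing_def set_lebesgue_integral_def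
    by (rule Bochner_Integration.integral_add[OF distribution_slice_integrable[OF du \<phi>] distribution_slice_integrable[OF W_distribution \<phi>], symmetric])
  also have "\<dots> = spacetime_pairing I (\<lambda>_. ?v) \<phi>"
    unfolding spacetime_pairing_def set_lebesgue_integral_def
    by (rule Bochner_Integration.integral_cong[OF refl]) (simp add: T scaleR_right_distrib)
  finally show "spacetime_pairing I (transported h \<delta> \<theta> b) \<phi> = spacetime_pairing I (\<lambda>_. ?v) \<phi>" .
qed

text \<open>Both functionals are tested on products of a bump in time, whose integral over
  \<open>I\<close> is nonzero, with an arbitrary test function in space.\<close>

lemma is_slice_unique:
  assumes u: "is_slice a u" and v: "is_slice a v" and a: "a \<in> I"
  shows "u = v"
proof (rule extensionalityI)
  show "u \<in> extensional (test_functions UNIV)" "v \<in> extensional (test_functions UNIV)" using u v by (auto simp: is_slice_def)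
  fix \<psi> :: "plane \<Rightarrow> complex" assume \<psi>: "\<psi> \<in> test_functions UNIV"
  obtain b where b: "(\<lambda>t. complex_of_real (b t)) \<in> test_functions I" "(LINT t:I|lebesgue. complex_of_real (b t)) \<noteq> 0"
    using bump_exists[OF h I_open a] by blast
  define \<phi> where "\<phi> p = complex_of_real (b (fst p)) * \<psi> (snd p)" for p
  have \<phi>: "\<phi> \<in> test_functions (I \<times> UNIV)" unfolding \<phi>_def[abs_def] by (rule test_functions_tensor[OF b(1) \<psi>])
  have pair: "spacetime_pairing I (\<lambda>_. w) \<phi> = (LINT t:I|lebesgue. complex_of_real (b t)) * w \<psi>" if "distribution w" for w
  proof -
    have l: "linear_functional_on (test_functions UNIV) w" using that by (simp add: distribution_def)
    have "w (\<lambda>x. \<phi> (t, x)) = complex_of_real (b t) * w \<psi>" for t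
      using l[unfolded linear_functional_on_def, rule_format, OF \<psi> \<psi>, of "complex_of_real (b t)" 0] by (simp add: \<phi>_def)
    then have "spacetime_pairing I (\<lambda>_. w) \<phi> = (LINT t:I|lebesgue. complex_of_real (b t) * w \<psi>)"
      unfolding spacetime_pairing_def by simp
    then show ?thesis by simp
  qed
  have "spacetime_pairing I (\<lambda>_. u) \<phi> = spacetime_pairing I (\<lambda>_. v) \<phi>" using u v \<phi> by (simp add: is_slice_def)
  then show "u \<psi> = v \<psi>" using u v b(2) by (simp add: pair is_slice_def)
qed

text \<open>If no slice exists, then \<open>THE\<close> denotes the same arbitrary functional at both times.\<close>

lemma time_slice_transfer:
  assumes a: "a \<in> I" and b: "b \<in> I"
  shows "(\<forall>\<psi>\<in>test_functions UNIV. time_slice h \<delta> I \<theta> b \<psi> = time_slice h \<delta> I \<theta> a \<psi> + W b a \<psi>)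
    \<or> time_slice h \<delta> I \<theta> b = time_slice h \<delta> I \<theta> a"
proof (cases "\<exists>u. is_slice a u")
  case True
  then obtain u where u: "is_slice a u" by blast
  have "time_slice h \<delta> I \<theta> a = u"
    unfolding time_slice_THE by (rule the_equality[where P = "is_slice a", OF u]) (rule is_slice_unique[OF _ u a])
  moreover have "time_slice h \<delta> I \<theta> b = restrict (\<lambda>\<psi>. u \<psi> + W b a \<psi>) (test_functions UNIV)"
    unfolding time_slice_THE
    by (rule the_equality[where P = "is_slice b", OF is_slice_transfer[OF u a b]]) (rule is_slice_unique[OF _ is_slice_transfer[OF u a b] b])
  ultimately show ?thesis by simp
next
  case False
  moreover have "\<nexists>u. is_slice b u" using False is_slice_transfer[OF _ b a] by blast
  ultimately have "is_slice a = is_slice b" by blast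
  then show ?thesis by (simp add: time_slice_THE)
qed

lemma has_moment_transfer:
  assumes a: "a \<in> I" and b: "b \<in> I"
    and T: "\<And>c R. c \<in> test_functions UNIV \<Longrightarrow> 0 < R \<Longrightarrow> (\<lambda>x. c (x /\<^sub>R R) * complex_of_real (Q x)) \<in> test_functions UNIV"
    and lim: "\<And>c. c \<in> test_functions UNIV \<Longrightarrow> (\<forall>\<^sub>F x in nhds 0. c x = 1) \<Longrightarrow> ((\<lambda>R. W b a (\<lambda>x. c (x /\<^sub>R R) * complex_of_real (Q x))) \<longlongrightarrow> 0) at_top"
    and m: "has_moment Q (time_slice h \<delta> I \<theta> a) L"
  shows "has_moment Q (time_slice h \<delta> I \<theta> b) L"
  using time_slice_transfer[OF a b]
proof
  assume *: "\<forall>\<psi>\<in>test_functions UNIV. time_slice h \<delta> I \<theta> b \<psi> = time_slice h \<delta> I \<theta> a \<psi> + W b a \<psi>"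
  show ?thesis
    unfolding has_moment_def
  proof (intro ballI impI)
    fix c :: "plane \<Rightarrow> complex" assume c: "c \<in> test_functions UNIV" "\<forall>\<^sub>F x in nhds 0. c x = 1"
    let ?p = "\<lambda>R x. c (x /\<^sub>R R) * complex_of_real (Q x)"
    have "((\<lambda>R. time_slice h \<delta> I \<theta> a (?p R) + W b a (?p R)) \<longlongrightarrow> L + 0) at_top"
      using m c unfolding has_moment_def by (intro tendsto_add lim) auto
    moreover have "eventually (\<lambda>R. time_slice h \<delta> I \<theta> a (?p R) + W b a (?p R) = time_slice h \<delta> I \<theta> b (?p R)) at_top"
      using eventually_gt_at_top[of 0] by eventually_elim (use * T[OF c(1)] in simp)
    ultimately show "((\<lambda>R. time_slice h \<delta> I \<theta> b (?p R)) \<longlongrightarrow> L) at_top"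
      by (simp add: filterlim_cong[OF refl refl])
  qed
qed (use m in simp)

section \<open>Vanishing of \<open>W\<close> on truncated moments\<close>

lemma W_tendsto_zero:
  assumes T: "\<And>R. 0 < R \<Longrightarrow> \<psi> R \<in> schwartz" and w: "((\<lambda>R. wiener (\<psi> R)) \<longlongrightarrow> 0) at_top"
  shows "((\<lambda>R::real. W a b (\<psi> R)) \<longlongrightarrow> 0) at_top"
proof -
  obtain c where c: "\<forall>a b. \<forall>\<psi>\<in>schwartz. norm (W a b \<psi>) \<le> c * wiener \<psi>" using W_bound by blast
  have ev: "eventually (\<lambda>R. norm (W a b (\<psi> R)) \<le> c * wiener (\<psi> R)) at_top"
    using eventually_gt_at_top[of 0] by eventually_elim (use c T in blast)
  have "((\<lambda>R. c * wiener (\<psi> R)) \<longlongrightarrow> 0) at_top" by (rule tendsto_mult_right_zero[OF w])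
  with ev show ?thesis by (rule Lim_null_comparison)
qed

lemma mean_limit:
  assumes c: "c \<in> test_functions UNIV"
  shows "((\<lambda>R. W a b (\<lambda>x. c (x /\<^sub>R R) * complex_of_real 1)) \<longlongrightarrow> 0) at_top"
proof (rule W_tendsto_zero)
  show "(\<lambda>x. c (x /\<^sub>R R) * complex_of_real 1) \<in> schwartz" if "0 < R" for R
    using test_functions_schwartz[OF test_function_scale[OF c that]] by simp
  have "((\<lambda>R::real. inverse (R\<^sup>2)) \<longlongrightarrow> 0) at_top"
    by (intro tendsto_inverse_0_at_top filterlim_pow_at_top filterlim_ident) simp
  from tendsto_mult_right_zero[OF this] have "((\<lambda>R. wiener c / R\<^sup>2) \<longlongrightarrow> 0) at_top" unfolding divide_inverse .
  moreover have "eventually (\<lambda>R. wiener c / R\<^sup>2 = wiener (\<lambda>x. c (x /\<^sub>R R) * complex_of_real 1)) at_top"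
    using eventually_gt_at_top[of 0] by eventually_elim (simp add: wiener_scale[OF test_functions_schwartz[OF c]])
  ultimately show "((\<lambda>R. wiener (\<lambda>x. c (x /\<^sub>R R) * complex_of_real 1)) \<longlongrightarrow> 0) at_top"
    by (simp add: filterlim_cong[OF refl refl])
qed

lemma smooth_component: "smooth (\<lambda>x::plane. complex_of_real (x $ i))"
  by (rule smooth_bounded_linear) (intro bounded_linear_compose[OF bounded_linear_of_real] bounded_linear_vec_nth)

lemma smooth_norm_squared: "smooth (\<lambda>x::plane. complex_of_real ((norm x)\<^sup>2))"
proof -
  have "(\<lambda>x::plane. complex_of_real ((norm x)\<^sup>2)) = (\<lambda>x. complex_of_real (x $ 1) * complex_of_real (x $ 1) + complex_of_real (x $ 2) * complex_of_real (x $ 2))"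
    by (rule ext) (simp add: power2_norm_eq_inner inner_vec_def sum_2)
  then show ?thesis using smooth_component by (simp only: smooth_add smooth_mult)
qed

lemma impulse_limit:
  assumes c: "c \<in> test_functions UNIV"
  shows "((\<lambda>R. W a b (\<lambda>x. c (x /\<^sub>R R) * complex_of_real (x $ i))) \<longlongrightarrow> 0) at_top"
proof (rule W_tendsto_zero)
  define \<Psi> where "\<Psi> x = c x * complex_of_real (x $ i)" for x :: plane
  have \<Psi>: "\<Psi> \<in> test_functions UNIV" unfolding \<Psi>_def[abs_def] by (rule test_function_mult[OF c smooth_component])
  \<comment> \<open>Homogeneity of degree one: the truncated moment is R times a dilate of the fixed
    profile \<Psi>.\<close>
  have eq: "(\<lambda>x. c (x /\<^sub>R R) * complex_of_real (x $ i)) = (\<lambda>x. complex_of_real R * \<Psi> (x /\<^sub>R R))" if "0 < R" for R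
    by (rule ext) (use that in \<open>simp add: \<Psi>_def field_simps\<close>)
  show "(\<lambda>x. c (x /\<^sub>R R) * complex_of_real (x $ i)) \<in> schwartz" if "0 < R" for R
    unfolding eq[OF that] by (intro schwartz_cmult test_functions_schwartz[OF test_function_scale[OF \<Psi> that]])
  have "((\<lambda>R::real. inverse R) \<longlongrightarrow> 0) at_top" by (rule tendsto_inverse_0_at_top[OF filterlim_ident])
  from tendsto_mult_right_zero[OF this] have "((\<lambda>R. wiener \<Psi> / R) \<longlongrightarrow> 0) at_top" unfolding divide_inverse .
  moreover have "eventually (\<lambda>R. wiener \<Psi> / R = wiener (\<lambda>x. c (x /\<^sub>R R) * complex_of_real (x $ i))) at_top"
    using eventually_gt_at_top[of 0]
    by eventually_elim (simp only: eq wiener_cmult wiener_scale[OF test_functions_schwartz[OF \<Psi>]] norm_of_real abs_of_pos,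
      simp add: power2_eq_square)
  ultimately show "((\<lambda>R. wiener (\<lambda>x. c (x /\<^sub>R R) * complex_of_real (x $ i))) \<longlongrightarrow> 0) at_top"
    by (simp add: filterlim_cong[OF refl refl])
qed

lemma angular_limit:
  assumes c: "c \<in> test_functions UNIV" and c1: "\<forall>\<^sub>F x in nhds 0. c x = 1"
  shows "((\<lambda>R. W a b (\<lambda>x. c (x /\<^sub>R R) * complex_of_real ((norm x)\<^sup>2))) \<longlongrightarrow> 0) at_top"
proof -
  define \<Psi> where "\<Psi> x = c x * complex_of_real ((norm x)\<^sup>2)" for x :: plane
  have \<Psi>: "\<Psi> \<in> test_functions UNIV" unfolding \<Psi>_def[abs_def] by (rule test_function_mult[OF c smooth_norm_squared])
  have \<Psi>0: "\<forall>\<^sub>F x in nhds 0. \<Psi> x = complex_of_real ((norm x)\<^sup>2)"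
    using c1 by eventually_elim (simp add: \<Psi>_def)
  let ?p = "\<lambda>R x. complex_of_real (R\<^sup>2) * \<Psi> (x /\<^sub>R R)"
  have S: "?p R \<in> schwartz" if "0 < R" for R
    by (intro schwartz_cmult test_functions_schwartz[OF test_function_scale[OF \<Psi> that]])
  \<comment> \<open>Homogeneity of degree two makes the \<open>wiener\<close> value independent of
    R, as \<open>w\<close> records; smallness has to come from
    \<open>B_angular_limit\<close>.\<close>
  have eq: "(\<lambda>x. c (x /\<^sub>R R) * complex_of_real ((norm x)\<^sup>2)) = ?p R" if "0 < R" for R
    by (rule ext) (use that in \<open>simp add: \<Psi>_def field_simps\<close>)
  have w: "wiener (?p R) = wiener \<Psi>" if "0 < R" for R
    unfolding wiener_cmult wiener_scale[OF test_functions_schwartz[OF \<Psi>] that] norm_of_real using that by simp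
  obtain M where M: "integrable lebesgue M" "\<And>s. 0 \<le> M s" "AE s in lebesgue. \<forall>\<psi>\<in>schwartz. norm (flux \<psi> s) \<le> wiener \<psi> * M s"
    by (rule flux_dominated) (rule that)
  have "((\<lambda>R. LINT s|lebesgue. oriented a b s *\<^sub>R flux (?p R) s) \<longlongrightarrow> (LINT s::real|lebesgue. 0)) at_top"
  proof (rule tendsto_at_topI_sequentially)
    fix X :: "nat \<Rightarrow> real" assume X: "filterlim X at_top sequentially"
    have "eventually (\<lambda>n. 0 < X n) sequentially" using X by (simp add: filterlim_at_top_dense)
    \<comment> \<open>The dilations are under control for positive R only, so finitely many terms of
      the sequence are dropped; \<open>LIMSEQ_offset\<close> restores them.\<close>
    then obtain N where N: "\<And>n. n \<ge> N \<Longrightarrow> 0 < X n" unfolding eventually_sequentially by blast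
    have X': "filterlim (\<lambda>n. X (n + N)) at_top sequentially"
      by (rule filterlim_compose[OF X filterlim_add_const_nat_at_top])
    have p: "0 < X (n + N)" for n using N[of "n + N"] by simp
    have "(\<lambda>n. LINT s|lebesgue. oriented a b s *\<^sub>R flux (?p (X (n + N))) s) \<longlonglongrightarrow> (LINT s::real|lebesgue. 0)"
    proof (rule integral_dominated_convergence)
      show "integrable lebesgue (\<lambda>s. wiener \<Psi> * M s)" using M(1) by simp
      show "(\<lambda>s. oriented a b s *\<^sub>R flux (?p (X (n + N))) s) \<in> borel_measurable lebesgue" for n
        by (rule borel_measurable_integrable[OF flux_integrable[OF S[OF p]]])
      show "AE s in lebesgue. (\<lambda>n. oriented a b s *\<^sub>R flux (?p (X (n + N))) s) \<longlonglongrightarrow> 0"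
      proof (rule AE_I2)
        fix s
        show "(\<lambda>n. oriented a b s *\<^sub>R flux (?p (X (n + N))) s) \<longlonglongrightarrow> 0"
        proof (cases "s \<in> I")
          case True
          have "(\<lambda>n. flux (?p (X (n + N))) s) \<longlonglongrightarrow> 0"
            using filterlim_compose[OF B_angular_limit[OF \<Psi> \<Psi>0 \<theta>_HH[OF True]] X'] True by (simp add: flux_def)
          from tendsto_scaleR[OF tendsto_const this] show ?thesis by simp
        qed (simp add: flux_def)
      qed
      show "AE s in lebesgue. norm (oriented a b s *\<^sub>R flux (?p (X (n + N))) s) \<le> wiener \<Psi> * M s" for n
        using M(3)
      proof eventually_elim
        case (elim s)
        have "norm (flux (?p (X (n + N))) s) \<le> wiener (?p (X (n + N))) * M s" using elim S[OF p] by blast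
        then have "norm (flux (?p (X (n + N))) s) \<le> wiener \<Psi> * M s" unfolding w[OF p] .
        then have "norm (oriented a b s *\<^sub>R flux (?p (X (n + N))) s) \<le> 1 * (wiener \<Psi> * M s)"
          unfolding norm_scaleR by (intro mult_mono) (use oriented_bound in auto)
        then show ?case by simp
      qed
    qed simp
    then show "(\<lambda>n. LINT s|lebesgue. oriented a b s *\<^sub>R flux (?p (X n)) s) \<longlonglongrightarrow> (LINT s::real|lebesgue. 0)"
      by (rule LIMSEQ_offset)
  qed
  moreover have "eventually (\<lambda>R. (LINT s|lebesgue. oriented a b s *\<^sub>R flux (?p R) s) = W a b (\<lambda>x. c (x /\<^sub>R R) * complex_of_real ((norm x)\<^sup>2))) at_top"
    using eventually_gt_at_top[of 0] by eventually_elim (simp only: eq W_def)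
  ultimately show ?thesis by (simp add: filterlim_cong[OF refl refl])
qed

lemma moment_conserved:
  assumes a: "a \<in> I" and b: "b \<in> I" and Q: "Q = (\<lambda>x. 1) \<or> (\<exists>i. Q = (\<lambda>x. x $ i)) \<or> Q = (\<lambda>x. (norm x)\<^sup>2)"
  shows "has_moment Q (time_slice h \<delta> I \<theta> a) = has_moment Q (time_slice h \<delta> I \<theta> b)"
proof -
  have sm: "smooth (\<lambda>x. complex_of_real (Q x))"
    using Q smooth_const[of 1] smooth_component smooth_norm_squared by auto
  have T: "(\<lambda>x. c (x /\<^sub>R R) * complex_of_real (Q x)) \<in> test_functions UNIV" if "c \<in> test_functions UNIV" "0 < R" for c R
    by (rule test_function_mult[OF test_function_scale[OF that] sm])
  have lim: "((\<lambda>R. W a b (\<lambda>x. c (x /\<^sub>R R) * complex_of_real (Q x))) \<longlongrightarrow> 0) at_top"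
    if "c \<in> test_functions UNIV" "\<forall>\<^sub>F x in nhds 0. c x = 1" for c a b
    using Q mean_limit[OF that(1), of a b] impulse_limit[OF that(1), of a b] angular_limit[OF that, of a b] by auto
  show ?thesis
    using has_moment_transfer[OF a b T lim] has_moment_transfer[OF b a T lim] by blast
qed

end

theorem theorem1:
  fixes \<delta> t0 :: real and I :: "real set" and h :: "plane \<Rightarrow> complex" and \<theta> :: "real \<Rightarrow> functional"
  assumes "0 \<le> \<delta>" and "\<delta> \<le> 1/2"
    and "open I" and "is_interval I"
    and "LP_symbol h"
    and "weak_solution h \<delta> I \<theta>"
    and "t0 \<in> I"
  shows
    "(well_defined_mean (time_slice h \<delta> I \<theta> t0) \<longrightarrow>
       (\<forall>t\<in>I. well_defined_mean (time_slice h \<delta> I \<theta> t) \<and>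
              mean (time_slice h \<delta> I \<theta> t) = mean (time_slice h \<delta> I \<theta> t0))) \<and>
     (well_defined_impulse (time_slice h \<delta> I \<theta> t0) \<longrightarrow>
       (\<forall>t\<in>I. well_defined_impulse (time_slice h \<delta> I \<theta> t) \<and>
              impulse (time_slice h \<delta> I \<theta> t) = impulse (time_slice h \<delta> I \<theta> t0))) \<and>
     (well_defined_angular_momentum (time_slice h \<delta> I \<theta> t0) \<longrightarrow>
       (\<forall>t\<in>I. well_defined_angular_momentum (time_slice h \<delta> I \<theta> t) \<and>
              angular_momentum (time_slice h \<delta> I \<theta> t) = angular_momentum (time_slice h \<delta> I \<theta> t0)))"
proof -
  interpret msqg_flow h \<delta> I \<theta>
    by unfold_locales (use assms in \<open>auto simp: weak_solution_def\<close>)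
  \<comment> \<open>Equality of the predicates gives existence and value at once, because
    \<open>moment\<close> depends on the distribution only through
    \<open>has_moment\<close>.\<close>
  have e: "has_moment Q (time_slice h \<delta> I \<theta> t) = has_moment Q (time_slice h \<delta> I \<theta> t0)"
    if "t \<in> I" "Q = (\<lambda>x. 1) \<or> (\<exists>i. Q = (\<lambda>x. x $ i)) \<or> Q = (\<lambda>x. (norm x)\<^sup>2)" for t Q
    by (rule moment_conserved[OF that(1) assms(7) that(2)])
  have 1: "has_moment (\<lambda>x. 1) (time_slice h \<delta> I \<theta> t) = has_moment (\<lambda>x. 1) (time_slice h \<delta> I \<theta> t0)" if "t \<in> I" for t
    by (rule e[OF that]) simp
  have 2: "has_moment (\<lambda>x. x $ i) (time_slice h \<delta> I \<theta> t) = has_moment (\<lambda>x. x $ i) (time_slice h \<delta> I \<theta> t0)" if "t \<in> I" for t i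
    by (rule e[OF that]) blast
  have 3: "has_moment (\<lambda>x. (norm x)\<^sup>2) (time_slice h \<delta> I \<theta> t) = has_moment (\<lambda>x. (norm x)\<^sup>2) (time_slice h \<delta> I \<theta> t0)" if "t \<in> I" for t
    by (rule e[OF that]) simp
  show ?thesis
    by (simp add: well_defined_mean_def well_defined_impulse_def well_defined_angular_momentum_def
        mean_def impulse_def angular_momentum_def moment_def 1 2 3)
qed

end
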